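(* The Curve/Point Set Matching problem under translations in $\mathbb{R}^d$ (points may be visited more than once) can be $(1+\varepsilon)$-approximated in $O(nk^3\log(nk)/\varepsilon^{d})$ time for the Continuous Subset version, and in $O(nk^2/\varepsilon^{d})$ time for the Discrete Subset version and for the Discrete All-Points version.
   Context: The input is a polygonal curve $P$ in $\mathbb{R}^d$ of length $n$ and a set $S\subset\mathbb{R}^d$ of $k$ points; $P+t$ is the translate of $P$ by $t\in\mathbb{R}^d$. The problem is to find a translation $t\in\mathbb{R}^d$ and an admissible polygonal curve $Q$ minimizing $\delta(P+t,Q)$, where $\delta$ is the continuous Fréchet distance $\delta_{\mathcal F}$ in the Continuous version and the discrete Fréchet distance $\delta_{\mathrm F}$ in the Discrete versions. In the Subset versions a polygonal curve is admissible if all its vertices belong to $S$ (repetitions allowed); in the All-Points version it is admissible if, in addition, every point of $S$ is one of its vertices. To $(1+\varepsilon)$-approximate the problem means to find a translation $t$ and an admissible $Q$ for which $\delta(P+t,Q)$ is at most $(1+\varepsilon)$ times the optimal value, $\varepsilon>0$ being the accuracy parameter. $\|p,q\|$ denotes the Euclidean distance between points $p,q$. A polygonal curve is given by its sequence of vertices, consecutive vertices being joined by straight segments. For curves $P,Q:[0,1]\to\mathbb{R}^d$, the continuous Fréchet distance is $$\delta_{\mathcal F}(P,Q)=\inf_{\sigma,\tau}\max_{s\in[0,1]}\|P(\sigma(s)),Q(\tau(s))\|,$$ where $\sigma,\tau:[0,1]\to[0,1]$ range over all continuous non-decreasing surjective functions. For polygonal curves $P$ with vertices $P_1,\dots,P_n$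 and $Q$ with vertices $Q_1,\dots,Q_m$, a paired walk is a sequence of integer pairs $(a_1,b_1),\dots,(a_l,b_l)$, $l\ge\max(n,m)$, with $(a_1,b_1)=(1,1)$, $(a_l,b_l)=(n,m)$, and $(a_{i+1},b_{i+1})\in\{(a_i+1,b_i),(a_i,b_i+1),(a_i+1,b_i+1)\}$ for all $i$. With $W$ the set of all paired walks for $P$ and $Q$, the discrete Fréchet distance is $$\delta_{\mathrm F}(P,Q)=\min_{(a,b)\in W}\max_i\|P_{a_i},Q_{b_i}\|.$$
   Formalization: The accuracy parameter is restricted to 0 < ε ≤ 1, since the bounds tend to 0 as ε grows, and for n = k = 1 no time bound is claimed in the Continuous version, where log(nk) = 0. *)

theory Defs
  imports "HOL-Analysis.Analysis"
begin

section \<open>Polygonal curves and Frechet distances\<close>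

text \<open>
  A polygonal curve is given by its vertex list. The speed of the parametrisation below is not
  uniform, but the Frechet distance does not depend on the choice of parametrisation.
\<close>

fun polygonal_path :: "'a::real_normed_vector list \<Rightarrow> real \<Rightarrow> 'a" where
  "polygonal_path [] = (\<lambda>_. 0)"
| "polygonal_path [p] = (\<lambda>_. p)"
| "polygonal_path [p, q] = linepath p q"
| "polygonal_path (p # q # r # ps) = linepath p q +++ polygonal_path (q # r # ps)"

definition reparametrization :: "(real \<Rightarrow> real) \<Rightarrow> bool" where
  "reparametrization \<sigma> \<longleftrightarrow>
     continuous_on {0..1} \<sigma> \<and> mono_on {0..1} \<sigma> \<and> \<sigma> ` {0..1} = {0..1}"

definition path_frechet_dist ::
    "(real \<Rightarrow> 'a::metric_space) \<Rightarrow> (real \<Rightarrow> 'a) \<Rightarrow> real" where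
  "path_frechet_dist f g =
     Inf {SUP s\<in>{0..1}. dist (f (\<sigma> s)) (g (\<tau> s)) | \<sigma> \<tau>.
            reparametrization \<sigma> \<and> reparametrization \<tau>}"

definition frechet_dist :: "'a::real_normed_vector list \<Rightarrow> 'a list \<Rightarrow> real" where
  "frechet_dist P Q = path_frechet_dist (polygonal_path P) (polygonal_path Q)"

text \<open>Vertices are numbered from 0, so a paired walk runs from (0,0) to (n-1,m-1).\<close>

definition paired_walk :: "nat \<Rightarrow> nat \<Rightarrow> (nat \<times> nat) list \<Rightarrow> bool" where
  "paired_walk n m w \<longleftrightarrow>
     w \<noteq> [] \<and> length w \<ge> max n m \<and> hd w = (0, 0) \<and> last w = (n - 1, m - 1) \<and>
     (\<forall>i. Suc i < length w \<longrightarrow>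
        (let (a, b) = w ! i in w ! Suc i \<in> {(a + 1, b), (a, b + 1), (a + 1, b + 1)}))"

definition discrete_frechet_dist :: "'a::metric_space list \<Rightarrow> 'a list \<Rightarrow> real" where
  "discrete_frechet_dist P Q =
     Min ((\<lambda>w. Max ((\<lambda>(a, b). dist (P ! a) (Q ! b)) ` set w)) `
            {w. paired_walk (length P) (length Q) w})"

text \<open>The set over which \<^const>\<open>Min\<close> is taken above is finite.\<close>

lemma paired_walk_step:
  assumes "paired_walk n m w" "Suc i < length w" "w ! i = (a, b)"
  shows "w ! Suc i \<in> {(a + 1, b), (a, b + 1), (a + 1, b + 1)}"
proof -
  have "let (a, b) = w ! i in w ! Suc i \<in> {(a + 1, b), (a, b + 1), (a + 1, b + 1)}"
    using assms(1,2) unfolding paired_walk_def by blast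
  then show ?thesis unfolding assms(3) Let_def by simp
qed

lemma paired_walk_sum_ge:
  assumes "paired_walk n m w" "i < length w"
  shows "i \<le> fst (w ! i) + snd (w ! i)"
  using assms(2)
proof (induction i)
  case (Suc i)
  obtain a b where ab: "w ! i = (a, b)" by (cases "w ! i")
  then have "w ! Suc i \<in> {(a + 1, b), (a, b + 1), (a + 1, b + 1)}"
    using paired_walk_step[OF assms(1) Suc.prems] by simp
  then show ?case using Suc ab by auto
qed simp

lemma paired_walk_mono:
  assumes "paired_walk n m w" "i \<le> j" "j < length w"
  shows "fst (w ! i) \<le> fst (w ! j) \<and> snd (w ! i) \<le> snd (w ! j)"
  using assms(2,3)
proof (induction j rule: dec_induct)
  case (step j)
  obtain a b where ab: "w ! j = (a, b)" by (cases "w ! j")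
  then have "w ! Suc j \<in> {(a + 1, b), (a, b + 1), (a + 1, b + 1)}"
    using paired_walk_step[OF assms(1) step.prems] by simp
  then show ?case using step ab by auto
qed simp

lemma finite_paired_walks: "finite {w. paired_walk n m w}"
proof -
  have "set w \<subseteq> {..n} \<times> {..m} \<and> length w \<le> n + m + 1" if w: "paired_walk n m w" for w
  proof
    have ne: "w \<noteq> []" and l: "w ! (length w - 1) = (n - 1, m - 1)"
      using w by (auto simp: paired_walk_def last_conv_nth)
    show "length w \<le> n + m + 1"
      using paired_walk_sum_ge[OF w, of "length w - 1"] ne l by auto
    show "set w \<subseteq> {..n} \<times> {..m}"
    proof
      fix x assume "x \<in> set w"
      then obtain i where i: "i < length w" "x = w ! i" by (metis in_set_conv_nth)
      then have "fst x \<le> n - 1 \<and> snd x \<le> m - 1"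
        using paired_walk_mono[OF w, of i "length w - 1"] l by simp
      then show "x \<in> {..n} \<times> {..m}" by (cases x) auto
    qed
  qed
  then have "{w. paired_walk n m w} \<subseteq> {w. set w \<subseteq> {..n} \<times> {..m} \<and> length w \<le> n + m + 1}"
    by blast
  then show ?thesis
    by (rule finite_subset) (intro finite_lists_length_le, simp)
qed

section \<open>Curve/point set matching under translations\<close>

definition subset_admissible :: "'a set \<Rightarrow> 'a list \<Rightarrow> bool" where
  "subset_admissible S Q \<longleftrightarrow> Q \<noteq> [] \<and> set Q \<subseteq> S"

definition all_points_admissible :: "'a set \<Rightarrow> 'a list \<Rightarrow> bool" where
  "all_points_admissible S Q \<longleftrightarrow> subset_admissible S Q \<and> S \<subseteq> set Q"

definition translate :: "'a::ab_group_add \<Rightarrow> 'a list \<Rightarrow> 'a list" where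
  "translate t P = map (\<lambda>p. p + t) P"

definition optimal_value ::
    "('a::ab_group_add list \<Rightarrow> 'a list \<Rightarrow> real) \<Rightarrow> ('a set \<Rightarrow> 'a list \<Rightarrow> bool) \<Rightarrow>
     'a list \<Rightarrow> 'a set \<Rightarrow> real" where
  "optimal_value \<delta> adm P S = Inf {\<delta> (translate t P) Q | t Q. adm S Q}"

definition approx_solution ::
    "('a::ab_group_add list \<Rightarrow> 'a list \<Rightarrow> real) \<Rightarrow> ('a set \<Rightarrow> 'a list \<Rightarrow> bool) \<Rightarrow>
     real \<Rightarrow> 'a list \<Rightarrow> 'a set \<Rightarrow> 'a \<Rightarrow> 'a list \<Rightarrow> bool" where
  "approx_solution \<delta> adm \<epsilon> P S t Q \<longleftrightarrow>
     adm S Q \<and> \<delta> (translate t P) Q \<le> (1 + \<epsilon>) * optimal_value \<delta> adm P S"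

section \<open>Real RAM\<close>

text \<open>
  The machine model is a real RAM: one infinite memory of natural numbers, used for counting and
  addressing, and one infinite memory of exact reals, both with indirect addressing. Naturals can
  be added, (truncatedly) subtracted and compared; reals admit the field operations, square roots
  and comparison. There is no rounding of reals to naturals, and the only real literals are natural
  numbers, so that no information can be smuggled into a program through a real constant.
  Division by zero and square roots of negative reals take their HOL values; a program could
  simulate this by testing its operands.
\<close>

datatype nexp =
    NConst nat
  | NMem nexp
  | NAdd nexp nexp
  | NSub nexp nexp

datatype rexp =
    ROfNat nexp
  | RMem nexp
  | RAdd rexp rexp
  | RSub rexp rexp
  | RMul rexp rexp
  | RDiv rexp rexp
  | RSqrt rexp

datatype bexp =
    NLess nexp nexp
  | RLess rexp rexp
  | BNot bexp
  | BAnd bexp bexp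

datatype com =
    Skip
  | NStore nexp nexp
  | RStore nexp rexp
  | Seq com com
  | Cond bexp com com
  | While bexp com

type_synonym state = "(nat \<Rightarrow> nat) \<times> (nat \<Rightarrow> real)"

fun nval :: "nexp \<Rightarrow> state \<Rightarrow> nat" where
  "nval (NConst c) s = c"
| "nval (NMem a) s = fst s (nval a s)"
| "nval (NAdd a b) s = nval a s + nval b s"
| "nval (NSub a b) s = nval a s - nval b s"

fun rval :: "rexp \<Rightarrow> state \<Rightarrow> real" where
  "rval (ROfNat a) s = real (nval a s)"
| "rval (RMem a) s = snd s (nval a s)"
| "rval (RAdd a b) s = rval a s + rval b s"
| "rval (RSub a b) s = rval a s - rval b s"
| "rval (RMul a b) s = rval a s * rval b s"
| "rval (RDiv a b) s = rval a s / rval b s"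
| "rval (RSqrt a) s = sqrt (rval a s)"

fun bval :: "bexp \<Rightarrow> state \<Rightarrow> bool" where
  "bval (NLess a b) s \<longleftrightarrow> nval a s < nval b s"
| "bval (RLess a b) s \<longleftrightarrow> rval a s < rval b s"
| "bval (BNot b) s \<longleftrightarrow> \<not> bval b s"
| "bval (BAnd a b) s \<longleftrightarrow> bval a s \<and> bval b s"

text \<open>
  \<open>exec c s t s'\<close>: started in state \<open>s\<close>, the program \<open>c\<close> halts in state \<open>s'\<close> after \<open>t\<close> steps. A step
  is a store or a test. As the expressions occurring in a program have a fixed size, this is within
  a constant factor (depending on the program only) of the number of elementary operations.
\<close>

inductive exec :: "com \<Rightarrow> state \<Rightarrow> nat \<Rightarrow> state \<Rightarrow> bool" where
  Skip: "exec Skip s 1 s"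
| NStore: "exec (NStore a e) s 1 ((fst s)(nval a s := nval e s), snd s)"
| RStore: "exec (RStore a e) s 1 (fst s, (snd s)(nval a s := rval e s))"
| Seq: "exec c1 s t1 s1 \<Longrightarrow> exec c2 s1 t2 s2 \<Longrightarrow> exec (Seq c1 c2) s (t1 + t2) s2"
| CondTrue: "bval b s \<Longrightarrow> exec c1 s t s1 \<Longrightarrow> exec (Cond b c1 c2) s (1 + t) s1"
| CondFalse: "\<not> bval b s \<Longrightarrow> exec c2 s t s1 \<Longrightarrow> exec (Cond b c1 c2) s (1 + t) s1"
| WhileFalse: "\<not> bval b s \<Longrightarrow> exec (While b c) s 1 s"
| WhileTrue: "bval b s \<Longrightarrow> exec c s t1 s1 \<Longrightarrow> exec (While b c) s1 t2 s2 \<Longrightarrow>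
    exec (While b c) s (1 + t1 + t2) s2"

inductive_cases SkipE: "exec Skip s t s'"
inductive_cases NStoreE: "exec (NStore a e) s t s'"
inductive_cases RStoreE: "exec (RStore a e) s t s'"
inductive_cases SeqE: "exec (Seq c1 c2) s t s'"
inductive_cases CondE: "exec (Cond b c1 c2) s t s'"
inductive_cases WhileE: "exec (While b c) s t s'"

lemma exec_deterministic:
  "exec c s t s' \<Longrightarrow> exec c s u s'' \<Longrightarrow> t = u \<and> s' = s''"
proof (induction arbitrary: u s'' rule: exec.induct)
  case Skip then show ?case by (auto elim: SkipE)
next
  case NStore then show ?case by (auto elim: NStoreE)
next
  case RStore then show ?case by (auto elim: RStoreE)
next
  case (Seq c1 s t1 s1 c2 t2 s2)
  from Seq.prems obtain u1 v u2
    where u: "u = u1 + u2" "exec c1 s u1 v" "exec c2 v u2 s''" by (rule SeqE)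
  have "t1 = u1 \<and> s1 = v" using u(2) by (rule Seq.IH(1))
  with u Seq.IH(2)[of u2 s''] show ?case by simp
next
  case (CondTrue b s c1 t s1 c2)
  from CondTrue.prems CondTrue.hyps(1) obtain u1 where u: "u = Suc u1" "exec c1 s u1 s''"
    by (elim CondE) simp_all
  with CondTrue.IH[OF u(2)] show ?case by simp
next
  case (CondFalse b s c2 t s1 c1)
  from CondFalse.prems CondFalse.hyps(1) obtain u1 where u: "u = Suc u1" "exec c2 s u1 s''"
    by (elim CondE) simp_all
  with CondFalse.IH[OF u(2)] show ?case by simp
next
  case (WhileFalse b s c)
  from WhileFalse.prems show ?case by (rule WhileE) (use WhileFalse.hyps in simp_all)
next
  case (WhileTrue b s c t1 s1 t2 s2)
  from WhileTrue.prems obtain u1 v u2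
    where u: "u = Suc (u1 + u2)" "exec c s u1 v" "exec (While b c) v u2 s''"
    by (rule WhileE) (use WhileTrue.hyps in simp_all)
  have "t1 = u1 \<and> s1 = v" using u(2) by (rule WhileTrue.IH(1))
  with u WhileTrue.IH(2)[of u2 s''] show ?case by simp
qed

section \<open>Input, output and running time\<close>

text \<open>
  The list \<open>es\<close> enumerates the coordinate axes and so fixes the order in which the coordinates of a
  point are stored.
\<close>

definition coords :: "'d list \<Rightarrow> (real ^ 'd) list \<Rightarrow> real list" where
  "coords es ps = concat (map (\<lambda>p. map (\<lambda>i. p $ i) es) ps)"

definition input_state ::
    "'d list \<Rightarrow> (real ^ 'd) list \<Rightarrow> (real ^ 'd) list \<Rightarrow> real \<Rightarrow> state" where
  "input_state es P S \<epsilon> =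
     (let ns = [length P, length S]; rs = \<epsilon> # coords es (P @ S)
      in (\<lambda>i. if i < length ns then ns ! i else 0, \<lambda>i. if i < length rs then rs ! i else 0))"

definition outputs :: "'d list \<Rightarrow> state \<Rightarrow> (real ^ 'd) \<Rightarrow> (real ^ 'd) list \<Rightarrow> bool" where
  "outputs es s t Q \<longleftrightarrow>
     fst s 0 = length Q \<and>
     (\<forall>i < length (coords es (t # Q)). snd s i = coords es (t # Q) ! i)"

text \<open>
  \<open>approximable_in_time es \<delta> adm f\<close>: for curves and point sets in a space of fixed dimension, one
  program and one constant \<open>C\<close> serve all inputs: every curve \<open>P\<close> with \<open>n\<close> vertices, every set of \<open>k\<close>
  points, listed without repetition in \<open>S\<close>, and every accuracy \<open>\<epsilon>\<close>. The bound on \<open>\<epsilon>\<close> is needed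
  because \<open>1 / \<epsilon> ^ d\<close> tends to 0 as \<open>\<epsilon>\<close> grows. The premise \<open>0 < f n k \<epsilon>\<close> only lifts the time bound
  (not correctness) where \<open>f\<close> vanishes, namely for \<open>ln (n * k)\<close> with \<open>n = k = 1\<close>.
\<close>

definition approximable_in_time ::
    "'d::finite list \<Rightarrow> ((real ^ 'd) list \<Rightarrow> (real ^ 'd) list \<Rightarrow> real) \<Rightarrow>
     ((real ^ 'd) set \<Rightarrow> (real ^ 'd) list \<Rightarrow> bool) \<Rightarrow>
     (nat \<Rightarrow> nat \<Rightarrow> real \<Rightarrow> real) \<Rightarrow> bool" where
  "approximable_in_time es \<delta> adm f \<longleftrightarrow>
     (\<exists>prog C. \<forall>P S \<epsilon>. P \<noteq> [] \<longrightarrow> S \<noteq> [] \<longrightarrow> distinct S \<longrightarrow> 0 < \<epsilon> \<longrightarrow> \<epsilon> \<le> 1 \<longrightarrow>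
        (\<exists>time s t Q.
           exec prog (input_state es P S \<epsilon>) time s \<and>
           outputs es s t Q \<and>
           approx_solution \<delta> adm \<epsilon> P (set S) t Q \<and>
           (0 < f (length P) (length S) \<epsilon> \<longrightarrow>
              real time \<le> C * f (length P) (length S) \<epsilon>)))"

end

theory Submission
  imports Defs
begin

text \<open>
  The first vertex of an admissible curve is a site, so an optimal translation moves the first
  vertex of \<open>P\<close> to within the optimum of a site. Translating it onto that site at most doubles the
  optimal radius; trying all sites hence gives a constant factor approximation, and a grid of
  \<open>O(1/\<epsilon>\<^sup>d)\<close> translations around each of them a \<open>(1 + \<epsilon>)\<close>-approximation. The translations are tried
  one after the other, and the current radius is decreased by a constant factor (in the first pass)
  or by the factor \<open>1 - \<epsilon>/4\<close> (in the second) as long as the decision procedure for the current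
  translation permits. Every decision but one per translation decreases the radius, which happens
  only \<open>O(log n)\<close> and \<open>O(1/\<epsilon>)\<close> times, respectively.

  For the discrete versions the value of a translation is a (one-sided) Hausdorff distance. For the
  continuous version the decision procedure sweeps over the vertices of \<open>P\<close> and maintains, for each of
  the \<open>k\<^sup>2\<close> possible edges of \<open>Q\<close>, the first point that can be matched to the current vertex. The radius
  is initialised by a bottleneck path problem that penalises backward motion only between
  consecutive vertices of \<open>P\<close> and thereby loses a factor \<open>O(n)\<close>.
\<close>

section \<open>Frechet distance by uniform parameters\<close>

text \<open>All translations of a pass share one radius. A translation rejected at some radius stays
  rejected at every smaller one, so nothing is retried, and the number of decisions is the number of
  translations plus the number of improvements, not their product. Improvements are few because the
  starting radius is within a known factor \<Lambda> of the optimum: a factor linear in n costs only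
  its logarithm, and this logarithm is added to the number of translations.

  The multiplicative guarantee also settles an optimum of 0. The initial radius is then 0 and no
  improvement is attempted, so the loops cannot descend forever; a positive radius conversely proves
  the optimum positive.

  Attainment of the infima is never shown. Completeness of the decision is claimed only for radii
  strictly above the distance, and the bounds on the optimum follow by density of the reals.

  In the second pass the radius r is at most four times the optimum. Hence a grid of width
  \<open>r * \<epsilon> / (32 * d)\<close> costs at most an \<epsilon>/8 share of the optimum, and
  \<open>1 + \<epsilon> / 8 \<le> (1 - \<epsilon> / 4) * (1 + \<epsilon>)\<close> absorbs both this
  loss and the last rejected improvement.\<close>

fun upath :: "'a::real_normed_vector list \<Rightarrow> real \<Rightarrow> 'a" where
  "upath [] x = 0"
| "upath [p] x = p"
| "upath (p # q # ps) x = (if x \<le> 1 then linepath p q x else upath (q # ps) (x - 1))"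

lemma upath_0 [simp]: "P \<noteq> [] \<Longrightarrow> upath P 0 = hd P"
  by (cases P rule: upath.cases[of "(_, 0)"]) (auto simp: linepath_def)

lemma upath_edge:
  assumes "Suc i < length P" "0 \<le> \<mu>" "\<mu> \<le> 1"
  shows "upath P (real i + \<mu>) = linepath (P ! i) (P ! Suc i) \<mu>"
  using assms
proof (induction P arbitrary: i \<mu> rule: induct_list012)
  case (3 p q ps)
  show ?case
  proof (cases i)
    case 0 then show ?thesis using 3 by simp
  next
    case (Suc j)
    show ?thesis
    proof (cases "real j + \<mu> = 0")
      case True
      then have "j = 0" "\<mu> = 0" using "3.prems" by auto
      then show ?thesis using Suc "3.prems" by (simp add: linepath_def)
    next
      case False
      then have "\<not> real i + \<mu> \<le> 1" using Suc "3.prems" by auto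
      then show ?thesis using Suc "3.prems" "3.IH"(2)[of j \<mu>] by simp
    qed
  qed
qed auto

lemma upath_nth:
  assumes "i < length P"
  shows "upath P (real i) = P ! i"
proof (cases "Suc i < length P")
  case True
  then show ?thesis using upath_edge[of i P 0] by (simp add: linepath_def)
next
  case False
  show ?thesis
  proof (cases i)
    case 0
    then show ?thesis using assms by (auto simp: hd_conv_nth)
  next
    case (Suc j)
    then show ?thesis using upath_edge[of j P 1] assms by (simp add: linepath_def add.commute)
  qed
qed

lemma upath_append:
  assumes "P \<noteq> []" "x \<le> real (length P) - 1" "0 \<le> x"
  shows "upath (P @ R) x = upath P x"
  using assms
proof (induction P arbitrary: x rule: induct_list012)
  case (2 p)
  then have "x = 0" by simp
  then show ?case by simp
next
  case (3 p q ps)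
  then show ?case by auto
qed auto

text \<open>\<open>+++\<close> spends half of its parameter interval on the first path, so the edges
  of \<open>polygonal_path\<close> have parameter lengths 1/2, 1/4, ..., the last two being equal.
  \<open>phi n\<close> stretches each of them to length 1, which turns a parameter of
  \<open>polygonal_path\<close> into one of \<open>upath\<close> for n vertices.\<close>

fun phi :: "nat \<Rightarrow> real \<Rightarrow> real" where
  "phi 0 v = 0"
| "phi (Suc 0) v = 0"
| "phi (Suc (Suc 0)) v = v"
| "phi (Suc (Suc (Suc n))) v = (if v \<le> 1/2 then 2 * v else 1 + phi (Suc (Suc n)) (2 * v - 1))"

lemma phi_0 [simp]: "phi n 0 = 0"
  by (induction n "0::real" rule: phi.induct) auto

lemma phi_1 [simp]: "phi (Suc n) 1 = real n"
  by (induction n) (auto, case_tac n, auto)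

lemma polygonal_path_phi:
  assumes "0 \<le> v" "v \<le> 1"
  shows "polygonal_path P v = upath P (phi (length P) v)"
  using assms
proof (induction P arbitrary: v rule: polygonal_path.induct)
  case (4 p q r ps)
  show ?case
  proof (cases "v \<le> 1/2")
    case True
    then show ?thesis by (simp add: joinpaths_def)
  next
    case False
    have IH: "polygonal_path (q # r # ps) (2 * v-1) = upath (q # r # ps) (phi (length (q#r#ps)) (2 * v-1))"
      using False 4 by simp
    \<comment> \<open>At the joint the argument of \<open>upath\<close> is exactly 1 and still falls
      into the branch of the first edge, whose end is q; beyond the joint the recursive branch
      applies.\<close>
    show ?thesis
    proof (cases "phi (Suc (Suc (length ps))) (2 * v-1) \<le> 0")
      case True
      have ge: "0 \<le> phi m w" if "0 \<le> w" for m w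
        using that by (induction m w rule: phi.induct) auto
      have "phi (Suc (Suc (length ps))) (2 * v-1) = 0"
        using ge[of "2 * v-1" "Suc (Suc (length ps))"] True False by simp
      then show ?thesis using False IH by (simp add: joinpaths_def linepath_def)
    next
      case nz: False
      then show ?thesis using False IH by (simp add: joinpaths_def)
    qed
  qed
qed auto

lemma phi_mono: "mono_on {0..1} (phi n)"
proof -
  have ge: "0 \<le> phi m w" if "0 \<le> w" for m w
    using that by (induction m w rule: phi.induct) auto
  have "phi n v \<le> phi n w" if "0 \<le> v" "v \<le> w" "w \<le> 1" for v w
    using that
  proof (induction n v arbitrary: w rule: phi.induct)
    case (4 n v)
    then show ?case using ge[of "2 * w - 1" "Suc (Suc n)"] by auto
  qed auto
  then show ?thesis by (auto simp: mono_on_def)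
qed

lemma continuous_on_phi: "continuous_on {0..1} (phi n)"
proof (induction n rule: induct_nat_012)
  case (ge2 n)
  show ?case
  proof (cases n)
    case 0 then show ?thesis by (simp add: continuous_on_id)
  next
    case (Suc m)
    have eq: "{0..1::real} = {0..1/2} \<union> {1/2..1}" by auto
    have "continuous_on {1/2..1::real} (\<lambda>v. phi (Suc n) (2 * v-1))"
      by (rule continuous_on_compose2[OF ge2(2)]) (auto intro!: continuous_intros)
    then have c2: "continuous_on {1/2..1::real} (\<lambda>v. 1 + phi (Suc n) (2 * v-1))"
      by (intro continuous_intros)
    have c1: "continuous_on {0..1/2::real} (\<lambda>v. 2 * v)" by (intro continuous_intros)
    have c3: "2 * v = 1 + phi (Suc n) (2 * v - 1)" if "v * 2 = 1" for v
      using that by (simp add: mult.commute)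
    have "continuous_on ({0..1/2} \<union> {1/2..1::real})
        (\<lambda>v. if v \<le> 1/2 then 2 * v else 1 + phi (Suc n) (2 * v-1))"
      by (intro continuous_on_cases c1 c2) (auto intro: c3)
    moreover have "phi (Suc (Suc n)) = (\<lambda>v. if v \<le> 1/2 then 2 * v else 1 + phi (Suc n) (2 * v-1))"
      using Suc by (intro ext) simp
    ultimately show ?thesis using eq by simp
  qed
qed auto

text \<open>The inverse of \<open>phi n\<close> on the interval from 0 to n - 1, for n at least 2.
  For a single vertex that interval is a point, so this case is treated separately.\<close>

fun psi :: "nat \<Rightarrow> real \<Rightarrow> real" where
  "psi (Suc (Suc (Suc n))) x = (if x \<le> 1 then x / 2 else 1/2 + psi (Suc (Suc n)) (x - 1) / 2)"
| "psi n x = x"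

lemma psi_0 [simp]: "psi n 0 = 0"
  by (induction n "0::real" rule: psi.induct) auto

lemma psi_top [simp]: "psi (Suc (Suc n)) (1 + real n) = 1"
  by (induction n) auto

lemma psi_range:
  assumes "0 \<le> x" "x \<le> real n - 1" "2 \<le> n"
  shows "0 \<le> psi n x \<and> psi n x \<le> 1"
  using assms by (induction n x rule: psi.induct) auto

lemma phi_psi:
  assumes "0 \<le> x" "x \<le> real n - 1" "2 \<le> n"
  shows "phi n (psi n x) = x"
  using assms
proof (induction n x rule: psi.induct)
  case (1 n x)
  show ?case
  proof (cases "x \<le> 1")
    case False
    have r: "0 \<le> psi (Suc (Suc n)) (x - 1)" "phi (Suc (Suc n)) (psi (Suc (Suc n)) (x-1)) = x - 1"
      using psi_range[of "x-1" "Suc (Suc n)"] 1 False by auto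
    then show ?thesis
    proof (cases "psi (Suc (Suc n)) (x - 1) = 0")
      case True
      then have "x - 1 = 0" using r(2) by simp
      then show ?thesis using False by simp
    qed (use r False in auto)
  qed (use 1 in auto)
qed auto

lemma psi_mono: "2 \<le> n \<Longrightarrow> mono_on {0..real n - 1} (psi n)"
proof -
  assume n: "2 \<le> n"
  have "psi n x \<le> psi n y" if "0 \<le> x" "x \<le> y" "y \<le> real n - 1" "2 \<le> n" for x y
    using that
  proof (induction n x arbitrary: y rule: psi.induct)
    case (1 n x)
    then show ?case using psi_range[of "y - 1" "Suc (Suc n)"] by auto
  qed auto
  then show ?thesis using n by (auto simp: mono_on_def)
qed

lemma continuous_on_psi: "2 \<le> n \<Longrightarrow> continuous_on {0..real n - 1} (psi n)"
proof (induction n rule: induct_nat_012)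
  case (ge2 n)
  show ?case
  proof (cases n)
    case 0 then show ?thesis by (simp add: continuous_on_id)
  next
    case (Suc m)
    have eq: "{0..1 + real n} = {0..1} \<union> {1..1 + real n}" by auto
    have "continuous_on {1..1 + real n} (\<lambda>x. psi (Suc n) (x - 1))"
      by (rule continuous_on_compose2[OF ge2(2)]) (auto simp: Suc intro!: continuous_intros)
    then have c2: "continuous_on {1..1 + real n} (\<lambda>x. 1/2 + psi (Suc n) (x - 1) / 2)"
      by (auto intro!: continuous_intros)
    have c1: "continuous_on {0..1::real} (\<lambda>x. x / 2)" by (auto intro!: continuous_intros)
    have "continuous_on ({0..1} \<union> {1..1 + real n})
        (\<lambda>x. if x \<le> 1 then x / 2 else 1/2 + psi (Suc n) (x - 1) / 2)"
      by (intro continuous_on_cases c1 c2) auto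
    moreover have "psi (Suc (Suc n)) = (\<lambda>x. if x \<le> 1 then x / 2 else 1/2 + psi (Suc n) (x - 1) / 2)"
      using Suc by (intro ext) simp
    ultimately show ?thesis using eq by simp
  qed
qed auto

section \<open>Frechet distance through pairs of reparametrizations\<close>

lemma continuous_on_polygonal_path [continuous_intros]: "continuous_on {0..1} (polygonal_path P)"
proof -
  \<comment> \<open>The starting point is carried through the induction because joining two paths
    requires that the end of one is the start of the other.\<close>
  have "path (polygonal_path P) \<and> (P \<noteq> [] \<longrightarrow> pathstart (polygonal_path P) = hd P)"
  proof (induction P rule: polygonal_path.induct)
    case 1 show ?case by (auto simp: path_def)
  next
    case 2 show ?case by (auto simp: path_def pathstart_def)
  qed (auto intro!: path_join_imp)
  then show ?thesis by (simp add: path_def)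
qed

text \<open>A real supremum bounds its elements only when the set is bounded. Here boundedness comes
  from continuity on a compact interval.\<close>

lemma bdd_above_reparametrized_dist:
  assumes "reparametrization \<sigma>" "reparametrization \<tau>"
  shows "bdd_above ((\<lambda>s. dist (polygonal_path P (\<sigma> s)) (polygonal_path Q (\<tau> s))) ` {0..1})"
proof -
  have "continuous_on {0..1} (\<lambda>s. dist (polygonal_path P (\<sigma> s)) (polygonal_path Q (\<tau> s)))"
    using assms unfolding reparametrization_def
    by (intro continuous_intros continuous_on_compose2[OF continuous_on_polygonal_path]) auto
  then show ?thesis
    by (intro bounded_imp_bdd_above compact_imp_bounded compact_continuous_image) auto
qed

lemma reparametrization_id: "reparametrization (\<lambda>s. s)"
  by (auto simp: reparametrization_def mono_on_def continuous_on_id)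

lemma reparametrized_SUP_nonneg:
  assumes "reparametrization \<sigma>" "reparametrization \<tau>"
  shows "0 \<le> (SUP s\<in>{0..1}. dist (polygonal_path P (\<sigma> s)) (polygonal_path Q (\<tau> s)))"
  by (rule cSUP_upper2[where x=0, OF bdd_above_reparametrized_dist[OF assms]]) auto

lemma frechet_dist_nonneg: "0 \<le> frechet_dist P Q"
  unfolding frechet_dist_def path_frechet_dist_def
  by (rule cInf_greatest) (use reparametrization_id reparametrized_SUP_nonneg in blast)+

lemma frechet_dist_le:
  assumes "reparametrization \<sigma>" "reparametrization \<tau>"
    and "\<And>s. s \<in> {0..1} \<Longrightarrow> dist (polygonal_path P (\<sigma> s)) (polygonal_path Q (\<tau> s)) \<le> r"
  shows "frechet_dist P Q \<le> r"
proof -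
  have "frechet_dist P Q \<le> (SUP s\<in>{0..1}. dist (polygonal_path P (\<sigma> s)) (polygonal_path Q (\<tau> s)))"
    unfolding frechet_dist_def path_frechet_dist_def
    by (rule cInf_lower) (use assms(1,2) reparametrized_SUP_nonneg in \<open>auto intro!: bdd_belowI[of _ 0]\<close>)
  also have "\<dots> \<le> r" by (rule cSUP_least) (use assms(3) in auto)
  finally show ?thesis .
qed

text \<open>The infimum may not be attained, so only a strict bound yields concrete
  reparametrizations. This strictness is passed on to the completeness of the decision
  procedure.\<close>

lemma frechet_dist_less:
  assumes "frechet_dist P Q < r"
  obtains \<sigma> \<tau> where "reparametrization \<sigma>" "reparametrization \<tau>"
    "\<And>s. s \<in> {0..1} \<Longrightarrow> dist (polygonal_path P (\<sigma> s)) (polygonal_path Q (\<tau> s)) \<le> r"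
proof -
  let ?A = "{SUP s\<in>{0..1}. dist (polygonal_path P (\<sigma> s)) (polygonal_path Q (\<tau> s)) | \<sigma> \<tau>.
            reparametrization \<sigma> \<and> reparametrization \<tau>}"
  have "?A \<noteq> {}" using reparametrization_id by blast
  moreover have "Inf ?A < r" using assms unfolding frechet_dist_def path_frechet_dist_def .
  ultimately obtain x where x: "x \<in> ?A" "x < r" using cInf_lessD[of ?A r] by blast
  then obtain \<sigma> \<tau> where st: "reparametrization \<sigma>" "reparametrization \<tau>"
    "(SUP s\<in>{0..1}. dist (polygonal_path P (\<sigma> s)) (polygonal_path Q (\<tau> s))) < r" by blast
  show ?thesis
  proof (rule that[OF st(1,2)])
    fix s :: real assume "s \<in> {0..1}"
    then have "dist (polygonal_path P (\<sigma> s)) (polygonal_path Q (\<tau> s)) \<le>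
        (SUP s\<in>{0..1}. dist (polygonal_path P (\<sigma> s)) (polygonal_path Q (\<tau> s)))"
      by (rule cSUP_upper[OF _ bdd_above_reparametrized_dist[OF st(1,2)]])
    then show "dist (polygonal_path P (\<sigma> s)) (polygonal_path Q (\<tau> s)) \<le> r" using st(3) by linarith
  qed
qed

text \<open>A monotone path from the origin to (x, y) in the free space diagram of \<open>P\<close>
  and \<open>Q\<close>. Arbitrary end points are allowed so that such paths can be assembled cell by
  cell; only a path to the far corner is turned into reparametrizations.\<close>

definition fpath :: "real \<Rightarrow> 'a::real_normed_vector list \<Rightarrow> 'a list \<Rightarrow> real \<Rightarrow> real \<Rightarrow> bool" where
  "fpath r P Q x y \<longleftrightarrow> (\<exists>\<sigma> \<tau>. path \<sigma> \<and> path \<tau> \<and> mono_on {0..1} \<sigma> \<and> mono_on {0..1} \<tau> \<and>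
     \<sigma> 0 = 0 \<and> \<tau> 0 = 0 \<and> \<sigma> 1 = x \<and> \<tau> 1 = y \<and>
     (\<forall>u\<in>{0..1}. dist (upath P (\<sigma> u)) (upath Q (\<tau> u)) \<le> r))"

lemma fpath_0:
  assumes "dist (upath P 0) (upath Q 0) \<le> r"
  shows "fpath r P Q 0 0"
  unfolding fpath_def
  by (rule exI[of _ "\<lambda>_. 0"], rule exI[of _ "\<lambda>_. 0"])
    (use assms in \<open>auto simp: path_def mono_on_def\<close>)

definition affine_between :: "'a::real_normed_vector list \<Rightarrow> real \<Rightarrow> real \<Rightarrow> bool" where
  "affine_between P x x' \<longleftrightarrow>
     (\<forall>u\<in>{0..1}. upath P (linepath x x' u) = linepath (upath P x) (upath P x') u)"

lemma affine_between_refl: "affine_between P x x"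
  by (auto simp: affine_between_def linepath_def algebra_simps)

lemma linepath_linepath:
  "linepath p q (linepath (\<mu>::real) \<mu>' u) = linepath (linepath p q \<mu>) (linepath p q \<mu>') u"
  by (simp add: linepath_def algebra_simps)

lemma affine_between_edge:
  assumes "Suc i < length P" "0 \<le> \<mu>" "\<mu> \<le> 1" "0 \<le> \<mu>'" "\<mu>' \<le> 1"
  shows "affine_between P (real i + \<mu>) (real i + \<mu>')"
  unfolding affine_between_def
proof
  fix u :: real assume u: "u \<in> {0..1}"
  have e: "linepath (real i + \<mu>) (real i + \<mu>') u = real i + linepath \<mu> \<mu>' u"
    by (simp add: linepath_def algebra_simps)
  have "linepath \<mu> \<mu>' u \<in> closed_segment \<mu> \<mu>'" using u by (auto intro: linepath_in_path)
  then have "0 \<le> linepath \<mu> \<mu>' u \<and> linepath \<mu> \<mu>' u \<le> 1"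
    using assms by (auto simp: closed_segment_eq_real_ivl split: if_splits)
  then show "upath P (linepath (real i + \<mu>) (real i + \<mu>') u) =
      linepath (upath P (real i + \<mu>)) (upath P (real i + \<mu>')) u"
    unfolding e using assms by (simp add: upath_edge linepath_linepath)
qed

lemma mono_on_join:
  fixes f g :: "real \<Rightarrow> real"
  assumes "mono_on {0..1} f" "mono_on {0..1} g" "f 1 = g 0"
  shows "mono_on {0..1} (f +++ g)"
  unfolding mono_on_def
proof (intro allI impI, elim conjE)
  fix a b :: real assume ab: "a \<in> {0..1}" "b \<in> {0..1}" "a \<le> b"
  consider "b \<le> 1/2" | "a \<le> 1/2" "1/2 < b" | "1/2 < a" by linarith
  then show "(f +++ g) a \<le> (f +++ g) b"
  proof cases
    case 1
    then show ?thesis using ab mono_onD[OF assms(1), of "2*a" "2*b"] by (simp add: joinpaths_def)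
  next
    case 2
    have "f (2*a) \<le> f 1" using 2 ab by (intro mono_onD[OF assms(1)]) auto
    moreover have "g 0 \<le> g (2*b-1)" using 2 ab by (intro mono_onD[OF assms(2)]) auto
    ultimately show ?thesis using 2 assms(3) by (simp add: joinpaths_def)
  next
    case 3
    then show ?thesis using ab mono_onD[OF assms(2), of "2*a-1" "2*b-1"] by (simp add: joinpaths_def)
  qed
qed

lemma mono_on_linepath: "(x::real) \<le> y \<Longrightarrow> mono_on {0..1} (linepath x y)"
proof -
  assume "x \<le> y"
  have "linepath x y = (\<lambda>u. x + u * (y - x))" by (auto simp: linepath_def algebra_simps)
  then show ?thesis using \<open>x \<le> y\<close> by (auto simp: mono_on_def intro!: mult_right_mono)
qed

lemma dist_linepath_le:
  fixes a b c d :: "'a::real_normed_vector"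
  assumes "dist a b \<le> r" "dist c d \<le> r" "0 \<le> u" "u \<le> 1"
  shows "dist (linepath a c u) (linepath b d u) \<le> r"
proof -
  have "linepath a c u - linepath b d u = (1-u) *\<^sub>R (a - b) + u *\<^sub>R (c - d)"
    by (simp add: linepath_def algebra_simps)
  then have "dist (linepath a c u) (linepath b d u) \<le> (1-u) * dist a b + u * dist c d"
    using norm_triangle_ineq[of "(1-u) *\<^sub>R (a - b)" "u *\<^sub>R (c - d)"] assms(3,4)
    by (simp add: dist_norm)
  also have "\<dots> \<le> (1-u) * r + u * r"
    using assms by (intro add_mono mult_left_mono) auto
  finally show ?thesis by (simp add: algebra_simps)
qed

text \<open>The cells of the free space diagram are convex: while both curves stay on one edge and
  both parameters move linearly, the distance is a convex function, so it suffices to control it at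
  the two ends.\<close>

lemma fpath_extend:
  assumes "fpath r P Q x y" "affine_between P x x'" "affine_between Q y y'" "x \<le> x'" "y \<le> y'"
    and d: "dist (upath P x') (upath Q y') \<le> r"
  shows "fpath r P Q x' y'"
proof -
  obtain \<sigma> \<tau> where st: "path \<sigma>" "path \<tau>" "mono_on {0..1} \<sigma>" "mono_on {0..1} \<tau>"
     "\<sigma> 0 = 0" "\<tau> 0 = 0" "\<sigma> 1 = x" "\<tau> 1 = y"
     "\<And>u. u\<in>{0..1} \<Longrightarrow> dist (upath P (\<sigma> u)) (upath Q (\<tau> u)) \<le> r"
    using assms(1) unfolding fpath_def by blast
  have d0: "dist (upath P x) (upath Q y) \<le> r" using st(9)[of 1] st(7,8) by simp
  have l: "dist (upath P (linepath x x' u)) (upath Q (linepath y y' u)) \<le> r" if "u \<in> {0..1}" for u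
    using that assms(2,3) dist_linepath_le[OF d0 d, of u] by (auto simp: affine_between_def)
  show ?thesis unfolding fpath_def
  proof (intro exI conjI ballI)
    show "path (\<sigma> +++ linepath x x')" "path (\<tau> +++ linepath y y')"
      using st by (auto intro!: path_join_imp simp: pathfinish_def)
    show "mono_on {0..1} (\<sigma> +++ linepath x x')" "mono_on {0..1} (\<tau> +++ linepath y y')"
      using st assms(4,5) by (intro mono_on_join mono_on_linepath; simp add: linepath_def)+
    fix u :: real assume "u \<in> {0..1}"
    then show "dist (upath P ((\<sigma> +++ linepath x x') u)) (upath Q ((\<tau> +++ linepath y y') u)) \<le> r"
      using st(9)[of "2*u"] l[of "2*u-1"] by (auto simp: joinpaths_def)
  qed (use st in \<open>auto simp: joinpaths_def linepath_def\<close>)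
qed

text \<open>The path never passes the last vertex of \<open>Q\<close>, and up to there
  \<open>upath\<close> does not see the appended vertices.\<close>

lemma fpath_append:
  assumes "fpath r P Q x y" "y \<le> real (length Q) - 1" "Q \<noteq> []"
  shows "fpath r P (Q @ R) x y"
proof -
  obtain \<sigma> \<tau> where st: "path \<sigma>" "path \<tau>" "mono_on {0..1} \<sigma>" "mono_on {0..1} \<tau>"
     "\<sigma> 0 = 0" "\<tau> 0 = 0" "\<sigma> 1 = x" "\<tau> 1 = y"
     "\<And>u. u\<in>{0..1} \<Longrightarrow> dist (upath P (\<sigma> u)) (upath Q (\<tau> u)) \<le> r"
    using assms(1) unfolding fpath_def by blast
  have "upath (Q @ R) (\<tau> u) = upath Q (\<tau> u)" if "u \<in> {0..1}" for u
    using mono_onD[OF st(4), of 0 u] mono_onD[OF st(4), of u 1] that assms(2,3) st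
    by (intro upath_append) auto
  then show ?thesis unfolding fpath_def using st by (intro exI[of _ \<sigma>] exI[of _ \<tau>]) auto
qed

lemma fpath_reparametrization:
  assumes "P \<noteq> []" "path \<sigma>" "mono_on {0..1} \<sigma>" "\<sigma> 0 = 0" "\<sigma> 1 = real (length P) - 1"
  shows "\<exists>\<sigma>'. reparametrization \<sigma>' \<and> (\<forall>u\<in>{0..1}. polygonal_path P (\<sigma>' u) = upath P (\<sigma> u))"
proof (cases "2 \<le> length P")
  case True
  let ?n = "length P"
  have rng: "\<sigma> u \<in> {0..real ?n - 1}" if "u \<in> {0..1}" for u
    using mono_onD[OF assms(3), of 0 u] mono_onD[OF assms(3), of u 1] that assms by auto
  have cont: "continuous_on {0..1} (psi ?n \<circ> \<sigma>)"
    using assms(2) rng unfolding path_def o_def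
    by (intro continuous_on_compose2[OF continuous_on_psi[OF True]]) auto
  have top: "psi ?n (\<sigma> 1) = 1"
  proof -
    obtain m where "?n = Suc (Suc m)" using True by (metis Suc_le_D numeral_2_eq_2 Suc_le_mono)
    then show ?thesis using assms(5) psi_top[of m] by simp
  qed
  have mono: "mono_on {0..1} (psi ?n \<circ> \<sigma>)"
    using psi_mono[OF True] assms(3) rng unfolding mono_on_def o_def by blast
  have "(psi ?n \<circ> \<sigma>) ` {0..1} = {0..1}"
  proof
    show "(psi ?n \<circ> \<sigma>) ` {0..1} \<subseteq> {0..1}" using rng psi_range[of _ ?n] True by fastforce
    show "{0..1} \<subseteq> (psi ?n \<circ> \<sigma>) ` {0..1}"
    proof
      fix y :: real assume "y \<in> {0..1}"
      then show "y \<in> (psi ?n \<circ> \<sigma>) ` {0..1}"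
        using IVT'[OF _ _ _ cont, of y] assms(4) top by (auto simp: image_iff)
    qed
  qed
  then have "reparametrization (psi ?n \<circ> \<sigma>)"
    using cont mono by (simp add: reparametrization_def)
  moreover have "polygonal_path P ((psi ?n \<circ> \<sigma>) u) = upath P (\<sigma> u)" if "u \<in> {0..1}" for u
    using rng[OF that] psi_range[of "\<sigma> u" ?n] True
    by (subst polygonal_path_phi) (auto simp: phi_psi)
  ultimately show ?thesis by blast
next
  \<comment> \<open>A curve with one vertex is constant, so the identity serves as
    reparametrization.\<close>
  case False
  then obtain p where "P = [p]" using assms(1) by (cases P rule: polygonal_path.cases) auto
  then show ?thesis by (intro exI[of _ "\<lambda>s. s"]) (auto intro: reparametrization_id)
qed

lemma frechet_dist_fpath:
  assumes "fpath r P Q (real (length P) - 1) (real (length Q) - 1)" "P \<noteq> []" "Q \<noteq> []"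
  shows "frechet_dist P Q \<le> r"
proof -
  obtain \<sigma> \<tau> where st: "path \<sigma>" "path \<tau>" "mono_on {0..1} \<sigma>" "mono_on {0..1} \<tau>"
     "\<sigma> 0 = 0" "\<tau> 0 = 0" "\<sigma> 1 = real (length P) - 1" "\<tau> 1 = real (length Q) - 1"
     "\<And>u. u\<in>{0..1} \<Longrightarrow> dist (upath P (\<sigma> u)) (upath Q (\<tau> u)) \<le> r"
    using assms(1) unfolding fpath_def by blast
  obtain \<sigma>' where s': "reparametrization \<sigma>'" "\<forall>u\<in>{0..1}. polygonal_path P (\<sigma>' u) = upath P (\<sigma> u)"
    using fpath_reparametrization[OF assms(2) st(1,3,5,7)] by blast
  obtain \<tau>' where t': "reparametrization \<tau>'" "\<forall>u\<in>{0..1}. polygonal_path Q (\<tau>' u) = upath Q (\<tau> u)"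
    using fpath_reparametrization[OF assms(3) st(2,4,6,8)] by blast
  show ?thesis by (rule frechet_dist_le[OF s'(1) t'(1)]) (use s' t' st(9) in auto)
qed

lemma reparametrization_uniform:
  assumes "reparametrization \<sigma>" "P \<noteq> []"
  obtains x where "continuous_on {0..1} x" "mono_on {0..1} x" "x 0 = 0" "x 1 = real (length P) - 1"
    "\<And>u. u \<in> {0..1} \<Longrightarrow> polygonal_path P (\<sigma> u) = upath P (x u)"
proof -
  let ?x = "\<lambda>u. phi (length P) (\<sigma> u)"
  have c: "continuous_on {0..1} \<sigma>" and m: "mono_on {0..1} \<sigma>" and i: "\<sigma> ` {0..1} = {0..1}"
    using assms by (auto simp: reparametrization_def)
  obtain a b where ab: "a \<in> {0..1}" "\<sigma> a = 0" "b \<in> {0..1}" "\<sigma> b = 1"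
    using i by (metis (no_types, lifting) atLeastAtMost_iff imageE order_refl zero_le_one)
  have rng: "\<sigma> u \<in> {0..1}" if "u \<in> {0..1}" for u using i that by blast
  \<comment> \<open>Surjectivity only says that 0 and 1 are attained somewhere; monotonicity moves
    them to the ends of the interval.\<close>
  have "\<sigma> 0 \<le> \<sigma> a" "\<sigma> b \<le> \<sigma> 1" using ab by (intro mono_onD[OF m]; simp)+
  then have e: "\<sigma> 0 = 0" "\<sigma> 1 = 1" using ab rng[of 0] rng[of 1] by auto
  show ?thesis
  proof (rule that[of ?x])
    show "continuous_on {0..1} ?x"
      by (rule continuous_on_compose2[OF continuous_on_phi c]) (use rng in auto)
    show "mono_on {0..1} ?x" using m rng phi_mono[of "length P"] unfolding mono_on_def by blast
    show "?x 0 = 0" "?x 1 = real (length P) - 1"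
      using e assms(2) by (auto simp: neq_Nil_conv)
    show "polygonal_path P (\<sigma> u) = upath P (?x u)" if "u \<in> {0..1}" for u
      using rng[OF that] by (auto simp: polygonal_path_phi)
  qed
qed

section \<open>Matchings of a polygonal curve with a curve through sites\<close>

text \<open>
  A curve \<open>Q\<close> through points of \<open>S\<close> is matched to \<open>p\<close> by recording, for each vertex \<open>p i\<close>, the edge
  \<open>S a\<close>--\<open>S b\<close> of \<open>Q\<close> and the parameter \<open>\<theta>\<close> of the point matched to \<open>p i\<close>. Of the vertices of \<open>Q\<close>
  matched to the edge from \<open>p i\<close> to \<open>p (Suc i)\<close> only the first and the last are kept.
\<close>

inductive reach :: "(nat \<Rightarrow> 'a::real_normed_vector) \<Rightarrow> (nat \<Rightarrow> 'a) \<Rightarrow> nat \<Rightarrow> real \<Rightarrow>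
    nat \<Rightarrow> nat list \<Rightarrow> nat \<Rightarrow> nat \<Rightarrow> real \<Rightarrow> bool" for p S k r where
  start: "a < k \<Longrightarrow> b < k \<Longrightarrow> dist (p 0) (S a) \<le> r \<Longrightarrow> 0 \<le> \<theta> \<Longrightarrow> \<theta> \<le> 1 \<Longrightarrow>
    dist (p 0) (linepath (S a) (S b) \<theta>) \<le> r \<Longrightarrow> reach p S k r 0 [] a b \<theta>"
| stay: "reach p S k r i qs a b \<theta> \<Longrightarrow> \<theta> \<le> \<theta>' \<Longrightarrow> \<theta>' \<le> 1 \<Longrightarrow>
    dist (p (Suc i)) (linepath (S a) (S b) \<theta>') \<le> r \<Longrightarrow> reach p S k r (Suc i) qs a b \<theta>'"
| switch: "reach p S k r i qs a b \<theta> \<Longrightarrow> a' < k \<Longrightarrow> b' < k \<Longrightarrow> 0 \<le> \<mu> \<Longrightarrow> \<mu> \<le> \<mu>' \<Longrightarrow> \<mu>' \<le> 1 \<Longrightarrow>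
    dist (linepath (p i) (p (Suc i)) \<mu>) (S b) \<le> r \<Longrightarrow>
    dist (linepath (p i) (p (Suc i)) \<mu>') (S a') \<le> r \<Longrightarrow> 0 \<le> \<theta>' \<Longrightarrow> \<theta>' \<le> 1 \<Longrightarrow>
    dist (p (Suc i)) (linepath (S a') (S b') \<theta>') \<le> r \<Longrightarrow>
    reach p S k r (Suc i) (qs @ [a, b]) a' b' \<theta>'"

lemma reach_bounds:
  assumes "reach p S k r i qs a b \<theta>"
  shows "a < k" "b < k" "0 \<le> \<theta>" "\<theta> \<le> 1" "set qs \<subseteq> {..<k}"
    "dist (p i) (linepath (S a) (S b) \<theta>) \<le> r"
  using assms by (induction rule: reach.induct) auto

lemma reach_mono:
  assumes "reach p S k r i qs a b \<theta>" "r \<le> r'"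
  shows "reach p S k r' i qs a b \<theta>"
  using assms
proof (induction rule: reach.induct)
  case (start a b \<theta>) then show ?case by (intro reach.start) auto
next
  case (stay i qs a b \<theta> \<theta>') then show ?case by (intro reach.stay[of _ _ _ _ _ _ _ _ \<theta>]) auto
next
  case (switch i qs a b \<theta> a' b' \<mu> \<mu>' \<theta>')
  then show ?case by (intro reach.switch[of _ _ _ _ _ _ _ _ \<theta> _ _ \<mu> \<mu>']) auto
qed

lemma linepath_translate: "linepath (a + u) (b + u) x = linepath a b x + u"
  by (simp add: linepath_def algebra_simps)

lemma dist_translate_le:
  fixes a b u :: "'a::real_normed_vector"
  shows "dist a b \<le> r \<Longrightarrow> dist (a + u) b \<le> r + norm u"
  using dist_triangle[of "a + u" b a] by (simp add: dist_norm)

text \<open>The derivation is kept with all its sites and parameters; each distance in it grows by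
  at most the length of the translation.\<close>

lemma reach_translate:
  assumes "reach p S k r i qs a b \<theta>"
  shows "reach (\<lambda>i. p i + u) S k (r + norm u) i qs a b \<theta>"
  using assms
proof (induction rule: reach.induct)
  case (start a b \<theta>) then show ?case by (intro reach.start dist_translate_le)
next
  case (stay i qs a b \<theta> \<theta>')
  then show ?case by (intro reach.stay[of _ _ _ _ _ _ _ _ \<theta>] dist_translate_le)
next
  case (switch i qs a b \<theta> a' b' \<mu> \<mu>' \<theta>')
  then show ?case unfolding linepath_translate
    by (intro reach.switch[of _ _ _ _ _ _ _ _ \<theta> _ _ \<mu> \<mu>'])
      (simp_all add: dist_translate_le linepath_translate)
qed

text \<open>At the start \<open>P\<close> rests at its first vertex while \<open>Q\<close> runs from
  \<open>S a\<close> to the parameter \<theta>. A switch consists of three linear pieces: the rest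
  of the edge from \<open>S a\<close> to \<open>S b\<close> until \<mu>, the connecting edge from
  \<open>S b\<close> to \<open>S a'\<close> between \<mu> and \<mu>', and the beginning of the new
  edge. In the list of sites the recorded edges therefore alternate with connecting ones.\<close>

lemma reach_fpath:
  assumes "reach p S k r i qs a b \<theta>" "P \<noteq> []" "i < length P" "\<And>j. j < length P \<Longrightarrow> p j = P ! j"
  shows "fpath r P (map S (qs @ [a, b])) (real i) (real (length qs) + \<theta>)"
  using assms
proof (induction rule: reach.induct)
  case (start a b \<theta>)
  let ?Q = "map S [a, b]"
  have "fpath r P ?Q 0 0"
    using start by (intro fpath_0) (simp add: hd_conv_nth linepath_def)
  then have "fpath r P ?Q 0 (real 0 + \<theta>)"
    using start affine_between_edge[of 0 ?Q 0 \<theta>] upath_edge[of 0 ?Q \<theta>]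
    by (elim fpath_extend) (auto simp: affine_between_refl hd_conv_nth)
  then show ?case by simp
next
  case (stay i qs a b \<theta> \<theta>')
  let ?Q = "map S (qs @ [a, b])"
  have "0 \<le> \<theta>" using reach_bounds[OF stay(1)] by simp
  moreover have "upath P (real (Suc i)) = p (Suc i)" using stay by (simp only: upath_nth)
  moreover have "affine_between P (real i) (real (Suc i))"
    using affine_between_edge[of i P 0 1] stay by (simp add: add.commute)
  moreover have "affine_between ?Q (real (length qs) + \<theta>) (real (length qs) + \<theta>')"
    using stay \<open>0 \<le> \<theta>\<close> by (intro affine_between_edge) auto
  moreover have "upath ?Q (real (length qs) + \<theta>') = linepath (S a) (S b) \<theta>'"
    using stay \<open>0 \<le> \<theta>\<close> upath_edge[of "length qs" ?Q \<theta>'] by (simp add: nth_append)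
  moreover have "fpath r P ?Q (real i) (real (length qs) + \<theta>)" using stay by simp
  ultimately show ?case using stay by (elim fpath_extend) auto
next
  case (switch i qs a b \<theta> a' b' \<mu> \<mu>' \<theta>')
  let ?Q = "map S (qs @ [a, b, a', b'])" and ?l = "length qs"
  have b: "0 \<le> \<theta>" "\<theta> \<le> 1" using reach_bounds[OF switch(1)] by auto
  have i: "Suc i < length P" using switch by simp
  have P: "upath P (real i + x) = linepath (p i) (p (Suc i)) x" if "0 \<le> x" "x \<le> 1" for x
    using upath_edge[OF i that] switch.prems i by simp
  have aP: "affine_between P (real i + x) (real i + y)" if "0 \<le> x" "x \<le> y" "y \<le> 1" for x y
    using affine_between_edge[OF i] that by simp
  have "fpath r P (map S (qs @ [a, b]) @ map S [a', b']) (real i) (real ?l + \<theta>)"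
    using switch b by (intro fpath_append) auto
  then have f0: "fpath r P ?Q (real i + 0) (real (?l + 0) + \<theta>)" by simp
  have aQ: "affine_between ?Q (real (?l + j) + x) (real (?l + j) + y)"
    if "j < 3" "0 \<le> x" "x \<le> y" "y \<le> 1" for j x y
    using that by (intro affine_between_edge) auto
  have uQ: "upath ?Q (real (?l + j) + x) = linepath (S ([a, b, a', b'] ! j)) (S ([a, b, a', b'] ! Suc j)) x"
    if "j < 3" "0 \<le> x" "x \<le> 1" for j x
    using upath_edge[of "?l + j" ?Q x] that
    by (simp add: nth_append numeral_3_eq_3 less_Suc_eq) (elim disjE; simp)
  have \<mu>: "0 \<le> \<mu>" "\<mu> \<le> \<mu>'" "\<mu>' \<le> 1" "\<mu> \<le> 1" "0 \<le> \<mu>'" using switch by auto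
  have "fpath r P ?Q (real i + \<mu>) (real (?l + 0) + 1)"
    by (rule fpath_extend[OF f0 aP aQ])
      (use \<mu> b switch uQ[of 0 1] in \<open>simp_all add: P linepath_1'\<close>)
  then have f1: "fpath r P ?Q (real i + \<mu>) (real (?l + 1) + 0)"
    by (simp add: add.commute)
  have "fpath r P ?Q (real i + \<mu>') (real (?l + 1) + 1)"
    by (rule fpath_extend[OF f1 aP aQ])
      (use \<mu> b switch uQ[of 1 1] in \<open>simp_all add: P linepath_1'\<close>)
  then have f2: "fpath r P ?Q (real i + \<mu>') (real (?l + 2) + 0)"
    by (simp add: algebra_simps)
  have "fpath r P ?Q (real i + 1) (real (?l + 2) + \<theta>')"
    by (rule fpath_extend[OF f2 aP aQ])
      (use \<mu> b switch uQ[of 2 \<theta>'] in \<open>simp_all add: P linepath_1'\<close>)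
  then show ?case by (simp add: add.commute)
qed

text \<open>\<open>P\<close> rests at its last vertex while \<open>Q\<close> completes its edge to
  \<open>S b\<close>. By convexity the distance at both ends of this motion is all that
  matters.\<close>

lemma frechet_dist_le_reach:
  assumes "reach p S k r (length P - 1) qs a b \<theta>" "dist (p (length P - 1)) (S b) \<le> r"
    and "P \<noteq> []" "\<And>j. j < length P \<Longrightarrow> p j = P ! j"
  shows "frechet_dist P (map S (qs @ [a, b])) \<le> r"
proof -
  let ?Q = "map S (qs @ [a, b])" and ?n = "length P - 1" and ?l = "length qs"
  have b: "0 \<le> \<theta>" "\<theta> \<le> 1" using reach_bounds[OF assms(1)] by auto
  have "fpath r P ?Q (real ?n) (real ?l + \<theta>)"
    using reach_fpath[OF assms(1)] assms by simp
  moreover have "upath P (real ?n) = p ?n" using assms by (simp add: upath_nth del: of_nat_diff)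
  ultimately have "fpath r P ?Q (real ?n) (real ?l + 1)"
    using b upath_edge[of ?l ?Q 1] assms(2)
    by (elim fpath_extend) (auto simp: nth_append affine_between_refl linepath_def simp del: of_nat_diff intro!: affine_between_edge)
  then show ?thesis using assms(3)
    by (intro frechet_dist_fpath) (auto simp: of_nat_diff Suc_le_eq add.commute)
qed

text \<open>A matching is sampled at times when \<open>P\<close> passes its vertices. If
  \<open>Q\<close> is on the same edge at two successive samples, monotonicity gives
  \<open>stay\<close>. Otherwise \<open>Q\<close> meets the end of its old edge and the start of its
  new one in between; the straight connection of these two vertices replaces the part of
  \<open>Q\<close> between them, which gives \<open>switch\<close>.\<close>

lemma reach_frechet_dist_less:
  fixes P Q :: "'a::real_normed_vector list"
  assumes "frechet_dist P Q < r" "P \<noteq> []" "Q \<noteq> []" "set Q \<subseteq> S ` {..<k}"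
    and p: "\<And>j. j < length P \<Longrightarrow> p j = P ! j"
  shows "\<exists>qs a b \<theta>. reach p S k r (length P - 1) qs a b \<theta> \<and> dist (p (length P - 1)) (S b) \<le> r"
proof -
  let ?n = "length P" and ?m = "length Q"
  obtain \<sigma> \<tau> where st: "reparametrization \<sigma>" "reparametrization \<tau>"
    "\<And>s. s \<in> {0..1} \<Longrightarrow> dist (polygonal_path P (\<sigma> s)) (polygonal_path Q (\<tau> s)) \<le> r"
    using frechet_dist_less[OF assms(1)] by blast
  obtain x where x: "continuous_on {0..1} x" "mono_on {0..1} x" "x 0 = 0" "x 1 = real ?n - 1"
    "\<And>u. u \<in> {0..1} \<Longrightarrow> polygonal_path P (\<sigma> u) = upath P (x u)"
    using reparametrization_uniform[OF st(1) assms(2)] by metis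
  obtain y where y: "continuous_on {0..1} y" "mono_on {0..1} y" "y 0 = 0" "y 1 = real ?m - 1"
    "\<And>u. u \<in> {0..1} \<Longrightarrow> polygonal_path Q (\<tau> u) = upath Q (y u)"
    using reparametrization_uniform[OF st(2) assms(3)] by metis
  have d: "dist (upath P (x u)) (upath Q (y u)) \<le> r" if "u \<in> {0..1}" for u
    using st(3) x(5) y(5) that by metis
  have yr: "0 \<le> y u" "y u \<le> real ?m - 1" if "u \<in> {0..1}" for u
    using mono_onD[OF y(2), of 0 u] mono_onD[OF y(2), of u 1] that y(3,4) by auto
  define c where "c j = (SOME i. i < k \<and> S i = Q ! j)" for j
  have c: "c j < k" "S (c j) = Q ! j" if "j < ?m" for j
  proof -
    have "Q ! j \<in> S ` {..<k}" using assms(4) that nth_mem by blast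
    then have "\<exists>i. i < k \<and> S i = Q ! j" by force
    from someI_ex[OF this] show "c j < k" "S (c j) = Q ! j" unfolding c_def by auto
  qed
  define J where "J u = nat \<lfloor>y u\<rfloor>" for u
  \<comment> \<open>No edge starts at the last vertex of \<open>Q\<close>. There the end index
    repeats the start index, and the degenerate edge is used with parameter 0.\<close>
  define J' where "J' u = min (Suc (J u)) (?m - 1)" for u
  define l where "l u = y u - real (J u)" for u
  have J: "J u \<le> ?m - 1" "real (J u) \<le> y u" "y u < real (J u) + 1" if "u \<in> {0..1}" for u
  proof -
    show "real (J u) \<le> y u" "y u < real (J u) + 1" unfolding J_def using yr[OF that] by auto
    then have "real (J u) \<le> real (?m - 1)" using yr[OF that] assms(3) by (simp add: of_nat_diff Suc_le_eq)
    then show "J u \<le> ?m - 1" by simp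
  qed
  have Jm: "J u < ?m" "J' u < ?m" if "u \<in> {0..1}" for u
    using J[OF that] assms(3) by (auto simp: J'_def Suc_le_eq dest: le_imp_less_Suc)
  have l01: "0 \<le> l u" "l u \<le> 1" if "u \<in> {0..1}" for u using J[OF that] by (auto simp: l_def)
  have yl: "upath Q (y u) = linepath (S (c (J u))) (S (c (J' u))) (l u)" if u: "u \<in> {0..1}" for u
  proof (cases "Suc (J u) < ?m")
    case True
    then have "J' u = Suc (J u)" by (simp add: J'_def)
    then show ?thesis using upath_edge[OF True l01[OF u]] c Jm[OF u] by (simp add: l_def)
  next
    case False
    then have e: "J u = ?m - 1" "J' u = ?m - 1" using J[OF u] by (auto simp: J'_def)
    then have "y u = real (?m - 1)" using J[OF u] yr[OF u] assms(3)
      by (simp add: of_nat_diff Suc_le_eq)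
    then have "l u = 0" "upath Q (y u) = Q ! (?m - 1)" using e assms(3) by (simp_all add: l_def upath_nth del: of_nat_diff)
    then show ?thesis using e c[of "?m - 1"] assms(3) by (simp add: linepath_def)
  qed
  have dv: "dist (p i) (linepath (S (c (J u))) (S (c (J' u))) (l u)) \<le> r"
    if "u \<in> {0..1}" "x u = real i" "i < ?n" for u i
    using d[OF that(1)] yl[OF that(1)] that upath_nth[OF that(3)] p by simp
  have J0: "J 0 = 0" by (simp add: J_def y(3))
  have st0: "reach p S k r 0 [] (c (J 0)) (c (J' 0)) (l 0)"
  proof (rule reach.start)
    show "dist (p 0) (linepath (S (c (J 0))) (S (c (J' 0))) (l 0)) \<le> r"
      using dv[of 0 0] x(3) assms(2) by simp
    then show "dist (p 0) (S (c (J 0))) \<le> r" by (simp add: l_def J0 y(3) linepath_def)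
  qed (use Jm[of 0] c l01[of 0] in auto)
  \<comment> \<open>\<open>P\<close> may rest at its first vertex for a while, but the derivation
    must begin with \<open>Q\<close> at its first vertex; hence the sample for \<open>i = 0\<close>
    is fixed to time 0.\<close>
  have ind: "\<exists>qs. reach p S k r i qs (c (J u)) (c (J' u)) (l u)"
    if "i < ?n" "u \<in> {0..1}" "x u = real i" "i = 0 \<Longrightarrow> u = 0" for i u
    using that
  proof (induction i arbitrary: u)
    case 0 then show ?case using st0 by auto
  next
    case (Suc i)
    have "\<exists>v. 0 \<le> v \<and> v \<le> u \<and> x v = real i \<and> (i = 0 \<longrightarrow> v = 0)"
    proof (cases "i = 0")
      case True then show ?thesis using x(3) Suc by (intro exI[of _ 0]) auto
    next
      case False
      have "continuous_on {0..u} x" by (rule continuous_on_subset[OF x(1)]) (use Suc in auto)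
      then show ?thesis using IVT'[of x 0 "real i" u] x(3) Suc False by auto
    qed
    then obtain v where v: "0 \<le> v" "v \<le> u" "x v = real i" "i = 0 \<longrightarrow> v = 0" by blast
    have v01: "v \<in> {0..1}" using v Suc by auto
    obtain qs where q: "reach p S k r i qs (c (J v)) (c (J' v)) (l v)"
      using Suc.IH[of v] v v01 Suc.prems by auto
    have yy: "y v \<le> y u" using v v01 Suc by (intro mono_onD[OF y(2)]) auto
    have new: "dist (p (Suc i)) (linepath (S (c (J u))) (S (c (J' u))) (l u)) \<le> r"
      using dv[of u "Suc i"] Suc by simp
    show ?case
    proof (cases "J u = J v")
      case True
      then have "J' u = J' v" by (simp add: J'_def)
      have "l v \<le> l u" using yy True by (simp add: l_def)
      then have "reach p S k r (Suc i) qs (c (J v)) (c (J' v)) (l u)"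
        using new True \<open>J' u = J' v\<close> l01[OF Suc.prems(2)] by (intro reach.stay[OF q]) auto
      then show ?thesis using True \<open>J' u = J' v\<close> by auto
    next
      case False
      have "J v \<le> J u" using yy unfolding J_def by (intro nat_mono floor_mono)
      then have lt: "Suc (J v) \<le> J u" using False by simp
      then have Jv': "J' v = Suc (J v)" using J(1)[OF Suc.prems(2)] by (simp add: J'_def)
      have c1: "continuous_on {v..u} y"
        by (rule continuous_on_subset[OF y(1)]) (use v Suc in auto)
      have r1: "y v \<le> real (Suc (J v))" "real (J u) \<le> y u" "real (Suc (J v)) \<le> real (J u)"
        using J[OF v01] J[OF Suc.prems(2)] lt by auto
      \<comment> \<open>The later time is chosen first and the earlier one is then sought before it,
        so that the two come in the right order without an appeal to monotonicity.\<close>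
      obtain w' where w': "v \<le> w'" "w' \<le> u" "y w' = real (J u)"
        using IVT'[OF _ _ v(2) c1, of "real (J u)"] r1 by auto
      have c2: "continuous_on {v..w'} y" by (rule continuous_on_subset[OF c1]) (use w' in auto)
      obtain w where w: "v \<le> w" "w \<le> w'" "y w = real (Suc (J v))"
        using IVT'[OF _ _ w'(1) c2, of "real (Suc (J v))"] r1 w' by auto
      have in01: "w \<in> {0..1}" "w' \<in> {0..1}" using v w w' Suc by auto
      have xs: "real i \<le> x w" "x w \<le> x w'" "x w' \<le> real (Suc i)"
        using mono_onD[OF x(2), of v w] mono_onD[OF x(2), of w w'] mono_onD[OF x(2), of w' u]
          v v01 w w' in01 Suc by auto
      have P: "upath P (x t) = linepath (p i) (p (Suc i)) (x t - real i)"
        if "real i \<le> x t" "x t \<le> real (Suc i)" for t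
        using upath_edge[of i P "x t - real i"] that Suc.prems p by simp
      have "reach p S k r (Suc i) (qs @ [c (J v), c (J' v)]) (c (J u)) (c (J' u)) (l u)"
      proof (rule reach.switch[OF q, where \<mu> = "x w - real i" and \<mu>' = "x w' - real i"])
        show "dist (linepath (p i) (p (Suc i)) (x w - real i)) (S (c (J' v))) \<le> r"
          using d[OF in01(1)] P[of w] xs w(3) Jv' Jm[OF v01] c by (simp add: upath_nth del: of_nat_Suc)
        show "dist (linepath (p i) (p (Suc i)) (x w' - real i)) (S (c (J u))) \<le> r"
          using d[OF in01(2)] P[of w'] xs w'(3) Jm[OF Suc.prems(2)] c by (simp add: upath_nth)
      qed (use xs new l01[OF Suc.prems(2)] Jm[OF Suc.prems(2)] c in auto)
      then show ?thesis by blast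
    qed
  qed
  show ?thesis
  proof (cases "?n = 1")
    case True
    have "reach p S k r 0 [] (c 0) (c 0) 0"
      using dv[of 0 0] x(3) assms(2,3) c[of 0] by (intro reach.start) (auto simp: linepath_def l_def J0 y(3))
    then show ?thesis using True reach_bounds(6)[of p S k r 0 "[]" "c 0" "c 0" 0]
      by (auto simp: linepath_def intro!: exI[of _ "c 0"])
  next
    case False
    then have "2 \<le> ?n" using assms(2) length_0_conv[of P] by linarith
    then have n: "?n - 1 \<noteq> 0" "?n - 1 < ?n" "x 1 = real (?n - 1)"
      using assms(2) x(4) by (auto simp: of_nat_diff Suc_le_eq)
    obtain qs where q: "reach p S k r (?n - 1) qs (c (J 1)) (c (J' 1)) (l 1)"
      using ind[of "?n - 1" 1] n by auto
    have "y 1 = real (?m - 1)" using y(4) assms(3) by (simp add: of_nat_diff Suc_le_eq)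
    then have "J 1 = ?m - 1" by (simp add: J_def)
    then have "J' 1 = J 1" by (simp add: J'_def)
    then have "dist (p (?n - 1)) (S (c (J' 1))) \<le> r"
      using reach_bounds(6)[OF q] by (simp add: linepath_def algebra_simps flip: scaleR_add_left)
    then show ?thesis using q by blast
  qed
qed

section \<open>Programming the real RAM\<close>

subsection \<open>Weakest preconditions with time\<close>

definition nupd :: "nat \<Rightarrow> nat \<Rightarrow> state \<Rightarrow> state" where
  "nupd a x s = ((fst s)(a := x), snd s)"

definition rupd :: "nat \<Rightarrow> real \<Rightarrow> state \<Rightarrow> state" where
  "rupd a x s = (fst s, (snd s)(a := x))"

lemma upd_sel [simp]:
  "fst (nupd a x s) b = (if a = b then x else fst s b)" "snd (nupd a x s) = snd s"
  "snd (rupd a y s) b = (if a = b then y else snd s b)" "fst (rupd a y s) = fst s"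
  by (auto simp: nupd_def rupd_def)

text \<open>Existence of a halting run is total correctness here, because execution is
  deterministic. The step count is an argument of the postcondition.\<close>

definition wp :: "com \<Rightarrow> state \<Rightarrow> (nat \<Rightarrow> state \<Rightarrow> bool) \<Rightarrow> bool" where
  "wp c s Q \<longleftrightarrow> (\<exists>t s'. exec c s t s' \<and> Q t s')"

lemma wp_mono: "wp c s Q \<Longrightarrow> (\<And>t s'. Q t s' \<Longrightarrow> Q' t s') \<Longrightarrow> wp c s Q'"
  unfolding wp_def by blast

lemma wp_Skip [simp]: "wp Skip s Q \<longleftrightarrow> Q 1 s"
  unfolding wp_def by (metis SkipE exec.Skip)

lemma wp_NStore [simp]: "wp (NStore a e) s Q \<longleftrightarrow> Q 1 (nupd (nval a s) (nval e s) s)"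
  unfolding wp_def nupd_def by (metis NStoreE exec.NStore)

lemma wp_RStore [simp]: "wp (RStore a e) s Q \<longleftrightarrow> Q 1 (rupd (nval a s) (rval e s) s)"
  unfolding wp_def rupd_def by (metis RStoreE exec.RStore)

lemma wp_Seq [simp]: "wp (Seq c1 c2) s Q \<longleftrightarrow> wp c1 s (\<lambda>t1 s1. wp c2 s1 (\<lambda>t2 s2. Q (t1 + t2) s2))"
  unfolding wp_def by (metis SeqE exec.Seq)

lemma exec_Cond: "exec (Cond b c1 c2) s t s' \<longleftrightarrow>
    (\<exists>u. t = Suc u \<and> exec (if bval b s then c1 else c2) s u s')"
proof
  assume "exec (Cond b c1 c2) s t s'"
  then show "\<exists>u. t = Suc u \<and> exec (if bval b s then c1 else c2) s u s'"
    by (rule CondE) auto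
next
  assume "\<exists>u. t = Suc u \<and> exec (if bval b s then c1 else c2) s u s'"
  then show "exec (Cond b c1 c2) s t s'"
    using exec.CondTrue[of b s c1 _ s' c2] exec.CondFalse[of b s c2 _ s' c1] by (auto split: if_splits)
qed

lemma wp_Cond [simp]: "wp (Cond b c1 c2) s Q \<longleftrightarrow>
    (if bval b s then wp c1 s (\<lambda>t. Q (1 + t)) else wp c2 s (\<lambda>t. Q (1 + t)))"
  unfolding wp_def exec_Cond by (cases "bval b s") auto

lemma exec_WhileTrue:
  assumes "bval b s"
  shows "exec (While b c) s t s' \<longleftrightarrow>
    (\<exists>t1 s1 t2. t = Suc (t1 + t2) \<and> exec c s t1 s1 \<and> exec (While b c) s1 t2 s')" (is "?l \<longleftrightarrow> ?r")
proof
  assume ?l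
  then show ?r by (rule WhileE) (use assms in \<open>metis plus_1_eq_Suc add_Suc\<close>)+
next
  assume ?r
  then obtain t1 s1 t2 where r: "t = Suc (t1 + t2)" "exec c s t1 s1" "exec (While b c) s1 t2 s'"
    by blast
  show ?l using exec.WhileTrue[OF assms r(2,3)] r(1) by simp
qed

text \<open>A single unfolding. As a rewrite rule it would loop, so unlike its companions it is not
  given to the simplifier.\<close>

lemma wp_While: "wp (While b c) s Q \<longleftrightarrow>
    (if bval b s then wp c s (\<lambda>t1 s1. wp (While b c) s1 (\<lambda>t2 s2. Q (1 + t1 + t2) s2)) else Q 1 s)"
proof (cases "bval b s")
  case True
  have "wp (While b c) s Q \<longleftrightarrow>
      (\<exists>t1 s1 t2 s2. exec c s t1 s1 \<and> exec (While b c) s1 t2 s2 \<and> Q (Suc (t1 + t2)) s2)"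
    unfolding wp_def exec_WhileTrue[OF True] by blast
  also have "\<dots> \<longleftrightarrow> wp c s (\<lambda>t1 s1. wp (While b c) s1 (\<lambda>t2 s2. Q (Suc (t1 + t2)) s2))"
    unfolding wp_def by blast
  finally show ?thesis using True by simp
next
  case False
  have "exec (While b c) s t s' \<longleftrightarrow> t = 1 \<and> s' = s" for t s'
  proof
    assume "exec (While b c) s t s'"
    then show "t = 1 \<and> s' = s" by (rule WhileE) (use False in simp_all)
  qed (use exec.WhileFalse[of b s c] False in simp)
  then have "wp (While b c) s Q \<longleftrightarrow> Q 1 s" unfolding wp_def by simp
  then show ?thesis using False by simp
qed

text \<open>The machine does not multiply naturals. Factors that depend only on the dimension are
  unrolled into additions, which keeps expressions of a size independent of the input.\<close>

fun nmulc :: "nat \<Rightarrow> nexp \<Rightarrow> nexp" where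
  "nmulc 0 e = NConst 0"
| "nmulc (Suc m) e = NAdd e (nmulc m e)"

lemma nval_nmulc [simp]: "nval (nmulc m e) s = m * nval e s"
  by (induction m) auto

abbreviation "NLe a b \<equiv> BNot (NLess b a)"
abbreviation "RLe a b \<equiv> BNot (RLess b a)"
abbreviation "NEq a b \<equiv> BAnd (NLe a b) (NLe b a)"
abbreviation "RNat m \<equiv> ROfNat (NConst m)"

text \<open>\<open>max x y\<close> is half of \<open>x + y + \<bar>x - y\<bar>\<close>, and the
  absolute value is the square root of a square. As an expression it needs no test and costs no
  step.\<close>

definition RMax :: "rexp \<Rightarrow> rexp \<Rightarrow> rexp" where
  "RMax x y = RDiv (RAdd (RAdd x y) (RSqrt (RMul (RSub x y) (RSub x y)))) (RNat 2)"

definition RMin :: "rexp \<Rightarrow> rexp \<Rightarrow> rexp" where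
  "RMin x y = RDiv (RSub (RAdd x y) (RSqrt (RMul (RSub x y) (RSub x y)))) (RNat 2)"

lemma rval_RMax [simp]: "rval (RMax x y) s = max (rval x s) (rval y s)"
  by (auto simp: RMax_def max_def simp flip: power2_eq_square)

lemma rval_RMin [simp]: "rval (RMin x y) s = min (rval x s) (rval y s)"
  by (auto simp: RMin_def min_def simp flip: power2_eq_square)

locale axes =
  fixes es :: "'d::finite list"
  assumes distinct_es: "distinct es" and set_es: "set es = UNIV"
begin

section \<open>Memory layout and frame conditions\<close>

definition d :: nat where "d = length es"

lemma d_eq: "d = CARD('d)"
  using distinct_card[OF distinct_es] set_es by (simp add: d_def)

lemma d_pos: "0 < d"
  by (simp add: d_eq)

text \<open>
  Both memories are divided into arrays, interleaved with a stride that leaves room for \<open>64\<close> named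
  arrays and \<open>d\<close> grid counters.
\<close>

definition adr :: "nat \<Rightarrow> nat \<Rightarrow> nat" where
  "adr c i = (64 + d) * i + c"

lemma adr_eq_iff [simp]:
  assumes "c < 64 + d" "c' < 64 + d"
  shows "adr c i = adr c' j \<longleftrightarrow> c = c' \<and> i = j"
proof
  assume e: "adr c i = adr c' j"
  have "c = adr c i mod (64 + d)" "c' = adr c' j mod (64 + d)" using assms by (simp_all add: adr_def)
  then have "c = c'" using e by simp
  then show "c = c' \<and> i = j" using e by (simp add: adr_def)
qed simp

definition Ad :: "nat \<Rightarrow> nexp \<Rightarrow> nexp" where
  "Ad c e = NAdd (nmulc (64 + d) e) (NConst c)"

lemma nval_Ad [simp]: "nval (Ad c e) s = adr c (nval e s)"
  by (simp add: Ad_def adr_def)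

abbreviation "NA c e \<equiv> NMem (Ad c e)"
abbreviation "RA c e \<equiv> RMem (Ad c e)"
abbreviation "NV c \<equiv> NMem (Ad c (NConst 0))"
abbreviation "RV c \<equiv> RMem (Ad c (NConst 0))"
abbreviation "NASet c i e \<equiv> NStore (Ad c i) e"
abbreviation "RASet c i e \<equiv> RStore (Ad c i) e"
abbreviation "NSet c e \<equiv> NStore (Ad c (NConst 0)) e"
abbreviation "RSet c e \<equiv> RStore (Ad c (NConst 0)) e"
abbreviation "nat_at s c \<equiv> fst (s :: state) (adr c 0)"
abbreviation "real_at s c \<equiv> snd (s :: state) (adr c 0)"

text \<open>A frame condition by whole arrays. One numbering serves the arrays of both memories, so
  a number outside \<open>X\<close> protects the naturals and the reals stored under it.\<close>

definition same :: "nat set \<Rightarrow> state \<Rightarrow> state \<Rightarrow> bool" where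
  "same X s s' \<longleftrightarrow> (\<forall>c i. c < 64 + d \<longrightarrow> c \<notin> X \<longrightarrow>
     fst s' (adr c i) = fst s (adr c i) \<and> snd s' (adr c i) = snd s (adr c i))"

lemma same_refl [simp]: "same X s s" by (simp add: same_def)

lemma same_trans: "same X s s' \<Longrightarrow> same X s' s'' \<Longrightarrow> same X s s''" by (simp add: same_def)

lemma same_mono: "same X s s' \<Longrightarrow> X \<subseteq> Y \<Longrightarrow> same Y s s'" by (auto simp: same_def)

lemma same_trans': "same X s s' \<Longrightarrow> same Y s' s'' \<Longrightarrow> X \<union> Y \<subseteq> Z \<Longrightarrow> same Z s s''"
  unfolding same_def by (metis UnCI subset_iff)

lemma same_nat: "same X s s' \<Longrightarrow> c < 64 + d \<Longrightarrow> c \<notin> X \<Longrightarrow> fst s' (adr c i) = fst s (adr c i)"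
  by (simp add: same_def)

lemma same_real: "same X s s' \<Longrightarrow> c < 64 + d \<Longrightarrow> c \<notin> X \<Longrightarrow> snd s' (adr c i) = snd s (adr c i)"
  by (simp add: same_def)

lemmas sameD = same_nat same_real

lemma same_nupd: "c < 64 + d \<Longrightarrow> c \<in> X \<Longrightarrow> same X s (nupd (adr c i) x s)"
  by (auto simp: same_def)

lemma same_rupd: "c < 64 + d \<Longrightarrow> c \<in> X \<Longrightarrow> same X s (rupd (adr c i) x s)"
  by (auto simp: same_def)

definition writes :: "nat set \<Rightarrow> com \<Rightarrow> bool" where
  "writes X c \<longleftrightarrow> (\<forall>s t s'. exec c s t s' \<longrightarrow> same X s s')"

lemma writes_mono: "writes X c \<Longrightarrow> X \<subseteq> Y \<Longrightarrow> writes Y c"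
  unfolding writes_def by (meson same_mono)

lemma writes_Skip: "writes X Skip"
  by (auto simp: writes_def elim!: SkipE)

lemma writes_NASet: "c < 64 + d \<Longrightarrow> c \<in> X \<Longrightarrow> writes X (NASet c i e)"
  unfolding writes_def by (auto elim!: NStoreE simp: same_def)

lemma writes_RASet: "c < 64 + d \<Longrightarrow> c \<in> X \<Longrightarrow> writes X (RASet c i e)"
  unfolding writes_def by (auto elim!: RStoreE simp: same_def)

lemma writes_Seq: "writes X c1 \<Longrightarrow> writes X c2 \<Longrightarrow> writes X (Seq c1 c2)"
  unfolding writes_def by (meson SeqE same_trans)

lemma writes_Cond: "writes X c1 \<Longrightarrow> writes X c2 \<Longrightarrow> writes X (Cond b c1 c2)"
  unfolding writes_def by (auto elim!: CondE)

lemma writes_While: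
  assumes "writes X c"
  shows "writes X (While b c)"
proof -
  have "w = While b c \<Longrightarrow> same X s s'" if "exec w s t s'" for w s t s'
    using that
  proof (induction rule: exec.induct)
    case WhileTrue
    then show ?case using assms unfolding writes_def by (metis com.inject(5) same_trans)
  qed auto
  then show ?thesis unfolding writes_def by blast
qed

text \<open>What a program may change is derived from its syntax once and for all. Functional
  specifications can thus stay silent about everything that is left alone.\<close>

lemma wp_writes: "wp c s Q \<Longrightarrow> writes X c \<Longrightarrow> wp c s (\<lambda>t s'. Q t s' \<and> same X s s')"
  unfolding wp_def writes_def by blast

section \<open>Counting loops\<close>

definition For :: "nat \<Rightarrow> nexp \<Rightarrow> com \<Rightarrow> com" where
  "For v b c = Seq (NSet v (NConst 0))
     (While (NLess (NV v) b) (Seq c (NSet v (NAdd (NV v) (NConst 1)))))"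

lemma writes_For: "v < 64 + d \<Longrightarrow> v \<in> X \<Longrightarrow> writes X c \<Longrightarrow> writes X (For v b c)"
  unfolding For_def by (intro writes_Seq writes_While writes_NASet)

lemmas writes_intros = writes_Skip writes_NASet writes_RASet writes_Seq writes_Cond writes_While writes_For

text \<open>The general rule, in which the frame is the business of the invariant. It is used
  directly for the two loops that copy between raw and interleaved addresses, where frames by arrays
  are not enough. Each round pays two steps for the test and the increment; the initialisation and
  the last test make up the final \<open>+ 2\<close>.\<close>

lemma wp_For_inv:
  assumes v: "v < 64 + d"
    and init: "J 0 0 (nupd (adr v 0) 0 s0)"
    and bound: "\<And>i t s. i \<le> m \<Longrightarrow> nat_at s v = i \<Longrightarrow> J i t s \<Longrightarrow> nval b s = m"
    and step: "\<And>i t s. i < m \<Longrightarrow> nat_at s v = i \<Longrightarrow> J i t s \<Longrightarrow>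
        wp c s (\<lambda>t' s'. nat_at s' v = i \<and> J (Suc i) (t + t' + 2) (nupd (adr v 0) (Suc i) s'))"
    and post: "\<And>t s. nat_at s v = m \<Longrightarrow> J m t s \<Longrightarrow> Q (t + 2) s"
  shows "wp (For v b c) s0 Q"
proof -
  let ?c = "Seq c (NSet v (NAdd (NV v) (NConst 1)))"
  let ?w = "While (NLess (NV v) b) ?c"
  have loop: "wp ?w s (\<lambda>t'. Q (t + t' + 1))"
    if "i \<le> m" "nat_at s v = i" "J i t s" for i t s
    using that
  proof (induction "m - i" arbitrary: i t s)
    case 0
    then have "i = m" by simp
    moreover have "nval b s = m" using bound[OF 0(2,3,4)] .
    ultimately show ?case using 0(3,4) post[of s t] by (subst wp_While) simp
  next
    case (Suc j)
    have lt: "i < m" using Suc by simp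
    have "wp c s (\<lambda>t' s'. wp (NSet v (NAdd (NV v) (NConst 1))) s'
        (\<lambda>u s''. wp ?w s'' (\<lambda>t''. Q (t + (1 + (t' + u) + t'') + 1))))"
    proof (rule wp_mono[OF step[OF lt Suc.prems(2,3)]], elim conjE)
      fix t' s' assume a: "nat_at s' v = i" "J (Suc i) (t + t' + 2) (nupd (adr v 0) (Suc i) s')"
      have "wp ?w (nupd (adr v 0) (Suc i) s') (\<lambda>t''. Q (t + t' + 2 + t'' + 1))"
        using a(2) Suc.hyps(2) lt by (intro Suc.hyps(1)) simp_all
      then show "wp (NSet v (NAdd (NV v) (NConst 1))) s'
        (\<lambda>u s''. wp ?w s'' (\<lambda>t''. Q (t + (1 + (t' + u) + t'') + 1)))"
        using a(1) by (simp add: add_ac)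
    qed
    moreover have "bval (NLess (NV v) b) s" using lt bound[OF Suc.prems] Suc.prems by simp
    ultimately show ?case unfolding wp_While[of _ _ s] wp_Seq by simp
  qed
  have "wp ?w (nupd (adr v 0) 0 s0) (\<lambda>t'. Q (0 + t' + 1))"
    by (rule loop[of 0]) (use init v in simp_all)
  then show ?thesis unfolding For_def by simp
qed

lemma wp_For:
  assumes wr: "writes X c" and v: "v \<notin> X" "v < 64 + d"
    and b: "\<And>s. same (insert v X) s0 s \<Longrightarrow> nval b s = m"
    and init: "I 0 0 (nupd (adr v 0) 0 s0)"
    and step: "\<And>i t s. i < m \<Longrightarrow> nat_at s v = i \<Longrightarrow> same (insert v X) s0 s \<Longrightarrow> I i t s \<Longrightarrow>
        wp c s (\<lambda>t' s'. I (Suc i) (t + t' + 2) (nupd (adr v 0) (Suc i) s'))"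
    and post: "\<And>t s. same (insert v X) s0 s \<Longrightarrow> nat_at s v = m \<Longrightarrow> I m t s \<Longrightarrow> Q (t + 2) s"
  shows "wp (For v b c) s0 Q"
proof (rule wp_For_inv[where J = "\<lambda>i t s. I i t s \<and> same (insert v X) s0 s", OF v(2)])
  fix i t s assume a: "i < m" "nat_at s v = i" "I i t s \<and> same (insert v X) s0 s"
  have "wp c s (\<lambda>t' s'. I (Suc i) (t + t' + 2) (nupd (adr v 0) (Suc i) s') \<and> same X s s')"
    by (rule wp_writes[OF step[OF a(1,2)] wr]) (use a(3) in simp_all)
  then show "wp c s (\<lambda>t' s'. nat_at s' v = i \<and> I (Suc i) (t + t' + 2) (nupd (adr v 0) (Suc i) s') \<and>
      same (insert v X) s0 (nupd (adr v 0) (Suc i) s'))"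
  proof (rule wp_mono, intro conjI)
    fix t' s' assume b: "I (Suc i) (t + t' + 2) (nupd (adr v 0) (Suc i) s') \<and> same X s s'"
    show "nat_at s' v = i" using sameD(1)[OF conjunct2[OF b] v(2,1)] a(2) by simp
    have "same (insert v X) s0 s'"
      by (rule same_trans[OF conjunct2[OF a(3)] same_mono[OF conjunct2[OF b]]]) auto
    then show "same (insert v X) s0 (nupd (adr v 0) (Suc i) s')"
      by (rule same_trans) (use v in \<open>simp add: same_nupd\<close>)
  qed (simp)
qed (use init b post v in \<open>auto intro: same_nupd\<close>)

lemma wp_For_bounded:
  assumes wr: "writes X c" and v: "v \<notin> X" "v < 64 + d"
    and b: "\<And>s. same (insert v X) s0 s \<Longrightarrow> nval b s = m"
    and init: "I 0 (nupd (adr v 0) 0 s0)"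
    and step: "\<And>i s. i < m \<Longrightarrow> nat_at s v = i \<Longrightarrow> same (insert v X) s0 s \<Longrightarrow> I i s \<Longrightarrow>
        wp c s (\<lambda>t' s'. t' \<le> T \<and> I (Suc i) (nupd (adr v 0) (Suc i) s'))"
    and post: "\<And>t s. same (insert v X) s0 s \<Longrightarrow> nat_at s v = m \<Longrightarrow> I m s \<Longrightarrow> t \<le> (T + 2) * m + 2 \<Longrightarrow> Q t s"
  shows "wp (For v b c) s0 Q"
proof (rule wp_For[where I = "\<lambda>i t s. t \<le> (T + 2) * i \<and> I i s" and m = m and X = X])
  fix i t s
  assume a: "i < m" "nat_at s v = i" "same (insert v X) s0 s" "t \<le> (T + 2) * i \<and> I i s"
  show "wp c s (\<lambda>t' s'. t + t' + 2 \<le> (T + 2) * Suc i \<and> I (Suc i) (nupd (adr v 0) (Suc i) s'))"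
    by (rule wp_mono[OF step[OF a(1-3) conjunct2[OF a(4)]]]) (use a(4) in simp)
next
  fix t s assume "same (insert v X) s0 s" "nat_at s v = m" "t \<le> (T + 2) * m \<and> I m s"
  then show "Q (t + 2) s" by (intro post) simp_all
qed (use wr v b init in simp_all)

subsection \<open>Points\<close>

definition pos :: "'d \<Rightarrow> nat" where
  "pos c = (THE e. e < d \<and> es ! e = c)"

lemma pos: "pos c < d" "es ! pos c = c"
proof -
  have "c \<in> set es" using set_es by simp
  then obtain e where "e < d" "es ! e = c" by (auto simp: in_set_conv_nth d_def)
  then have "\<exists>!e. e < d \<and> es ! e = c"
    using distinct_es by (auto simp: d_def nth_eq_iff_index_eq)
  from theI'[OF this] show "pos c < d" "es ! pos c = c" unfolding pos_def by auto
qed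

lemma pos_nth: "e < d \<Longrightarrow> pos (es ! e) = e"
  using pos[of "es ! e"] distinct_es by (simp add: d_def nth_eq_iff_index_eq)

lemma bij_betw_es: "bij_betw (\<lambda>e. es ! e) {..<d} UNIV"
  by (rule bij_betw_nth) (simp_all add: distinct_es set_es d_def)

text \<open>Vectors exist only while a program is being built: a vector expression is a family of
  scalar expressions, one for each axis. This is possible because the dimension is fixed for the
  program.\<close>

type_synonym vexp = "nat \<Rightarrow> rexp"

definition vval :: "vexp \<Rightarrow> state \<Rightarrow> real ^ 'd" where
  "vval u s = (\<chi> c. rval (u (pos c)) s)"

definition VAdd :: "vexp \<Rightarrow> vexp \<Rightarrow> vexp" where "VAdd u v = (\<lambda>e. RAdd (u e) (v e))"
definition VSub :: "vexp \<Rightarrow> vexp \<Rightarrow> vexp" where "VSub u v = (\<lambda>e. RSub (u e) (v e))"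
definition VScale :: "rexp \<Rightarrow> vexp \<Rightarrow> vexp" where "VScale x u = (\<lambda>e. RMul x (u e))"
definition VDot :: "vexp \<Rightarrow> vexp \<Rightarrow> rexp" where
  "VDot u v = foldr (\<lambda>e. RAdd (RMul (u e) (v e))) [0..<d] (RNat 0)"

lemma vval_simps [simp]:
  "vval (VAdd u v) s = vval u s + vval v s"
  "vval (VSub u v) s = vval u s - vval v s"
  "vval (VScale x u) s = rval x s *\<^sub>R vval u s"
  by (simp_all add: vval_def VAdd_def VSub_def VScale_def vec_eq_iff)

lemma rval_VDot [simp]: "rval (VDot u v) s = vval u s \<bullet> vval v s"
proof -
  have f: "rval (foldr (\<lambda>e. RAdd (RMul (u e) (v e))) xs (RNat 0)) s =
      (\<Sum>e\<leftarrow>xs. rval (u e) s * rval (v e) s)" for xs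
    by (induction xs) auto
  have "rval (VDot u v) s = (\<Sum>e<d. rval (u e) s * rval (v e) s)"
    unfolding VDot_def f by (simp add: sum_list_distinct_conv_sum_set atLeast0LessThan)
  also have "\<dots> = (\<Sum>e<d. rval (u (pos (es ! e))) s * rval (v (pos (es ! e))) s)"
    by (simp add: pos_nth)
  also have "\<dots> = (\<Sum>c\<in>UNIV. rval (u (pos c)) s * rval (v (pos c)) s)"
    by (rule sum.reindex_bij_betw[OF bij_betw_es])
  finally show ?thesis by (simp add: inner_vec_def vval_def)
qed

definition VDist :: "vexp \<Rightarrow> vexp \<Rightarrow> rexp" where
  "VDist u v = RSqrt (VDot (VSub u v) (VSub u v))"

lemma rval_VDist [simp]: "rval (VDist u v) s = dist (vval u s) (vval v s)"
  by (simp add: VDist_def dist_norm norm_eq_sqrt_inner)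

definition VLine :: "vexp \<Rightarrow> vexp \<Rightarrow> rexp \<Rightarrow> vexp" where
  "VLine u v x = VAdd u (VScale x (VSub v u))"

lemma vval_VLine [simp]: "vval (VLine u v x) s = linepath (vval u s) (vval v s) (rval x s)"
  by (simp add: VLine_def linepath_def algebra_simps)

definition vec :: "nat \<Rightarrow> nat \<Rightarrow> state \<Rightarrow> real ^ 'd" where
  "vec c i s = (\<chi> x. snd s (adr c (pos x + d * i)))"

definition VVar :: "nat \<Rightarrow> nexp \<Rightarrow> vexp" where
  "VVar c a = (\<lambda>e. RA c (NAdd (NConst e) (nmulc d a)))"

lemma vval_VVar [simp]: "vval (VVar c a) s = vec c (nval a s) s"
  by (simp add: VVar_def vval_def vec_def)

lemma vec_same: "same X s s' \<Longrightarrow> c < 64 + d \<Longrightarrow> c \<notin> X \<Longrightarrow> vec c i s' = vec c i s"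
  by (simp add: vec_def sameD)

lemma vec_upd [simp]:
  "vec c j (nupd a x s) = vec c j s"
  "c < 64 + d \<Longrightarrow> c' < 64 + d \<Longrightarrow> c \<noteq> c' \<Longrightarrow> vec c j (rupd (adr c' i) y s) = vec c j s"
  by (simp_all add: vec_def)

text \<open>The shift by one leaves the first cell of array 0 to the accuracy, as in the input
  format.\<close>

definition pt :: "nat \<Rightarrow> state \<Rightarrow> real ^ 'd" where
  "pt i s = (\<chi> c. snd s (adr 0 (Suc (pos c + d * i))))"

definition VPt :: "nexp \<Rightarrow> vexp" where
  "VPt a = (\<lambda>e. RA 0 (NAdd (NConst (Suc e)) (nmulc d a)))"

lemma vval_VPt [simp]: "vval (VPt a) s = pt (nval a s) s"
  by (simp add: VPt_def vval_def pt_def)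

lemma pt_same: "same X s s' \<Longrightarrow> 0 \<notin> X \<Longrightarrow> pt i s' = pt i s"
  by (simp add: pt_def sameD)

lemma pt_upd [simp]:
  "pt i (nupd a x s) = pt i s"
  "c < 64 + d \<Longrightarrow> 0 < c \<Longrightarrow> pt i (rupd (adr c j) y s) = pt i s"
  by (simp_all add: pt_def)

lemma nval_cong: "fst s = fst s' \<Longrightarrow> nval a s = nval a s'"
  by (induction a) auto

fun VSetN :: "nat \<Rightarrow> nexp \<Rightarrow> vexp \<Rightarrow> nat \<Rightarrow> com" where
  "VSetN c a u 0 = Skip"
| "VSetN c a u (Suc e) = Seq (VSetN c a u e) (RASet c (NAdd (NConst e) (nmulc d a)) (u e))"

definition VSet :: "nat \<Rightarrow> nexp \<Rightarrow> vexp \<Rightarrow> com" where "VSet c a u = VSetN c a u d"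

lemma writes_VSetN: "c < 64 + d \<Longrightarrow> c \<in> X \<Longrightarrow> writes X (VSetN c a u e)"
  by (induction e) (auto intro!: writes_intros)

lemma writes_VSet: "c < 64 + d \<Longrightarrow> c \<in> X \<Longrightarrow> writes X (VSet c a u)"
  unfolding VSet_def by (rule writes_VSetN)

text \<open>Coordinates are stored one after the other, so those still to be evaluated must not
  depend on the target array; this is the hypothesis on \<open>u\<close>. Different vectors of an
  array occupy disjoint blocks of \<open>d\<close> cells, hence all others survive.\<close>

lemma wp_VSet:
  assumes c: "c < 64 + d"
    and u: "\<And>e s'. e < d \<Longrightarrow> same {c} s s' \<Longrightarrow> fst s' = fst s \<Longrightarrow> rval (u e) s' = rval (u e) s"
    and Q: "\<And>s'. same {c} s s' \<Longrightarrow> fst s' = fst s \<Longrightarrow> vec c (nval a s) s' = vval u s \<Longrightarrow>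
        (\<And>j. j \<noteq> nval a s \<Longrightarrow> vec c j s' = vec c j s) \<Longrightarrow> Q (d + 1) s'"
  shows "wp (VSet c a u) s Q"
proof -
  let ?i = "nval a s"
  have "wp (VSetN c a u e) s (\<lambda>t s'. t = e + 1 \<and> fst s' = fst s \<and>
      (\<forall>e'<e. snd s' (adr c (e' + d * ?i)) = rval (u e') s) \<and>
      (\<forall>x. (\<forall>e'<e. x \<noteq> e' + d * ?i) \<longrightarrow> snd s' (adr c x) = snd s (adr c x)))" (is "wp _ s (?R e)")
    if "e \<le> d" for e
    using that
  proof (induction e)
    case (Suc e)
    have "wp (VSetN c a u e) s (?R e)" using Suc by simp
    from wp_writes[OF this writes_VSetN[of c "{c}"]] c
    have "wp (VSetN c a u e) s (\<lambda>t s'. ?R e t s' \<and> same {c} s s')" by simp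
    then have "wp (VSetN c a u e) s (\<lambda>t s'. ?R e t s' \<and> rval (u e) s' = rval (u e) s \<and> nval a s' = nval a s)"
    proof (rule wp_mono)
      fix t s' assume h: "?R e t s' \<and> same {c} s s'"
      have "rval (u e) s' = rval (u e) s" by (rule u) (use h Suc.prems in auto)
      moreover have "nval a s' = nval a s" by (rule nval_cong) (use h in auto)
      ultimately show "?R e t s' \<and> rval (u e) s' = rval (u e) s \<and> nval a s' = nval a s" using h by blast
    qed
    then show ?case unfolding VSetN.simps wp_Seq wp_RStore
      by (rule wp_mono) (use c in \<open>auto simp: less_Suc_eq\<close>)
  qed simp
  then have "wp (VSet c a u) s (?R d)"
    unfolding VSet_def by simp
  from wp_writes[OF this writes_VSet[of c "{c}"]] c
  have "wp (VSet c a u) s (\<lambda>t s'. ?R d t s' \<and> same {c} s s')" by simp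
  then show ?thesis
  proof (rule wp_mono, elim conjE)
    fix t s' assume h: "t = d + 1" "fst s' = fst s"
      "\<forall>e'<d. snd s' (adr c (e' + d * ?i)) = rval (u e') s"
      "\<forall>x. (\<forall>e'<d. x \<noteq> e' + d * ?i) \<longrightarrow> snd s' (adr c x) = snd s (adr c x)" "same {c} s s'"
    show "Q t s'" unfolding h(1)
    proof (rule Q[OF h(5,2)])
      show "vec c ?i s' = vval u s" using h(3) by (simp add: vec_def vval_def vec_eq_iff pos)
      fix j assume j: "j \<noteq> ?i"
      have "e + d * j \<noteq> e' + d * ?i" if "e < d" "e' < d" for e e'
      proof
        assume "e + d * j = e' + d * ?i"
        then have "(e + d * j) div d = (e' + d * ?i) div d" by simp
        then show False using that j by simp
      qed
      then show "vec c j s' = vec c j s" using h(4) by (simp add: vec_def vec_eq_iff pos)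
    qed
  qed
qed

end

subsection \<open>Input and output\<close>

lemma concat_nth_uniform:
  assumes "\<And>xs. xs \<in> set xss \<Longrightarrow> length xs = m" "i < length xss" "e < m"
  shows "concat xss ! (e + m * i) = xss ! i ! e"
  using assms
proof (induction xss arbitrary: i)
  case (Cons xs xss)
  show ?case
  proof (cases i)
    case (Suc j)
    have "concat (xs # xss) ! (e + m * i) = concat xss ! (e + m * j)"
      using Cons.prems(1)[of xs] Suc by (simp add: nth_append)
    then show ?thesis using Cons Suc by simp
  qed (use Cons.prems in \<open>simp add: nth_append\<close>)
qed simp

context axes
begin

lemma length_coords: "length (coords es ps) = d * length ps"
  by (induction ps) (auto simp: coords_def d_def)

lemma coords_nth: "i < length ps \<Longrightarrow> e < d \<Longrightarrow> coords es ps ! (e + d * i) = ps ! i $ (es ! e)"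
  unfolding coords_def by (subst concat_nth_uniform) (auto simp: d_def)

text \<open>
  Natural arrays: \<open>0\<close> and \<open>1\<close> hold \<open>n\<close> and \<open>k\<close>, \<open>2\<close> holds \<open>k\<^sup>2\<close>, \<open>3\<close> and \<open>4\<close> the components of the
  pair of sites numbered \<open>q\<close>, \<open>11\<close> the outcome of a decision, \<open>13\<close> and \<open>14\<close> the computed curve and
  its length, \<open>64 + e\<close> the grid counters. Real arrays: \<open>0\<close> holds \<open>\<epsilon>\<close> and the input points, \<open>32\<close> and \<open>33\<close>
  the current and the best translation, \<open>34\<close> the best radius, \<open>35\<close> the grid width, \<open>36\<close> the factor by
  which a pass improves the radius, \<open>37\<close> the radius to be decided, \<open>44\<close> the result of an evaluation,
  \<open>45\<close> the output. The numbers in \<open>inner\<close> below are at the disposal of subroutines.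
\<close>

definition inp :: "(real ^ 'd) list \<Rightarrow> (real ^ 'd) list \<Rightarrow> real \<Rightarrow> state \<Rightarrow> bool" where
  "inp P S \<epsilon> s \<longleftrightarrow> nat_at s 0 = length P \<and> nat_at s 1 = length S \<and> real_at s 0 = \<epsilon> \<and>
     (\<forall>i < length P + length S. pt i s = (P @ S) ! i) \<and>
     nat_at s 2 = length S * length S \<and>
     (\<forall>q < length S * length S. fst s (adr 3 q) = q div length S \<and> fst s (adr 4 q) = q mod length S)"

lemma inp_same:
  "inp P S \<epsilon> s \<Longrightarrow> same X s s' \<Longrightarrow> X \<inter> {0,1,2,3,4} = {} \<Longrightarrow> inp P S \<epsilon> s'"
  unfolding inp_def by (simp add: sameD[of X s s'] pt_same[of X s s'])

lemma inpD:
  assumes "inp P S \<epsilon> s"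
  shows "nat_at s 0 = length P" "nat_at s 1 = length S" "real_at s 0 = \<epsilon>"
    "\<And>i. i < length P \<Longrightarrow> pt i s = P ! i" "\<And>j. j < length S \<Longrightarrow> pt (length P + j) s = S ! j"
    "nat_at s 2 = length S * length S"
    "\<And>q. q < length S * length S \<Longrightarrow> fst s (adr 3 q) = q div length S"
    "\<And>q. q < length S * length S \<Longrightarrow> fst s (adr 4 q) = q mod length S"
  using assms by (auto simp: inp_def nth_append)

definition total :: nexp where
  "total = NAdd (NConst 1) (nmulc d (NAdd (NV 0) (NV 1)))"

text \<open>Moves the input reals from consecutive addresses into array 0. An interleaved address is
  never smaller than its index, so copying from the last cell downwards destroys nothing that is
  still to be read. The two input naturals already lie where arrays 0 and 1 begin.\<close>

definition spread :: com where
  "spread = For 5 total (RASet 0 (NSub (NSub total (NConst 1)) (NV 5))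
     (RMem (NSub (NSub total (NConst 1)) (NV 5))))"

text \<open>Division by \<open>k\<close> is not a machine operation; tabulating all pairs in their
  numbering replaces it.\<close>

definition tables :: com where
  "tables = Seq (NSet 2 (NConst 0)) (For 5 (NV 1) (For 6 (NV 1)
     (Seq (NASet 3 (NV 2) (NV 5)) (Seq (NASet 4 (NV 2) (NV 6))
        (NSet 2 (NAdd (NV 2) (NConst 1)))))))"

definition prelude :: com where "prelude = Seq spread tables"

lemma adr_ge: "i \<le> adr c i"
  unfolding adr_def by (simp add: algebra_simps)

lemma adr_0_0: "adr 0 0 = 0" and adr_1_0: "adr (Suc 0) 0 = Suc 0"
  by (simp_all add: adr_def)

lemma wp_spread:
  assumes n: "nat_at s 0 = n" "nat_at s 1 = k"
    and Q: "\<And>t s'. t \<le> 3 * (1 + d * (n + k)) + 2 \<Longrightarrow> nat_at s' 0 = n \<Longrightarrow> nat_at s' 1 = k \<Longrightarrow>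
      (\<And>i. i < 1 + d * (n + k) \<Longrightarrow> snd s' (adr 0 i) = snd s i) \<Longrightarrow> Q t s'"
  shows "wp spread s Q"
proof -
  let ?m = "1 + d * (n + k)"
  show ?thesis unfolding spread_def
  proof (rule wp_For_inv[where m = ?m and J = "\<lambda>i t s'. t \<le> 3 * i \<and> nat_at s' 0 = n \<and> nat_at s' 1 = k \<and>
      (\<forall>j<?m. ?m - i \<le> j \<longrightarrow> snd s' (adr 0 j) = snd s j) \<and> (\<forall>j<?m - i. snd s' j = snd s j)"])
    fix i t s'
    assume i: "i < ?m" "nat_at s' 5 = i" and J: "t \<le> 3 * i \<and> nat_at s' 0 = n \<and> nat_at s' 1 = k \<and>
      (\<forall>j<?m. ?m - i \<le> j \<longrightarrow> snd s' (adr 0 j) = snd s j) \<and> (\<forall>j<?m - i. snd s' j = snd s j)"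
    define x where "x = d * (n + k) - i"
    have x: "x < ?m" "?m - Suc i = x" "?m - i = Suc x" using i by (auto simp: x_def)
    have ge: "adr 0 x \<noteq> j" if "j < x" for j using adr_ge[of x 0] that by simp
    show "wp (RASet 0 (NSub (NSub total (NConst 1)) (NV 5)) (RMem (NSub (NSub total (NConst 1)) (NV 5)))) s'
      (\<lambda>t' s''. nat_at s'' 5 = i \<and> t + t' + 2 \<le> 3 * Suc i \<and>
        nat_at (nupd (adr 5 0) (Suc i) s'') 0 = n \<and> nat_at (nupd (adr 5 0) (Suc i) s'') 1 = k \<and>
        (\<forall>j<?m. ?m - Suc i \<le> j \<longrightarrow> snd (nupd (adr 5 0) (Suc i) s'') (adr 0 j) = snd s j) \<and>
        (\<forall>j<?m - Suc i. snd (nupd (adr 5 0) (Suc i) s'') j = snd s j))"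
      unfolding x(2)
      using i J x ge by (auto simp: total_def x_def[symmetric] Suc_le_eq)
  qed (use n in \<open>auto simp: total_def intro!: Q\<close>)
qed

lemma wp_tables:
  assumes k: "nat_at s 1 = k"
    and Q: "\<And>t s'. t \<le> 9 * k * k + 9 \<Longrightarrow> same {2,3,4,5,6} s s' \<Longrightarrow> nat_at s' 2 = k * k \<Longrightarrow>
      (\<And>q. q < k * k \<Longrightarrow> fst s' (adr 3 q) = q div k \<and> fst s' (adr 4 q) = q mod k) \<Longrightarrow> Q t s'"
  shows "wp tables s Q"
proof -
  let ?T = "\<lambda>m s'. nat_at s' 2 = m \<and> (\<forall>q<m. fst s' (adr 3 q) = q div k \<and> fst s' (adr 4 q) = q mod k)"
  show ?thesis unfolding tables_def wp_Seq
    apply simp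
  proof (rule wp_For_bounded[where m = k and X = "{2,3,4,6}" and T = "5 * k + 2" and
        I = "\<lambda>i s'. ?T (i * k) s'"])
    fix i s1
    assume i: "i < k" "nat_at s1 5 = i" "same {5,2,3,4,6} (nupd (adr 2 0) 0 s) s1" "?T (i * k) s1"
    have k1: "nat_at s1 (Suc 0) = k" using i(3) k by (simp add: sameD)
    show "wp (For 6 (NV (Suc 0)) (Seq (NASet 3 (NV 2) (NV 5)) (Seq (NASet 4 (NV 2) (NV 6))
        (NSet 2 (NAdd (NV 2) (NConst (Suc 0))))))) s1
      (\<lambda>t' s'. t' \<le> 5 * k + 2 \<and> ?T (Suc i * k) (nupd (adr 5 0) (Suc i) s'))"
    proof (rule wp_For_bounded[where m = k and X = "{2,3,4}" and T = 3 and
        I = "\<lambda>j s'. ?T (i * k + j) s'"])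
      fix j s2
      assume j: "j < k" "nat_at s2 6 = j" "same {6,2,3,4} s1 s2" "?T (i * k + j) s2"
      have "nat_at s2 5 = i" using j(3) i(2) by (simp add: sameD)
      then show "wp (Seq (NASet 3 (NV 2) (NV 5)) (Seq (NASet 4 (NV 2) (NV 6))
        (NSet 2 (NAdd (NV 2) (NConst (Suc 0)))))) s2
        (\<lambda>t' s'. t' \<le> 3 \<and> ?T (i * k + Suc j) (nupd (adr 6 0) (Suc j) s'))"
        using i j by (auto simp: less_Suc_eq)
    qed (use i k1 in \<open>auto intro!: writes_intros simp: sameD add.commute\<close>)
  next
    fix t s' assume a: "same {5,2,3,4,6} (nupd (adr 2 0) 0 s) s'" "?T (k * k) s'" "t \<le> (5 * k + 2 + 2) * k + 2"
    have "same {2,3,4,5,6} s s'"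
      by (rule same_trans'[OF same_nupd[of 2 "{2}"] a(1)]) auto
    moreover have "(5 * k + 2 + 2) * k + 2 \<le> 9 * k * k + 8" by (cases k) (auto simp: algebra_simps)
    ultimately show "Q (Suc t) s'" using a by (intro Q) auto
  qed (use k in \<open>auto intro!: writes_intros simp: sameD\<close>)
qed

lemma input_state_at:
  "fst (input_state es P S \<epsilon>) 0 = length P" "fst (input_state es P S \<epsilon>) (Suc 0) = length S"
  "snd (input_state es P S \<epsilon>) 0 = \<epsilon>"
  "i < length P + length S \<Longrightarrow> e < d \<Longrightarrow>
     snd (input_state es P S \<epsilon>) (Suc (e + d * i)) = (P @ S) ! i $ (es ! e)"
proof -
  assume a: "i < length P + length S" "e < d"
  have "e + d * i < d * Suc i" using a by simp
  also have "\<dots> \<le> d * (length P + length S)" using a by (intro mult_le_mono2) simp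
  finally show "snd (input_state es P S \<epsilon>) (Suc (e + d * i)) = (P @ S) ! i $ (es ! e)"
    using a coords_nth[of i "P @ S" e] length_coords[of "P @ S"] by (simp add: input_state_def Let_def)
qed (simp_all add: input_state_def Let_def)

lemma wp_prelude:
  assumes Q: "\<And>t s. t \<le> 9 * length S * length S + 3 * (1 + d * (length P + length S)) + 11 \<Longrightarrow>
     inp P S \<epsilon> s \<Longrightarrow> Q t s"
  shows "wp prelude (input_state es P S \<epsilon>) Q"
  unfolding prelude_def wp_Seq
proof (rule wp_spread)
  fix t s1
  assume t: "t \<le> 3 * (1 + d * (length P + length S)) + 2"
    and s1: "nat_at s1 0 = length P" "nat_at s1 1 = length S"
    "\<And>i. i < 1 + d * (length P + length S) \<Longrightarrow> snd s1 (adr 0 i) = snd (input_state es P S \<epsilon>) i"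
  show "wp tables s1 (\<lambda>t2. Q (t + t2))"
  proof (rule wp_tables[OF s1(2)])
    fix t' s2
    assume t': "t' \<le> 9 * length S * length S + 9" and s2: "same {2,3,4,5,6} s1 s2"
      "nat_at s2 2 = length S * length S"
      "\<And>q. q < length S * length S \<Longrightarrow> fst s2 (adr 3 q) = q div length S \<and> fst s2 (adr 4 q) = q mod length S"
    have "pt i s1 = (P @ S) ! i" if i: "i < length P + length S" for i
    proof -
      have "Suc (e + d * i) < 1 + d * (length P + length S)" if "e < d" for e
      proof -
        have "e + d * i < d * Suc i" using that by simp
        also have "\<dots> \<le> d * (length P + length S)" using i by (intro mult_le_mono2) simp
        finally show ?thesis by simp
      qed
      then show ?thesis unfolding pt_def vec_eq_iff using s1(3) i by (simp add: pos input_state_at)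
    qed
    moreover have "pt i s2 = pt i s1" for i by (rule pt_same[OF s2(1)]) simp
    moreover have "real_at s1 0 = \<epsilon>" using s1(3)[of 0] by (simp add: input_state_at)
    ultimately have "inp P S \<epsilon> s2" using s1 s2 by (simp add: inp_def sameD[OF s2(1)])
    then show "Q (t + t') s2" using t t' by (intro Q) simp_all
  qed
qed (simp_all add: adr_0_0 adr_1_0 input_state_at)

text \<open>The output is first collected in array 45, since writing to raw addresses would
  overwrite input points that are still needed. It is then copied upwards, now from larger addresses
  to smaller ones. The length of the curve is written last because its cell also holds
  \<open>n\<close>, on which the addresses of the sites depend.\<close>

definition emit :: "nexp \<Rightarrow> com" where
  "emit a = Seq (VSet 45 (NConst 0) (VVar 33 (NConst 0)))
     (Seq (For 5 (NV 14) (VSet 45 (NAdd (NV 5) (NConst 1)) (VPt (NAdd (NV 0) (NA 13 a)))))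
     (Seq (For 5 (nmulc d (NAdd (NV 14) (NConst 1))) (RStore (NV 5) (RA 45 (NV 5))))
        (NStore (NConst 0) (NV 14))))"

lemma wp_emit:
  assumes s: "inp P S \<epsilon> s" "nat_at s 14 = m"
    and a: "\<And>j s'. j < m \<Longrightarrow> same {5,45} s s' \<Longrightarrow> nat_at s' 5 = j \<Longrightarrow>
        nval a s' = a' j \<and> fst s (adr 13 (a' j)) < length S"
    and Q: "\<And>t s'. t \<le> (6 * d + 20) * (m + 1) \<Longrightarrow>
        outputs es s' (vec 33 0 s) (map (\<lambda>j. S ! fst s (adr 13 (a' j))) [0..<m]) \<Longrightarrow> Q t s'"
  shows "wp (emit a) s Q"
proof -
  let ?B = "VSet 45 (NAdd (NV 5) (NConst 1)) (VPt (NAdd (NV 0) (NA 13 a)))"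
  let ?q = "\<lambda>j. S ! fst s (adr 13 (a' j))"
  let ?Q = "vec 33 0 s # map ?q [0..<m]"
  let ?M = "d * (m + 1)"
  have n: "nat_at s 0 = length P" using inpD[OF s(1)] by simp
  have copy: "wp (For 5 (nmulc d (NAdd (NV 14) (NConst 1))) (RStore (NV 5) (RA 45 (NV 5)))) s2
      (\<lambda>t s'. t \<le> 3 * ?M + 2 \<and> nat_at s' 14 = m \<and> (\<forall>i<?M. snd s' i = snd s2 (adr 45 i)))"
    if "nat_at s2 14 = m" for s2
  proof (rule wp_For_inv[where m = ?M and J = "\<lambda>i t s'. t \<le> 3 * i \<and> nat_at s' 14 = m \<and>
      (\<forall>j<i. snd s' j = snd s2 (adr 45 j)) \<and> (\<forall>j\<ge>i. snd s' (adr 45 j) = snd s2 (adr 45 j))"])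
    fix i t s'
    assume "i < ?M" "nat_at s' 5 = i" and J: "t \<le> 3 * i \<and> nat_at s' 14 = m \<and>
      (\<forall>j<i. snd s' j = snd s2 (adr 45 j)) \<and> (\<forall>j\<ge>i. snd s' (adr 45 j) = snd s2 (adr 45 j))"
    moreover have ne: "i = adr 45 j \<longleftrightarrow> False" if "Suc i \<le> j" for j
      using adr_ge[of j 45] that by simp
    ultimately show "wp (RStore (NV 5) (RA 45 (NV 5))) s'
      (\<lambda>t' s''. nat_at s'' 5 = i \<and> t + t' + 2 \<le> 3 * Suc i \<and> nat_at (nupd (adr 5 0) (Suc i) s'') 14 = m \<and>
        (\<forall>j<Suc i. snd (nupd (adr 5 0) (Suc i) s'') j = snd s2 (adr 45 j)) \<and>
        (\<forall>j\<ge>Suc i. snd (nupd (adr 5 0) (Suc i) s'') (adr 45 j) = snd s2 (adr 45 j)))"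
      by (simp add: ne less_Suc_eq)
  qed (use that in auto)
  show ?thesis unfolding emit_def wp_Seq
  proof (rule wp_VSet)
    fix s1 assume s1: "same {45} s s1" "fst s1 = fst s"
      "vec 45 (nval (NConst 0) s) s1 = vval (VVar 33 (NConst 0)) s"
    show "wp (For 5 (NV 14) ?B) s1 (\<lambda>t1 s2. wp (For 5 (nmulc d (NAdd (NV 14) (NConst 1)))
        (RStore (NV 5) (RA 45 (NV 5)))) s2
      (\<lambda>t2 s3. wp (NStore (NConst 0) (NV 14)) s3 (\<lambda>t3. Q (d + 1 + (t1 + (t2 + t3))))))"
    proof (rule wp_For_bounded[where m = m and X = "{45}" and T = "d + 1" and
        I = "\<lambda>i s'. \<forall>j\<le>i. vec 45 j s' = ?Q ! j"])
      fix i s2 assume i: "i < m" "nat_at s2 5 = i" "same {5,45} s1 s2" "\<forall>j\<le>i. vec 45 j s2 = ?Q ! j"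
      have ss: "same {5,45} s s2" by (rule same_trans'[OF s1(1) i(3)]) auto
      have av: "nval a s2 = a' i" "fst s (adr 13 (a' i)) < length S" using a[OF i(1) ss i(2)] by auto
      have "pt j s2 = pt j s" for j by (rule pt_same[OF ss]) simp
      then have v: "vval (VPt (NAdd (NV 0) (NA 13 a))) s2 = ?q i"
        using av n inpD(5)[OF s(1) av(2)] by (simp add: sameD[OF ss])
      show "wp ?B s2 (\<lambda>t' s'. t' \<le> d + 1 \<and> (\<forall>j\<le>Suc i. vec 45 j (nupd (adr 5 0) (Suc i) s') = ?Q ! j))"
      proof (rule wp_VSet)
        fix e s' assume e: "same {45} s2 s'" "fst s' = fst s2"
        have "nval a s' = nval a s2" by (rule nval_cong[OF e(2)])
        then show "rval (VPt (NAdd (NV 0) (NA 13 a)) e) s' = rval (VPt (NAdd (NV 0) (NA 13 a)) e) s2"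
          by (simp add: VPt_def sameD[OF e(1)])
      next
        fix s' assume "vec 45 (nval (NAdd (NV 5) (NConst 1)) s2) s' = vval (VPt (NAdd (NV 0) (NA 13 a))) s2"
          "\<And>j. j \<noteq> nval (NAdd (NV 5) (NConst 1)) s2 \<Longrightarrow> vec 45 j s' = vec 45 j s2"
        then show "d + 1 \<le> d + 1 \<and> (\<forall>j\<le>Suc i. vec 45 j (nupd (adr 5 0) (Suc i) s') = ?Q ! j)"
          using i v by (auto simp: le_Suc_eq)
      qed simp
    next
      fix t s2 assume s2: "same {5,45} s1 s2" "\<forall>j\<le>m. vec 45 j s2 = ?Q ! j" "t \<le> (d + 1 + 2) * m + 2"
      have m: "nat_at s2 14 = m" using s(2) s1 by (simp add: sameD[OF s2(1)])
      show "wp (For 5 (nmulc d (NAdd (NV 14) (NConst 1))) (RStore (NV 5) (RA 45 (NV 5)))) s2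
        (\<lambda>t2 s3. wp (NStore (NConst 0) (NV 14)) s3 (\<lambda>t3. Q (d + 1 + (t + (t2 + t3)))))"
      proof (rule wp_mono[OF copy[OF m]], elim conjE)
        fix t2 s3 assume s3: "t2 \<le> 3 * ?M + 2" "nat_at s3 14 = m" "\<forall>i<?M. snd s3 i = snd s2 (adr 45 i)"
        have "d + 1 + (t + (t2 + 1)) \<le> (6 * d + 20) * (m + 1)"
          using s2(3) s3(1) by (simp add: algebra_simps)
        moreover have "outputs es (nupd 0 m s3) (vec 33 0 s) (map ?q [0..<m])"
          unfolding outputs_def
        proof (intro conjI allI impI)
          fix i assume "i < length (coords es ?Q)"
          then have i: "i < ?M" by (simp add: length_coords)
          define e j where "e = i mod d" and "j = i div d"
          have ij: "i = e + d * j" "e < d" using d_pos by (simp_all add: e_def j_def)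
          have "j < m + 1" using i d_pos unfolding j_def by (simp add: less_mult_imp_div_less mult.commute)
          then have "vec 45 j s2 $ (es ! e) = ?Q ! j $ (es ! e)" using s2(2) by (simp add: less_Suc_eq_le)
          then have "snd s2 (adr 45 i) = ?Q ! j $ (es ! e)" using ij by (simp add: vec_def pos_nth)
          then show "snd (nupd 0 m s3) i = coords es ?Q ! i"
            using coords_nth[of j ?Q e] s3(3) i ij \<open>j < m + 1\<close> by simp
        qed simp
        ultimately show "wp (NStore (NConst 0) (NV 14)) s3 (\<lambda>t3. Q (d + 1 + (t + (t2 + t3))))"
          using s3(2) by (auto intro!: Q)
      qed
    qed (use s1 s(2) in \<open>auto intro!: writes_VSet simp: sameD\<close>)
  qed (auto simp: VVar_def sameD)
qed

end

section \<open>Approximation from a decision procedure\<close>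

context axes
begin

definition inner :: "nat set" where
  "inner = {c. 5 \<le> c \<and> c \<le> 7 \<or> 11 \<le> c \<and> c \<le> 18 \<or> 38 \<le> c \<and> c \<le> 63}"

lemma mem_inner [simp]: "c \<in> inner \<longleftrightarrow> 5 \<le> c \<and> c \<le> 7 \<or> 11 \<le> c \<and> c \<le> 18 \<or> 38 \<le> c \<and> c \<le> 63"
  by (simp add: inner_def)

section \<open>Enumeration of the grid by nested loops, one for each axis\<close>

fun grid_loop :: "nat \<Rightarrow> com \<Rightarrow> com" where
  "grid_loop 0 c = c"
| "grid_loop (Suc m) c = For (64 + m) (NV 9) (grid_loop m c)"

lemma writes_grid_loop: "writes X c \<Longrightarrow> m \<le> d \<Longrightarrow> writes (X \<union> {64..<64 + m}) (grid_loop m c)"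
proof (induction m)
  case (Suc m)
  then have "writes (X \<union> {64..<64 + m}) (grid_loop m c)" by simp
  then have "writes (X \<union> {64..<64 + Suc m}) (grid_loop m c)" by (rule writes_mono) auto
  then show ?case using Suc.prems by (auto intro!: writes_For)
qed simp

text \<open>An amortised rule. \<open>a\<close> is a potential that only grows, and a round may take
  time proportional to one plus its growth; the growth is therefore paid once for the whole grid and
  not at each point. \<open>D g a\<close> means that point \<open>g\<close> is settled at level
  \<open>a\<close>, and it must persist when the level rises.\<close>

lemma wp_grid_loop:
  assumes wr: "writes X c" "X \<inter> {64..<64 + d} = {}"
    and body: "\<And>a s. I a s \<Longrightarrow> wp c s (\<lambda>t s'. \<exists>a'\<ge>a. I a' s' \<and> D (\<lambda>e. nat_at s (64 + e)) a' \<and>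
        t \<le> \<tau> * (1 + (a' - a)))"
    and upd: "\<And>a s e x. I a s \<Longrightarrow> e < d \<Longrightarrow> I a (nupd (adr (64 + e) 0) x s)"
    and W: "0 < W" "9 \<notin> X" "nat_at s 9 = W"
    and mono: "\<And>g a a'. D g a \<Longrightarrow> a \<le> a' \<Longrightarrow> D g a'"
    and ext: "\<And>g g' a. D g a \<Longrightarrow> (\<And>e. e < d \<Longrightarrow> g e = g' e) \<Longrightarrow> D g' a"
    and m: "m \<le> d" and I: "I a s"
  shows "wp (grid_loop m c) s (\<lambda>t s'. \<exists>a'\<ge>a. I a' s' \<and>
      (\<forall>g. (\<forall>e<m. g e < W) \<and> (\<forall>e. m \<le> e \<and> e < d \<longrightarrow> g e = nat_at s (64 + e)) \<longrightarrow> D g a') \<and>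
      t \<le> (\<tau> + 4 * m) * (W ^ m + (a' - a)))"
  using m I W(3)
proof (induction m arbitrary: a s)
  case 0
  show ?case unfolding grid_loop.simps
  proof (rule wp_mono[OF body[OF "0.prems"(2)]])
    fix t s' assume "\<exists>a'\<ge>a. I a' s' \<and> D (\<lambda>e. nat_at s (64 + e)) a' \<and> t \<le> \<tau> * (1 + (a' - a))"
    then obtain a' where a': "a \<le> a'" "I a' s'" "D (\<lambda>e. nat_at s (64 + e)) a'" "t \<le> \<tau> * (1 + (a' - a))"
      by blast
    have "D g a'" if "\<forall>e. 0 \<le> e \<and> e < d \<longrightarrow> g e = nat_at s (64 + e)" for g
      by (rule ext[OF a'(3)]) (use that in simp)
    then show "\<exists>a'\<ge>a. I a' s' \<and>
      (\<forall>g. (\<forall>e<0. g e < W) \<and> (\<forall>e. 0 \<le> e \<and> e < d \<longrightarrow> g e = nat_at s (64 + e)) \<longrightarrow> D g a') \<and>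
      t \<le> (\<tau> + 4 * 0) * (W ^ 0 + (a' - a))"
      using a' by (intro exI[of _ a']) simp
  qed
next
  case (Suc m)
  let ?G = "\<lambda>i a'. \<forall>g. g m < i \<and> (\<forall>e<m. g e < W) \<and>
      (\<forall>e. m < e \<and> e < d \<longrightarrow> g e = nat_at s (64 + e)) \<longrightarrow> D g a'"
  have wr': "writes (X \<union> {64..<64 + m}) (grid_loop m c)" using writes_grid_loop[OF wr(1)] Suc by simp
  show ?case unfolding grid_loop.simps
  proof (rule wp_For[where m = W and I = "\<lambda>i t s'. \<exists>a'\<ge>a. I a' s' \<and> ?G i a' \<and>
        t \<le> (\<tau> + 4 * m) * (i * W ^ m + (a' - a)) + 2 * i", OF wr'])
    show "64 + m \<notin> X \<union> {64..<64 + m}" "64 + m < 64 + d" using wr(2) Suc.prems by auto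
    show "nval (NV 9) s' = W" if "same (insert (64 + m) (X \<union> {64..<64 + m})) s s'" for s'
      using Suc.prems W(2) sameD(1)[OF that, of 9] by simp
    show "\<exists>a'\<ge>a. I a' (nupd (adr (64 + m) 0) 0 s) \<and> ?G 0 a' \<and>
        0 \<le> (\<tau> + 4 * m) * (0 * W ^ m + (a' - a)) + 2 * 0"
      using upd Suc.prems by (intro exI[of _ a]) auto
  next
    fix i t s1
    assume i: "i < W" "nat_at s1 (64 + m) = i"
      and sm: "same (insert (64 + m) (X \<union> {64..<64 + m})) s s1"
      and inv: "\<exists>a'\<ge>a. I a' s1 \<and> ?G i a' \<and> t \<le> (\<tau> + 4 * m) * (i * W ^ m + (a' - a)) + 2 * i"
    obtain a1 where a1: "a \<le> a1" "I a1 s1" "?G i a1"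
      "t \<le> (\<tau> + 4 * m) * (i * W ^ m + (a1 - a)) + 2 * i" using inv by blast
    have ge: "nat_at s1 (64 + e) = nat_at s (64 + e)" if "m < e" "e < d" for e
      using that wr(2) by (intro sameD(1)[OF sm]) auto
    have W1: "nat_at s1 9 = W" using Suc.prems W(2) sameD(1)[OF sm, of 9] by simp
    show "wp (grid_loop m c) s1 (\<lambda>t' s'. \<exists>a'\<ge>a. I a' (nupd (adr (64 + m) 0) (Suc i) s') \<and> ?G (Suc i) a' \<and>
        t + t' + 2 \<le> (\<tau> + 4 * m) * (Suc i * W ^ m + (a' - a)) + 2 * Suc i)"
    proof (rule wp_mono[OF Suc.IH[OF _ a1(2) W1]])
      fix t' s' assume "\<exists>a'\<ge>a1. I a' s' \<and>
        (\<forall>g. (\<forall>e<m. g e < W) \<and> (\<forall>e. m \<le> e \<and> e < d \<longrightarrow> g e = nat_at s1 (64 + e)) \<longrightarrow> D g a') \<and>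
        t' \<le> (\<tau> + 4 * m) * (W ^ m + (a' - a1))"
      then obtain a2 where a2: "a1 \<le> a2" "I a2 s'"
        "\<And>g. (\<forall>e<m. g e < W) \<and> (\<forall>e. m \<le> e \<and> e < d \<longrightarrow> g e = nat_at s1 (64 + e)) \<Longrightarrow> D g a2"
        "t' \<le> (\<tau> + 4 * m) * (W ^ m + (a2 - a1))" by blast
      have "?G (Suc i) a2"
      proof (intro allI impI, elim conjE)
        fix g assume g: "g m < Suc i" "\<forall>e<m. g e < W" "\<forall>e. m < e \<and> e < d \<longrightarrow> g e = nat_at s (64 + e)"
        show "D g a2"
        proof (cases "g m = i")
          case True
          have "g e = nat_at s1 (64 + e)" if "m \<le> e" "e < d" for e
            using that True i(2) g(3) ge[of e] by (cases "e = m") auto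
          then show ?thesis using g(2) by (intro a2(3)) auto
        next
          case False
          then show ?thesis using a1(3) g mono[OF _ a2(1)] by auto
        qed
      qed
      moreover have "t + t' + 2 \<le> (\<tau> + 4 * m) * (Suc i * W ^ m + (a2 - a)) + 2 * Suc i"
      proof -
        have "a2 - a = (a1 - a) + (a2 - a1)" using a1(1) a2(1) by simp
        then have "(\<tau> + 4 * m) * (Suc i * W ^ m + (a2 - a)) =
          (\<tau> + 4 * m) * (i * W ^ m + (a1 - a)) + (\<tau> + 4 * m) * (W ^ m + (a2 - a1))"
          by (simp add: algebra_simps)
        then show ?thesis using a1(4) a2(4) by simp
      qed
      ultimately show "\<exists>a'\<ge>a. I a' (nupd (adr (64 + m) 0) (Suc i) s') \<and> ?G (Suc i) a' \<and>
        t + t' + 2 \<le> (\<tau> + 4 * m) * (Suc i * W ^ m + (a' - a)) + 2 * Suc i"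
        using a1(1) a2(1,2) upd Suc.prems by (intro exI[of _ a2]) auto
    qed (use Suc.prems in simp)
  next
    fix t s' assume "\<exists>a'\<ge>a. I a' s' \<and> ?G W a' \<and> t \<le> (\<tau> + 4 * m) * (W * W ^ m + (a' - a)) + 2 * W"
    then obtain a1 where a1: "a \<le> a1" "I a1 s'" "?G W a1"
      "t \<le> (\<tau> + 4 * m) * (W * W ^ m + (a1 - a)) + 2 * W" by blast
    \<comment> \<open>The loop control takes \<open>2 * W + 2\<close> steps, at most four times the
      number of grid points; so each nesting level adds 4 to the constant.\<close>
    have "W \<le> W ^ Suc m" "1 \<le> W ^ Suc m" using W(1) by simp_all
    then have "t + 2 \<le> (\<tau> + 4 * m) * (W ^ Suc m + (a1 - a)) + 4 * (W ^ Suc m + (a1 - a))"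
      using a1(4) unfolding power_Suc distrib_left by linarith
    also have "\<dots> = (\<tau> + 4 * Suc m) * (W ^ Suc m + (a1 - a))" by (simp add: algebra_simps)
    finally have T: "t + 2 \<le> (\<tau> + 4 * Suc m) * (W ^ Suc m + (a1 - a))" .
    have "D g a1" if "\<forall>e<Suc m. g e < W" "\<forall>e. Suc m \<le> e \<and> e < d \<longrightarrow> g e = nat_at s (64 + e)" for g
      using a1(3) that by (simp add: less_Suc_eq Suc_le_eq)
    then show "\<exists>a'\<ge>a. I a' s' \<and>
      (\<forall>g. (\<forall>e<Suc m. g e < W) \<and> (\<forall>e. Suc m \<le> e \<and> e < d \<longrightarrow> g e = nat_at s (64 + e)) \<longrightarrow> D g a') \<and>
      t + 2 \<le> (\<tau> + 4 * Suc m) * (W ^ Suc m + (a' - a))"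
      using a1(1,2) T by blast
  qed
qed

definition anchor :: "(real ^ 'd) list \<Rightarrow> (real ^ 'd) list \<Rightarrow> nat \<Rightarrow> real ^ 'd" where
  "anchor P S j = S ! j - P ! 0"

text \<open>Counters are naturals, so they are shifted by \<open>M\<close> to centre the grid at the
  anchor. \<open>M = 0\<close> leaves the anchor alone, and the first pass is run in this
  way.\<close>

definition grid :: "(real ^ 'd) list \<Rightarrow> (real ^ 'd) list \<Rightarrow> real \<Rightarrow> nat \<Rightarrow> nat \<Rightarrow> (nat \<Rightarrow> nat) \<Rightarrow> real ^ 'd" where
  "grid P S h M j g = anchor P S j + (\<chi> c. h * (real (g (pos c)) - real M))"

text \<open>Every coordinate of the offset is rounded down to a multiple of \<open>h\<close>; an
  offset of norm at most \<open>M * h\<close> keeps the shifted indices between 0 and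
  \<open>2 * M\<close>. The error is estimated by the sum norm, which gives the factor
  \<open>d\<close> where its square root would do and affects only the constant.\<close>

lemma grid_near:
  assumes "dist (P ! 0 + t) (S ! j) \<le> \<rho>" "0 < h" "\<rho> \<le> real M * h"
  shows "\<exists>g. (\<forall>e<d. g e < 2 * M + 1) \<and> dist t (grid P S h M j g) \<le> real d * h"
proof -
  define u where "u = t - anchor P S j"
  have u: "norm u \<le> real M * h"
    using assms(1,3) by (simp add: u_def anchor_def dist_norm algebra_simps)
  define g where "g e = nat \<lfloor>u $ (es ! e) / h + real M\<rfloor>" for e
  have cu: "- real M \<le> u $ c / h" "u $ c / h \<le> real M" for c
    using component_le_norm_cart[of u c] u assms(2) by (auto simp: field_simps abs_le_iff)
  have "g e < 2 * M + 1" for e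
  proof -
    have "\<lfloor>u $ (es ! e) / h + real M\<rfloor> \<le> \<lfloor>real (2 * M)\<rfloor>"
      using cu(2)[of "es ! e"] by (intro floor_mono) simp
    then have "\<lfloor>u $ (es ! e) / h + real M\<rfloor> \<le> int (2 * M)" by (simp only: floor_of_nat)
    then show ?thesis unfolding g_def by linarith
  qed
  moreover have "dist t (grid P S h M j g) \<le> real d * h"
  proof -
    have c: "\<bar>(t - grid P S h M j g) $ c\<bar> \<le> h" for c
    proof -
      have gp: "real (g (pos c)) \<le> u $ c / h + real M" "u $ c / h + real M \<le> real (g (pos c)) + 1"
        using cu[of c] by (simp_all add: g_def pos)  linarith+
      have "h * (real (g (pos c)) - real M) \<le> u $ c" "u $ c \<le> h * (real (g (pos c)) - real M) + h"
        using gp assms(2) by (simp_all add: field_simps)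
      then show ?thesis by (auto simp: grid_def u_def abs_le_iff)
    qed
    have "norm (t - grid P S h M j g) \<le> (\<Sum>c\<in>UNIV. \<bar>(t - grid P S h M j g) $ c\<bar>)"
      by (rule norm_le_l1_cart)
    also have "\<dots> \<le> (\<Sum>c\<in>(UNIV :: 'd set). h)" by (intro sum_mono c)
    finally show ?thesis by (simp add: dist_norm d_eq)
  qed
  ultimately show ?thesis by blast
qed

end

text \<open>
  \<open>feas P S t r\<close> is the decision problem for a fixed translation; \<open>eval\<close> approximates the least
  feasible \<open>r\<close> up to the factor \<open>\<Lambda>\<close>, and \<open>fin\<close> computes a curve for a feasible \<open>r\<close>.
\<close>

locale scheme = axes es for es :: "'d::finite list" +
  fixes \<delta> :: "(real ^ 'd) list \<Rightarrow> (real ^ 'd) list \<Rightarrow> real"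
    and adm :: "(real ^ 'd) set \<Rightarrow> (real ^ 'd) list \<Rightarrow> bool"
    and feas :: "(real ^ 'd) list \<Rightarrow> (real ^ 'd) list \<Rightarrow> real ^ 'd \<Rightarrow> real \<Rightarrow> bool"
    and eval decide fin :: com and out :: nexp and out' :: "nat \<Rightarrow> nat \<Rightarrow> nat"
    and \<Lambda> :: "nat \<Rightarrow> real" and \<tau> :: "nat \<Rightarrow> nat \<Rightarrow> nat"
  assumes feas_mono: "\<And>P S t r r'. feas P S t r \<Longrightarrow> r \<le> r' \<Longrightarrow> feas P S t r'"
    and feas_translate: "\<And>P S t r t'. P \<noteq> [] \<Longrightarrow> feas P S t r \<Longrightarrow> feas P S t' (r + dist t t')"
    and feas_near: "\<And>P S t r. P \<noteq> [] \<Longrightarrow> feas P S t r \<Longrightarrow> \<exists>j<length S. dist (P ! 0 + t) (S ! j) \<le> r"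
    and feas_complete: "\<And>P S t Q r. P \<noteq> [] \<Longrightarrow> S \<noteq> [] \<Longrightarrow> adm (set S) Q \<Longrightarrow>
        \<delta> (translate t P) Q < r \<Longrightarrow> feas P S t r"
    and feas_sound: "\<And>P S t r. P \<noteq> [] \<Longrightarrow> S \<noteq> [] \<Longrightarrow> feas P S t r \<Longrightarrow>
        \<exists>Q. adm (set S) Q \<and> \<delta> (translate t P) Q \<le> r"
    and adm_ex: "\<And>S. S \<noteq> [] \<Longrightarrow> \<exists>Q. adm (set S) Q"
    and \<delta>_nonneg: "\<And>S t P Q. P \<noteq> [] \<Longrightarrow> adm (set S) Q \<Longrightarrow> 0 \<le> \<delta> (translate t P) Q"
    and \<Lambda>_ge: "\<And>n. 1 \<le> \<Lambda> n"
    and writes_inner: "writes inner eval" "writes inner decide" "writes inner fin"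
    and wp_eval: "\<And>P S \<epsilon> s. P \<noteq> [] \<Longrightarrow> S \<noteq> [] \<Longrightarrow> inp P S \<epsilon> s \<Longrightarrow>
        wp eval s (\<lambda>t s'. t \<le> \<tau> (length P) (length S) \<and> feas P S (vec 32 0 s) (real_at s' 44) \<and>
          (\<forall>r. feas P S (vec 32 0 s) r \<longrightarrow> real_at s' 44 \<le> \<Lambda> (length P) * r))"
    and wp_decide: "\<And>P S \<epsilon> s. P \<noteq> [] \<Longrightarrow> S \<noteq> [] \<Longrightarrow> inp P S \<epsilon> s \<Longrightarrow>
        wp decide s (\<lambda>t s'. t \<le> \<tau> (length P) (length S) \<and>
          nat_at s' 11 = (if feas P S (vec 32 0 s) (real_at s 37) then 1 else 0))"
    and wp_fin: "\<And>P S \<epsilon> s. P \<noteq> [] \<Longrightarrow> S \<noteq> [] \<Longrightarrow> distinct S \<Longrightarrow> inp P S \<epsilon> s \<Longrightarrow>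
        feas P S (vec 32 0 s) (real_at s 37) \<Longrightarrow>
        wp fin s (\<lambda>t s'. t \<le> \<tau> (length P) (length S) \<and> nat_at s' 14 < \<tau> (length P) (length S) \<and>
          (\<forall>j < nat_at s' 14. fst s' (adr 13 (out' (nat_at s' 14) j)) < length S) \<and>
          (let Q = map (\<lambda>j. S ! fst s' (adr 13 (out' (nat_at s' 14) j))) [0..<nat_at s' 14] in
            adm (set S) Q \<and> \<delta> (translate (vec 32 0 s) P) Q \<le> real_at s 37))"
    and nval_out: "\<And>s. nval out s = out' (nat_at s 14) (nat_at s 5)"
begin

section \<open>Feasibility at anchors and grid points close to the optimum\<close>

abbreviation "opt P S \<equiv> optimal_value \<delta> adm P (set S)"

lemma opt_le:
  assumes "P \<noteq> []" "S \<noteq> []" "feas P S t r"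
  shows "opt P S \<le> r"
proof -
  obtain Q where Q: "adm (set S) Q" "\<delta> (translate t P) Q \<le> r" using feas_sound assms by blast
  have "opt P S \<le> \<delta> (translate t P) Q" unfolding optimal_value_def
    by (rule cInf_lower) (use Q \<delta>_nonneg[OF assms(1)] in \<open>auto intro!: bdd_belowI[of _ 0]\<close>)
  then show ?thesis using Q by simp
qed

lemma opt_less:
  assumes "P \<noteq> []" "S \<noteq> []" "opt P S < r"
  shows "\<exists>t. feas P S t r"
proof -
  have "{\<delta> (translate t P) Q | t Q. adm (set S) Q} \<noteq> {}" using adm_ex[OF assms(2)] by blast
  from cInf_lessD[OF this assms(3)[unfolded optimal_value_def]]
  show ?thesis using feas_complete[OF assms(1,2)] by blast
qed

lemma opt_nonneg:
  assumes "P \<noteq> []" "S \<noteq> []"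
  shows "0 \<le> opt P S"
  unfolding optimal_value_def
  by (rule cInf_greatest) (use adm_ex[OF assms(2)] \<delta>_nonneg[OF assms(1)] in auto)

lemma feas_nonneg: "P \<noteq> [] \<Longrightarrow> S \<noteq> [] \<Longrightarrow> feas P S t r \<Longrightarrow> 0 \<le> r"
  by (rule order_trans[OF opt_nonneg opt_le])

lemma feas_anchor:
  assumes "P \<noteq> []" "S \<noteq> []" "opt P S < r"
  shows "\<exists>j<length S. feas P S (anchor P S j) (2 * r)"
proof -
  obtain t where t: "feas P S t r" using opt_less assms by blast
  obtain j where j: "j < length S" "dist (P ! 0 + t) (S ! j) \<le> r"
    using feas_near[OF assms(1) t] by blast
  have "dist t (anchor P S j) \<le> r" using j(2) by (simp add: anchor_def dist_norm algebra_simps)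
  then have "feas P S (anchor P S j) (2 * r)"
    by (intro feas_mono[OF feas_translate[OF assms(1) t]]) simp
  then show ?thesis using j by blast
qed

lemma feas_grid:
  assumes "P \<noteq> []" "S \<noteq> []" "opt P S < r" "0 < h" "r \<le> real M * h"
  shows "\<exists>j<length S. \<exists>g. (\<forall>e<d. g e < 2 * M + 1) \<and> feas P S (grid P S h M j g) (r + real d * h)"
proof -
  obtain t where t: "feas P S t r" using opt_less assms by blast
  obtain j where j: "j < length S" "dist (P ! 0 + t) (S ! j) \<le> r"
    using feas_near[OF assms(1) t] by blast
  obtain g where g: "\<forall>e<d. g e < 2 * M + 1" "dist t (grid P S h M j g) \<le> real d * h"
    using grid_near[OF j(2) assms(4,5)] by blast
  have "feas P S (grid P S h M j g) (r + real d * h)"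
    by (rule feas_mono[OF feas_translate[OF assms(1) t]]) (use g in simp)
  then show ?thesis using j g by blast
qed

end

context scheme
begin

section \<open>The two passes and their amortised cost\<close>

lemma loop_time_step: "(t::nat) \<le> A + 2 * i \<Longrightarrow> t' \<le> B \<Longrightarrow> t + t' + 2 \<le> A + B + 2 * Suc i"
  by simp

lemma attempt_time_step: "(t::nat) \<le> A + 3 \<Longrightarrow> t' \<le> B + 1 \<Longrightarrow> d + 1 + (t + t') \<le> (A + d + 10) + B"
  by simp

lemma loop_time_total: "(t::nat) \<le> A + 2 * k \<Longrightarrow> k \<le> X \<Longrightarrow> 1 \<le> k \<Longrightarrow> t + 2 \<le> A + 4 * (X + a)"
  by simp

text \<open>There is no infinite radius to begin the minimum with; natural cell 10 records instead
  whether some value has been stored.\<close>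

definition start :: com where
  "start = Seq (NSet 10 (NConst 0)) (For 8 (NV 1)
     (Seq (VSet 32 (NConst 0) (VSub (VPt (NAdd (NV 0) (NV 8))) (VPt (NConst 0))))
     (Seq eval
       (Cond (BAnd (NLess (NConst 0) (NV 10)) (RLe (RV 34) (RV 44))) Skip
         (Seq (NSet 10 (NConst 1)) (Seq (RSet 34 (RV 44)) (VSet 33 (NConst 0) (VVar 32 (NConst 0)))))))))"

text \<open>At radius 0 the answer is overridden by a refusal: a feasible radius 0 would otherwise
  be replaced by itself without end.\<close>

definition test :: com where
  "test = Seq (RSet 37 (RMul (RV 36) (RV 34)))
     (Seq decide (Cond (RLess (RNat 0) (RV 34)) Skip (NSet 11 (NConst 0))))"

definition attempt :: com where
  "attempt = Seq (VSet 32 (NConst 0) (\<lambda>e. RAdd (VSub (VPt (NAdd (NV 0) (NV 8))) (VPt (NConst 0)) e)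
       (RMul (RV 35) (RSub (ROfNat (NV (64 + e))) (ROfNat (NV 19))))))
     (Seq test (While (NLess (NConst 0) (NV 11))
       (Seq (RSet 34 (RV 37)) (Seq (VSet 33 (NConst 0) (VVar 32 (NConst 0))) test))))"

definition pass :: com where
  "pass = For 8 (NV 1) (grid_loop d attempt)"

definition outer :: "nat set" where
  "outer = inner \<union> {32, 33, 34, 37}"

lemma mem_outer [simp]: "c \<in> outer \<longleftrightarrow> c \<in> inner \<or> c = 32 \<or> c = 33 \<or> c = 34 \<or> c = 37"
  by (auto simp: outer_def)

lemma writes_outer:
  "writes outer eval" "writes outer decide" "writes outer fin" "writes outer test" "writes outer attempt"
proof -
  show a: "writes outer eval" "writes outer decide" "writes outer fin"
    using writes_inner by (auto elim!: writes_mono simp: outer_def)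
  show t: "writes outer test"
    unfolding test_def by (intro writes_intros a) auto
  show "writes outer attempt"
    unfolding attempt_def by (intro writes_intros writes_VSet t) auto
qed

lemma wp_start:
  assumes PS: "P \<noteq> []" "S \<noteq> []" and s: "inp P S \<epsilon> s"
    and Q: "\<And>t s'. t \<le> (\<tau> (length P) (length S) + 2 * d + 10) * length S + 3 \<Longrightarrow> inp P S \<epsilon> s' \<Longrightarrow>
      feas P S (vec 33 0 s') (real_at s' 34) \<Longrightarrow>
      (\<And>j r. j < length S \<Longrightarrow> feas P S (anchor P S j) r \<Longrightarrow> real_at s' 34 \<le> \<Lambda> (length P) * r) \<Longrightarrow> Q t s'"
  shows "wp start s Q"
proof -
  let ?I = "\<lambda>i s'. inp P S \<epsilon> s' \<and> (0 < i \<longrightarrow> 0 < nat_at s' 10 \<and> feas P S (vec 33 0 s') (real_at s' 34)) \<and>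
      (i = 0 \<longrightarrow> nat_at s' 10 = 0) \<and>
      (\<forall>j<i. \<forall>r. feas P S (anchor P S j) r \<longrightarrow> real_at s' 34 \<le> \<Lambda> (length P) * r)"
  let ?upd = "Cond (BAnd (NLess (NConst 0) (NV 10)) (RLe (RV 34) (RV 44))) Skip
         (Seq (NSet 10 (NConst 1)) (Seq (RSet 34 (RV 44)) (VSet 33 (NConst 0) (VVar 32 (NConst 0)))))"
  let ?\<tau> = "\<tau> (length P) (length S)"
  show ?thesis unfolding start_def wp_Seq wp_NStore
  proof (rule wp_For_bounded[where m = "length S" and X = "outer \<union> {10}" and I = ?I and T = "?\<tau> + 2 * d + 8"])
    show "writes (outer \<union> {10}) (Seq (VSet 32 (NConst 0) (VSub (VPt (NAdd (NV 0) (NV 8))) (VPt (NConst 0))))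
     (Seq eval ?upd))"
      by (intro writes_intros writes_VSet writes_mono[OF writes_inner(1)]) (auto simp: outer_def)
  next
    fix i s1 assume i: "i < length S" "nat_at s1 8 = i" and I: "?I i s1"
    show "wp (Seq (VSet 32 (NConst 0) (VSub (VPt (NAdd (NV 0) (NV 8))) (VPt (NConst 0)))) (Seq eval ?upd)) s1
      (\<lambda>t' s'. t' \<le> ?\<tau> + 2 * d + 8 \<and> ?I (Suc i) (nupd (adr 8 0) (Suc i) s'))"
      unfolding wp_Seq
    proof (rule wp_VSet)
      fix s2 assume s2: "same {32} s1 s2" "fst s2 = fst s1"
        "vec 32 (nval (NConst 0) s1) s2 = vval (VSub (VPt (NAdd (NV 0) (NV 8))) (VPt (NConst 0))) s1"
      have T: "vec 32 0 s2 = anchor P S i"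
        using s2(3) inpD[OF conjunct1[OF I]] i PS by (simp add: anchor_def)
      have inp2: "inp P S \<epsilon> s2" by (rule inp_same[OF conjunct1[OF I] s2(1)]) simp
      show "wp eval s2 (\<lambda>t1 s3. wp ?upd s3 (\<lambda>t2 s'. d + 1 + (t1 + t2) \<le> ?\<tau> + 2 * d + 8 \<and>
          ?I (Suc i) (nupd (adr 8 0) (Suc i) s')))"
      proof (rule wp_mono[OF wp_writes[OF wp_eval[OF PS inp2] writes_inner(1)]], elim conjE)
        fix t1 s3 assume e: "t1 \<le> ?\<tau>" "feas P S (vec 32 0 s2) (real_at s3 44)"
          "\<forall>r. feas P S (vec 32 0 s2) r \<longrightarrow> real_at s3 44 \<le> \<Lambda> (length P) * r" and sm: "same inner s2 s3"
        have inp3: "inp P S \<epsilon> s3" by (rule inp_same[OF inp2 sm]) (simp add: inner_def)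
        have v: "vec 32 0 s3 = anchor P S i" "vec 33 0 s3 = vec 33 0 s1"
          using T vec_same[OF sm, of 32] vec_same[OF sm, of 33] vec_same[OF s2(1), of 33] by simp_all
        have o: "real_at s3 34 = real_at s1 34" "nat_at s3 10 = nat_at s1 10"
          using sameD[OF sm, of 34] sameD[OF s2(1), of 34] sameD[OF sm, of 10] sameD[OF s2(1), of 10] by simp_all
        have e': "feas P S (anchor P S i) (real_at s3 44)"
          "\<And>r. feas P S (anchor P S i) r \<Longrightarrow> real_at s3 44 \<le> \<Lambda> (length P) * r" using e T by simp_all
        show "wp ?upd s3 (\<lambda>t2 s'. d + 1 + (t1 + t2) \<le> ?\<tau> + 2 * d + 8 \<and> ?I (Suc i) (nupd (adr 8 0) (Suc i) s'))"
        proof (cases "0 < nat_at s1 10 \<and> real_at s1 34 \<le> real_at s3 44")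
          case True
          have "real_at s1 34 \<le> \<Lambda> (length P) * r" if "feas P S (anchor P S j) r" "j < Suc i" for j r
          proof (cases "j = i")
            case True
            then show ?thesis using e'(2)[of r] that \<open>0 < nat_at s1 10 \<and> real_at s1 34 \<le> real_at s3 44\<close> by simp
          next
            case False
            then have "j < i" using that by simp
            then show ?thesis using I that by blast
          qed
          moreover have "0 < i" using True I by (cases "i = 0") auto
          ultimately show ?thesis
            using True I v o e(1) inp_same[OF inp3 same_nupd[of 8 "{8}"]] by simp
        next
          case False
          have low: "real_at s3 44 \<le> \<Lambda> (length P) * r" if "feas P S (anchor P S j) r" "j < Suc i" for j r
          proof (cases "j = i")
            case True
            then show ?thesis using e'(2)[of r] that by simp
          next
            case ne: False
            then have "j < i" using that by simp
            then have "real_at s1 34 \<le> \<Lambda> (length P) * r" "0 < nat_at s1 10" using I that by blast+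
            then show ?thesis using False by linarith
          qed
          have "\<not> bval (BAnd (NLess (NConst 0) (NV 10)) (RLe (RV 34) (RV 44))) s3" using False o by (auto simp: not_le)
          then show ?thesis unfolding wp_Cond wp_Seq wp_NStore wp_RStore
            apply (simp only: if_False)
          proof (rule wp_VSet)
            let ?s = "rupd (nval (Ad 34 (NConst 0)) (nupd (nval (Ad 10 (NConst 0)) s3) (nval (NConst 1) s3) s3))
                (rval (RV 44) (nupd (nval (Ad 10 (NConst 0)) s3) (nval (NConst 1) s3) s3))
                (nupd (nval (Ad 10 (NConst 0)) s3) (nval (NConst 1) s3) s3)"
            fix s4 assume s4: "same {33} ?s s4"
              "vec 33 (nval (NConst 0) ?s) s4 = vval (VVar 32 (NConst 0)) ?s"
            have "vec 33 0 s4 = anchor P S i" using s4(2) v by simp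
            moreover have "real_at s4 34 = real_at s3 44" "nat_at s4 10 = 1"
              using sameD(2)[OF s4(1), of 34] sameD(1)[OF s4(1), of 10] by simp_all
            moreover have "inp P S \<epsilon> (nupd (adr 8 0) (Suc i) s4)"
            proof -
              have "same {10,34} s3 ?s"
                by (rule same_trans[of _ _ "nupd (adr 10 0) (Suc 0) s3"]) (simp_all add: same_nupd same_rupd)
              from same_trans'[OF this s4(1), of "{10,33,34}"]
              have "same {10,33,34} s3 s4" by auto
              from same_trans'[OF this same_nupd[of 8 "{8}"], of "{8,10,33,34}"]
              have "same {8,10,33,34} s3 (nupd (adr 8 0) (Suc i) s4)" by auto
              then show ?thesis by (rule inp_same[OF inp3]) simp
            qed
            ultimately show "d + 1 + (t1 + (1 + (1 + (1 + (d + 1))))) \<le> ?\<tau> + 2 * d + 8 \<and> ?I (Suc i) (nupd (adr 8 0) (Suc i) s4)"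
              using e(1) e'(1) low by simp
          qed (auto simp: VVar_def sameD)
        qed
      qed
    qed (auto simp: VSub_def VPt_def sameD)
  next
    fix t s' assume "?I (length S) s'" "t \<le> (?\<tau> + 2 * d + 8 + 2) * length S + 2"
    then show "Q (1 + t) s'" using PS by (intro Q) (auto simp: add_ac)
  next
    fix s' assume a: "same (insert 8 (outer \<union> {10})) (nupd (nval (Ad 10 (NConst 0)) s) (nval (NConst 0) s) s) s'"
    show "nval (NV 1) s' = length S"
      using sameD(1)[OF a, of 1] inpD(2)[OF s] by simp
  next
    have "same {8,10} s (nupd (adr 8 0) 0 (nupd (adr 10 0) 0 s))"
      by (rule same_trans[of _ _ "nupd (adr 10 0) 0 s"]) (simp_all add: same_nupd)
    from inp_same[OF s this]
    show "?I 0 (nupd (adr 8 0) 0 (nupd (nval (Ad 10 (NConst 0)) s) (nval (NConst 0) s) s))" by simp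
  qed auto
qed

lemma wp_test:
  assumes PS: "P \<noteq> []" "S \<noteq> []" and s: "inp P S \<epsilon> s"
    and Q: "\<And>t s'. t \<le> \<tau> (length P) (length S) + 3 \<Longrightarrow> same (insert 37 inner) s s' \<Longrightarrow>
      real_at s' 37 = real_at s 36 * real_at s 34 \<Longrightarrow>
      nat_at s' 11 = (if 0 < real_at s 34 \<and> feas P S (vec 32 0 s) (real_at s 36 * real_at s 34) then 1 else 0) \<Longrightarrow>
      Q t s'"
  shows "wp test s Q"
proof -
  let ?s = "rupd (adr 37 0) (real_at s 36 * real_at s 34) s"
  have s1: "same {37} s ?s" by (simp add: same_rupd)
  have inp1: "inp P S \<epsilon> ?s" by (rule inp_same[OF s s1]) simp
  have "wp decide ?s (\<lambda>t s2. wp (Cond (RLess (RNat 0) (RV 34)) Skip (NSet 11 (NConst 0))) s2 (\<lambda>t3. Q (1 + (t + t3))))"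
  proof (rule wp_mono[OF wp_writes[OF wp_decide[OF PS inp1] writes_inner(2)]], elim conjE)
    fix t s2 assume t: "t \<le> \<tau> (length P) (length S)"
      "nat_at s2 11 = (if feas P S (vec 32 0 ?s) (real_at ?s 37) then 1 else 0)" and sm: "same inner ?s s2"
    have sm': "same (insert 37 inner) s s2" by (rule same_trans'[OF s1 sm]) auto
    have sm'': "same (insert 37 inner) s (nupd (adr 11 0) 0 s2)"
      by (rule same_trans[OF sm']) (simp add: same_nupd)
    have r: "real_at s2 37 = real_at s 36 * real_at s 34" "real_at s2 34 = real_at s 34"
      using sameD[OF sm, of 37] sameD[OF sm, of 34] by simp_all
    show "wp (Cond (RLess (RNat 0) (RV 34)) Skip (NSet 11 (NConst 0))) s2 (\<lambda>t3. Q (1 + (t + t3)))"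
      using t r sm' sm'' by (auto intro!: Q)
  qed
  then show ?thesis unfolding test_def wp_Seq wp_RStore by (simp only: nval_Ad nval.simps rval.simps)
qed

text \<open>\<open>a\<close> counts the improvements made in the pass so far and is the potential of
  the amortised rule. At radius 0 the factor no longer shrinks anything, so there the count must be
  0 for it to be bounded later.\<close>

definition pinv :: "(real ^ 'd) list \<Rightarrow> (real ^ 'd) list \<Rightarrow> real \<Rightarrow> real \<Rightarrow> real \<Rightarrow> real \<Rightarrow> nat \<Rightarrow> nat \<Rightarrow> nat \<Rightarrow>
    state \<Rightarrow> bool" where
  "pinv P S \<epsilon> r0 f h W M a s \<longleftrightarrow> inp P S \<epsilon> s \<and> (r0 = 0 \<longrightarrow> a = 0) \<and> real_at s 34 = f ^ a * r0 \<and> real_at s 36 = f \<and>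
     real_at s 35 = h \<and> nat_at s 9 = W \<and> nat_at s 19 = M \<and> feas P S (vec 33 0 s) (f ^ a * r0)"

lemma pinv_same:
  assumes "pinv P S \<epsilon> r0 f h W M a s" "same X s s'" "X \<inter> ({0,1,2,3,4,9,19,33,34,35,36}) = {}"
  shows "pinv P S \<epsilon> r0 f h W M a s'"
proof -
  have "inp P S \<epsilon> s'" by (rule inp_same[OF _ assms(2)]) (use assms in \<open>auto simp: pinv_def\<close>)
  then show ?thesis
    using assms by (simp add: pinv_def sameD[OF assms(2)] vec_same[OF assms(2)])
qed

definition blocked :: "(real ^ 'd) list \<Rightarrow> (real ^ 'd) list \<Rightarrow> real \<Rightarrow> real \<Rightarrow> nat \<Rightarrow> real ^ 'd \<Rightarrow> bool" where
  "blocked P S r0 f a t \<longleftrightarrow> f ^ a * r0 = 0 \<or> \<not> feas P S t (f * (f ^ a * r0))"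

text \<open>Infeasibility passes to smaller radii. This is the persistence needed by the grid rule,
  and it is why each translation is tried only once in a pass.\<close>

lemma blocked_mono:
  assumes "blocked P S r0 f a t" "a \<le> a'" "0 < f" "f < 1" "0 \<le> r0"
  shows "blocked P S r0 f a' t"
proof -
  have "f ^ a' \<le> f ^ a" using assms by (intro power_decreasing) auto
  then have "f * (f ^ a' * r0) \<le> f * (f ^ a * r0)" using assms by (intro mult_left_mono mult_right_mono) auto
  then show ?thesis using assms(1,3) feas_mono by (auto simp: blocked_def)
qed

text \<open>Each round is an improvement and is charged to the growth of \<open>a\<close>. All radii
  reached are feasible and so bounded below by the optimum, which is positive whenever the initial
  radius is; this rules out endless improvement.\<close>

lemma wp_attempt_loop:
  assumes PS: "P \<noteq> []" "S \<noteq> []" and f: "0 < f" "f < 1" and r0: "0 \<le> r0" "0 < r0 \<Longrightarrow> 0 < opt P S"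
    and inv: "pinv P S \<epsilon> r0 f h W M a s" "real_at s 37 = f * (f ^ a * r0)" "vec 32 0 s = T"
    and flag: "nat_at s 11 = (if blocked P S r0 f a T then 0 else 1)"
  shows "wp (While (NLess (NConst 0) (NV 11))
       (Seq (RSet 34 (RV 37)) (Seq (VSet 33 (NConst 0) (VVar 32 (NConst 0))) test))) s
     (\<lambda>t s'. \<exists>a'\<ge>a. pinv P S \<epsilon> r0 f h W M a' s' \<and> blocked P S r0 f a' T \<and>
        t \<le> (\<tau> (length P) (length S) + d + 10) * (a' - a) + 1)"
proof (cases "r0 = 0")
  case True
  then have "blocked P S r0 f a T" by (simp add: blocked_def)
  then show ?thesis using flag inv by (subst wp_While) auto
next
  case False
  then have opt: "0 < opt P S" "0 < r0" using r0 by auto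
  \<comment> \<open>From exponent \<open>N\<close> on the radius would lie below the optimum.
    \<open>N\<close> serves for termination only and does not enter the time.\<close>
  obtain N where "f ^ N < opt P S / r0" using real_arch_pow_inv[of "opt P S / r0" f] opt f by auto
  then have N: "f ^ N * r0 < opt P S" using opt by (simp add: field_simps)
  let ?\<tau> = "\<tau> (length P) (length S)"
  have lt: "b < N" if "pinv P S \<epsilon> r0 f h W M b s" for b s
  proof (rule ccontr)
    assume "\<not> b < N"
    then have "f ^ b \<le> f ^ N" using f by (intro power_decreasing) auto
    then have "f ^ b * r0 \<le> f ^ N * r0" using opt by simp
    moreover have "opt P S \<le> f ^ b * r0" using that opt_le[OF PS] by (auto simp: pinv_def)
    ultimately show False using N by simp
  qed
  let ?B = "Seq (RSet 34 (RV 37)) (Seq (VSet 33 (NConst 0) (VVar 32 (NConst 0))) test)"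
  show ?thesis using inv flag
  proof (induction "N - a" arbitrary: a s rule: less_induct)
    case less
    show ?case
    proof (cases "blocked P S r0 f a T")
      case True
      then show ?thesis using less.prems by (subst wp_While) auto
    next
      case False
      have fe: "feas P S T (f * (f ^ a * r0))" using False by (auto simp: blocked_def)
      let ?s = "rupd (adr 34 0) (f * (f ^ a * r0)) s"
      have "wp ?B s (\<lambda>t1 s1. t1 \<le> ?\<tau> + d + 5 \<and> pinv P S \<epsilon> r0 f h W M (Suc a) s1 \<and>
          real_at s1 37 = f * (f ^ Suc a * r0) \<and> vec 32 0 s1 = T \<and>
          nat_at s1 11 = (if blocked P S r0 f (Suc a) T then 0 else 1))"
        unfolding wp_Seq wp_RStore
      proof (rule wp_VSet)
        fix s2 assume s2: "same {33} (rupd (nval (Ad 34 (NConst 0)) s) (rval (RV 37) s) s) s2"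
          "vec 33 (nval (NConst 0) (rupd (nval (Ad 34 (NConst 0)) s) (rval (RV 37) s) s)) s2 =
           vval (VVar 32 (NConst 0)) (rupd (nval (Ad 34 (NConst 0)) s) (rval (RV 37) s) s)"
        have sm: "same {33} ?s s2" using s2(1) less.prems(2) by simp
        have sm': "same {33,34} s s2"
          by (rule same_trans'[OF same_rupd[of 34 "{34}"] sm]) auto
        have "inp P S \<epsilon> s2" by (rule inp_same[OF _ sm']) (use less.prems(1) in \<open>auto simp: pinv_def\<close>)
        moreover have v: "vec 33 0 s2 = T" "vec 32 0 s2 = T"
          using s2(2) less.prems(3) vec_same[OF sm', of 32] by simp_all
        moreover have "real_at s2 34 = f ^ Suc a * r0" using sameD(2)[OF sm, of 34] by simp
        ultimately have p2: "pinv P S \<epsilon> r0 f h W M (Suc a) s2"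
          using less.prems(1) fe opt by (simp add: pinv_def sameD[OF sm'] mult.assoc)
        show "wp test s2 (\<lambda>t2 s1. 1 + (d + 1 + t2) \<le> ?\<tau> + d + 5 \<and> pinv P S \<epsilon> r0 f h W M (Suc a) s1 \<and>
          real_at s1 37 = f * (f ^ Suc a * r0) \<and> vec 32 0 s1 = T \<and>
          nat_at s1 11 = (if blocked P S r0 f (Suc a) T then 0 else 1))"
        proof (rule wp_test[OF PS \<open>inp P S \<epsilon> s2\<close>])
          fix t s' assume t: "t \<le> ?\<tau> + 3" "same (insert 37 inner) s2 s'"
            "real_at s' 37 = real_at s2 36 * real_at s2 34"
            "nat_at s' 11 = (if 0 < real_at s2 34 \<and> feas P S (vec 32 0 s2) (real_at s2 36 * real_at s2 34) then 1 else 0)"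
          have "pinv P S \<epsilon> r0 f h W M (Suc a) s'" by (rule pinv_same[OF p2 t(2)]) (auto simp: inner_def)
          moreover have "vec 32 0 s' = T" using vec_same[OF t(2), of 32] v by simp
          moreover have "0 < f ^ Suc a * r0" using f opt by simp
          ultimately show "1 + (d + 1 + t) \<le> ?\<tau> + d + 5 \<and> pinv P S \<epsilon> r0 f h W M (Suc a) s' \<and>
            real_at s' 37 = f * (f ^ Suc a * r0) \<and> vec 32 0 s' = T \<and>
            nat_at s' 11 = (if blocked P S r0 f (Suc a) T then 0 else 1)"
            using t p2 v by (auto simp: pinv_def blocked_def)
        qed
      qed (auto simp: VVar_def sameD)
      then have "wp ?B s (\<lambda>t1 s1. wp (While (NLess (NConst 0) (NV 11)) ?B) s1
         (\<lambda>t2 s'. \<exists>a'\<ge>a. pinv P S \<epsilon> r0 f h W M a' s' \<and> blocked P S r0 f a' T \<and>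
            1 + t1 + t2 \<le> (?\<tau> + d + 10) * (a' - a) + 1))"
      proof (rule wp_mono, elim conjE)
        fix t1 s1 assume s1: "t1 \<le> ?\<tau> + d + 5" "pinv P S \<epsilon> r0 f h W M (Suc a) s1"
          "real_at s1 37 = f * (f ^ Suc a * r0)" "vec 32 0 s1 = T"
          "nat_at s1 11 = (if blocked P S r0 f (Suc a) T then 0 else 1)"
        have "N - Suc a < N - a" using lt[OF less.prems(1)] by simp
        from less.hyps[OF this s1(2-5)]
        show "wp (While (NLess (NConst 0) (NV 11)) ?B) s1
         (\<lambda>t2 s'. \<exists>a'\<ge>a. pinv P S \<epsilon> r0 f h W M a' s' \<and> blocked P S r0 f a' T \<and>
            1 + t1 + t2 \<le> (?\<tau> + d + 10) * (a' - a) + 1)"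
        proof (rule wp_mono)
          fix t2 s' assume "\<exists>a'\<ge>Suc a. pinv P S \<epsilon> r0 f h W M a' s' \<and> blocked P S r0 f a' T \<and>
            t2 \<le> (?\<tau> + d + 10) * (a' - Suc a) + 1"
          then obtain a' where a': "Suc a \<le> a'" "pinv P S \<epsilon> r0 f h W M a' s'" "blocked P S r0 f a' T"
            "t2 \<le> (?\<tau> + d + 10) * (a' - Suc a) + 1" by blast
          have "a' - a = Suc (a' - Suc a)" using a'(1) by simp
          then have "(?\<tau> + d + 10) * (a' - a) = (?\<tau> + d + 10) + (?\<tau> + d + 10) * (a' - Suc a)" by simp
          then have "1 + t1 + t2 \<le> (?\<tau> + d + 10) * (a' - a) + 1" using a'(4) s1(1) by linarith
          then show "\<exists>a'\<ge>a. pinv P S \<epsilon> r0 f h W M a' s' \<and> blocked P S r0 f a' T \<and>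
            1 + t1 + t2 \<le> (?\<tau> + d + 10) * (a' - a) + 1"
            using a' by (intro exI[of _ a']) simp
        qed
      qed
      then show ?thesis using False less.prems(4) by (subst wp_While) simp
    qed
  qed
qed

lemma wp_attempt:
  assumes PS: "P \<noteq> []" "S \<noteq> []" and f: "0 < f" "f < 1" and r0: "0 \<le> r0" "0 < r0 \<Longrightarrow> 0 < opt P S"
    and inv: "pinv P S \<epsilon> r0 f h W M a s" and j: "nat_at s 8 = j" "j < length S"
  shows "wp attempt s (\<lambda>t s'. \<exists>a'\<ge>a. pinv P S \<epsilon> r0 f h W M a' s' \<and>
      blocked P S r0 f a' (grid P S h M j (\<lambda>e. nat_at s (64 + e))) \<and>
      t \<le> (\<tau> (length P) (length S) + d + 10) * (1 + (a' - a)))"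
  unfolding attempt_def wp_Seq
proof (rule wp_VSet)
  let ?\<tau> = "\<tau> (length P) (length S)" and ?T = "grid P S h M j (\<lambda>e. nat_at s (64 + e))"
  let ?V = "\<lambda>e. RAdd (VSub (VPt (NAdd (NV 0) (NV 8))) (VPt (NConst 0)) e)
       (RMul (RV 35) (RSub (ROfNat (NV (64 + e))) (ROfNat (NV 19))))"
  let ?W = "While (NLess (NConst 0) (NV 11)) (Seq (RSet 34 (RV 37)) (Seq (VSet 33 (NConst 0) (VVar 32 (NConst 0))) test))"
  fix s1 assume s1: "same {32} s s1" "vec 32 (nval (NConst 0) s) s1 = vval ?V s"
  have i: "inp P S \<epsilon> s" using inv by (simp add: pinv_def)
  have "vval ?V s = vval (VSub (VPt (NAdd (NV 0) (NV 8))) (VPt (NConst 0))) s +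
      (\<chi> c. h * (real (nat_at s (64 + pos c)) - real M))"
    using inv by (simp add: vval_def vec_eq_iff pinv_def)
  then have T: "vec 32 0 s1 = ?T"
    using s1(2) inpD[OF i] j PS by (simp add: grid_def anchor_def)
  have p1: "pinv P S \<epsilon> r0 f h W M a s1" by (rule pinv_same[OF inv s1(1)]) auto
  then have i1: "inp P S \<epsilon> s1" by (simp add: pinv_def)
  show "wp test s1 (\<lambda>t1 s2. wp ?W s2 (\<lambda>t2 s'. \<exists>a'\<ge>a. pinv P S \<epsilon> r0 f h W M a' s' \<and> blocked P S r0 f a' ?T \<and>
      d + 1 + (t1 + t2) \<le> (?\<tau> + d + 10) * (1 + (a' - a))))"
  proof (rule wp_test[OF PS i1])
    fix t s' assume t: "t \<le> ?\<tau> + 3" "same (insert 37 inner) s1 s'"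
      "real_at s' 37 = real_at s1 36 * real_at s1 34"
      "nat_at s' 11 = (if 0 < real_at s1 34 \<and> feas P S (vec 32 0 s1) (real_at s1 36 * real_at s1 34) then 1 else 0)"
    have p2: "pinv P S \<epsilon> r0 f h W M a s'" by (rule pinv_same[OF p1 t(2)]) (auto simp: inner_def)
    have T2: "vec 32 0 s' = ?T" using vec_same[OF t(2), of 32] T by simp
    have r37: "real_at s' 37 = f * (f ^ a * r0)" using t(3) p1 by (simp add: pinv_def)
    have "0 \<le> f ^ a * r0" using f r0 by simp
    then have flag: "nat_at s' 11 = (if blocked P S r0 f a ?T then 0 else 1)"
      using t(4) p1 T f by (auto simp: pinv_def blocked_def)
    show "wp ?W s' (\<lambda>t2 s'. \<exists>a'\<ge>a. pinv P S \<epsilon> r0 f h W M a' s' \<and> blocked P S r0 f a' ?T \<and>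
      d + 1 + (t + t2) \<le> (?\<tau> + d + 10) * (1 + (a' - a)))"
    proof (rule wp_mono[OF wp_attempt_loop[OF PS f r0 p2 r37 T2 flag]])
      fix t2 s'' assume "\<exists>a'\<ge>a. pinv P S \<epsilon> r0 f h W M a' s'' \<and> blocked P S r0 f a' ?T \<and>
        t2 \<le> (?\<tau> + d + 10) * (a' - a) + 1"
      then obtain a' where a': "a \<le> a'" "pinv P S \<epsilon> r0 f h W M a' s''" "blocked P S r0 f a' ?T"
        "t2 \<le> (?\<tau> + d + 10) * (a' - a) + 1" by blast
      have "d + 1 + (t + t2) \<le> (?\<tau> + d + 10) * (1 + (a' - a))"
        using attempt_time_step[OF t(1) a'(4)] by simp
      then show "\<exists>a'\<ge>a. pinv P S \<epsilon> r0 f h W M a' s'' \<and> blocked P S r0 f a' ?T \<and>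
        d + 1 + (t + t2) \<le> (?\<tau> + d + 10) * (1 + (a' - a))" using a' by blast
    qed
  qed
qed (auto simp: VSub_def VPt_def sameD)

text \<open>The count \<open>a\<close> is handed from one anchor to the next, so improvements are
  added up over the whole pass and appear once, beside the number of translations.\<close>

lemma wp_pass:
  assumes PS: "P \<noteq> []" "S \<noteq> []" and f: "0 < f" "f < 1" and r0: "0 \<le> r0" "0 < r0 \<Longrightarrow> 0 < opt P S"
    and inv: "pinv P S \<epsilon> r0 f h W M 0 s" and W: "0 < W"
  shows "wp pass s (\<lambda>t s'. \<exists>a. pinv P S \<epsilon> r0 f h W M a s' \<and>
      (\<forall>j<length S. \<forall>g. (\<forall>e<d. g e < W) \<longrightarrow> blocked P S r0 f a (grid P S h M j g)) \<and>
      t \<le> (\<tau> (length P) (length S) + 5 * d + 14) * (length S * W ^ d + a))"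
proof -
  let ?\<tau> = "\<tau> (length P) (length S) + d + 10" and ?k = "length S"
  let ?I = "\<lambda>i t s'. \<exists>a. pinv P S \<epsilon> r0 f h W M a s' \<and>
      (\<forall>j<i. \<forall>g. (\<forall>e<d. g e < W) \<longrightarrow> blocked P S r0 f a (grid P S h M j g)) \<and>
      t \<le> (?\<tau> + 4 * d) * (i * W ^ d + a) + 2 * i"
  let ?X = "outer \<union> {64..<64 + d}"
  have v: "8 \<notin> ?X" "8 < 64 + d" by auto
  have wr: "writes ?X (grid_loop d attempt)" by (rule writes_grid_loop[OF writes_outer(5)]) simp
  have upd8: "pinv P S \<epsilon> r0 f h W M a (nupd (adr 8 0) x s)" if "pinv P S \<epsilon> r0 f h W M a s" for a s x
    by (rule pinv_same[OF that same_nupd[of 8 "{8}"]]) auto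
  show ?thesis unfolding pass_def
  proof (rule wp_For[where m = ?k and I = ?I, OF wr v])
    fix s' assume "same (insert 8 ?X) s s'"
    from sameD(1)[OF this, of 1] show "nval (NV 1) s' = ?k" using inv inpD(2)[of P S \<epsilon> s] by (simp add: pinv_def)
  next
    show "?I 0 0 (nupd (adr 8 0) 0 s)" using upd8[OF inv] by auto
  next
    fix i t s1 assume i: "i < ?k" "nat_at s1 8 = i" and "?I i t s1"
    then obtain a where a: "pinv P S \<epsilon> r0 f h W M a s1"
      "\<forall>j<i. \<forall>g. (\<forall>e<d. g e < W) \<longrightarrow> blocked P S r0 f a (grid P S h M j g)"
      "t \<le> (?\<tau> + 4 * d) * (i * W ^ d + a) + 2 * i" by blast
    show "wp (grid_loop d attempt) s1 (\<lambda>t' s'. ?I (Suc i) (t + t' + 2) (nupd (adr 8 0) (Suc i) s'))"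
    proof (rule wp_mono[OF wp_grid_loop[where m = d and W = W and a = a and s = s1 and X = outer and c = attempt and
          I = "\<lambda>a s. pinv P S \<epsilon> r0 f h W M a s \<and> nat_at s 8 = i" and \<tau> = ?\<tau> and
          D = "\<lambda>g a. blocked P S r0 f a (grid P S h M i g)"]])
      show "outer \<inter> {64..<64 + d} = {}" by (auto simp: outer_def inner_def)
      show "9 \<notin> outer" by simp
      show "nat_at s1 9 = W" using a(1) by (simp add: pinv_def)
    next
      fix a s assume as: "pinv P S \<epsilon> r0 f h W M a s \<and> nat_at s 8 = i"
      have "wp attempt s (\<lambda>t s'. \<exists>a'\<ge>a. pinv P S \<epsilon> r0 f h W M a' s' \<and>
        blocked P S r0 f a' (grid P S h M i (\<lambda>e. nat_at s (64 + e))) \<and> t \<le> ?\<tau> * (1 + (a' - a)))"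
        using wp_attempt[OF PS f r0 conjunct1[OF as] conjunct2[OF as] i(1)] .
      from wp_writes[OF this writes_outer(5)]
      show "wp attempt s (\<lambda>t s'. \<exists>a'\<ge>a. (pinv P S \<epsilon> r0 f h W M a' s' \<and> nat_at s' 8 = i) \<and>
        blocked P S r0 f a' (grid P S h M i (\<lambda>e. nat_at s (64 + e))) \<and> t \<le> ?\<tau> * (1 + (a' - a)))"
      proof (rule wp_mono)
        fix t s' assume b: "(\<exists>a'\<ge>a. pinv P S \<epsilon> r0 f h W M a' s' \<and>
          blocked P S r0 f a' (grid P S h M i (\<lambda>e. nat_at s (64 + e))) \<and> t \<le> ?\<tau> * (1 + (a' - a))) \<and> same outer s s'"
        have "nat_at s' 8 = i" using sameD(1)[OF conjunct2[OF b], of 8] as by simp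
        then show "\<exists>a'\<ge>a. (pinv P S \<epsilon> r0 f h W M a' s' \<and> nat_at s' 8 = i) \<and>
          blocked P S r0 f a' (grid P S h M i (\<lambda>e. nat_at s (64 + e))) \<and> t \<le> ?\<tau> * (1 + (a' - a))"
          using b by blast
      qed
    next
      fix a s e x assume as: "pinv P S \<epsilon> r0 f h W M a s \<and> nat_at s 8 = i" "e < d"
      have "pinv P S \<epsilon> r0 f h W M a (nupd (adr (64 + e) 0) x s)"
        by (rule pinv_same[OF conjunct1[OF as(1)] same_nupd[of "64 + e" "{64 + e}"]]) (use as(2) in auto)
      then show "pinv P S \<epsilon> r0 f h W M a (nupd (adr (64 + e) 0) x s) \<and> nat_at (nupd (adr (64 + e) 0) x s) 8 = i"
        using as by simp
    next
      fix g a a' assume "blocked P S r0 f a (grid P S h M i g)" "a \<le> a'"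
      then show "blocked P S r0 f a' (grid P S h M i g)" by (rule blocked_mono[OF _ _ f r0(1)])
    next
      fix g g' a assume b: "blocked P S r0 f a (grid P S h M i g)" "\<And>e. e < d \<Longrightarrow> g e = g' e"
      have "grid P S h M i g = grid P S h M i g'" using b(2) by (simp add: grid_def vec_eq_iff pos)
      then show "blocked P S r0 f a (grid P S h M i g')" using b(1) by simp
    next
      fix t' s' assume "\<exists>a'\<ge>a. (pinv P S \<epsilon> r0 f h W M a' s' \<and> nat_at s' 8 = i) \<and>
        (\<forall>g. (\<forall>e<d. g e < W) \<and> (\<forall>e. d \<le> e \<and> e < d \<longrightarrow> g e = nat_at s1 (64 + e)) \<longrightarrow>
          blocked P S r0 f a' (grid P S h M i g)) \<and> t' \<le> (?\<tau> + 4 * d) * (W ^ d + (a' - a))"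
      then obtain a' where a': "a \<le> a'" "pinv P S \<epsilon> r0 f h W M a' s'"
        "\<And>g. (\<forall>e<d. g e < W) \<Longrightarrow> blocked P S r0 f a' (grid P S h M i g)"
        "t' \<le> (?\<tau> + 4 * d) * (W ^ d + (a' - a))" by auto
      have "Suc i * W ^ d + a' = (i * W ^ d + a) + (W ^ d + (a' - a))" using a'(1) by simp
      then have "(?\<tau> + 4 * d) * (Suc i * W ^ d + a') =
        (?\<tau> + 4 * d) * (i * W ^ d + a) + (?\<tau> + 4 * d) * (W ^ d + (a' - a))" by (simp only: distrib_left)
      then have "t + t' + 2 \<le> (?\<tau> + 4 * d) * (Suc i * W ^ d + a') + 2 * Suc i"
        using loop_time_step[OF a(3) a'(4)] by simp
      moreover have "blocked P S r0 f a' (grid P S h M j g)" if "j < Suc i" "\<forall>e<d. g e < W" for j g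
      proof (cases "j = i")
        case False
        then show ?thesis using a(2) that blocked_mono[OF _ a'(1) f r0(1)] by auto
      qed (use a'(3) that in simp)
      ultimately show "?I (Suc i) (t + t' + 2) (nupd (adr 8 0) (Suc i) s')"
        using upd8[OF a'(2)] by blast
    qed (use writes_outer W a(1) i(2) in auto)
  next
    fix t s' assume "?I ?k t s'"
    then obtain a where a: "pinv P S \<epsilon> r0 f h W M a s'"
      "\<forall>j<?k. \<forall>g. (\<forall>e<d. g e < W) \<longrightarrow> blocked P S r0 f a (grid P S h M j g)"
      "t \<le> (?\<tau> + 4 * d) * (?k * W ^ d + a) + 2 * ?k" by blast
    have "?k * 1 \<le> ?k * W ^ d" "1 \<le> ?k" using W PS(2) by (auto simp: Suc_le_eq)
    then have "t + 2 \<le> (?\<tau> + 4 * d) * (?k * W ^ d + a) + 4 * (?k * W ^ d + a)"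
      using loop_time_total[OF a(3)] by simp
    also have "\<dots> = (\<tau> (length P) (length S) + 5 * d + 14) * (?k * W ^ d + a)" by (simp add: algebra_simps)
    finally show "\<exists>a. pinv P S \<epsilon> r0 f h W M a s' \<and>
      (\<forall>j<?k. \<forall>g. (\<forall>e<d. g e < W) \<longrightarrow> blocked P S r0 f a (grid P S h M j g)) \<and>
      t + 2 \<le> (\<tau> (length P) (length S) + 5 * d + 14) * (?k * W ^ d + a)" using a by blast
  qed
qed

end

context scheme
begin

section \<open>The complete algorithm and its guarantee\<close>

definition grow :: com where
  "grow = Seq (NSet 19 (NConst 0))
     (While (RLess (RMul (ROfNat (NV 19)) (RV 0)) (RNat (32 * d))) (NSet 19 (NAdd (NV 19) (NConst 1))))"

text \<open>Reals cannot be rounded to naturals, so \<open>32 * d / \<epsilon>\<close> is rounded up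
  by counting. This takes a number of steps linear in \<open>1 / \<epsilon>\<close>, within the
  bound because the dimension is at least 1.\<close>

lemma wp_grow:
  assumes \<epsilon>: "real_at s 0 = \<epsilon>" "0 < \<epsilon>"
    and Q: "\<And>M. 32 * real d \<le> real M * \<epsilon> \<Longrightarrow> real M * \<epsilon> \<le> 32 * real d + \<epsilon> \<Longrightarrow>
      Q (2 * M + 2) (nupd (adr 19 0) M s)"
  shows "wp grow s Q"
proof -
  let ?w = "While (RLess (RMul (ROfNat (NV 19)) (RV 0)) (RNat (32 * d))) (NSet 19 (NAdd (NV 19) (NConst 1)))"
  have nn: "nupd a x (nupd a y s') = nupd a x s'" for a x y s' by (simp add: nupd_def)
  obtain N where N: "32 * real d / \<epsilon> < real N" using reals_Archimedean2 by blast
  have "wp ?w (nupd (adr 19 0) i s) (\<lambda>t'. Q (1 + (2 * i + t')))"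
    if "real i * \<epsilon> \<le> 32 * real d + \<epsilon>" for i
    using that
  proof (induction "N - i" arbitrary: i rule: less_induct)
    case less
    show ?case
    proof (cases "real i * \<epsilon> < 32 * real d")
      case True
      moreover have "32 * real d < real N * \<epsilon>" using N \<epsilon>(2) by (simp add: field_simps)
      ultimately have "real i * \<epsilon> < real N * \<epsilon>" by linarith
      then have "real i < real N" using \<epsilon>(2) by simp
      then have "N - Suc i < N - i" by simp
      from less.hyps[OF this] have "wp ?w (nupd (adr 19 0) (Suc i) s) (\<lambda>t'. Q (1 + (2 * Suc i + t')))"
        using True \<epsilon>(2) by (simp add: algebra_simps)
      then show ?thesis using True \<epsilon>(1) by (subst wp_While) (simp add: nn)
    next
      case False
      then show ?thesis using \<epsilon>(1) Q[of i] less.prems by (subst wp_While) simp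
    qed
  qed
  from this[of 0] show ?thesis using \<epsilon>(2) unfolding grow_def by simp
qed

text \<open>Both passes are the same program under different settings: natural cells 19 and 9 hold
  \<open>M\<close> and the side \<open>2 * M + 1\<close> of the grid, real cells 35 and 36 its width
  and the improvement factor. The first pass uses one point per anchor and the factor 1/2.\<close>

definition main :: com where
  "main = Seq prelude (Seq start
     (Seq (NSet 19 (NConst 0)) (Seq (NSet 9 (NConst 1)) (Seq (RSet 35 (RNat 0)) (Seq (RSet 36 (RDiv (RNat 1) (RNat 2)))
     (Seq pass
     (Seq grow
     (Seq (NSet 9 (NAdd (NAdd (NV 19) (NV 19)) (NConst 1)))
     (Seq (RSet 35 (RDiv (RMul (RV 34) (RV 0)) (RNat (32 * d))))
     (Seq (RSet 36 (RSub (RNat 1) (RDiv (RV 0) (RNat 4))))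
     (Seq pass
     (Seq (VSet 32 (NConst 0) (VVar 33 (NConst 0))) (Seq (RSet 37 (RV 34)) (Seq fin (emit out)))))))))))))))"

lemma wp_output:
  assumes PS: "P \<noteq> []" "S \<noteq> []" "distinct S" and s: "inp P S \<epsilon> s" "feas P S (vec 33 0 s) (real_at s 34)"
    and Q: "\<And>t s' Z. t \<le> (6 * d + 20) * \<tau> (length P) (length S) + \<tau> (length P) (length S) + d + 2 \<Longrightarrow>
      outputs es s' (vec 33 0 s) Z \<Longrightarrow> adm (set S) Z \<Longrightarrow>
      \<delta> (translate (vec 33 0 s) P) Z \<le> real_at s 34 \<Longrightarrow> Q t s'"
  shows "wp (Seq (VSet 32 (NConst 0) (VVar 33 (NConst 0))) (Seq (RSet 37 (RV 34)) (Seq fin (emit out)))) s Q"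
  unfolding wp_Seq wp_RStore
proof (rule wp_VSet)
  let ?\<tau> = "\<tau> (length P) (length S)"
  fix s1 assume s1: "same {32} s s1" "vec 32 (nval (NConst 0) s) s1 = vval (VVar 33 (NConst 0)) s"
  let ?s = "rupd (nval (Ad 37 (NConst 0)) s1) (rval (RV 34) s1) s1"
  have "same {37} s1 ?s" by (simp add: same_rupd)
  from same_trans'[OF s1(1) this, of "{32,37}"] have sm: "same {32,37} s ?s" by auto
  have inp2: "inp P S \<epsilon> ?s" by (rule inp_same[OF s(1) sm]) simp
  have v: "vec 32 0 ?s = vec 33 0 s" "vec 33 0 ?s = vec 33 0 s" "real_at ?s 37 = real_at s 34"
    using s1(2) vec_same[OF s1(1), of 33] sameD(2)[OF s1(1), of 34] by simp_all
  have fe: "feas P S (vec 32 0 ?s) (real_at ?s 37)" unfolding v by (rule s(2))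
  show "wp fin ?s (\<lambda>t1 s'. wp (emit out) s' (\<lambda>t2. Q (d + 1 + (1 + (t1 + t2)))))"
  proof (rule wp_mono[OF wp_writes[OF wp_fin[OF PS inp2 fe] writes_inner(3)]], elim conjE)
    fix t1 s2
    let ?m = "nat_at s2 14"
    let ?Z = "map (\<lambda>j. S ! fst s2 (adr 13 (out' ?m j))) [0..<?m]"
    assume t1: "t1 \<le> ?\<tau>" "?m < ?\<tau>" and sm2: "same inner ?s s2"
      and O: "\<forall>j<?m. fst s2 (adr 13 (out' ?m j)) < length S"
      and Z: "let Q = ?Z in adm (set S) Q \<and> \<delta> (translate (vec 32 0 ?s) P) Q \<le> real_at ?s 37"
    have inp3: "inp P S \<epsilon> s2" by (rule inp_same[OF inp2 sm2]) (auto simp: inner_def)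
    show "wp (emit out) s2 (\<lambda>t2. Q (d + 1 + (1 + (t1 + t2))))"
    proof (rule wp_emit[where a' = "out' ?m", OF inp3 refl])
      fix j s' assume "j < ?m" "same {5,45} s2 s'" "nat_at s' 5 = j"
      then show "nval out s' = out' ?m j \<and> fst s2 (adr 13 (out' ?m j)) < length S"
        using O sameD(1)[of "{5,45}" s2 s' 14] by (simp add: nval_out)
    next
      fix t s' assume t: "t \<le> (6 * d + 20) * (?m + 1)" and o: "outputs es s' (vec 33 0 s2) ?Z"
      have "(6 * d + 20) * (?m + 1) \<le> (6 * d + 20) * ?\<tau>" using t1(2) by (intro mult_le_mono2) simp
      then show "Q (d + 1 + (1 + (t1 + t))) s'"
        using t t1 Z o v vec_same[OF sm2, of 33] by (intro Q[of _ s' ?Z]) (auto simp: Let_def)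
    qed
  qed
qed (auto simp: VVar_def sameD)

text \<open>Above the optimum some anchor is feasible at twice the radius, and the evaluation loses
  at most \<Lambda> there.\<close>

lemma opt_bound_start:
  assumes PS: "P \<noteq> []" "S \<noteq> []" and low: "\<And>j r. j < length S \<Longrightarrow> feas P S (anchor P S j) r \<Longrightarrow> r0 \<le> \<Lambda> (length P) * r"
  shows "r0 \<le> 2 * \<Lambda> (length P) * opt P S"
proof -
  have L: "0 < \<Lambda> (length P)" using \<Lambda>_ge[of "length P"] by linarith
  have "r0 / (2 * \<Lambda> (length P)) \<le> opt P S"
  proof (rule dense_ge)
    fix r assume "opt P S < r"
    then obtain j where "j < length S" "feas P S (anchor P S j) (2 * r)" using feas_anchor PS by blast
    from low[OF this] show "r0 / (2 * \<Lambda> (length P)) \<le> r" using L by (simp add: field_simps)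
  qed
  then show ?thesis using L by (simp add: field_simps)
qed

text \<open>If \<open>r / 4\<close> exceeded the optimum, some x between them would make an anchor
  feasible at \<open>2 * x\<close>, hence at \<open>r / 2\<close>, which has been refused.\<close>

lemma opt_bound_anchor:
  assumes PS: "P \<noteq> []" "S \<noteq> []"
    and b: "\<And>j. j < length S \<Longrightarrow> r = 0 \<or> \<not> feas P S (anchor P S j) (r / 2)"
  shows "r \<le> 4 * opt P S"
proof (cases "r = 0")
  case False
  have "r / 4 \<le> opt P S"
  proof (rule dense_ge)
    fix x assume "opt P S < x"
    then obtain j where j: "j < length S" "feas P S (anchor P S j) (2 * x)" using feas_anchor PS by blast
    show "r / 4 \<le> x"
    proof (rule ccontr)
      assume "\<not> r / 4 \<le> x"
      then have "feas P S (anchor P S j) (r / 2)" by (intro feas_mono[OF j(2)]) simp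
      then show False using b[OF j(1)] False by simp
    qed
  qed
  then show ?thesis by simp
qed (use opt_nonneg[OF PS] in simp)

text \<open>The choice of \<open>M\<close> makes the grid cover all offsets of length
  \<open>r1\<close>, and the choice of \<open>h\<close> makes the rounding error at most
  \<open>r1 * \<epsilon> / 32\<close>, hence at most \<epsilon>/8 of the optimum. As every grid
  point refuses \<open>(1 - \<epsilon> / 4) * r2\<close>, this number is at most
  \<open>1 + \<epsilon> / 8\<close> times the optimum.\<close>

lemma opt_bound_grid:
  assumes PS: "P \<noteq> []" "S \<noteq> []" and \<epsilon>: "0 < \<epsilon>" "\<epsilon> \<le> 1"
    and r1: "r1 \<le> 4 * opt P S" "opt P S \<le> r1" and r2: "r2 \<le> r1" "0 \<le> r2"
    and M: "32 * real d \<le> real M * \<epsilon>" and h: "h = r1 * \<epsilon> / (32 * real d)"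
    and b: "\<And>j g. j < length S \<Longrightarrow> (\<forall>e<d. g e < 2 * M + 1) \<Longrightarrow>
      r2 = 0 \<or> \<not> feas P S (grid P S h M j g) ((1 - \<epsilon> / 4) * r2)"
  shows "r2 \<le> (1 + \<epsilon>) * opt P S"
proof (cases "r2 = 0 \<or> opt P S = r1")
  case True
  have "opt P S * 1 \<le> opt P S * (1 + \<epsilon>)" using opt_nonneg[OF PS] \<epsilon> by (intro mult_left_mono) auto
  then show ?thesis using True r2 opt_nonneg[OF PS] \<epsilon> by (auto simp: mult.commute)
next
  \<comment> \<open>The grid covers offsets only up to \<open>r1\<close>, so radii strictly between
    the optimum and \<open>r1\<close> are needed; where there are none, \<open>r1\<close> is already
    optimal.\<close>
  case False
  then have lt: "opt P S < r1" and r2': "0 < r2" "0 < r1" using r1 r2 by auto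
  have d0: "0 < real d" using d_pos by simp
  have h0: "0 < h" using r2' \<epsilon> d0 by (simp add: h)
  have Mh: "r1 \<le> real M * h"
  proof -
    have "r1 * (32 * real d) \<le> r1 * (real M * \<epsilon>)" using M r2' by (intro mult_left_mono) auto
    then show ?thesis using d0 by (simp add: h field_simps)
  qed
  have dh: "real d * h \<le> opt P S * \<epsilon> / 8"
  proof -
    have "real d * h = r1 * \<epsilon> / 32" using d0 by (simp add: h)
    also have "\<dots> \<le> 4 * opt P S * \<epsilon> / 32" using r1 \<epsilon> by (intro divide_right_mono mult_right_mono) auto
    finally show ?thesis by (simp add: mult.commute)
  qed
  have "(1 - \<epsilon> / 4) * r2 - opt P S * \<epsilon> / 8 \<le> opt P S"
  proof (rule dense_ge_bounded[OF lt])
    fix x assume x: "opt P S < x" "x < r1"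
    then obtain j g where j: "j < length S" "\<forall>e<d. g e < 2 * M + 1" "feas P S (grid P S h M j g) (x + real d * h)"
      using feas_grid[OF PS x(1) h0, of M] Mh by auto
    show "(1 - \<epsilon> / 4) * r2 - opt P S * \<epsilon> / 8 \<le> x"
    proof (rule ccontr)
      assume "\<not> ?thesis"
      then have "feas P S (grid P S h M j g) ((1 - \<epsilon> / 4) * r2)"
        using dh by (intro feas_mono[OF j(3)]) linarith
      then show False using b[OF j(1,2)] r2' by simp
    qed
  qed
  then have "(1 - \<epsilon> / 4) * r2 \<le> opt P S * (1 + \<epsilon> / 8)" by (simp add: algebra_simps)
  also have "\<dots> \<le> opt P S * ((1 - \<epsilon> / 4) * (1 + \<epsilon>))"
  proof (rule mult_left_mono)
    \<comment> \<open>Since \<epsilon> is at most 1, the quadratic term costs at most \<epsilon>/4,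
      which leaves \<open>1 + \<epsilon> / 2\<close> on the right.\<close>
    have "\<epsilon> * \<epsilon> \<le> \<epsilon> * 1" using \<epsilon> by (intro mult_left_mono) auto
    moreover have "(1 - \<epsilon> / 4) * (1 + \<epsilon>) = 1 + 3 * \<epsilon> / 4 - \<epsilon> * \<epsilon> / 4" by (simp add: field_simps)
    ultimately show "1 + \<epsilon> / 8 \<le> (1 - \<epsilon> / 4) * (1 + \<epsilon>)" using \<epsilon> by linarith
  qed (rule opt_nonneg[OF PS])
  finally have "(1 - \<epsilon> / 4) * r2 \<le> (1 - \<epsilon> / 4) * ((1 + \<epsilon>) * opt P S)" by (simp only: mult_ac)
  then show ?thesis using \<epsilon> by simp
qed

text \<open>All radii of the first pass lie between the optimum and \<open>2 * \<Lambda>\<close>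
  times the optimum, so \<open>2 ^ a\<close> is at most the quotient of these bounds.\<close>

lemma count_halvings:
  assumes "r0 \<le> 2 * \<Lambda> n * x" "x \<le> (1/2) ^ a * r0" "r0 = 0 \<longrightarrow> a = 0" "0 \<le> x" "0 \<le> r0"
  shows "real a \<le> log 2 (2 * \<Lambda> n)"
proof -
  have L: "1 \<le> \<Lambda> n" by (rule \<Lambda>_ge)
  show ?thesis
  proof (cases "r0 = 0")
    case True
    then show ?thesis using assms(3) L by simp
  next
    case False
    have "r0 \<le> 2 * \<Lambda> n * ((1/2) ^ a * r0)"
      by (rule order_trans[OF assms(1)]) (use assms(2) L in \<open>intro mult_left_mono; simp\<close>)
    then have "2 ^ a * r0 \<le> 2 * \<Lambda> n * r0" by (simp add: power_one_over field_simps)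
    then have "2 ^ a \<le> 2 * \<Lambda> n" using False assms(5) by simp
    then have "log 2 (2 ^ a) \<le> log 2 (2 * \<Lambda> n)" using L by (intro iffD2[OF log_le_cancel_iff]) auto
    then show ?thesis by simp
  qed
qed

text \<open>The radii of the second pass stay between the optimum and four times the optimum. With
  \<open>1 - y \<le> exp (- y)\<close> this gives \<open>exp (a * \<epsilon> / 4) \<le> 4\<close>,
  and 4 is at most \<open>exp 2\<close>.\<close>

lemma count_improvements:
  assumes \<epsilon>: "0 < \<epsilon>" "\<epsilon> \<le> 1" and "r1 \<le> 4 * x" "x \<le> (1 - \<epsilon> / 4) ^ a * r1" "r1 = 0 \<longrightarrow> a = 0" "0 \<le> r1"
  shows "real a * \<epsilon> \<le> 8"
proof (cases "r1 = 0")
  case False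
  have "r1 \<le> 4 * (1 - \<epsilon> / 4) ^ a * r1" using assms by linarith
  then have "1 \<le> 4 * (1 - \<epsilon> / 4) ^ a" using False assms(6) by simp
  also have "(1 - \<epsilon> / 4) ^ a \<le> exp (- (\<epsilon> / 4)) ^ a"
    using \<epsilon> exp_ge_add_one_self[of "- (\<epsilon> / 4)"] by (intro power_mono) auto
  also have "\<dots> = exp (- (real a * (\<epsilon> / 4)))" by (simp flip: exp_of_nat_mult)
  finally have "exp (real a * (\<epsilon> / 4)) \<le> 4" by (simp add: exp_minus field_simps)
  also have "(4::real) \<le> exp 1 * exp 1"
    using exp_ge_add_one_self[of "1::real"] mult_mono[of 2 "exp 1" 2 "exp (1::real)"] by simp
  also have "\<dots> = exp 2" by (simp flip: exp_add)
  finally have "real a * (\<epsilon> / 4) \<le> 2" by simp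
  then show ?thesis by simp
qed (use assms in simp)

lemma wp_init_coarse:
  "wp (Seq (NSet 19 (NConst 0)) (Seq (NSet 9 (NConst 1)) (Seq (RSet 35 (RNat 0))
     (Seq (RSet 36 (RDiv (RNat 1) (RNat 2))) c)))) s Q \<longleftrightarrow>
   wp c (rupd (adr 36 0) (1/2) (rupd (adr 35 0) 0 (nupd (adr 9 0) 1 (nupd (adr 19 0) 0 s))))
     (\<lambda>t. Q (1 + (1 + (1 + (1 + t)))))"
  by simp

lemma wp_init_fine:
  assumes "real_at s 0 = \<epsilon>" "real_at s 34 = r" "nat_at s 19 = M"
  shows "wp (Seq (NSet 9 (NAdd (NAdd (NV 19) (NV 19)) (NConst 1)))
     (Seq (RSet 35 (RDiv (RMul (RV 34) (RV 0)) (RNat (32 * d))))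
     (Seq (RSet 36 (RSub (RNat 1) (RDiv (RV 0) (RNat 4)))) c))) s Q \<longleftrightarrow>
   wp c (rupd (adr 36 0) (1 - \<epsilon> / 4) (rupd (adr 35 0) (r * \<epsilon> / (32 * real d)) (nupd (adr 9 0) (2 * M + 1) s)))
     (\<lambda>t. Q (1 + (1 + (1 + t))))"
  using assms by (simp add: mult_2)

text \<open>The summands of the bound belong, in order, to the preparation of the memory, the
  evaluation of the anchors, the pass over anchors, the computation of the grid size together with
  all settings, the pass over the grid, and the output. \<open>a1\<close> and \<open>a2\<close> are
  the numbers of improvements in the two passes.\<close>

lemma wp_main:
  assumes PS: "P \<noteq> []" "S \<noteq> []" "distinct S" and \<epsilon>: "0 < \<epsilon>" "\<epsilon> \<le> 1"
  shows "wp main (input_state es P S \<epsilon>) (\<lambda>time s'. \<exists>t Q M a1 a2. outputs es s' t Q \<and>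
     approx_solution \<delta> adm \<epsilon> P (set S) t Q \<and> real M * \<epsilon> \<le> 32 * real d + \<epsilon> \<and>
     real a1 \<le> log 2 (2 * \<Lambda> (length P)) \<and> real a2 * \<epsilon> \<le> 8 \<and>
     time \<le> (9 * length S * length S + 3 * (1 + d * (length P + length S)) + 11) +
       ((\<tau> (length P) (length S) + 2 * d + 10) * length S + 3) +
       (\<tau> (length P) (length S) + 5 * d + 14) * (length S + a1) + (2 * M + 9) +
       (\<tau> (length P) (length S) + 5 * d + 14) * (length S * (2 * M + 1) ^ d + a2) +
       ((6 * d + 20) * \<tau> (length P) (length S) + \<tau> (length P) (length S) + d + 2))"
  (is "wp _ _ ?G")
proof -
  let ?\<tau> = "\<tau> (length P) (length S)" and ?k = "length S" and ?n = "length P"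
  let ?O = "Seq (VSet 32 (NConst 0) (VVar 33 (NConst 0))) (Seq (RSet 37 (RV 34)) (Seq fin (emit out)))"
  let ?R2 = "Seq pass ?O"
  let ?R1 = "Seq grow (Seq (NSet 9 (NAdd (NAdd (NV 19) (NV 19)) (NConst 1)))
     (Seq (RSet 35 (RDiv (RMul (RV 34) (RV 0)) (RNat (32 * d))))
     (Seq (RSet 36 (RSub (RNat 1) (RDiv (RV 0) (RNat 4)))) ?R2)))"
  let ?R0 = "Seq (NSet 19 (NConst 0)) (Seq (NSet 9 (NConst 1)) (Seq (RSet 35 (RNat 0))
     (Seq (RSet 36 (RDiv (RNat 1) (RNat 2))) (Seq pass ?R1))))"
  have start: "wp (Seq start ?R0) s (\<lambda>t. ?G (tp + t))"
    if tp: "tp \<le> 9 * ?k * ?k + 3 * (1 + d * (?n + ?k)) + 11" and s: "inp P S \<epsilon> s" for tp s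
    unfolding wp_Seq[of start]
  proof (rule wp_start[OF PS(1,2) s])
    fix t0 s0
    assume t0: "t0 \<le> (?\<tau> + 2 * d + 10) * ?k + 3" and s0: "inp P S \<epsilon> s0" "feas P S (vec 33 0 s0) (real_at s0 34)"
      and low: "\<And>j r. j < ?k \<Longrightarrow> feas P S (anchor P S j) r \<Longrightarrow> real_at s0 34 \<le> \<Lambda> ?n * r"
    define r0 where "r0 = real_at s0 34"
    have r0: "0 \<le> r0" "opt P S \<le> r0" using feas_nonneg opt_le PS s0(2) by (auto simp: r0_def)
    have r0': "r0 \<le> 2 * \<Lambda> ?n * opt P S" unfolding r0_def by (rule opt_bound_start[OF PS(1,2) low])
    \<comment> \<open>This is where the multiplicative guarantee of the evaluation secures
      termination: a positive initial radius forces a positive optimum.\<close>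
    have r0pos: "0 < opt P S" if "0 < r0"
      using that r0' opt_nonneg[OF PS(1,2)] by (cases "opt P S = 0") auto
    let ?s1 = "rupd (adr 36 0) (1/2) (rupd (adr 35 0) 0 (nupd (adr 9 0) 1 (nupd (adr 19 0) 0 s0)))"
    have sm1: "same {9,19,35,36} s0 ?s1" by (auto simp: same_def)
    have "inp P S \<epsilon> ?s1" by (rule inp_same[OF s0(1) sm1]) simp
    then have inv1: "pinv P S \<epsilon> r0 (1/2) 0 1 0 0 ?s1" using s0(2) by (simp add: pinv_def r0_def)
    have half: "0 < (1/2::real)" "1/2 < (1::real)" by simp_all
    have "wp pass ?s1 (\<lambda>t1 s2. wp ?R1 s2 (\<lambda>t2. ?G (tp + (t0 + (1 + (1 + (1 + (1 + (t1 + t2)))))))))"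
    proof (rule wp_mono[OF wp_pass[OF PS(1,2) half r0(1) r0pos inv1 zero_less_one]])
      fix t1 s2 assume "\<exists>a. pinv P S \<epsilon> r0 (1/2) 0 1 0 a s2 \<and>
        (\<forall>j<?k. \<forall>g. (\<forall>e<d. g e < 1) \<longrightarrow> blocked P S r0 (1/2) a (grid P S 0 0 j g)) \<and>
        t1 \<le> (?\<tau> + 5 * d + 14) * (?k * 1 ^ d + a)"
      then obtain a1 where p1: "pinv P S \<epsilon> r0 (1/2) 0 1 0 a1 s2"
        and b1: "\<forall>j<?k. \<forall>g. (\<forall>e<d. g e < 1) \<longrightarrow> blocked P S r0 (1/2) a1 (grid P S 0 0 j g)"
        and t1: "t1 \<le> (?\<tau> + 5 * d + 14) * (?k * 1 ^ d + a1)" by blast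
      define r1 where "r1 = (1/2) ^ a1 * r0"
      have s2: "inp P S \<epsilon> s2" "feas P S (vec 33 0 s2) r1" "real_at s2 34 = r1" "r0 = 0 \<longrightarrow> a1 = 0"
        using p1 by (auto simp: pinv_def r1_def)
      have r1: "0 \<le> r1" "opt P S \<le> r1" using feas_nonneg opt_le PS s2(2) by auto
      have r1': "r1 \<le> 4 * opt P S"
      proof (rule opt_bound_anchor[OF PS(1,2)])
        fix j assume j: "j < ?k"
        have "grid P S 0 0 j (\<lambda>_. 0) = anchor P S j" by (simp add: grid_def vec_eq_iff)
        then have "blocked P S r0 (1/2) a1 (anchor P S j)"
          using b1[rule_format, OF j, of "\<lambda>_. 0"] by simp
        then show "r1 = 0 \<or> \<not> feas P S (anchor P S j) (r1 / 2)" by (simp add: blocked_def r1_def)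
      qed
      have r1pos: "0 < opt P S" if "0 < r1" using that r1' by simp
      have A1: "real a1 \<le> log 2 (2 * \<Lambda> ?n)"
        by (rule count_halvings[OF r0']) (use r1 r0 s2 opt_nonneg[OF PS(1,2)] in \<open>auto simp: r1_def\<close>)
      have e2: "real_at s2 0 = \<epsilon>" using inpD(3)[OF s2(1)] .
      show "wp ?R1 s2 (\<lambda>t2. ?G (tp + (t0 + (1 + (1 + (1 + (1 + (t1 + t2))))))))"
        unfolding wp_Seq[of grow]
      proof (rule wp_grow[OF e2 \<epsilon>(1)])
        fix M assume M: "32 * real d \<le> real M * \<epsilon>" "real M * \<epsilon> \<le> 32 * real d + \<epsilon>"
        define h where "h = r1 * \<epsilon> / (32 * real d)"
        let ?s3 = "rupd (adr 36 0) (1 - \<epsilon> / 4) (rupd (adr 35 0) h (nupd (adr 9 0) (2 * M + 1) (nupd (adr 19 0) M s2)))"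
        have sm3: "same {9,19,35,36} s2 ?s3" by (auto simp: same_def)
        have "inp P S \<epsilon> ?s3" by (rule inp_same[OF s2(1) sm3]) simp
        then have inv3: "pinv P S \<epsilon> r1 (1 - \<epsilon> / 4) h (2 * M + 1) M 0 ?s3" using s2 by (simp add: pinv_def)
        have f: "0 < 1 - \<epsilon> / 4" "1 - \<epsilon> / 4 < 1" using \<epsilon> by auto
        have W: "0 < 2 * M + 1" by simp
        have e3: "real_at (nupd (adr 19 0) M s2) 0 = \<epsilon>" "real_at (nupd (adr 19 0) M s2) 34 = r1"
          "nat_at (nupd (adr 19 0) M s2) 19 = M" using e2 s2(3) by simp_all
        let ?t = "\<lambda>t3 t4. tp + (t0 + (1 + (1 + (1 + (1 + (t1 + (2 * M + 2 + (1 + (1 + (1 + (t3 + t4)))))))))))"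
        have "wp pass ?s3 (\<lambda>t3 s4. wp ?O s4 (\<lambda>t4. ?G (?t t3 t4)))"
        proof (rule wp_mono[OF wp_pass[OF PS(1,2) f r1(1) r1pos inv3 W]])
          fix t3 s4 assume "\<exists>a. pinv P S \<epsilon> r1 (1 - \<epsilon> / 4) h (2 * M + 1) M a s4 \<and>
            (\<forall>j<?k. \<forall>g. (\<forall>e<d. g e < 2 * M + 1) \<longrightarrow> blocked P S r1 (1 - \<epsilon> / 4) a (grid P S h M j g)) \<and>
            t3 \<le> (?\<tau> + 5 * d + 14) * (?k * (2 * M + 1) ^ d + a)"
          then obtain a2 where p2: "pinv P S \<epsilon> r1 (1 - \<epsilon> / 4) h (2 * M + 1) M a2 s4"
            and b2: "\<forall>j<?k. \<forall>g. (\<forall>e<d. g e < 2 * M + 1) \<longrightarrow> blocked P S r1 (1 - \<epsilon> / 4) a2 (grid P S h M j g)"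
            and t3: "t3 \<le> (?\<tau> + 5 * d + 14) * (?k * (2 * M + 1) ^ d + a2)" by blast
          define r2 where "r2 = (1 - \<epsilon> / 4) ^ a2 * r1"
          have s4: "inp P S \<epsilon> s4" "feas P S (vec 33 0 s4) r2" "real_at s4 34 = r2" "r1 = 0 \<longrightarrow> a2 = 0"
            using p2 by (auto simp: pinv_def r2_def)
          have r2: "0 \<le> r2" "opt P S \<le> r2" using feas_nonneg opt_le PS s4(2) by auto
          have A2: "real a2 * \<epsilon> \<le> 8"
            by (rule count_improvements[OF \<epsilon> r1']) (use r2 r1 s4 in \<open>auto simp: r2_def\<close>)
          have "(1 - \<epsilon> / 4) ^ a2 * r1 \<le> 1 * r1" using f r1 by (intro mult_right_mono power_le_one) auto
          then have "r2 \<le> r1" by (simp add: r2_def)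
          then have opt2: "r2 \<le> (1 + \<epsilon>) * opt P S"
            using b2 by (intro opt_bound_grid[OF PS(1,2) \<epsilon> r1' r1(2) _ r2(1) M(1) h_def]) (auto simp: blocked_def r2_def)
          show "wp ?O s4 (\<lambda>t4. ?G (?t t3 t4))"
          proof (rule wp_output[OF PS s4(1)])
            show "feas P S (vec 33 0 s4) (real_at s4 34)" using s4 by simp
            fix t4 s' Z assume t4: "t4 \<le> (6 * d + 20) * ?\<tau> + ?\<tau> + d + 2" and o: "outputs es s' (vec 33 0 s4) Z"
              and Z: "adm (set S) Z" "\<delta> (translate (vec 33 0 s4) P) Z \<le> real_at s4 34"
            have "approx_solution \<delta> adm \<epsilon> P (set S) (vec 33 0 s4) Z"
              unfolding approx_solution_def using Z opt2 s4(3) by simp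
            moreover have "?t t3 t4 \<le> (9 * ?k * ?k + 3 * (1 + d * (?n + ?k)) + 11) + ((?\<tau> + 2 * d + 10) * ?k + 3) +
             (?\<tau> + 5 * d + 14) * (?k + a1) + (2 * M + 9) + (?\<tau> + 5 * d + 14) * (?k * (2 * M + 1) ^ d + a2) +
             ((6 * d + 20) * ?\<tau> + ?\<tau> + d + 2)" (is "_ \<le> ?a + ?b + ?c + _ + ?d + ?e")
            proof -
              have "tp \<le> ?a" "t0 \<le> ?b" "t1 \<le> ?c" "t3 \<le> ?d" "t4 \<le> ?e" using tp t0 t1 t3 t4 by simp_all
              then show ?thesis by linarith
            qed
            ultimately show "?G (?t t3 t4) s'" using o A1 A2 M(2) by blast
          qed
        qed
        then show "wp (Seq (NSet 9 (NAdd (NAdd (NV 19) (NV 19)) (NConst 1)))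
           (Seq (RSet 35 (RDiv (RMul (RV 34) (RV 0)) (RNat (32 * d))))
           (Seq (RSet 36 (RSub (RNat 1) (RDiv (RV 0) (RNat 4)))) ?R2))) (nupd (adr 19 0) M s2)
          (\<lambda>t2. ?G (tp + (t0 + (1 + (1 + (1 + (1 + (t1 + (2 * M + 2 + t2)))))))))"
          unfolding wp_init_fine[OF e3] wp_Seq[of pass] h_def .
      qed
    qed auto
    then show "wp ?R0 s0 (\<lambda>t. ?G (tp + (t0 + t)))"
      unfolding wp_init_coarse wp_Seq[of pass] .
  qed
  show ?thesis unfolding main_def wp_Seq[of prelude] by (rule wp_prelude) (rule start)
qed

end

section \<open>The discrete Frechet distance\<close>

definition matched :: "real \<Rightarrow> 'a::metric_space list \<Rightarrow> 'a list \<Rightarrow> bool" where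
  "matched r P Q \<longleftrightarrow> (\<exists>w. paired_walk (length P) (length Q) w \<and> (\<forall>(a, b)\<in>set w. dist (P ! a) (Q ! b) \<le> r))"

lemma paired_walk_range:
  assumes "paired_walk n m w" "(a, b) \<in> set w"
  shows "a \<le> n - 1" "b \<le> m - 1"
proof -
  obtain i where i: "i < length w" "w ! i = (a, b)" using assms(2) by (metis in_set_conv_nth)
  have l: "w ! (length w - 1) = (n - 1, m - 1)" using assms(1) i by (auto simp: paired_walk_def last_conv_nth)
  show "a \<le> n - 1" "b \<le> m - 1" using paired_walk_mono[OF assms(1), of i "length w - 1"] i l by auto
qed

text \<open>Walks are lengthened at their end, when one of the curves, or both, receives another
  vertex. All walks below are built in this way.\<close>

lemma paired_walk_snoc:
  assumes "paired_walk n m w" "(n', m') \<in> {(n + 1, m), (n, m + 1), (n + 1, m + 1)}" "0 < n" "0 < m"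
  shows "paired_walk n' m' (w @ [(n' - 1, m' - 1)])"
proof -
  have w: "w \<noteq> []" "length w \<ge> max n m" "hd w = (0, 0)" "w ! (length w - 1) = (n - 1, m - 1)"
    using assms(1) by (auto simp: paired_walk_def last_conv_nth)
  let ?W = "w @ [(n' - 1, m' - 1)]"
  have st: "let (a, b) = ?W ! i in ?W ! Suc i \<in> {(a + 1, b), (a, b + 1), (a + 1, b + 1)}"
    if i: "Suc i < length ?W" for i
  proof (cases "?W ! i")
    case (Pair a b)
    have "?W ! Suc i \<in> {(a + 1, b), (a, b + 1), (a + 1, b + 1)}"
    proof (cases "Suc i < length w")
      case True
      then show ?thesis using paired_walk_step[OF assms(1) True] Pair by (simp add: nth_append)
    next
      case False
      then have e: "i = length w - 1" "Suc i = length w" using i by auto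
      then have "(a, b) = (n - 1, m - 1)" using Pair w by (simp add: nth_append)
      moreover have "?W ! Suc i = (n' - 1, m' - 1)" using e by simp
      ultimately show ?thesis using assms(2-4) by auto
    qed
    then show ?thesis by (simp only: Let_def prod.case Pair)
  qed
  have "max n' m' \<le> length ?W" using w(2) assms(2) by auto
  then show ?thesis unfolding paired_walk_def using st w by simp
qed

lemma matched_single: "dist p q \<le> r \<Longrightarrow> matched r [p] [q]"
  unfolding matched_def by (rule exI[of _ "[(0,0)]"]) (auto simp: paired_walk_def)

lemma matched_snoc:
  assumes "matched r P Q" "P \<noteq> []" "Q \<noteq> []"
  shows "dist (last P) q \<le> r \<Longrightarrow> matched r P (Q @ [q])"
    and "dist p q \<le> r \<Longrightarrow> matched r (P @ [p]) (Q @ [q])"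
proof -
  obtain w where w: "paired_walk (length P) (length Q) w" "\<forall>(a, b)\<in>set w. dist (P ! a) (Q ! b) \<le> r"
    using assms(1) unfolding matched_def by blast
  have app: "(P @ xs) ! a = P ! a" "(Q @ ys) ! b = Q ! b" if "(a, b) \<in> set w" for a b xs ys
  proof -
    have "0 < length P" "0 < length Q" using assms by auto
    then have "a < length P" "b < length Q" using paired_walk_range[OF w(1) that] by linarith+
    then show "(P @ xs) ! a = P ! a" "(Q @ ys) ! b = Q ! b" by (simp_all add: nth_append)
  qed
  have l: "P ! (length P - 1) = last P" "Q ! (length Q - 1) = last Q" using assms by (auto simp: last_conv_nth)
  have old: "\<forall>(a, b)\<in>set w. dist ((P @ xs) ! a) ((Q @ ys) ! b) \<le> r" for xs ys
  proof
    fix x assume x: "x \<in> set w"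
    obtain a b where "x = (a, b)" by (cases x)
    then show "case x of (a, b) \<Rightarrow> dist ((P @ xs) ! a) ((Q @ ys) ! b) \<le> r"
      using w(2) x app[of a b] by auto
  qed
  show "matched r P (Q @ [q])" if "dist (last P) q \<le> r"
    unfolding matched_def
    by (intro exI[of _ "w @ [(length P - 1, length (Q @ [q]) - 1)]"] conjI paired_walk_snoc[OF w(1)])
      (use assms old[of "[]" "[q]"] that l in simp_all)
  show "matched r (P @ [p]) (Q @ [q])" if "dist p q \<le> r"
    unfolding matched_def
    by (intro exI[of _ "w @ [(length (P @ [p]) - 1, length (Q @ [q]) - 1)]"] conjI paired_walk_snoc[OF w(1)])
      (use assms old[of "[p]" "[q]"] that in simp_all)
qed

lemma matched_append:
  assumes "matched r P Q" "P \<noteq> []" "Q \<noteq> []" "\<forall>q\<in>set B. dist (last P) q \<le> r"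
  shows "matched r P (Q @ B)"
  using assms(4)
proof (induction B rule: rev_induct)
  case (snoc q B)
  then show ?case using matched_snoc(1)[of r P "Q @ B" q] assms by simp
qed (use assms in simp)

text \<open>Each vertex of \<open>P\<close> is matched to its whole block: a diagonal step enters
  the block together with the vertex, and the rest of the block passes while \<open>P\<close> stands
  still.\<close>

lemma matched_concat:
  assumes "P \<noteq> []" "\<And>i. i < length P \<Longrightarrow> blk i \<noteq> [] \<and> (\<forall>q\<in>set (blk i). dist (P ! i) q \<le> r)"
  shows "matched r P (concat (map blk [0..<length P]))"
  using assms
proof (induction P rule: rev_induct)
  case (snoc p P)
  have p: "blk (length P) \<noteq> []" "\<forall>q\<in>set (blk (length P)). dist p q \<le> r"
    using snoc.prems(2)[of "length P"] by auto
  obtain q B where B: "blk (length P) = q # B" using p by (cases "blk (length P)") auto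
  show ?case
  proof (cases "P = []")
    case True
    then show ?thesis using matched_append[OF matched_single[of p q r], of B] p B by simp
  next
    case False
    let ?Q = "concat (map blk [0..<length P])"
    have "blk i \<noteq> [] \<and> (\<forall>q\<in>set (blk i). dist (P ! i) q \<le> r)" if "i < length P" for i
      using snoc.prems(2)[of i] that by (simp add: nth_append)
    then have m: "matched r P ?Q" using snoc.IH False by blast
    have "?Q \<noteq> []" using snoc.prems(2)[of 0] False by (auto simp: upt_conv_Cons nth_append)
    then have "matched r (P @ [p]) ((?Q @ [q]) @ B)"
      using p B by (intro matched_append matched_snoc(2)[OF m False]) auto
    then show ?thesis using B by simp
  qed
qed simp

text \<open>Shows that walks exist at all, without which the minimum defining the distance would be
  unspecified.\<close>

lemma matched_ex: "P \<noteq> [] \<Longrightarrow> Q \<noteq> [] \<Longrightarrow> \<exists>r. matched r P Q"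
proof -
  assume PQ: "P \<noteq> []" "Q \<noteq> []"
  have "\<exists>w. paired_walk (Suc n) (Suc m) w" for n m
  proof (induction n)
    case 0
    show ?case
    proof (induction m)
      case 0
      show ?case by (intro exI[of _ "[(0,0)]"]) (simp add: paired_walk_def)
    next
      case (Suc m)
      then show ?case using paired_walk_snoc[of "Suc 0" "Suc m" _ "Suc 0" "Suc (Suc m)"] by auto
    qed
  next
    case (Suc n)
    then show ?case using paired_walk_snoc[of "Suc n" "Suc m" _ "Suc (Suc n)" "Suc m"] by auto
  qed
  from this[of "length P - 1" "length Q - 1"] obtain w where w: "paired_walk (length P) (length Q) w"
    using PQ by auto
  let ?A = "(\<lambda>(a, b). dist (P ! a) (Q ! b)) ` set w"
  have "dist (P ! a) (Q ! b) \<le> Max ?A" if "(a, b) \<in> set w" for a b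
    using that by (intro Max_ge) (auto intro: rev_image_eqI)
  then show ?thesis unfolding matched_def using w by blast
qed

lemma discrete_frechet_dist_le_iff:
  assumes "P \<noteq> []" "Q \<noteq> []"
  shows "discrete_frechet_dist P Q \<le> r \<longleftrightarrow> matched r P Q"
proof -
  let ?W = "{w. paired_walk (length P) (length Q) w}"
  let ?f = "\<lambda>w. Max ((\<lambda>(a, b). dist (P ! a) (Q ! b)) ` set w)"
  have ne: "?W \<noteq> {}" using matched_ex[OF assms] by (auto simp: matched_def)
  have f: "?f w \<le> r \<longleftrightarrow> (\<forall>(a, b)\<in>set w. dist (P ! a) (Q ! b) \<le> r)" if "w \<in> ?W" for w
    using that by (subst Max_le_iff) (auto simp: paired_walk_def)
  have "discrete_frechet_dist P Q \<le> r \<longleftrightarrow> (\<exists>w\<in>?W. ?f w \<le> r)"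
    unfolding discrete_frechet_dist_def using ne finite_paired_walks by (subst Min_le_iff) auto
  then show ?thesis unfolding matched_def using f by blast
qed

lemma discrete_frechet_dist_nonneg:
  assumes "P \<noteq> []" "Q \<noteq> []"
  shows "0 \<le> discrete_frechet_dist P Q"
proof -
  obtain w where w: "paired_walk (length P) (length Q) w"
      "\<forall>(a, b)\<in>set w. dist (P ! a) (Q ! b) \<le> discrete_frechet_dist P Q"
    using discrete_frechet_dist_le_iff[OF assms, of "discrete_frechet_dist P Q"] by (auto simp: matched_def)
  have "(0, 0) \<in> set w" using w(1) by (metis hd_in_set paired_walk_def)
  then have "dist (P ! 0) (Q ! 0) \<le> discrete_frechet_dist P Q" using w(2) by auto
  then show ?thesis using zero_le_dist order_trans by blast
qed

text \<open>An index grows by at most one per step, so none is skipped. The induction shows that all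
  indices up to the current ones have occurred.\<close>

lemma paired_walk_covers:
  assumes "paired_walk n m w" "0 < n" "0 < m"
  shows "i < n \<Longrightarrow> \<exists>b<m. (i, b) \<in> set w" and "j < m \<Longrightarrow> \<exists>a<n. (a, j) \<in> set w"
proof -
  have z: "w ! 0 = (0, 0)" "w \<noteq> []" and l: "w ! (length w - 1) = (n - 1, m - 1)"
    using assms by (auto simp: paired_walk_def last_conv_nth hd_conv_nth)
  have c: "(\<forall>i\<le>fst (w ! x). \<exists>b. (i, b) \<in> set w) \<and> (\<forall>j\<le>snd (w ! x). \<exists>a. (a, j) \<in> set w)"
    if "x < length w" for x
    using that
  proof (induction x)
    case 0
    then have "(0, 0) \<in> set w" using z by (metis nth_mem)
    then show ?case using z by auto
  next
    case (Suc x)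
    obtain a b where ab: "w ! x = (a, b)" by (cases "w ! x")
    obtain a' b' where ab': "w ! Suc x = (a', b')" by (cases "w ! Suc x")
    have "(a', b') \<in> {(a + 1, b), (a, b + 1), (a + 1, b + 1)}"
      using paired_walk_step[OF assms(1) Suc.prems ab] ab' by simp
    moreover have "(a', b') \<in> set w" using Suc.prems ab' by (metis nth_mem)
    ultimately show ?case using Suc ab ab' by (auto simp: le_Suc_eq)
  qed
  have "length w - 1 < length w" using z by simp
  from c[OF this] l have c': "\<forall>i\<le>n - 1. \<exists>b. (i, b) \<in> set w" "\<forall>j\<le>m - 1. \<exists>a. (a, j) \<in> set w" by auto
  show "\<exists>b<m. (i, b) \<in> set w" if i: "i < n"
  proof -
    have "i \<le> n - 1" using i by simp
    then obtain b where b: "(i, b) \<in> set w" using c'(1) by blast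
    then show ?thesis using paired_walk_range(2)[OF assms(1) b] assms(3) by (intro exI[of _ b]) auto
  qed
  show "\<exists>a<n. (a, j) \<in> set w" if j: "j < m"
  proof -
    have "j \<le> m - 1" using j by simp
    then obtain a where a: "(a, j) \<in> set w" using c'(2) by blast
    then show ?thesis using paired_walk_range(1)[OF assms(1) a] assms(2) by (intro exI[of _ a]) auto
  qed
qed

section \<open>Hausdorff conditions for the discrete versions\<close>

definition hausdorff_feas :: "bool \<Rightarrow> 'a::real_normed_vector list \<Rightarrow> 'a list \<Rightarrow> 'a \<Rightarrow> real \<Rightarrow> bool" where
  "hausdorff_feas b P S t r \<longleftrightarrow> (\<forall>i<length P. \<exists>j<length S. dist (P ! i + t) (S ! j) \<le> r) \<and>
     (b \<longrightarrow> (\<forall>j<length S. \<exists>i<length P. dist (P ! i + t) (S ! j) \<le> r))"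

definition discrete_adm :: "bool \<Rightarrow> 'a set \<Rightarrow> 'a list \<Rightarrow> bool" where
  "discrete_adm b = (if b then all_points_admissible else subset_admissible)"

lemma hausdorff_feas_translate:
  assumes "hausdorff_feas b P S t r"
  shows "hausdorff_feas b P S t' (r + dist t t')"
proof -
  have "dist (p + t') q \<le> r + dist t t'" if "dist (p + t) q \<le> r" for p q :: 'a
    using dist_translate_le[OF that, of "t' - t"] by (simp add: dist_norm norm_minus_commute)
  then show ?thesis using assms unfolding hausdorff_feas_def by meson
qed

text \<open>Every vertex of either curve occurs in a walk, so each finds a partner within r. The
  order of the walk can be forgotten: sites may be repeated and inserted at will, so the condition
  is sufficient too.\<close>

lemma hausdorff_feas_complete:
  assumes "P \<noteq> []" "discrete_adm b (set S) Q" "discrete_frechet_dist (translate t P) Q \<le> r"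
  shows "hausdorff_feas b P S t r"
proof -
  have Q: "Q \<noteq> []" "set Q \<subseteq> set S" "b \<Longrightarrow> set S \<subseteq> set Q"
    using assms(2) by (auto simp: discrete_adm_def all_points_admissible_def subset_admissible_def split: if_splits)
  have P': "translate t P \<noteq> []" "length (translate t P) = length P" using assms(1) by (auto simp: translate_def)
  have "matched r (translate t P) Q" using assms(3) discrete_frechet_dist_le_iff[OF P'(1) Q(1)] by simp
  then obtain w where "paired_walk (length P) (length Q) w"
      "\<forall>(i, c)\<in>set w. dist (translate t P ! i) (Q ! c) \<le> r"
    unfolding matched_def P'(2) by blast
  then have w: "paired_walk (length P) (length Q) w"
      "\<And>i c. (i, c) \<in> set w \<Longrightarrow> dist (translate t P ! i) (Q ! c) \<le> r" by auto
  have n: "0 < length P" "0 < length Q" using assms(1) Q by auto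
  show ?thesis unfolding hausdorff_feas_def
  proof (intro conjI allI impI)
    fix i assume i: "i < length P"
    obtain c where c: "c < length Q" "(i, c) \<in> set w" using paired_walk_covers(1)[OF w(1) n i] by blast
    then obtain j where "j < length S" "S ! j = Q ! c" using Q(2) by (metis in_set_conv_nth nth_mem subsetD)
    then show "\<exists>j<length S. dist (P ! i + t) (S ! j) \<le> r"
      using w(2)[OF c(2)] i by (auto simp: translate_def)
  next
    fix j assume "b" "j < length S"
    then have "S ! j \<in> set Q" using Q(3) by auto
    then obtain c where c: "c < length Q" "Q ! c = S ! j" by (metis in_set_conv_nth)
    obtain i where i: "i < length P" "(i, c) \<in> set w" using paired_walk_covers(2)[OF w(1) n c(1)] by blast
    then show "\<exists>i<length P. dist (P ! i + t) (S ! j) \<le> r" using w(2)[OF i(2)] c by (auto simp: translate_def)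
  qed
qed

text \<open>\<open>J i\<close> is a site near vertex \<open>i\<close> and keeps the block nonempty.
  In the all-points version a site \<open>j\<close> is visited additionally at the one vertex
  \<open>I j\<close> chosen for it.\<close>

definition curve_block :: "bool \<Rightarrow> (nat \<Rightarrow> nat) \<Rightarrow> (nat \<Rightarrow> nat) \<Rightarrow> nat \<Rightarrow> nat \<Rightarrow> nat list" where
  "curve_block b J I k i = J i # (if b then filter (\<lambda>j. I j = i) [0..<k] else [])"

lemma curve_block_sound:
  assumes "P \<noteq> []" "S \<noteq> []" and J: "\<And>i. i < length P \<Longrightarrow> J i < length S \<and> dist (P ! i + t) (S ! J i) \<le> r"
    and I: "\<And>j. b \<Longrightarrow> j < length S \<Longrightarrow> I j < length P \<and> dist (P ! I j + t) (S ! j) \<le> r"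
    and L: "L = concat (map (curve_block b J I (length S)) [0..<length P])"
  shows "set L \<subseteq> {..<length S}" "discrete_adm b (set S) (map ((!) S) L)"
    "discrete_frechet_dist (translate t P) (map ((!) S) L) \<le> r"
proof -
  let ?B = "curve_block b J I (length S)"
  show sub: "set L \<subseteq> {..<length S}" using J by (auto simp: L curve_block_def split: if_splits)
  have ne: "L \<noteq> []" using assms(1) by (simp add: L curve_block_def upt_conv_Cons)
  have cov: "set S \<subseteq> (!) S ` set L" if b
  proof
    fix x assume "x \<in> set S"
    then obtain j where j: "j < length S" "x = S ! j" by (metis in_set_conv_nth)
    then have "j \<in> set (?B (I j))" "I j < length P" using that I[OF that j(1)] by (auto simp: curve_block_def)
    then have "j \<in> set L" by (auto simp: L)
    then show "x \<in> (!) S ` set L" using j by blast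
  qed
  show "discrete_adm b (set S) (map ((!) S) L)"
    using sub ne cov by (auto simp: discrete_adm_def all_points_admissible_def subset_admissible_def)
  have e: "map ((!) S) L = concat (map (\<lambda>i. map ((!) S) (?B i)) [0..<length (translate t P)])"
    by (simp add: L map_concat translate_def comp_def)
  have "matched r (translate t P) (map ((!) S) L)" unfolding e
  proof (rule matched_concat)
    fix i assume i: "i < length (translate t P)"
    show "map ((!) S) (?B i) \<noteq> [] \<and> (\<forall>q\<in>set (map ((!) S) (?B i)). dist (translate t P ! i) q \<le> r)"
      using i J[of i] I by (auto simp: curve_block_def translate_def)
  qed (use assms(1) in \<open>simp add: translate_def\<close>)
  then show "discrete_frechet_dist (translate t P) (map ((!) S) L) \<le> r"
    using discrete_frechet_dist_le_iff[of "translate t P" "map ((!) S) L"] assms(1) ne by (simp add: translate_def)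
qed

section \<open>Programs for the discrete versions\<close>

context axes
begin

text \<open>A maximum of row minima, with the minimisers kept in array \<open>c\<close>. The inner
  counter is set to 0 by hand so that the first entry of the row can start the minimum. Cell 44 is
  not initialised, so that two calls with exchanged roles accumulate in it.\<close>

definition bottleneck :: "nat \<Rightarrow> nexp \<Rightarrow> nat \<Rightarrow> nexp \<Rightarrow> nat \<Rightarrow> rexp \<Rightarrow> com" where
  "bottleneck v b v' b' c D = For v b (Seq (NSet v' (NConst 0)) (Seq (NASet c (NV v) (NConst 0)) (Seq (RSet 41 D)
     (Seq (For v' b' (Cond (RLess D (RV 41)) (Seq (RSet 41 D) (NASet c (NV v) (NV v'))) Skip))
       (RSet 44 (RMax (RV 44) (RV 41)))))))"

lemma writes_bottleneck:
  "{v, v', c, 41, 44} \<subseteq> X \<Longrightarrow> X \<subseteq> {..<64} \<Longrightarrow> writes X (bottleneck v b v' b' c D)"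
  unfolding bottleneck_def by (intro writes_intros) auto

text \<open>The result is described as the least radius that is not below the old value and is met
  in every row. This is the form in which feasibility uses it.\<close>

lemma wp_bottleneck:
  fixes m l :: nat
  assumes v: "v < 64" "v' < 64" "c < 64" "v \<noteq> v'" "c \<notin> {v, v'}" "{v, v', c} \<inter> {41, 44} = {}"
    and b: "\<And>s'. same {v, v', c, 41, 44} s s' \<Longrightarrow> nval b s' = m \<and> nval b' s' = l" and l: "0 < l"
    and D: "\<And>s' i j. same {v, v', c, 41, 44} s s' \<Longrightarrow> nat_at s' v = i \<Longrightarrow> nat_at s' v' = j \<Longrightarrow> i < m \<Longrightarrow> j < l \<Longrightarrow>
        rval D s' = E i j"
    and Q: "\<And>t s'. t \<le> (5 * l + 9) * m + 2 \<Longrightarrow> same {v, v', c, 41, 44} s s' \<Longrightarrow>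
      (\<And>i. i < m \<Longrightarrow> fst s' (adr c i) < l \<and> E i (fst s' (adr c i)) \<le> real_at s' 44) \<Longrightarrow>
      real_at s 44 \<le> real_at s' 44 \<Longrightarrow>
      (\<And>r. real_at s 44 \<le> r \<Longrightarrow> \<forall>i<m. \<exists>j<l. E i j \<le> r \<Longrightarrow> real_at s' 44 \<le> r) \<Longrightarrow> Q t s'"
  shows "wp (bottleneck v b v' b' c D) s Q"
proof -
  let ?X = "{v, v', c, 41, 44}"
  let ?in = "Cond (RLess D (RV 41)) (Seq (RSet 41 D) (NASet c (NV v) (NV v'))) Skip"
  let ?I = "\<lambda>i s'. (\<forall>x<i. fst s' (adr c x) < l \<and> E x (fst s' (adr c x)) \<le> real_at s' 44) \<and>
      real_at s 44 \<le> real_at s' 44 \<and>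
      (\<forall>r. real_at s 44 \<le> r \<longrightarrow> (\<forall>x<i. \<exists>j<l. E x j \<le> r) \<longrightarrow> real_at s' 44 \<le> r)"
  have v64: "v < 64 + d" "v' < 64 + d" "c < 64 + d" using v by auto
  have sym: "v' \<noteq> v" "v \<noteq> c" "v' \<noteq> c" "41 \<noteq> v" "41 \<noteq> v'" "41 \<noteq> c" "44 \<noteq> v" "44 \<noteq> v'" "44 \<noteq> c"
    using v by auto
  note ne = v(4-6) sym
  show ?thesis unfolding bottleneck_def
  proof (rule wp_For_bounded[where m = m and X = "{v', c, 41, 44}" and I = ?I and T = "5 * l + 7"])
    show "writes {v', c, 41, 44} (Seq (NSet v' (NConst 0)) (Seq (NASet c (NV v) (NConst 0)) (Seq (RSet 41 D)
     (Seq (For v' b' ?in) (RSet 44 (RMax (RV 44) (RV 41)))))))"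
      using v by (intro writes_intros) auto
    show "v \<notin> {v', c, 41, 44}" using v by auto
    fix i s1
    assume i: "i < m" "nat_at s1 v = i" and sm: "same (insert v {v', c, 41, 44}) s s1" and I: "?I i s1"
    let ?s2 = "nupd (adr c i) 0 (nupd (adr v' 0) 0 s1)"
    have sm2: "same ?X s ?s2"
      by (rule same_trans[OF sm]) (use v64 in \<open>auto simp: same_def\<close>)
    have D2: "rval D ?s2 = E i 0" by (rule D[OF sm2]) (use i l v64 ne in auto)
    let ?s3 = "rupd (adr 41 0) (E i 0) ?s2"
    have sm3: "same ?X s ?s3" by (rule same_trans[OF sm2]) (simp add: same_rupd)
    let ?J = "\<lambda>j s'. fst s' (adr c i) < l \<and> E i (fst s' (adr c i)) = real_at s' 41 \<and>
        (\<forall>x<j. real_at s' 41 \<le> E i x) \<and> (\<forall>x. x \<noteq> i \<longrightarrow> fst s' (adr c x) = fst s1 (adr c x))"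
    have "wp (For v' b' ?in) ?s3 (\<lambda>t s'. wp (RSet 44 (RMax (RV 44) (RV 41))) s' (\<lambda>t'.
        (\<lambda>t' s'. t' \<le> 5 * l + 7 \<and> ?I (Suc i) (nupd (adr v 0) (Suc i) s')) (1 + (1 + (1 + (t + t'))))))"
    proof (rule wp_For_bounded[where m = l and X = "{c, 41}" and I = ?J and T = 3])
      show "writes {c, 41} ?in" using v by (intro writes_intros) auto
      show "v' \<notin> {c, 41}" "v' < 64 + d" using v by auto
      show "nval b' s' = l" if "same (insert v' {c, 41}) ?s3 s'" for s'
        using b[OF same_trans[OF sm3 same_mono[OF that]]] by auto
      show "?J 0 (nupd (adr v' 0) 0 ?s3)" using l v64 ne by auto
    next
      fix j s' assume j: "j < l" "nat_at s' v' = j" and sj: "same (insert v' {c, 41}) ?s3 s'" and J: "?J j s'"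
      have s': "same ?X s s'" by (rule same_trans[OF sm3 same_mono[OF sj]]) auto
      have vi: "nat_at s' v = i" using sameD(1)[OF sj v64(1)] i v64 ne by simp
      have De: "rval D s' = E i j" by (rule D[OF s' vi j(2) i(1) j(1)])
      have J1: "fst s' (adr c i) < l" "E i (fst s' (adr c i)) = real_at s' 41"
        and J2: "\<And>x. x < j \<Longrightarrow> real_at s' 41 \<le> E i x"
        and J3: "\<And>x. x \<noteq> i \<Longrightarrow> fst s' (adr c x) = fst s1 (adr c x)" using J by blast+
      show "wp ?in s' (\<lambda>t' s'. t' \<le> 3 \<and> ?J (Suc j) (nupd (adr v' 0) (Suc j) s'))"
      proof (cases "E i j < real_at s' 41")
        case True
        let ?s = "nupd (adr v' 0) (Suc j) (nupd (adr c i) j (rupd (adr 41 0) (E i j) s'))"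
        have "?J (Suc j) ?s"
        proof (intro conjI allI impI)
          fix x assume "x < Suc j"
          then have "E i j \<le> E i x" using True J2[of x] by (cases "x = j") simp_all
          then show "real_at ?s 41 \<le> E i x" by simp
        next
          fix x assume "x \<noteq> i"
          then show "fst ?s (adr c x) = fst s1 (adr c x)" using J3[of x] v64 ne by simp
        qed (use j(1) v64 ne in simp_all)
        then show ?thesis using True De vi j(2) v64 ne by simp
      next
        case False
        let ?s = "nupd (adr v' 0) (Suc j) s'"
        have "?J (Suc j) ?s"
        proof (intro conjI allI impI)
          fix x assume "x < Suc j"
          then have "real_at s' 41 \<le> E i x" using False J2[of x] by (cases "x = j") simp_all
          then show "real_at ?s 41 \<le> E i x" by simp
        next
          fix x assume "x \<noteq> i"
          then show "fst ?s (adr c x) = fst s1 (adr c x)" using J3[of x] v64 ne by simp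
        qed (use J1 v64 ne in simp_all)
        then show ?thesis using False De by simp
      qed
    next
      fix t s' assume sj: "same (insert v' {c, 41}) ?s3 s'" and J: "?J l s'" and t: "t \<le> (3 + 2) * l + 2"
      have o: "real_at s' 44 = real_at s1 44" using sameD(2)[OF sj, of 44 0] v64 ne by simp
      let ?J = "fst s' (adr c i)"
      have J1: "fst s' (adr c i) < l" "E i (fst s' (adr c i)) = real_at s' 41"
        and J2: "\<And>x. x < l \<Longrightarrow> real_at s' 41 \<le> E i x"
        and J3: "\<And>x. x \<noteq> i \<Longrightarrow> fst s' (adr c x) = fst s1 (adr c x)" using J by blast+
      have I1: "\<And>x. x < i \<Longrightarrow> fst s1 (adr c x) < l \<and> E x (fst s1 (adr c x)) \<le> real_at s1 44"
        using conjunct1[OF I] by simp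
      have I2: "real_at s 44 \<le> real_at s1 44" by (rule conjunct1[OF conjunct2[OF I]])
      have I3: "\<And>r. real_at s 44 \<le> r \<Longrightarrow> \<forall>x<i. \<exists>j<l. E x j \<le> r \<Longrightarrow> real_at s1 44 \<le> r"
        by (rule conjunct2[OF conjunct2[OF I], rule_format]) blast+
      let ?s = "nupd (adr v 0) (Suc i) (rupd (adr 44 0) (max (real_at s' 44) (real_at s' 41)) s')"
      have r44: "real_at ?s 44 = max (real_at s1 44) (real_at s' 41)" using o by simp
      have cx: "fst ?s (adr c x) = fst s' (adr c x)" for x using v64 ne by simp
      have "?I (Suc i) ?s"
        unfolding r44 cx
      proof (intro conjI allI impI)
        fix x assume x: "x < Suc i"
        have "fst s' (adr c x) < l \<and> E x (fst s' (adr c x)) \<le> max (real_at s1 44) (real_at s' 41)"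
        proof (cases "x = i")
          case False
          then have "x < i" using x by simp
          then show ?thesis using I1[of x] J3[OF False] by (simp add: le_max_iff_disj)
        qed (use J1 in simp)
        then show "fst s' (adr c x) < l" "E x (fst s' (adr c x)) \<le> max (real_at s1 44) (real_at s' 41)" by auto
      next
        fix r assume r: "real_at s 44 \<le> r" "\<forall>x<Suc i. \<exists>j<l. E x j \<le> r"
        obtain j where "j < l" "E i j \<le> r" using r(2) by blast
        then have "real_at s' 41 \<le> r" using J2[of j] by simp
        then show "max (real_at s1 44) (real_at s' 41) \<le> r" using I3[OF r(1)] r(2) by simp
      qed (use I2 in simp)
      then show "wp (RSet 44 (RMax (RV 44) (RV 41))) s' (\<lambda>t'.
        (\<lambda>t' s'. t' \<le> 5 * l + 7 \<and> ?I (Suc i) (nupd (adr v 0) (Suc i) s')) (1 + (1 + (1 + (t + t')))))"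
        using t by simp
    qed
    then show "wp (Seq (NSet v' (NConst 0)) (Seq (NASet c (NV v) (NConst 0)) (Seq (RSet 41 D)
     (Seq (For v' b' ?in) (RSet 44 (RMax (RV 44) (RV 41))))))) s1
       (\<lambda>t' s'. t' \<le> 5 * l + 7 \<and> ?I (Suc i) (nupd (adr v 0) (Suc i) s'))"
      unfolding wp_Seq wp_NStore wp_RStore using i D2 v64 ne by simp
  next
    fix t s' assume a: "same (insert v {v', c, 41, 44}) s s'" "?I m s'" "t \<le> (5 * l + 7 + 2) * m + 2"
    show "Q t s'"
    proof (rule Q)
      show "t \<le> (5 * l + 9) * m + 2" using a(3) by (simp add: add.commute)
      show "same ?X s s'" by (rule a(1))
      show "real_at s 44 \<le> real_at s' 44" by (rule conjunct1[OF conjunct2[OF a(2)]])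
      show "fst s' (adr c i) < l \<and> E i (fst s' (adr c i)) \<le> real_at s' 44" if "i < m" for i
        using conjunct1[OF a(2)] that by simp
      show "real_at s' 44 \<le> r" if "real_at s 44 \<le> r" "\<forall>i<m. \<exists>j<l. E i j \<le> r" for r
        using conjunct2[OF conjunct2[OF a(2)]] that by blast
    qed
  next
    fix s' assume "same (insert v {v', c, 41, 44}) s s'"
    then show "nval b s' = m" using b by blast
  qed (use v64 ne in auto)
qed

definition VMoved :: "nexp \<Rightarrow> vexp" where
  "VMoved a = VAdd (VPt a) (VVar 32 (NConst 0))"

definition VSite :: "nexp \<Rightarrow> vexp" where
  "VSite a = VPt (NAdd (NV 0) a)"

lemma vval_VMoved:
  assumes "inp P S \<epsilon> s" "nval a s < length P"
  shows "vval (VMoved a) s = P ! nval a s + vec 32 0 s"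
  using inpD(4)[OF assms] by (simp add: VMoved_def)

lemma vval_VSite:
  assumes "inp P S \<epsilon> s" "nval a s < length S"
  shows "vval (VSite a) s = S ! nval a s"
  using inpD(1,5)[OF assms(1)] assms(2) by (simp add: VSite_def)

definition heval :: "bool \<Rightarrow> com" where
  "heval b = Seq (RSet 44 (RNat 0))
     (Seq (bottleneck 6 (NV 0) 7 (NV 1) 16 (VDist (VMoved (NV 6)) (VSite (NV 7))))
     (if b then bottleneck 7 (NV 1) 6 (NV 0) 17 (VDist (VMoved (NV 6)) (VSite (NV 7))) else Skip))"

definition hdecide :: "bool \<Rightarrow> com" where
  "hdecide b = Seq (heval b) (Cond (RLe (RV 44) (RV 37)) (NSet 11 (NConst 1)) (NSet 11 (NConst 0)))"

definition append_site :: "nexp \<Rightarrow> com" where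
  "append_site a = Seq (NASet 13 (NV 14) a) (NSet 14 (NAdd (NV 14) (NConst 1)))"

definition hfin :: "bool \<Rightarrow> com" where
  "hfin b = Seq (heval b) (Seq (NSet 14 (NConst 0)) (For 6 (NV 0) (Seq (append_site (NA 16 (NV 6)))
     (if b then For 7 (NV 1) (Cond (NEq (NA 17 (NV 7)) (NV 6)) (append_site (NV 7)) Skip) else Skip))))"

lemma wp_append_site:
  assumes L: "nat_at s 14 = length L" "map (\<lambda>x. fst s (adr 13 x)) [0..<length L] = L" and y: "nval a s = y"
    and Q: "\<And>s'. same {13, 14} s s' \<Longrightarrow> nat_at s' 14 = length (L @ [y]) \<Longrightarrow>
      map (\<lambda>x. fst s' (adr 13 x)) [0..<length (L @ [y])] = L @ [y] \<Longrightarrow> Q 2 s'"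
  shows "wp (append_site a) s Q"
proof -
  let ?s = "nupd (adr 14 0) (Suc (length L)) (nupd (adr 13 (length L)) y s)"
  have "map (\<lambda>x. fst ?s (adr 13 x)) [0..<length L] = map (\<lambda>x. fst s (adr 13 x)) [0..<length L]"
    by (rule map_cong) auto
  then have "Q 2 ?s" using L(2) by (intro Q) (auto simp: same_def)
  then show ?thesis unfolding append_site_def using L(1) y by (simp add: numeral_2_eq_2)
qed

lemma writes_heval: "writes inner (heval b)"
  unfolding heval_def by (cases b) (auto intro!: writes_intros writes_bottleneck)

lemma writes_hdecide: "writes inner (hdecide b)"
  unfolding hdecide_def by (intro writes_intros writes_heval) auto

lemma writes_append_site: "{13, 14} \<subseteq> X \<Longrightarrow> writes X (append_site a)"
  unfolding append_site_def by (intro writes_intros) auto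

lemma writes_hfin: "writes inner (hfin b)"
  unfolding hfin_def by (cases b) (auto intro!: writes_intros writes_heval writes_append_site)

lemma wp_heval:
  assumes PS: "P \<noteq> []" "S \<noteq> []" and s: "inp P S \<epsilon> s"
    and Q: "\<And>t s'. t \<le> 30 * length P * length S + 6 \<Longrightarrow> same inner s s' \<Longrightarrow> 0 \<le> real_at s' 44 \<Longrightarrow>
      (\<And>i. i < length P \<Longrightarrow> fst s' (adr 16 i) < length S \<and>
        dist (P ! i + vec 32 0 s) (S ! fst s' (adr 16 i)) \<le> real_at s' 44) \<Longrightarrow>
      (\<And>j. b \<Longrightarrow> j < length S \<Longrightarrow> fst s' (adr 17 j) < length P \<and>
        dist (P ! fst s' (adr 17 j) + vec 32 0 s) (S ! j) \<le> real_at s' 44) \<Longrightarrow>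
      (\<And>r. hausdorff_feas b P S (vec 32 0 s) r \<Longrightarrow> real_at s' 44 \<le> r) \<Longrightarrow> Q t s'"
  shows "wp (heval b) s Q"
proof -
  let ?n = "length P" and ?k = "length S" and ?T = "vec 32 0 s"
  let ?D = "VDist (VMoved (NV 6)) (VSite (NV 7))"
  have nk: "0 < ?n" "0 < ?k" using PS by auto
  have frame: "nval (NV 0) s' = ?n \<and> nval (NV 1) s' = ?k \<and> inp P S \<epsilon> s' \<and> vec 32 0 s' = ?T" if "same inner s s'" for s'
    using inp_same[OF s that] vec_same[OF that, of 32] inpD(1,2) by (auto simp: inner_def)
  have D: "rval ?D s' = dist (P ! i + ?T) (S ! j)"
    if "same inner s s'" "nat_at s' 6 = i" "nat_at s' 7 = j" "i < ?n" "j < ?k" for s' i j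
    using frame[OF that(1)] that vval_VMoved[of P S \<epsilon> s' "NV 6"] vval_VSite[of P S \<epsilon> s' "NV 7"] by simp
  let ?s = "rupd (adr 44 0) 0 s"
  have sm0: "same inner s ?s" by (simp add: same_rupd)
  have to: "same inner s s'" if "same Y ?s s'" "Y \<subseteq> inner" for s' Y
    by (rule same_trans'[OF sm0 that(1)]) (use that in auto)
  \<comment> \<open>The maximum is started at 0. This does not spoil its minimality because a
    feasible radius bounds a distance.\<close>
  have feas_nonneg: "0 \<le> r" if f: "hausdorff_feas b P S ?T r" for r
  proof -
    obtain j where "dist (P ! 0 + ?T) (S ! j) \<le> r" using f nk(1) by (auto simp: hausdorff_feas_def)
    then show ?thesis by (meson order_trans zero_le_dist)
  qed
  have e1: "(5 * ?k + 9) * ?n + 2 \<le> 14 * (?n * ?k) + 2" "(5 * ?n + 9) * ?k + 2 \<le> 14 * (?n * ?k) + 2"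
    using nk by (cases ?n; cases ?k; simp add: algebra_simps)+
  have "wp (bottleneck 6 (NV 0) 7 (NV 1) 16 ?D) ?s (\<lambda>t1 s1.
      wp (if b then bottleneck 7 (NV 1) 6 (NV 0) 17 ?D else Skip) s1 (\<lambda>t2. Q (1 + (t1 + t2))))"
  proof (rule wp_bottleneck[where m = ?n and l = ?k and E = "\<lambda>i j. dist (P ! i + ?T) (S ! j)"])
    fix s' assume "same {6, 7, 16, 41, 44} ?s s'"
    from to[OF this] frame[of s'] show "nval (NV 0) s' = ?n \<and> nval (NV 1) s' = ?k" by auto
  next
    fix s' i j assume a: "same {6, 7, 16, 41, 44} ?s s'" "nat_at s' 6 = i" "nat_at s' 7 = j" "i < ?n" "j < ?k"
    have "same inner s s'" by (rule to[OF a(1)]) auto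
    from D[OF this a(2-5)] show "rval ?D s' = dist (P ! i + ?T) (S ! j)" .
  next
    fix t1 s1 assume t1: "t1 \<le> (5 * ?k + 9) * ?n + 2" and sm1: "same {6, 7, 16, 41, 44} ?s s1"
      and J: "\<And>i. i < ?n \<Longrightarrow> fst s1 (adr 16 i) < ?k \<and> dist (P ! i + ?T) (S ! fst s1 (adr 16 i)) \<le> real_at s1 44"
      and C: "real_at ?s 44 \<le> real_at s1 44"
      and low: "\<And>r. real_at ?s 44 \<le> r \<Longrightarrow> \<forall>i<?n. \<exists>j<?k. dist (P ! i + ?T) (S ! j) \<le> r \<Longrightarrow> real_at s1 44 \<le> r"
    have s1: "same inner s s1" by (rule to[OF sm1]) auto
    have low1: "real_at s1 44 \<le> r" if "hausdorff_feas b P S ?T r" for r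
      using low[of r] feas_nonneg[OF that] that by (simp add: hausdorff_feas_def)
    show "wp (if b then bottleneck 7 (NV 1) 6 (NV 0) 17 ?D else Skip) s1 (\<lambda>t2. Q (1 + (t1 + t2)))"
    proof (cases b)
      case True
      have to2: "same inner s s'" if "same {7, 6, 17, 41, 44} s1 s'" for s'
        by (rule same_trans[OF s1 same_mono[OF that]]) auto
      have "wp (bottleneck 7 (NV 1) 6 (NV 0) 17 ?D) s1 (\<lambda>t2. Q (1 + (t1 + t2)))"
      proof (rule wp_bottleneck[where m = ?k and l = ?n and E = "\<lambda>j i. dist (P ! i + ?T) (S ! j)"])
        fix s' assume "same {7, 6, 17, 41, 44} s1 s'"
        from frame[OF to2[OF this]] show "nval (NV 1) s' = ?k \<and> nval (NV 0) s' = ?n" by auto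
      next
        fix s' j i assume a: "same {7, 6, 17, 41, 44} s1 s'" "nat_at s' 7 = j" "nat_at s' 6 = i" "j < ?k" "i < ?n"
        from D[OF to2[OF a(1)] a(3,2,5,4)] show "rval ?D s' = dist (P ! i + ?T) (S ! j)" .
      next
        fix t2 s2 assume t2: "t2 \<le> (5 * ?n + 9) * ?k + 2" and sm2: "same {7, 6, 17, 41, 44} s1 s2"
          and I: "\<And>j. j < ?k \<Longrightarrow> fst s2 (adr 17 j) < ?n \<and> dist (P ! fst s2 (adr 17 j) + ?T) (S ! j) \<le> real_at s2 44"
          and C2: "real_at s1 44 \<le> real_at s2 44"
          and low2: "\<And>r. real_at s1 44 \<le> r \<Longrightarrow> \<forall>j<?k. \<exists>i<?n. dist (P ! i + ?T) (S ! j) \<le> r \<Longrightarrow> real_at s2 44 \<le> r"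
        have J2: "fst s2 (adr 16 i) = fst s1 (adr 16 i)" for i using sameD(1)[OF sm2, of 16] by simp
        show "Q (1 + (t1 + t2)) s2"
        proof (rule Q)
          show "1 + (t1 + t2) \<le> 30 * ?n * ?k + 6" using t1 t2 e1 by linarith
          show "real_at s2 44 \<le> r" if "hausdorff_feas b P S ?T r" for r
            using low2[of r] low1[OF that] that True by (simp add: hausdorff_feas_def)
        qed (use to2[OF sm2] I C C2 J J2 in \<open>auto intro: order_trans\<close>)
      qed (use nk in auto)
      then show ?thesis using True by simp
    next
      case False
      have "1 + (t1 + 1) \<le> 30 * ?n * ?k + 6" using t1 e1 by linarith
      then have "Q (1 + (t1 + 1)) s1"
        by (rule Q) (use s1 J C low1 False in auto)
      then show ?thesis using False by simp
    qed
  qed (use nk in auto)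
  then show ?thesis unfolding heval_def wp_Seq wp_RStore by simp
qed

lemma heval_feas:
  assumes "P \<noteq> []" "S \<noteq> []"
    and "\<And>i. i < length P \<Longrightarrow> J i < length S \<and> dist (P ! i + T) (S ! J i) \<le> C"
    and "\<And>j. b \<Longrightarrow> j < length S \<Longrightarrow> I j < length P \<and> dist (P ! I j + T) (S ! j) \<le> C"
  shows "hausdorff_feas b P S T C"
  using assms unfolding hausdorff_feas_def by blast

lemma wp_hfin:
  assumes PS: "P \<noteq> []" "S \<noteq> []" and s: "inp P S \<epsilon> s" and f: "hausdorff_feas b P S (vec 32 0 s) r"
    and Q: "\<And>t s' L. t \<le> 60 * length P * length S + 20 \<Longrightarrow>
      L = map (\<lambda>x. fst s' (adr 13 x)) [0..<nat_at s' 14] \<Longrightarrow> length L \<le> 2 * length P * length S \<Longrightarrow>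
      set L \<subseteq> {..<length S} \<Longrightarrow> discrete_adm b (set S) (map ((!) S) L) \<Longrightarrow>
      discrete_frechet_dist (translate (vec 32 0 s) P) (map ((!) S) L) \<le> r \<Longrightarrow> Q t s'"
  shows "wp (hfin b) s Q"
  unfolding hfin_def wp_Seq[of "heval b"]
proof (rule wp_heval[OF PS s, where b = b])
  let ?n = "length P" and ?k = "length S" and ?T = "vec 32 0 s"
  fix t1 s1 assume t1: "t1 \<le> 30 * ?n * ?k + 6" and sm1: "same inner s s1"
    and J: "\<And>i. i < ?n \<Longrightarrow> fst s1 (adr 16 i) < ?k \<and> dist (P ! i + ?T) (S ! fst s1 (adr 16 i)) \<le> real_at s1 44"
    and I: "\<And>j. b \<Longrightarrow> j < ?k \<Longrightarrow> fst s1 (adr 17 j) < ?n \<and> dist (P ! fst s1 (adr 17 j) + ?T) (S ! j) \<le> real_at s1 44"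
    and low: "\<And>r. hausdorff_feas b P S ?T r \<Longrightarrow> real_at s1 44 \<le> r"
  have nk: "1 \<le> ?n" "1 \<le> ?k" using PS by (auto simp: Suc_le_eq)
  define J' I' where "J' i = fst s1 (adr 16 i)" and "I' j = fst s1 (adr 17 j)" for i j
  let ?blk = "curve_block b J' I' ?k"
  let ?R = "\<lambda>L s'. nat_at s' 14 = length L \<and> map (\<lambda>x. fst s' (adr 13 x)) [0..<length L] = L"
  have app: "wp (append_site a) s' Q'"
    if "?R L s'" "nval a s' = y" "\<And>s''. same {13,14} s' s'' \<Longrightarrow> ?R (L @ [y]) s'' \<Longrightarrow> Q' 2 s''" for L s' a y Q'
    by (rule wp_append_site[OF conjunct1[OF that(1)] conjunct2[OF that(1)] that(2)]) (use that(3) in blast)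
  let ?in = "if b then For 7 (NV 1) (Cond (NEq (NA 17 (NV 7)) (NV 6)) (append_site (NV 7)) Skip) else Skip"
  let ?K = "\<lambda>i. concat (map ?blk [0..<i])"
  let ?s1 = "nupd (adr 14 0) 0 s1"
  have len: "length (?K i) \<le> (?k + 1) * i" for i
  proof (induction i)
    case (Suc i)
    have "length (?blk i) \<le> ?k + 1"
      using length_filter_le[of "\<lambda>j. I' j = i" "[0..<?k]"] by (simp add: curve_block_def)
    then show ?case using Suc by simp
  qed simp
  have "wp (For 6 (NV 0) (Seq (append_site (NA 16 (NV 6))) ?in)) ?s1 (\<lambda>t2. Q (t1 + (1 + t2)))"
  proof (rule wp_For_bounded[where m = ?n and X = "{7,13,14}" and I = "\<lambda>i s'. ?R (?K i) s'" and T = "5 * ?k + 4"])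
    show "writes {7,13,14} (Seq (append_site (NA 16 (NV 6))) ?in)"
      by (cases b) (auto intro!: writes_intros writes_append_site)
    show "nval (NV 0) s' = ?n" if "same (insert 6 {7,13,14}) ?s1 s'" for s'
      using sameD(1)[OF that, of 0] sameD(1)[OF sm1, of 0] inpD(1)[OF s] by simp
  next
    fix i s2 assume i: "i < ?n" "nat_at s2 6 = i" and sm2: "same (insert 6 {7,13,14}) ?s1 s2" and R: "?R (?K i) s2"
    have a16: "nval (NA 16 (NV 6)) s2 = J' i" using i sameD(1)[OF sm2, of 16] by (simp add: J'_def)
    show "wp (Seq (append_site (NA 16 (NV 6))) ?in) s2
       (\<lambda>t' s'. t' \<le> 5 * ?k + 4 \<and> ?R (?K (Suc i)) (nupd (adr 6 0) (Suc i) s'))"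
      unfolding wp_Seq
    proof (rule app[OF R a16])
      fix s3 assume sm3: "same {13,14} s2 s3" and R3: "?R (?K i @ [J' i]) s3"
      show "wp ?in s3 (\<lambda>t2 s'. 2 + t2 \<le> 5 * ?k + 4 \<and> ?R (?K (Suc i)) (nupd (adr 6 0) (Suc i) s'))"
      proof (cases b)
        case True
        let ?F = "\<lambda>j. ?K i @ [J' i] @ filter (\<lambda>j. I' j = i) [0..<j]"
        have "wp (For 7 (NV 1) (Cond (NEq (NA 17 (NV 7)) (NV 6)) (append_site (NV 7)) Skip)) s3
          (\<lambda>t2 s'. 2 + t2 \<le> 5 * ?k + 4 \<and> ?R (?K (Suc i)) (nupd (adr 6 0) (Suc i) s'))"
        proof (rule wp_For_bounded[where m = ?k and X = "{13,14}" and I = "\<lambda>j s'. ?R (?F j) s'" and T = 3])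
          show "nval (NV 1) s' = ?k" if "same (insert 7 {13,14}) s3 s'" for s'
            using sameD(1)[OF that, of 1] sameD(1)[OF sm3, of 1] sameD(1)[OF sm2, of 1] sameD(1)[OF sm1, of 1]
              inpD(2)[OF s] by simp
        next
          fix j s4 assume j: "j < ?k" "nat_at s4 7 = j" and sm4: "same (insert 7 {13,14}) s3 s4" and R4: "?R (?F j) s4"
          have v6: "nat_at s4 6 = i" using sameD(1)[OF sm4, of 6] sameD(1)[OF sm3, of 6] i by simp
          have v17: "fst s4 (adr 17 j) = I' j"
            using sameD(1)[OF sm4, of 17] sameD(1)[OF sm3, of 17] sameD(1)[OF sm2, of 17] by (simp add: I'_def)
          show "wp (Cond (NEq (NA 17 (NV 7)) (NV 6)) (append_site (NV 7)) Skip) s4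
            (\<lambda>t' s'. t' \<le> 3 \<and> ?R (?F (Suc j)) (nupd (adr 7 0) (Suc j) s'))"
          proof (cases "I' j = i")
            case True
            have "wp (append_site (NV 7)) s4 (\<lambda>t' s'. 1 + t' \<le> 3 \<and> ?R (?F (Suc j)) (nupd (adr 7 0) (Suc j) s'))"
              by (rule app[OF R4, of _ j]) (use j True in auto)
            then show ?thesis using True v6 v17 j by simp
          next
            case False
            then show ?thesis using R4 v6 v17 j by auto
          qed
        next
          fix t s' assume "?R (?F ?k) s'" "t \<le> (3 + 2) * ?k + 2"
          then show "2 + t \<le> 5 * ?k + 4 \<and> ?R (?K (Suc i)) (nupd (adr 6 0) (Suc i) s')"
            using True by (simp add: curve_block_def)
        qed (use R3 in \<open>auto intro!: writes_intros writes_append_site\<close>)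
        then show ?thesis using True by simp
      next
        case False
        then show ?thesis using R3 by (simp add: curve_block_def)
      qed
    qed
  next
    fix t2 s' assume R: "?R (?K ?n) s'" and t2: "t2 \<le> (5 * ?k + 4 + 2) * ?n + 2"
    let ?L = "?K ?n"
    \<comment> \<open>The curve is built for the least feasible radius, which cannot exceed the
      requested one.\<close>
    have C: "real_at s1 44 \<le> r" by (rule low[OF f])
    have snd: "set ?L \<subseteq> {..<?k}" "discrete_adm b (set S) (map ((!) S) ?L)"
      "discrete_frechet_dist (translate ?T P) (map ((!) S) ?L) \<le> r"
      by (rule curve_block_sound[OF PS, of J' ?T r b I'];
          use J I C in \<open>auto simp: J'_def I'_def intro: order_trans\<close>)+
    show "Q (t1 + (1 + t2)) s'"
    proof (rule Q[of _ ?L])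
      have "(5 * ?k + 4 + 2) * ?n + 2 \<le> 11 * (?n * ?k) + 2" "(?k + 1) * ?n \<le> 2 * (?n * ?k)"
        using nk by (cases ?k; simp add: algebra_simps)+
      then show "t1 + (1 + t2) \<le> 60 * ?n * ?k + 20" "length ?L \<le> 2 * ?n * ?k"
        using t1 t2 len[of ?n] by linarith+
    qed (use R snd in auto)
  qed auto
  then show "wp (Seq (NSet 14 (NConst 0)) (For 6 (NV 0) (Seq (append_site (NA 16 (NV 6))) ?in))) s1 (\<lambda>t2. Q (t1 + t2))"
    unfolding wp_Seq[of "NSet _ _"] wp_NStore by (simp only: nval_Ad nval.simps)
qed

end

section \<open>Running time\<close>

lemma running_time_bound:
  fixes \<tau> k n d M a1 a2 time :: nat and \<epsilon> L :: real
  assumes pos: "1 \<le> \<tau>" "1 \<le> k" "1 \<le> d" and \<epsilon>: "0 < \<epsilon>" "\<epsilon> \<le> 1"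
    and M: "real M * \<epsilon> \<le> 32 * real d + \<epsilon>" and a1: "real a1 \<le> L" and a2: "real a2 * \<epsilon> \<le> 8"
    and time: "time \<le> (9 * k * k + 3 * (1 + d * (n + k)) + 11) + ((\<tau> + 2 * d + 10) * k + 3) +
       (\<tau> + 5 * d + 14) * (k + a1) + (2 * M + 9) + (\<tau> + 5 * d + 14) * (k * (2 * M + 1) ^ d + a2) +
       ((6 * d + 20) * \<tau> + \<tau> + d + 2)"
  shows "real time \<le> (9 + 3 * real d + (78 * real d + 60) + (15 + 5 * real d) * (10 + (67 * real d) ^ d)) *
     (real k ^ 2 + real n + real \<tau> * (real k / \<epsilon> ^ d + L))"
proof -
  define c where "c = 5 * real d + 14"
  define E where "E = 1 / \<epsilon> ^ d"
  \<comment> \<open>All summands except those in \<open>k ^ 2\<close>, \<open>n\<close> and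
    \<open>L\<close> are compared with \<open>u\<close>. As \<epsilon> is at most 1 and
    \<open>d\<close> at least 1, \<open>E\<close> dominates both 1 and
    \<open>1 / \<epsilon>\<close>.\<close>
  define u where "u = real \<tau> * real k * E"
  have "\<epsilon> ^ d \<le> \<epsilon> ^ 1" using \<epsilon> pos by (intro power_decreasing) auto
  then have E: "1 \<le> E" "1 / \<epsilon> \<le> E" using \<epsilon> by (auto simp: E_def power_le_one frac_le)
  have t1: "1 \<le> real \<tau>" "1 \<le> real k" "1 \<le> real d" using pos by auto
  have c0: "0 \<le> c" by (simp add: c_def)
  have tk: "real \<tau> * 1 \<le> real \<tau> * real k" "1 * real k \<le> real \<tau> * real k"
    using t1 by (intro mult_left_mono mult_right_mono; simp)+
  have tkE: "real \<tau> * real k * 1 \<le> u" unfolding u_def using E t1 by (intro mult_left_mono) auto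
  have tE: "real \<tau> * E \<le> u" unfolding u_def using E t1 tk by (intro mult_right_mono) auto
  have u: "real \<tau> \<le> u" "real k \<le> u" "real \<tau> * real k \<le> u" "1 \<le> u" using tk tkE t1 by linarith+
  have Eu: "E \<le> u" using mult_right_mono[of 1 "real \<tau>" E] E t1 tE by linarith
  have tc: "real \<tau> + c \<le> (1 + c) * real \<tau>"
    using mult_left_mono[of 1 "real \<tau>" c] t1 c0 by (simp add: algebra_simps)
  \<comment> \<open>The excess of \<epsilon> over \<open>32 * d\<close> is at most 1, hence at most
    \<open>d\<close>. In the same way \<open>(2 * M + 1) * \<epsilon>\<close> is at most
    \<open>67 * d\<close>, which bounds the number of grid points by
    \<open>(67 * d) ^ d * E\<close>.\<close>
  have Me: "real M * \<epsilon> \<le> 33 * real d" using M \<epsilon> t1 by linarith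
  have "real M \<le> 33 * real d * (1 / \<epsilon>)" using Me \<epsilon> by (simp add: field_simps)
  also have "\<dots> \<le> 33 * real d * u" using E Eu by (intro mult_left_mono) auto
  finally have T4: "2 * real M \<le> 66 * (real d * u)" by (simp add: mult_ac)
  have "(2 * real M + 1) * \<epsilon> \<le> 67 * real d" using Me \<epsilon> t1 by (simp add: distrib_right)
  then have "2 * real M + 1 \<le> 67 * real d / \<epsilon>" using \<epsilon> by (simp add: field_simps)
  then have "(2 * real M + 1) ^ d \<le> (67 * real d / \<epsilon>) ^ d" by (intro power_mono) auto
  then have W: "(2 * real M + 1) ^ d \<le> (67 * real d) ^ d * E" by (simp add: E_def power_divide)
  have "(real \<tau> + c) * (real k * (2 * real M + 1) ^ d) \<le> (1 + c) * real \<tau> * (real k * ((67 * real d) ^ d * E))"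
    using tc W c0 by (intro mult_mono mult_left_mono) auto
  then have T5: "(real \<tau> + c) * (real k * (2 * real M + 1) ^ d) \<le> (1 + c) * (67 * real d) ^ d * u"
    by (simp add: u_def mult_ac)
  have "real a2 \<le> 8 * (1 / \<epsilon>)" using a2 \<epsilon> by (simp add: field_simps)
  then have "real a2 \<le> 8 * E" using E by linarith
  then have "(real \<tau> + c) * real a2 \<le> (1 + c) * real \<tau> * (8 * E)" using tc c0 by (intro mult_mono) auto
  also have "\<dots> = 8 * (1 + c) * (real \<tau> * E)" by (simp add: mult_ac)
  also have "\<dots> \<le> 8 * (1 + c) * u" using tE c0 by (intro mult_left_mono) auto
  finally have T5': "(real \<tau> + c) * real a2 \<le> 8 * (1 + c) * u" .
  have "(real \<tau> + c) * real k \<le> (1 + c) * real \<tau> * real k" using tc by (intro mult_right_mono) auto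
  also have "\<dots> = (1 + c) * (real \<tau> * real k)" by simp
  also have "\<dots> \<le> (1 + c) * u" using u c0 by (intro mult_left_mono) auto
  finally have T3: "(real \<tau> + c) * real k \<le> (1 + c) * u" .
  have "(real \<tau> + c) * real a1 \<le> (1 + c) * real \<tau> * L" using tc a1 c0 by (intro mult_mono) auto
  then have T3': "(real \<tau> + c) * real a1 \<le> (1 + c) * (real \<tau> * L)" by (simp add: mult_ac)
  have dk: "real d * real k \<le> real d * u" "real d * 1 \<le> real d * u" "real d * real \<tau> \<le> real d * u"
    using u by (intro mult_left_mono; simp)+
  have L: "0 \<le> L" using a1 by linarith
  have tL: "0 \<le> real \<tau> * L" using L by simp
  have "real time \<le> real ((9 * k * k + 3 * (1 + d * (n + k)) + 11) + ((\<tau> + 2 * d + 10) * k + 3) +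
       (\<tau> + 5 * d + 14) * (k + a1) + (2 * M + 9) + (\<tau> + 5 * d + 14) * (k * (2 * M + 1) ^ d + a2) +
       ((6 * d + 20) * \<tau> + \<tau> + d + 2))" by (rule of_nat_mono[OF time])
  also have "\<dots> = 9 * real k ^ 2 + 3 * real d * real n + (3 * (real d * real k) + 14) +
      (real \<tau> * real k + 2 * (real d * real k) + 10 * real k + 3) +
      ((real \<tau> + c) * real k + (real \<tau> + c) * real a1) + (2 * real M + 9) +
      ((real \<tau> + c) * (real k * (2 * real M + 1) ^ d) + (real \<tau> + c) * real a2) +
      (6 * (real d * real \<tau>) + 21 * real \<tau> + real d + 2)"
    by (simp add: c_def algebra_simps power2_eq_square)
  also have "\<dots> \<le> 9 * real k ^ 2 + 3 * real d * real n + (3 * (real d * u) + 14 * u) +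
      (u + 2 * (real d * u) + 10 * u + 3 * u) +
      ((1 + c) * u + (1 + c) * (real \<tau> * L)) + (66 * (real d * u) + 9 * u) +
      ((1 + c) * (67 * real d) ^ d * u + 8 * (1 + c) * u) +
      (6 * (real d * u) + 21 * u + real d * u + 2 * u)"
    using u dk T3 T3' T4 T5 T5' by (intro add_mono) linarith+
  also have "\<dots> = 9 * real k ^ 2 + 3 * real d * real n + ((78 * real d + 60) + (1 + c) * (9 + (67 * real d) ^ d)) * u +
      (1 + c) * (real \<tau> * L)"
    by (simp add: algebra_simps)
  also have "\<dots> \<le> (9 + 3 * real d + (78 * real d + 60) + (1 + c) * (10 + (67 * real d) ^ d)) *
     (real k ^ 2 + real n + (u + real \<tau> * L))" (is "_ \<le> ?B * _")
  proof -
    define B where "B = ?B"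
    define e where "e = (67 * real d) ^ d"
    define g where "g = (78 * real d + 60) + (1 + c) * (9 + e)"
    have "0 \<le> (1 + c) * e" using c0 by (simp add: e_def)
    moreover have "B = 9 + 3 * real d + (78 * real d + 60) + (10 + 10 * c + (1 + c) * e)"
      unfolding B_def e_def[symmetric] by (simp add: algebra_simps)
    moreover have "g = (78 * real d + 60) + (9 + 9 * c + (1 + c) * e)"
      unfolding g_def by (simp add: algebra_simps)
    ultimately have B: "9 \<le> B" "3 * real d \<le> B" "g \<le> B" "1 + c \<le> B" using c0 t1 by linarith+
    have "9 * real k ^ 2 \<le> B * real k ^ 2" by (rule mult_right_mono[OF B(1)]) simp
    moreover have "3 * real d * real n \<le> B * real n" by (rule mult_right_mono[OF B(2)]) simp
    moreover have "g * u \<le> B * u" by (rule mult_right_mono[OF B(3)]) (use u in simp)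
    moreover have "(1 + c) * (real \<tau> * L) \<le> B * (real \<tau> * L)" by (rule mult_right_mono[OF B(4) tL])
    ultimately have "9 * real k ^ 2 + 3 * real d * real n + g * u + (1 + c) * (real \<tau> * L) \<le>
        B * (real k ^ 2 + real n + (u + real \<tau> * L))" unfolding distrib_left by linarith
    then show ?thesis unfolding B_def e_def g_def .
  qed
  finally show ?thesis by (simp add: c_def u_def E_def distrib_left add.commute)
qed

context scheme
begin

text \<open>Everything that depends on the problem enters through the cost \<tau> of one decision
  and the logarithm of \<Lambda>; an instance only has to compare the resulting expression with its
  claimed bound.\<close>

lemma approximable:
  assumes K: "0 \<le> K" and \<tau>: "\<And>n k. 1 \<le> \<tau> n k"
    and f: "\<And>n k \<epsilon>. 0 < n \<Longrightarrow> 0 < k \<Longrightarrow> 0 < \<epsilon> \<Longrightarrow> \<epsilon> \<le> 1 \<Longrightarrow> 0 < f n k \<epsilon> \<Longrightarrow>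
      real k ^ 2 + real n + real (\<tau> n k) * (real k / \<epsilon> ^ CARD('d) + log 2 (2 * \<Lambda> n)) \<le> K * f n k \<epsilon>"
  shows "approximable_in_time es \<delta> adm f"
proof -
  define B where "B = 9 + 3 * real d + (78 * real d + 60) + (15 + 5 * real d) * (10 + (67 * real d) ^ d)"
  have B: "0 \<le> B" by (simp add: B_def)
  show ?thesis unfolding approximable_in_time_def
  proof (intro exI[of _ main] exI[of _ "B * K"] allI impI)
    fix P S :: "(real ^ 'd) list" and \<epsilon> :: real
    assume PS: "P \<noteq> []" "S \<noteq> []" "distinct S" and \<epsilon>: "0 < \<epsilon>" "\<epsilon> \<le> 1"
    obtain time s' t Q M a1 a2 where w: "exec main (input_state es P S \<epsilon>) time s'"
     "outputs es s' t Q" "approx_solution \<delta> adm \<epsilon> P (set S) t Q" "real M * \<epsilon> \<le> 32 * real d + \<epsilon>"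
     "real a1 \<le> log 2 (2 * \<Lambda> (length P))" "real a2 * \<epsilon> \<le> 8"
     "time \<le> (9 * length S * length S + 3 * (1 + d * (length P + length S)) + 11) +
       ((\<tau> (length P) (length S) + 2 * d + 10) * length S + 3) +
       (\<tau> (length P) (length S) + 5 * d + 14) * (length S + a1) + (2 * M + 9) +
       (\<tau> (length P) (length S) + 5 * d + 14) * (length S * (2 * M + 1) ^ d + a2) +
       ((6 * d + 20) * \<tau> (length P) (length S) + \<tau> (length P) (length S) + d + 2)"
      using wp_main[OF PS \<epsilon>] unfolding wp_def by blast
    have S1: "1 \<le> length S" "1 \<le> d" using PS d_pos by (auto simp: Suc_le_eq)
    have "real time \<le> B * (real (length S) ^ 2 + real (length P) +
        real (\<tau> (length P) (length S)) * (real (length S) / \<epsilon> ^ d + log 2 (2 * \<Lambda> (length P))))"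
      unfolding B_def by (rule running_time_bound[OF \<tau> S1 \<epsilon> w(4-7)])
    moreover have "B * (real (length S) ^ 2 + real (length P) +
        real (\<tau> (length P) (length S)) * (real (length S) / \<epsilon> ^ d + log 2 (2 * \<Lambda> (length P)))) \<le>
        B * (K * f (length P) (length S) \<epsilon>)" if "0 < f (length P) (length S) \<epsilon>"
      using f[OF _ _ \<epsilon> that] PS B by (intro mult_left_mono) (auto simp: d_eq)
    ultimately have "0 < f (length P) (length S) \<epsilon> \<longrightarrow> real time \<le> B * K * f (length P) (length S) \<epsilon>"
      by (auto simp: mult.assoc)
    then show "\<exists>time s t Q. exec main (input_state es P S \<epsilon>) time s \<and> outputs es s t Q \<and>
        approx_solution \<delta> adm \<epsilon> P (set S) t Q \<and>
        (0 < f (length P) (length S) \<epsilon> \<longrightarrow> real time \<le> B * K * f (length P) (length S) \<epsilon>)"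
      using w by blast
  qed
qed

end

section \<open>The scheme for the discrete versions\<close>

lemma hausdorff_feas_mono: "hausdorff_feas b P S t r \<Longrightarrow> r \<le> r' \<Longrightarrow> hausdorff_feas b P S t r'"
  unfolding hausdorff_feas_def by (meson order_trans)

context axes
begin

lemma wp_hdecide:
  assumes PS: "P \<noteq> []" "S \<noteq> []" and s: "inp P S \<epsilon> s"
  shows "wp (hdecide b) s (\<lambda>t s'. t \<le> 60 * length P * length S + 60 \<and>
    nat_at s' 11 = (if hausdorff_feas b P S (vec 32 0 s) (real_at s 37) then 1 else 0))"
  unfolding hdecide_def wp_Seq
proof (rule wp_heval[OF PS s, where b = b])
  fix t s' assume t: "t \<le> 30 * length P * length S + 6" and sm: "same inner s s'"
    and J: "\<And>i. i < length P \<Longrightarrow> fst s' (adr 16 i) < length S \<and>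
        dist (P ! i + vec 32 0 s) (S ! fst s' (adr 16 i)) \<le> real_at s' 44"
    and I: "\<And>j. b \<Longrightarrow> j < length S \<Longrightarrow> fst s' (adr 17 j) < length P \<and>
        dist (P ! fst s' (adr 17 j) + vec 32 0 s) (S ! j) \<le> real_at s' 44"
    and low: "\<And>r. hausdorff_feas b P S (vec 32 0 s) r \<Longrightarrow> real_at s' 44 \<le> r"
  have f: "hausdorff_feas b P S (vec 32 0 s) (real_at s' 44)"
    by (rule heval_feas[OF PS, of "\<lambda>i. fst s' (adr 16 i)" _ _ b "\<lambda>j. fst s' (adr 17 j)"]) (use J I in blast)+
  have "hausdorff_feas b P S (vec 32 0 s) r \<longleftrightarrow> real_at s' 44 \<le> r" for r
    using hausdorff_feas_mono[OF f] low by blast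
  moreover have "real_at s' 37 = real_at s 37" using sameD(2)[OF sm, of 37] by simp
  ultimately show "wp (Cond (RLe (RV 44) (RV 37)) (NSet 11 (NConst 1)) (NSet 11 (NConst 0))) s'
    (\<lambda>t2 s''. t + t2 \<le> 60 * length P * length S + 60 \<and>
      nat_at s'' 11 = (if hausdorff_feas b P S (vec 32 0 s) (real_at s 37) then 1 else 0))"
    using t by simp
qed

text \<open>The value of a translation is computed exactly, so \<Lambda> is 1 and the logarithmic
  term shrinks to \<open>log 2 2 = 1\<close>. No logarithm of the input size remains.\<close>

lemma hausdorff_scheme:
  "scheme es discrete_frechet_dist (discrete_adm b) (hausdorff_feas b) (heval b) (hdecide b) (hfin b)
     (NV 5) (\<lambda>m j. j) (\<lambda>_. 1) (\<lambda>n k. 60 * n * k + 60)"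
proof
  fix P S :: "(real ^ 'd) list" and t t' r r'
  assume "P \<noteq> []" and f: "hausdorff_feas b P S t r"
  then show "\<exists>j<length S. dist (P ! 0 + t) (S ! j) \<le> r" by (simp add: hausdorff_feas_def)
next
  fix P S :: "(real ^ 'd) list" and t Q r
  assume "P \<noteq> []" "discrete_adm b (set S) Q" "discrete_frechet_dist (translate t P) Q < r"
  then show "hausdorff_feas b P S t r" by (intro hausdorff_feas_complete) auto
next
  fix P S :: "(real ^ 'd) list" and t r
  assume PS: "P \<noteq> []" "S \<noteq> []" and f: "hausdorff_feas b P S t r"
  obtain J where J: "\<And>i. i < length P \<Longrightarrow> J i < length S \<and> dist (P ! i + t) (S ! J i) \<le> r"
    using f unfolding hausdorff_feas_def by metis
  obtain I where I: "\<And>j. b \<Longrightarrow> j < length S \<Longrightarrow> I j < length P \<and> dist (P ! I j + t) (S ! j) \<le> r"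
    using f unfolding hausdorff_feas_def by metis
  show "\<exists>Q. discrete_adm b (set S) Q \<and> discrete_frechet_dist (translate t P) Q \<le> r"
    using curve_block_sound(2,3)[OF PS J I refl] by blast
next
  fix S :: "(real ^ 'd) list" assume "S \<noteq> []"
  then show "\<exists>Q. discrete_adm b (set S) Q"
    by (intro exI[of _ S]) (simp add: discrete_adm_def all_points_admissible_def subset_admissible_def)
next
  fix S P Q :: "(real ^ 'd) list" and t
  assume "P \<noteq> []" "discrete_adm b (set S) Q"
  then show "0 \<le> discrete_frechet_dist (translate t P) Q"
    by (intro discrete_frechet_dist_nonneg)
      (auto simp: translate_def discrete_adm_def all_points_admissible_def subset_admissible_def split: if_splits)
next
  fix P S :: "(real ^ 'd) list" and \<epsilon> s
  assume PS: "P \<noteq> []" "S \<noteq> []" and s: "inp P S \<epsilon> s"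
  show "wp (heval b) s (\<lambda>t s'. t \<le> 60 * length P * length S + 60 \<and>
      hausdorff_feas b P S (vec 32 0 s) (real_at s' 44) \<and>
      (\<forall>r. hausdorff_feas b P S (vec 32 0 s) r \<longrightarrow> real_at s' 44 \<le> 1 * r))"
  proof (rule wp_heval[OF PS s, where b = b])
    fix t s' assume a: "t \<le> 30 * length P * length S + 6"
      "\<And>i. i < length P \<Longrightarrow> fst s' (adr 16 i) < length S \<and>
        dist (P ! i + vec 32 0 s) (S ! fst s' (adr 16 i)) \<le> real_at s' 44"
      "\<And>j. b \<Longrightarrow> j < length S \<Longrightarrow> fst s' (adr 17 j) < length P \<and>
        dist (P ! fst s' (adr 17 j) + vec 32 0 s) (S ! j) \<le> real_at s' 44"
      "\<And>r. hausdorff_feas b P S (vec 32 0 s) r \<Longrightarrow> real_at s' 44 \<le> r"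
    have "hausdorff_feas b P S (vec 32 0 s) (real_at s' 44)"
      by (rule heval_feas[OF PS, of "\<lambda>i. fst s' (adr 16 i)" _ _ b "\<lambda>j. fst s' (adr 17 j)"]) (use a(2,3) in blast)+
    then show "t \<le> 60 * length P * length S + 60 \<and> hausdorff_feas b P S (vec 32 0 s) (real_at s' 44) \<and>
      (\<forall>r. hausdorff_feas b P S (vec 32 0 s) r \<longrightarrow> real_at s' 44 \<le> 1 * r)" using a(1,4) by simp
  qed
  show "wp (hdecide b) s (\<lambda>t s'. t \<le> 60 * length P * length S + 60 \<and>
      nat_at s' 11 = (if hausdorff_feas b P S (vec 32 0 s) (real_at s 37) then 1 else 0))"
    by (rule wp_hdecide[OF PS s])
  assume f: "hausdorff_feas b P S (vec 32 0 s) (real_at s 37)"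
  show "wp (hfin b) s (\<lambda>t s'. t \<le> 60 * length P * length S + 60 \<and> nat_at s' 14 < 60 * length P * length S + 60 \<and>
      (\<forall>j<nat_at s' 14. fst s' (adr 13 j) < length S) \<and>
      (let Q = map (\<lambda>j. S ! fst s' (adr 13 j)) [0..<nat_at s' 14] in
        discrete_adm b (set S) Q \<and> discrete_frechet_dist (translate (vec 32 0 s) P) Q \<le> real_at s 37))"
  proof (rule wp_hfin[OF PS s f])
    fix t s' L assume t: "t \<le> 60 * length P * length S + 20" and L: "L = map (\<lambda>x. fst s' (adr 13 x)) [0..<nat_at s' 14]"
      and l: "length L \<le> 2 * length P * length S" "set L \<subseteq> {..<length S}" "discrete_adm b (set S) (map ((!) S) L)"
      "discrete_frechet_dist (translate (vec 32 0 s) P) (map ((!) S) L) \<le> real_at s 37"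
    have "map ((!) S) L = map (\<lambda>j. S ! fst s' (adr 13 j)) [0..<nat_at s' 14]" by (simp add: L)
    moreover have "\<forall>j<nat_at s' 14. fst s' (adr 13 j) < length S"
    proof (intro allI impI)
      fix j assume "j < nat_at s' 14"
      then have "fst s' (adr 13 j) \<in> set L" by (auto simp: L)
      then show "fst s' (adr 13 j) < length S" using l(2) by blast
    qed
    moreover have "nat_at s' 14 \<le> 2 * length P * length S" using l(1) by (simp add: L)
    ultimately show "t \<le> 60 * length P * length S + 60 \<and> nat_at s' 14 < 60 * length P * length S + 60 \<and>
      (\<forall>j<nat_at s' 14. fst s' (adr 13 j) < length S) \<and>
      (let Q = map (\<lambda>j. S ! fst s' (adr 13 j)) [0..<nat_at s' 14] in
        discrete_adm b (set S) Q \<and> discrete_frechet_dist (translate (vec 32 0 s) P) Q \<le> real_at s 37)"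
      using t l(3,4) by (simp add: Let_def)
  qed
qed (use hausdorff_feas_mono hausdorff_feas_translate writes_heval writes_hdecide writes_hfin in auto)

lemma discrete_approximable:
  "approximable_in_time es discrete_frechet_dist (discrete_adm b)
     (\<lambda>n k \<epsilon>. real n * real k ^ 2 / \<epsilon> ^ CARD('d))"
proof -
  interpret scheme es discrete_frechet_dist "discrete_adm b" "hausdorff_feas b" "heval b" "hdecide b" "hfin b"
     "NV 5" "\<lambda>m j. j" "\<lambda>_. 1" "\<lambda>n k. 60 * n * k + 60"
    by (rule hausdorff_scheme)
  show ?thesis
  proof (rule approximable[where K = 300])
    fix n k :: nat and \<epsilon> :: real assume a: "0 < n" "0 < k" "0 < \<epsilon>" "\<epsilon> \<le> 1"
    define E where "E = 1 / \<epsilon> ^ CARD('d)"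
    have E: "1 \<le> E" using a by (simp add: E_def power_le_one)
    define u where "u = real n * real k ^ 2 * E"
    have nk: "1 \<le> real n" "1 \<le> real k" using a by auto
    have k2: "real k \<le> real k ^ 2" using nk by (simp add: power2_eq_square)
    have "1 * real k ^ 2 \<le> real n * real k ^ 2" using nk by (intro mult_right_mono) auto
    moreover have nk2: "real n * real k ^ 2 * 1 \<le> u" unfolding u_def using E by (intro mult_left_mono) auto
    moreover have "real n * 1 \<le> real n * real k ^ 2" using nk k2 by (intro mult_left_mono) auto
    moreover have "real n * real k \<le> real n * real k ^ 2" using k2 by (intro mult_left_mono) auto
    moreover have "1 * real k * E \<le> u" unfolding u_def using nk k2 E by (intro mult_mono) auto
    ultimately have b: "real k ^ 2 \<le> u" "real n \<le> u" "real n * real k \<le> u" "1 \<le> u" "real k * E \<le> u"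
      using nk by linarith+
    \<comment> \<open>The logarithm is 1. Each of \<open>k ^ 2\<close>, \<open>n\<close>,
      \<open>n * k\<close>, \<open>k * E\<close> and 1 is at most \<open>u\<close>, so the sum is at
      most \<open>242 * u\<close>.\<close>
    have "real k ^ 2 + real n + real (60 * n * k + 60) * (real k / \<epsilon> ^ CARD('d) + log 2 (2 * 1)) =
        real k ^ 2 + real n + 60 * u + 60 * (real n * real k) + 60 * (real k * E) + 60"
      by (simp add: E_def u_def algebra_simps power2_eq_square)
    also have "\<dots> \<le> 300 * u" using b by linarith
    finally show "real k ^ 2 + real n + real (60 * n * k + 60) * (real k / \<epsilon> ^ CARD('d) + log 2 (2 * 1)) \<le>
        300 * (real n * real k ^ 2 / \<epsilon> ^ CARD('d))" by (simp add: E_def u_def)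
  qed auto
qed

end

section \<open>Deciding and approximating the continuous version\<close>

text \<open>The parameter of the foot of the perpendicular from \<open>x\<close> to the line through
  \<open>a\<close> and \<open>b\<close>; division by zero makes it 0 when these coincide.\<close>

definition line_param :: "'a::real_inner \<Rightarrow> 'a \<Rightarrow> 'a \<Rightarrow> real" where
  "line_param x a b = ((x - a) \<bullet> (b - a)) / ((b - a) \<bullet> (b - a))"

definition near_param :: "'a::real_inner \<Rightarrow> 'a \<Rightarrow> 'a \<Rightarrow> real" where
  "near_param x a b = max 0 (min 1 (line_param x a b))"

text \<open>
  The first parameter at which the segment from \<open>a\<close> to \<open>b\<close> is within \<open>r\<close> of \<open>x\<close>, if there is one.
  For \<open>a = b\<close> the divisions by zero yield the parameter \<open>0\<close>.
\<close>

definition first_param :: "'a::real_inner \<Rightarrow> 'a \<Rightarrow> 'a \<Rightarrow> real \<Rightarrow> real" where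
  "first_param x a b r = max 0 (min 1 (line_param x a b -
     sqrt ((r * r - ((x - a) \<bullet> (x - a) - line_param x a b * line_param x a b * ((b - a) \<bullet> (b - a)))) /
       ((b - a) \<bullet> (b - a)))))"

lemma near_param_range: "0 \<le> near_param x a b" "near_param x a b \<le> 1"
  by (auto simp: near_param_def)

lemma first_param_range: "0 \<le> first_param x a b r" "first_param x a b r \<le> 1"
  by (auto simp: first_param_def)

text \<open>Completion of the square: the squared distance is a parabola in the parameter with its
  vertex at \<open>line_param\<close>, and the constant term is the squared distance to the
  line.\<close>

lemma dist_linepath_square:
  fixes x a b :: "'a::real_inner"
  assumes "a \<noteq> b"
  shows "(dist x (linepath a b \<theta>))\<^sup>2 = (\<theta> - line_param x a b)\<^sup>2 * ((b - a) \<bullet> (b - a)) +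
    ((x - a) \<bullet> (x - a) - line_param x a b * line_param x a b * ((b - a) \<bullet> (b - a)))"
proof -
  let ?c = "line_param x a b" and ?v = "b - a" and ?u = "x - a"
  have c: "?u \<bullet> ?v = ?c * (?v \<bullet> ?v)" using assms by (simp add: line_param_def)
  have e: "x - linepath a b \<theta> = ?u - \<theta> *\<^sub>R ?v" by (simp add: linepath_def algebra_simps)
  have "(dist x (linepath a b \<theta>))\<^sup>2 = (?u - \<theta> *\<^sub>R ?v) \<bullet> (?u - \<theta> *\<^sub>R ?v)"
    unfolding dist_norm power2_norm_eq_inner e ..
  also have "\<dots> = ?u \<bullet> ?u - 2 * \<theta> * (?u \<bullet> ?v) + \<theta>\<^sup>2 * (?v \<bullet> ?v)"
    by (simp add: inner_diff_left inner_diff_right inner_commute power2_eq_square algebra_simps)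
  finally show ?thesis unfolding c by (simp add: power2_eq_square algebra_simps)
qed

text \<open>Clamping to the unit interval gives the point of that interval closest to the vertex of
  the parabola.\<close>

lemma near_param_least:
  fixes x a b :: "'a::real_inner"
  assumes "0 \<le> \<theta>" "\<theta> \<le> 1"
  shows "dist x (linepath a b (near_param x a b)) \<le> dist x (linepath a b \<theta>)"
proof (cases "a = b")
  case True
  then show ?thesis by (simp add: linepath_def flip: scaleR_add_left)
next
  case False
  have "\<bar>near_param x a b - line_param x a b\<bar> \<le> \<bar>\<theta> - line_param x a b\<bar>"
    using assms by (auto simp: near_param_def)
  then have "(near_param x a b - line_param x a b)\<^sup>2 \<le> (\<theta> - line_param x a b)\<^sup>2"
    by (simp add: abs_le_square_iff)
  then have "(dist x (linepath a b (near_param x a b)))\<^sup>2 \<le> (dist x (linepath a b \<theta>))\<^sup>2"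
    unfolding dist_linepath_square[OF False] by (simp add: mult_right_mono)
  then show ?thesis by (simp add: power2_le_iff_abs_le)
qed

text \<open>The parameters within distance \<open>r\<close> form an interval centred at the vertex
  of the parabola, and \<open>first_param\<close> clamps its lower end. If no parameter of the
  segment qualifies, the formula still returns a number; for this reason every use of it below tests
  the distance again.\<close>

lemma first_param_least:
  fixes x a b :: "'a::real_inner"
  assumes "0 \<le> \<theta>" "\<theta> \<le> 1" and r: "dist x (linepath a b \<theta>) \<le> r"
  shows "first_param x a b r \<le> \<theta>" "dist x (linepath a b (first_param x a b r)) \<le> r"
proof -
  have "first_param x a b r \<le> \<theta> \<and> dist x (linepath a b (first_param x a b r)) \<le> r"
  proof (cases "a = b")
    case True
    then show ?thesis using assms by (simp add: first_param_def line_param_def linepath_def flip: scaleR_add_left)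
  next
    case False
    define c where "c = line_param x a b"
    define V where "V = (b - a) \<bullet> (b - a)"
    define H where "H = (x - a) \<bullet> (x - a) - c * c * V"
    define w where "w = sqrt ((r * r - H) / V)"
    have V: "0 < V" using False by (simp add: V_def)
    have r0: "0 \<le> r" using r zero_le_dist order_trans by blast
    have sq: "(dist x (linepath a b \<eta>))\<^sup>2 = (\<eta> - c)\<^sup>2 * V + H" for \<eta>
      using dist_linepath_square[OF False, of x \<eta>] by (simp add: c_def V_def H_def)
    have iff: "dist x (linepath a b \<eta>) \<le> r \<longleftrightarrow> (\<eta> - c)\<^sup>2 \<le> (r * r - H) / V" for \<eta>
    proof -
      have "dist x (linepath a b \<eta>) \<le> r \<longleftrightarrow> (dist x (linepath a b \<eta>))\<^sup>2 \<le> r\<^sup>2"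
        using r0 by (simp add: power2_le_iff_abs_le)
      also have "\<dots> \<longleftrightarrow> (\<eta> - c)\<^sup>2 * V \<le> r * r - H" unfolding sq by (auto simp: power2_eq_square)
      finally show ?thesis using V by (simp add: field_simps)
    qed
    have th: "(\<theta> - c)\<^sup>2 \<le> (r * r - H) / V" using iff r by blast
    then have nn: "0 \<le> (r * r - H) / V" using zero_le_power2 order_trans by blast
    have w: "w\<^sup>2 = (r * r - H) / V" "0 \<le> w" using nn by (simp_all add: w_def)
    have "\<bar>\<theta> - c\<bar> \<le> w" using th w by (metis abs_le_square_iff abs_of_nonneg)
    then have cw: "c - w \<le> \<theta>" "\<theta> \<le> c + w" by linarith+
    have f: "first_param x a b r = max 0 (min 1 (c - w))"
      by (simp add: first_param_def c_def V_def H_def w_def)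
    then have f': "first_param x a b r = max 0 (c - w)" using cw assms by simp
    have "\<bar>max 0 (c - w) - c\<bar> \<le> \<bar>w\<bar>" using cw assms w(2) by auto
    then have "(max 0 (c - w) - c)\<^sup>2 \<le> w\<^sup>2" by (simp add: abs_le_square_iff)
    then show ?thesis using f' cw assms iff[of "first_param x a b r"] w(1) by auto
  qed
  then show "first_param x a b r \<le> \<theta>" "dist x (linepath a b (first_param x a b r)) \<le> r" by auto
qed

lemma dist_linepath_between:
  fixes x a b :: "'a::real_normed_vector"
  assumes "dist x (linepath a b \<mu>) \<le> r" "dist x (linepath a b \<nu>) \<le> r" "\<mu> \<le> \<theta>" "\<theta> \<le> \<nu>"
  shows "dist x (linepath a b \<theta>) \<le> r"
proof (cases "\<mu> = \<nu>")
  case False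
  define u where "u = (\<theta> - \<mu>) / (\<nu> - \<mu>)"
  have u: "0 \<le> u" "u \<le> 1" using assms False by (auto simp: u_def field_simps)
  have "u * (\<nu> - \<mu>) = \<theta> - \<mu>" using False by (simp add: u_def)
  then have "linepath \<mu> \<nu> u = \<theta>" by (simp add: linepath_def algebra_simps)
  then have "linepath a b \<theta> = linepath (linepath a b \<mu>) (linepath a b \<nu>) u"
    using linepath_linepath[of a b \<mu> \<nu> u] by simp
  then show ?thesis using dist_linepath_le[OF assms(1,2) u] by (simp add: linepath_def flip: scaleR_add_left)
qed (use assms in auto)

text \<open>The admissible parameters form an interval, so the first one that is not below
  \<open>l\<close> is the larger of \<open>l\<close> and the start of the interval, provided that
  there is one.\<close>

lemma first_param_max:
  fixes x a b :: "'a::real_inner"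
  assumes "dist x (linepath a b \<theta>) \<le> r" "0 \<le> \<theta>" "\<theta> \<le> 1" "l \<le> \<theta>"
  shows "max l (first_param x a b r) \<le> \<theta>" "dist x (linepath a b (max l (first_param x a b r))) \<le> r"
proof -
  show m: "max l (first_param x a b r) \<le> \<theta>" using first_param_least(1)[OF assms(2,3,1)] assms(4) by simp
  show "dist x (linepath a b (max l (first_param x a b r))) \<le> r"
    by (rule dist_linepath_between[OF first_param_least(2)[OF assms(2,3,1)] assms(1) _ m]) simp
qed

subsection \<open>The decision procedure\<close>

text \<open>
  The pair of sites \<open>(a, b)\<close> is numbered \<open>a * k + b\<close>. \<open>alpha i q\<close> is the least parameter on the
  segment \<open>q\<close> that can be matched to \<open>p i\<close>, and \<open>2\<close> if there is none.
\<close>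

context
  fixes p :: "nat \<Rightarrow> 'a::real_inner" and S :: "nat \<Rightarrow> 'a" and k :: nat and r :: real
begin

text \<open>The earliest point of the edge of \<open>P\<close> at which some edge of
  \<open>Q\<close> reachable so far can be finished, together with that edge. Only the earliest
  matters: leaving sooner leaves more room for the next vertex of \<open>Q\<close>. The value 2
  exceeds every parameter and stands for failure.\<close>

fun scan :: "(nat \<Rightarrow> real) \<Rightarrow> nat \<Rightarrow> nat \<Rightarrow> real \<times> nat" where
  "scan A i 0 = (2, 0)"
| "scan A i (Suc m) = (let \<mu> = first_param (S (m mod k)) (p i) (p (Suc i)) r in
     if A m \<le> 1 \<and> dist (S (m mod k)) (linepath (p i) (p (Suc i)) \<mu>) \<le> r \<and> \<mu> < fst (scan A i m)
     then (\<mu>, m) else scan A i m)"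

definition switches :: "real \<Rightarrow> nat \<Rightarrow> nat \<Rightarrow> bool" where
  "switches L i a \<longleftrightarrow> L \<le> 1 \<and>
     dist (S a) (linepath (p i) (p (Suc i)) (max L (first_param (S a) (p i) (p (Suc i)) r))) \<le> r"

definition advance :: "real \<Rightarrow> nat \<Rightarrow> nat \<Rightarrow> real" where
  "advance base i q = (let \<theta> = max base (first_param (p (Suc i)) (S (q div k)) (S (q mod k)) r) in
     if base \<le> 1 \<and> dist (p (Suc i)) (linepath (S (q div k)) (S (q mod k)) \<theta>) \<le> r then \<theta> else 2)"

primrec alpha :: "nat \<Rightarrow> nat \<Rightarrow> real" where
  "alpha 0 q = (if dist (p 0) (S (q div k)) \<le> r then 0 else 2)"
| "alpha (Suc i) q = advance
     (if switches (fst (scan (alpha i) i (k * k))) i (q div k) then 0 else alpha i q) i q"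

abbreviation entry :: "nat \<Rightarrow> real" where "entry i \<equiv> fst (scan (alpha i) i (k * k))"
abbreviation pred :: "nat \<Rightarrow> nat" where "pred i \<equiv> snd (scan (alpha i) i (k * k))"

text \<open>Repeats the case distinction of \<open>alpha\<close>. One entry parameter and one
  predecessor for each edge of \<open>P\<close> therefore suffice; no pointers for all pairs are
  stored.\<close>

primrec trace :: "nat \<Rightarrow> nat \<Rightarrow> nat list" where
  "trace 0 q = []"
| "trace (Suc i) q = (if switches (entry i) i (q div k)
     then trace i (pred i) @ [pred i div k, pred i mod k] else trace i q)"

lemma scan_le:
  assumes "x < m" "A x \<le> 1" "0 \<le> \<mu>" "\<mu> \<le> 1" "dist (S (x mod k)) (linepath (p i) (p (Suc i)) \<mu>) \<le> r"
  shows "fst (scan A i m) \<le> \<mu>"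
  using assms(1)
proof (induction m)
  case (Suc m)
  show ?case
  proof (cases "x = m")
    case True
    then show ?thesis using first_param_least[OF assms(3,4,5)] assms(2) by (auto simp: Let_def)
  next
    case False
    then have "fst (scan A i m) \<le> \<mu>" using Suc by simp
    then show ?thesis by (auto simp: Let_def)
  qed
qed simp

lemma scan_valid:
  assumes "fst (scan A i m) \<le> 1"
  shows "snd (scan A i m) < m \<and> A (snd (scan A i m)) \<le> 1 \<and> 0 \<le> fst (scan A i m) \<and>
     dist (S (snd (scan A i m) mod k)) (linepath (p i) (p (Suc i)) (fst (scan A i m))) \<le> r"
  using assms by (induction m) (auto simp: Let_def first_param_range less_SucI split: if_splits)

lemma advance_le:
  assumes "base \<le> \<theta>" "0 \<le> \<theta>" "\<theta> \<le> 1" "dist (p (Suc i)) (linepath (S (q div k)) (S (q mod k)) \<theta>) \<le> r"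
  shows "advance base i q \<le> \<theta>"
  using first_param_max[OF assms(4,2,3,1)] assms unfolding advance_def by (simp add: Let_def)

text \<open>A smaller parameter is never worse. If a switch into an edge is possible, it can be
  entered at parameter 0, which beats staying on it; otherwise staying is the only way, and the
  induction hypothesis bounds the previous position.\<close>

lemma alpha_le:
  assumes "reach p S k r i qs a b \<theta>"
  shows "alpha i (a * k + b) \<le> \<theta>"
  using assms
proof (induction rule: reach.induct)
  case (start a b \<theta>)
  then show ?case by simp
next
  case (stay i qs a b \<theta> \<theta>')
  have ab: "a < k" "b < k" "0 \<le> \<theta>" using reach_bounds[OF stay(1)] by auto
  have "(if switches (entry i) i ((a * k + b) div k) then 0 else alpha i (a * k + b)) \<le> \<theta>'"
    using stay ab by auto
  then show ?case unfolding alpha.simps by (rule advance_le) (use stay ab in auto)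
next
  case (switch i qs a b \<theta> a' b' \<mu> \<mu>' \<theta>')
  have ab: "a < k" "b < k" "0 \<le> \<theta>" "\<theta> \<le> 1" using reach_bounds[OF switch(1)] by auto
  have "a * k + b < Suc a * k" using ab by simp
  also have "\<dots> \<le> k * k" using ab by (intro mult_right_mono) auto
  finally have q: "a * k + b < k * k" .
  have "entry i \<le> \<mu>"
    by (rule scan_le[OF q]) (use switch ab in \<open>auto simp: dist_commute\<close>)
  then have L: "entry i \<le> \<mu>'" "entry i \<le> 1" using switch by auto
  have "switches (entry i) i a'"
    unfolding switches_def
    using L(2) first_param_max(2)[of "S a'" "p i" "p (Suc i)" \<mu>' r "entry i"] switch L by (auto simp: dist_commute)
  then show ?case unfolding alpha.simps by (intro advance_le) (use switch in auto)
qed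

lemma reach_alpha:
  assumes "alpha i q \<le> 1" "q < k * k"
  shows "reach p S k r i (trace i q) (q div k) (q mod k) (alpha i q)"
  using assms
proof (induction i arbitrary: q)
  case 0
  have k: "0 < k" using 0 by (cases k) auto
  have "q div k < k" using 0 k by (simp add: less_mult_imp_div_less)
  then show ?case using 0 k by (auto intro!: reach.start simp: linepath_def split: if_splits)
next
  case (Suc i)
  have k: "0 < k" using Suc by (cases k) auto
  have q: "q div k < k" "q mod k < k" using Suc k by (simp_all add: less_mult_imp_div_less)
  let ?base = "if switches (entry i) i (q div k) then 0 else alpha i q"
  let ?\<theta> = "max ?base (first_param (p (Suc i)) (S (q div k)) (S (q mod k)) r)"
  have a: "alpha (Suc i) q = ?\<theta>" "?base \<le> 1" "dist (p (Suc i)) (linepath (S (q div k)) (S (q mod k)) ?\<theta>) \<le> r"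
    using Suc.prems(1) unfolding alpha.simps advance_def by (auto simp: Let_def split: if_splits)
  have \<theta>: "0 \<le> ?\<theta>" "?\<theta> \<le> 1" using a(2) first_param_range by (auto simp: le_max_iff_disj)
  show ?case
  proof (cases "switches (entry i) i (q div k)")
    case True
    then have L: "entry i \<le> 1" by (simp add: switches_def)
    note v = scan_valid[OF L]
    let ?\<mu>' = "max (entry i) (first_param (S (q div k)) (p i) (p (Suc i)) r)"
    have "reach p S k r (Suc i) (trace i (pred i) @ [pred i div k, pred i mod k]) (q div k) (q mod k) ?\<theta>"
    proof (rule reach.switch[where \<mu> = "entry i" and \<mu>' = ?\<mu>'])
      show "reach p S k r i (trace i (pred i)) (pred i div k) (pred i mod k) (alpha i (pred i))"
        using Suc.IH v by blast
    qed (use v True q L \<theta> a first_param_range in \<open>auto simp: switches_def dist_commute\<close>)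
    then show ?thesis using True a(1) by simp
  next
    case False
    then have "reach p S k r i (trace i q) (q div k) (q mod k) (alpha i q)" using Suc a(2) by simp
    then have "reach p S k r (Suc i) (trace i q) (q div k) (q mod k) ?\<theta>"
      by (rule reach.stay) (use False \<theta> a in auto)
    then show ?thesis using False a(1) by simp
  qed
qed

end

subsection \<open>The relaxed problem\<close>

text \<open>
  Replacing the global monotonicity along an edge of \<open>Q\<close> by a penalty for moving back between
  consecutive vertices of \<open>P\<close> makes the problem a bottleneck path problem and changes its value by
  at most a factor linear in the number of vertices.
\<close>

definition seg_dist :: "'a::real_inner \<Rightarrow> 'a \<Rightarrow> 'a \<Rightarrow> real" where
  "seg_dist x a b = dist x (linepath a b (near_param x a b))"

text \<open>The length by which the match moves backwards on the segment when first \<open>x\<close>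
  and then \<open>y\<close> is matched to its nearest point.\<close>

definition setback :: "'a::real_inner \<Rightarrow> 'a \<Rightarrow> 'a \<Rightarrow> 'a \<Rightarrow> real" where
  "setback x y a b = max 0 (near_param x a b - near_param y a b) * dist a b"

definition switch_cost :: "'a::real_inner \<Rightarrow> 'a \<Rightarrow> 'a \<Rightarrow> 'a \<Rightarrow> real" where
  "switch_cost x y a b = max (seg_dist x a b) (max (seg_dist y a b) (setback x y a b))"

text \<open>All points are matched to nearest points and the cost is a maximum of local terms, so
  the least \<open>w\<close> satisfies a recurrence of minima and maxima. In a switch the roles are
  exchanged: sites are projected to an edge of \<open>P\<close>.\<close>

primrec relaxed :: "(nat \<Rightarrow> 'a::real_inner) \<Rightarrow> (nat \<Rightarrow> 'a) \<Rightarrow> nat \<Rightarrow> nat \<Rightarrow> nat \<Rightarrow> real \<Rightarrow> bool" where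
  "relaxed p S k 0 q w \<longleftrightarrow> dist (p 0) (S (q div k)) \<le> w"
| "relaxed p S k (Suc i) q w \<longleftrightarrow> seg_dist (p (Suc i)) (S (q div k)) (S (q mod k)) \<le> w \<and>
     (relaxed p S k i q w \<and> setback (p i) (p (Suc i)) (S (q div k)) (S (q mod k)) \<le> w \<or>
      (\<exists>q'<k * k. relaxed p S k i q' w \<and>
         switch_cost (S (q' mod k)) (S (q div k)) (p i) (p (Suc i)) \<le> w))"

lemma dist_linepath_linepath: "dist (linepath a b x) (linepath a b y) = \<bar>x - y\<bar> * dist a b"
proof -
  have "linepath a b x - linepath a b y = (y - x) *\<^sub>R (a - b)" by (simp add: linepath_def algebra_simps)
  then show ?thesis by (simp add: dist_norm abs_minus_commute)
qed

lemma seg_dist_le: "0 \<le> \<theta> \<Longrightarrow> \<theta> \<le> 1 \<Longrightarrow> dist x (linepath a b \<theta>) \<le> r \<Longrightarrow> seg_dist x a b \<le> r"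
  unfolding seg_dist_def using near_param_least order_trans by blast

lemma near_param_close:
  assumes "0 \<le> \<theta>" "\<theta> \<le> 1" "dist x (linepath a b \<theta>) \<le> r"
  shows "\<bar>near_param x a b - \<theta>\<bar> * dist a b \<le> 2 * r"
  using dist_triangle3[of "linepath a b (near_param x a b)" "linepath a b \<theta>" x]
    seg_dist_le[OF assms] assms(3) by (simp add: dist_linepath_linepath seg_dist_def)

text \<open>Each nearest point lies within \<open>2 * r\<close> of the point actually matched, and
  the matched points are in the right order. This is the source of the factor 4.\<close>

lemma setback_le:
  assumes "0 \<le> \<theta>" "\<theta> \<le> \<eta>" "\<eta> \<le> 1" "dist x (linepath a b \<theta>) \<le> r" "dist y (linepath a b \<eta>) \<le> r"
  shows "setback x y a b \<le> 4 * r"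
proof -
  have 1: "\<bar>near_param x a b - \<theta>\<bar> * dist a b \<le> 2 * r" using assms by (intro near_param_close) auto
  have 2: "\<bar>near_param y a b - \<eta>\<bar> * dist a b \<le> 2 * r" using assms by (intro near_param_close) auto
  have "max 0 (near_param x a b - near_param y a b) \<le> \<bar>near_param x a b - \<theta>\<bar> + \<bar>near_param y a b - \<eta>\<bar>"
    using assms(2) by linarith
  then have "setback x y a b \<le> (\<bar>near_param x a b - \<theta>\<bar> + \<bar>near_param y a b - \<eta>\<bar>) * dist a b"
    unfolding setback_def by (intro mult_right_mono) auto
  then show ?thesis using 1 2 by (simp add: distrib_right)
qed

lemma relaxed_reach:
  assumes "reach p S k r i qs a b \<theta>"
  shows "relaxed p S k i (a * k + b) (4 * r)"
  using assms
proof (induction rule: reach.induct)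
  case (start a b \<theta>)
  have "0 \<le> r" using start(3) zero_le_dist order_trans by blast
  then show ?case using start by simp
next
  case (stay i qs a b \<theta> \<theta>')
  note b = reach_bounds[OF stay(1)]
  have "0 \<le> r" using b(6) zero_le_dist order_trans by blast
  moreover have "seg_dist (p (Suc i)) (S a) (S b) \<le> r" using stay b by (intro seg_dist_le[of \<theta>']) auto
  moreover have "setback (p i) (p (Suc i)) (S a) (S b) \<le> 4 * r" using stay b by (intro setback_le[of \<theta> \<theta>']) auto
  ultimately show ?case using stay b by simp
next
  case (switch i qs a b \<theta> a' b' \<mu> \<mu>' \<theta>')
  note b = reach_bounds[OF switch(1)]
  have r0: "0 \<le> r" using b(6) zero_le_dist order_trans by blast
  have "a * k + b < Suc a * k" using b by simp
  also have "\<dots> \<le> k * k" using b by (intro mult_right_mono) auto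
  finally have q: "a * k + b < k * k" .
  have "seg_dist (p (Suc i)) (S a') (S b') \<le> r" using switch by (intro seg_dist_le[of \<theta>']) auto
  moreover have "seg_dist (S b) (p i) (p (Suc i)) \<le> r" "seg_dist (S a') (p i) (p (Suc i)) \<le> r"
    using switch by (intro seg_dist_le[of \<mu>] seg_dist_le[of \<mu>']; simp add: dist_commute)+
  moreover have "setback (S b) (S a') (p i) (p (Suc i)) \<le> 4 * r"
    using switch by (intro setback_le[of \<mu> \<mu>']) (auto simp: dist_commute)
  ultimately show ?case using switch b r0 q by (auto simp: switch_cost_def intro!: exI[of _ "a * k + b"])
qed

text \<open>Monotonicity is restored by the running maximum of the nearest parameters. Each stay
  adds at most \<open>w\<close> to the lead over the nearest point, so at vertex \<open>i\<close>
  the lead has length at most \<open>i * w\<close> and the distance is at most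
  \<open>(i + 1) * w\<close>. A switch starts afresh at the nearest point, and repairing the order
  of its two sites costs \<open>2 * w\<close>, which is covered because \<open>n\<close> is at least
  1.\<close>

lemma reach_relaxed:
  assumes "relaxed p S k i q w" "q < k * k" "0 \<le> w" "i < n"
  shows "\<exists>qs \<theta>. reach p S k ((real n + 1) * w) i qs (q div k) (q mod k) \<theta> \<and>
     near_param (p i) (S (q div k)) (S (q mod k)) \<le> \<theta> \<and>
     (\<theta> - near_param (p i) (S (q div k)) (S (q mod k))) * dist (S (q div k)) (S (q mod k)) \<le> real i * w"
  using assms
proof (induction i arbitrary: q)
  case 0
  have k: "0 < k" using 0 by (cases k) auto
  have q: "q div k < k" "q mod k < k" using 0 k by (simp_all add: less_mult_imp_div_less)
  have w: "dist (p 0) (S (q div k)) \<le> w" using 0 by simp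
  have wR: "w \<le> (real n + 1) * w" using 0 by (simp add: distrib_right)
  have "dist (p 0) (linepath (S (q div k)) (S (q mod k)) (near_param (p 0) (S (q div k)) (S (q mod k)))) \<le> w"
    using near_param_least[of 0 "p 0" "S (q div k)" "S (q mod k)"] w by (simp add: linepath_def)
  then have "reach p S k ((real n + 1) * w) 0 [] (q div k) (q mod k) (near_param (p 0) (S (q div k)) (S (q mod k)))"
    using q w wR near_param_range by (intro reach.start) auto
  then show ?case by fastforce
next
  case (Suc i)
  have k: "0 < k" using Suc by (cases k) auto
  have q: "q div k < k" "q mod k < k" using Suc k by (simp_all add: less_mult_imp_div_less)
  let ?a = "S (q div k)" and ?b = "S (q mod k)" and ?R = "(real n + 1) * w"
  let ?\<nu> = "near_param (p (Suc i)) ?a ?b"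
  have seg: "dist (p (Suc i)) (linepath ?a ?b ?\<nu>) \<le> w" using Suc.prems by (simp add: seg_dist_def)
  have le: "dist (p (Suc i)) (linepath ?a ?b \<theta>) \<le> w + (\<theta> - ?\<nu>) * dist ?a ?b" if "?\<nu> \<le> \<theta>" for \<theta>
    using dist_triangle[of "p (Suc i)" "linepath ?a ?b \<theta>" "linepath ?a ?b ?\<nu>"] seg that
      dist_linepath_linepath[of ?a ?b ?\<nu> \<theta>] by simp
  have wR: "w \<le> ?R" "2 * w \<le> ?R"
    using mult_right_mono[of 1 "real n + 1" w] mult_right_mono[of 2 "real n + 1" w] Suc.prems by auto
  consider (stay) "relaxed p S k i q w" "setback (p i) (p (Suc i)) ?a ?b \<le> w"
    | (switch) q' where "q' < k * k" "relaxed p S k i q' w"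
        "switch_cost (S (q' mod k)) ?a (p i) (p (Suc i)) \<le> w"
    using Suc.prems(1) by auto
  then show ?case
  proof cases
    case stay
    obtain qs \<theta> where \<theta>: "reach p S k ?R i qs (q div k) (q mod k) \<theta>" "near_param (p i) ?a ?b \<le> \<theta>"
      "(\<theta> - near_param (p i) ?a ?b) * dist ?a ?b \<le> real i * w"
      using Suc.IH[OF stay(1) Suc.prems(2,3)] Suc.prems(4) by auto
    let ?\<theta>' = "max \<theta> ?\<nu>"
    have "?\<theta>' - ?\<nu> \<le> (\<theta> - near_param (p i) ?a ?b) + max 0 (near_param (p i) ?a ?b - ?\<nu>)" using \<theta>(2) by linarith
    then have "(?\<theta>' - ?\<nu>) * dist ?a ?b \<le>
        ((\<theta> - near_param (p i) ?a ?b) + max 0 (near_param (p i) ?a ?b - ?\<nu>)) * dist ?a ?b"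
      by (intro mult_right_mono) auto
    also have "\<dots> \<le> real i * w + w" using \<theta>(3) stay(2) by (simp add: distrib_right setback_def)
    finally have s: "(?\<theta>' - ?\<nu>) * dist ?a ?b \<le> real (Suc i) * w" by (simp add: distrib_right)
    have "real (Suc i) * w + w \<le> ?R"
      using mult_right_mono[of "real (Suc i)" "real n" w] Suc.prems by (simp add: distrib_right)
    then have "dist (p (Suc i)) (linepath ?a ?b ?\<theta>') \<le> ?R" using le[of ?\<theta>'] s by simp
    then have "reach p S k ?R (Suc i) qs (q div k) (q mod k) ?\<theta>'"
      using reach_bounds(4)[OF \<theta>(1)] near_param_range by (intro reach.stay[OF \<theta>(1)]) auto
    then show ?thesis using s by (intro exI[of _ qs] exI[of _ ?\<theta>']) auto
  next
    case switch
    let ?e = "linepath (p i) (p (Suc i))" and ?s = "S (q' mod k)"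
    let ?\<mu> = "near_param ?s (p i) (p (Suc i))" and ?\<mu>a = "near_param ?a (p i) (p (Suc i))"
    obtain qs \<theta> where \<theta>: "reach p S k ?R i qs (q' div k) (q' mod k) \<theta>"
      using Suc.IH[OF switch(2,1) Suc.prems(3)] Suc.prems(4) by auto
    have c: "dist ?s (?e ?\<mu>) \<le> w" "dist ?a (?e ?\<mu>a) \<le> w"
      "max 0 (?\<mu> - ?\<mu>a) * dist (p i) (p (Suc i)) \<le> w"
      using switch(3) by (auto simp: switch_cost_def seg_dist_def setback_def)
    have "dist ?a (?e (max ?\<mu> ?\<mu>a)) \<le> dist ?a (?e ?\<mu>a) + dist (?e ?\<mu>a) (?e (max ?\<mu> ?\<mu>a))"
      by (rule dist_triangle)
    also have "dist (?e ?\<mu>a) (?e (max ?\<mu> ?\<mu>a)) = max 0 (?\<mu> - ?\<mu>a) * dist (p i) (p (Suc i))"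
      unfolding dist_linepath_linepath by (auto simp: max_def)
    finally have "dist ?a (?e (max ?\<mu> ?\<mu>a)) \<le> 2 * w" using c by linarith
    then have "reach p S k ?R (Suc i) (qs @ [q' div k, q' mod k]) (q div k) (q mod k) ?\<nu>"
      using c wR seg q near_param_range
      by (intro reach.switch[OF \<theta>, where \<mu> = ?\<mu> and \<mu>' = "max ?\<mu> ?\<mu>a"]) (auto simp: dist_commute)
    then show ?thesis using Suc.prems(3) by (intro exI[of _ "qs @ [q' div k, q' mod k]"] exI[of _ ?\<nu>]) auto
  qed
qed

section \<open>Programs for the continuous version\<close>

context axes
begin

text \<open>The expression may read the cell about to be overwritten, which still has its old
  content; the relaxation updates its array in place this way.\<close>

lemma wp_map_loop:
  assumes c: "c < 64" "c \<noteq> 7" and b: "\<And>s'. same {7, c} s s' \<Longrightarrow> nval b s' = m"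
    and val: "\<And>q s'. q < m \<Longrightarrow> same {7, c} s s' \<Longrightarrow> nat_at s' 7 = q \<Longrightarrow>
        snd s' (adr c q) = snd s (adr c q) \<Longrightarrow> rval e s' = f q"
    and Q: "\<And>t s'. t \<le> 3 * m + 2 \<Longrightarrow> same {7, c} s s' \<Longrightarrow> (\<And>q. q < m \<Longrightarrow> snd s' (adr c q) = f q) \<Longrightarrow> Q t s'"
  shows "wp (For 7 b (RASet c (NV 7) e)) s Q"
proof (rule wp_For_bounded[where m = m and X = "{c}" and T = 1 and
    I = "\<lambda>i s'. (\<forall>q<i. snd s' (adr c q) = f q) \<and> (\<forall>q\<ge>i. snd s' (adr c q) = snd s (adr c q))"])
  fix i s' assume i: "i < m" "nat_at s' 7 = i" and sm: "same (insert 7 {c}) s s'"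
    and I: "(\<forall>q<i. snd s' (adr c q) = f q) \<and> (\<forall>q\<ge>i. snd s' (adr c q) = snd s (adr c q))"
  have "rval e s' = f i" by (rule val[OF i(1) sm i(2)]) (use I in simp)
  then show "wp (RASet c (NV 7) e) s' (\<lambda>t' s''. t' \<le> 1 \<and>
      (\<forall>q<Suc i. snd (nupd (adr 7 0) (Suc i) s'') (adr c q) = f q) \<and>
      (\<forall>q\<ge>Suc i. snd (nupd (adr 7 0) (Suc i) s'') (adr c q) = snd s (adr c q)))"
    using I i c by (simp add: less_Suc_eq)
next
  fix t s' assume "same (insert 7 {c}) s s'" "t \<le> (1 + 2) * m + 2"
    "(\<forall>q<m. snd s' (adr c q) = f q) \<and> (\<forall>q\<ge>m. snd s' (adr c q) = snd s (adr c q))"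
  then show "Q t s'" by (intro Q) simp_all
qed (use c b in \<open>auto intro!: writes_intros\<close>)

text \<open>Several indices may write to the same cell. The outcome is described by the bounds that
  hold for it, so no minimum over a possibly empty set of contributions has to be named.\<close>

lemma wp_scatter_min:
  assumes c: "c < 64" "c \<noteq> 7" and b: "\<And>s'. same {7, c} s s' \<Longrightarrow> nval b s' = m"
    and val: "\<And>q s'. q < m \<Longrightarrow> same {7, c} s s' \<Longrightarrow> nat_at s' 7 = q \<Longrightarrow> rval e s' = f q \<and> nval g s' = G q"
    and Q: "\<And>t s'. t \<le> 3 * m + 2 \<Longrightarrow> same {7, c} s s' \<Longrightarrow>
      (\<And>j w. snd s' (adr c j) \<le> w \<longleftrightarrow> snd s (adr c j) \<le> w \<or> (\<exists>q<m. G q = j \<and> f q \<le> w)) \<Longrightarrow> Q t s'"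
  shows "wp (For 7 b (RASet c g (RMin (RA c g) e))) s Q"
proof (rule wp_For_bounded[where m = m and X = "{c}" and T = 1 and
    I = "\<lambda>i s'. \<forall>j w. snd s' (adr c j) \<le> w \<longleftrightarrow> snd s (adr c j) \<le> w \<or> (\<exists>q<i. G q = j \<and> f q \<le> w)"])
  fix i s' assume i: "i < m" "nat_at s' 7 = i" and sm: "same (insert 7 {c}) s s'"
    and I: "\<forall>j w. snd s' (adr c j) \<le> w \<longleftrightarrow> snd s (adr c j) \<le> w \<or> (\<exists>q<i. G q = j \<and> f q \<le> w)"
  have v: "rval e s' = f i" "nval g s' = G i" using val[OF i(1) sm i(2)] by auto
  show "wp (RASet c g (RMin (RA c g) e)) s' (\<lambda>t' s''. t' \<le> 1 \<and>
      (\<forall>j w. snd (nupd (adr 7 0) (Suc i) s'') (adr c j) \<le> w \<longleftrightarrow>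
        snd s (adr c j) \<le> w \<or> (\<exists>q<Suc i. G q = j \<and> f q \<le> w)))"
  proof -
    have "min (snd s' (adr c (G i))) (f i) \<le> w \<longleftrightarrow> snd s (adr c (G i)) \<le> w \<or> (\<exists>q<Suc i. G q = G i \<and> f q \<le> w)" for w
      using I by (auto simp: min_le_iff_disj less_Suc_eq)
    moreover have "snd s' (adr c j) \<le> w \<longleftrightarrow> snd s (adr c j) \<le> w \<or> (\<exists>q<Suc i. G q = j \<and> f q \<le> w)" if "j \<noteq> G i" for j w
      using I that by (auto simp: less_Suc_eq)
    ultimately show ?thesis using v c by simp
  qed
next
  fix t s' assume "same (insert 7 {c}) s s'" "t \<le> (1 + 2) * m + 2"
    "\<forall>j w. snd s' (adr c j) \<le> w \<longleftrightarrow> snd s (adr c j) \<le> w \<or> (\<exists>q<m. G q = j \<and> f q \<le> w)"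
  then show "Q t s'" by (intro Q) simp_all
qed (use c b in \<open>auto intro!: writes_intros\<close>)

definition RLineParam :: "vexp \<Rightarrow> vexp \<Rightarrow> vexp \<Rightarrow> rexp" where
  "RLineParam x a b = RDiv (VDot (VSub x a) (VSub b a)) (VDot (VSub b a) (VSub b a))"

definition RNear :: "vexp \<Rightarrow> vexp \<Rightarrow> vexp \<Rightarrow> rexp" where
  "RNear x a b = RMax (RNat 0) (RMin (RNat 1) (RLineParam x a b))"

definition RFirst :: "vexp \<Rightarrow> vexp \<Rightarrow> vexp \<Rightarrow> rexp \<Rightarrow> rexp" where
  "RFirst x a b r = RMax (RNat 0) (RMin (RNat 1) (RSub (RLineParam x a b)
     (RSqrt (RDiv (RSub (RMul r r) (RSub (VDot (VSub x a) (VSub x a))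
        (RMul (RMul (RLineParam x a b) (RLineParam x a b)) (VDot (VSub b a) (VSub b a)))))
       (VDot (VSub b a) (VSub b a))))))"

definition RSegDist :: "vexp \<Rightarrow> vexp \<Rightarrow> vexp \<Rightarrow> rexp" where
  "RSegDist x a b = VDist x (VLine a b (RNear x a b))"

definition RSetback :: "vexp \<Rightarrow> vexp \<Rightarrow> vexp \<Rightarrow> vexp \<Rightarrow> rexp" where
  "RSetback x y a b = RMul (RMax (RNat 0) (RSub (RNear x a b) (RNear y a b))) (VDist a b)"

definition RSwitch :: "vexp \<Rightarrow> vexp \<Rightarrow> vexp \<Rightarrow> vexp \<Rightarrow> rexp" where
  "RSwitch x y a b = RMax (RSegDist x a b) (RMax (RSegDist y a b) (RSetback x y a b))"

lemma rval_near [simp]: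
  "rval (RNear x a b) s = near_param (vval x s) (vval a s) (vval b s)"
  "rval (RFirst x a b e) s = first_param (vval x s) (vval a s) (vval b s) (rval e s)"
  "rval (RSegDist x a b) s = seg_dist (vval x s) (vval a s) (vval b s)"
  "rval (RSetback x y a b) s = setback (vval x s) (vval y s) (vval a s) (vval b s)"
  "rval (RSwitch x y a b) s = switch_cost (vval x s) (vval y s) (vval a s) (vval b s)"
  by (simp_all add: RNear_def RFirst_def RSegDist_def RSetback_def RSwitch_def RLineParam_def
      near_param_def first_param_def seg_dist_def setback_def switch_cost_def line_param_def)

abbreviation "XQ \<equiv> NA 3 (NV 7)"
abbreviation "YQ \<equiv> NA 4 (NV 7)"
abbreviation "NLast \<equiv> NSub (NV 0) (NConst 1)"
abbreviation "NNext \<equiv> NAdd (NV 6) (NConst 1)"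

text \<open>The cost of a switch depends on the old edge only through its end and on the new one
  only through its start. Array 47 collects the best edge for each end and array 48 the best switch
  for each start, so a step takes \<open>k ^ 2\<close> operations up to a constant and not
  \<open>k ^ 4\<close>. Both arrays are first filled with the candidates coming from site 0, in
  place of an infinite value.\<close>

definition relax_step :: com where
  "relax_step =
     Seq (For 7 (NV 1) (RASet 47 (NV 7) (RA 46 (NV 7))))
     (Seq (For 7 (NV 2) (RASet 47 YQ (RMin (RA 47 YQ) (RA 46 (NV 7)))))
     (Seq (For 7 (NV 1) (RASet 48 (NV 7) (RMax (RA 47 (NConst 0))
        (RSwitch (VSite (NConst 0)) (VSite (NV 7)) (VMoved (NV 6)) (VMoved NNext)))))
     (Seq (For 7 (NV 2) (RASet 48 YQ (RMin (RA 48 YQ) (RMax (RA 47 XQ)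
        (RSwitch (VSite XQ) (VSite YQ) (VMoved (NV 6)) (VMoved NNext))))))
     (For 7 (NV 2) (RASet 46 (NV 7) (RMax (RSegDist (VMoved NNext) (VSite XQ) (VSite YQ))
        (RMin (RMax (RA 46 (NV 7)) (RSetback (VMoved (NV 6)) (VMoved NNext) (VSite XQ) (VSite YQ)))
          (RA 48 XQ))))))))"

text \<open>The final factor \<open>n + 1\<close> is the loss of the relaxation and turns its value
  into a feasible radius.\<close>

definition ceval :: com where
  "ceval = Seq (For 7 (NV 2) (RASet 46 (NV 7) (VDist (VMoved (NConst 0)) (VSite XQ))))
     (Seq (For 6 NLast relax_step)
     (Seq (RSet 44 (RMax (RA 46 (NConst 0)) (VDist (VMoved NLast) (VSite (NConst 0)))))
     (Seq (For 7 (NV 2) (RASet 44 (NConst 0) (RMin (RA 44 (NConst 0))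
        (RMax (RA 46 (NV 7)) (VDist (VMoved NLast) (VSite YQ))))))
       (RSet 44 (RMul (ROfNat (NAdd (NV 0) (NConst 1))) (RV 44))))))"

lemma writes_relax_step: "writes {7, 46, 47, 48} relax_step"
  unfolding relax_step_def by (intro writes_intros) auto

lemma writes_ceval: "writes inner ceval"
  unfolding ceval_def by (intro writes_intros writes_mono[OF writes_relax_step]) auto

lemma inner_frame:
  assumes "inp P S \<epsilon> s" "same inner s s'"
  shows "inp P S \<epsilon> s'" "vec 32 i s' = vec 32 i s" "nat_at s' 0 = length P" "nat_at s' 1 = length S"
    "nat_at s' 2 = length S * length S" "real_at s' 37 = real_at s 37"
    "q < length S * length S \<Longrightarrow> fst s' (adr 3 q) = q div length S"
    "q < length S * length S \<Longrightarrow> fst s' (adr 4 q) = q mod length S"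
proof -
  show i: "inp P S \<epsilon> s'" by (rule inp_same[OF assms]) (auto simp: inner_def)
  show "vec 32 i s' = vec 32 i s" by (rule vec_same[OF assms(2)]) auto
  show "real_at s' 37 = real_at s 37" by (rule sameD(2)[OF assms(2)]) auto
qed (use inp_same[OF assms] in \<open>auto simp: inner_def dest: inpD\<close>)

lemma div_mod_less:
  assumes "q < k * k"
  shows "q div k < k" "q mod k < (k::nat)"
proof -
  have "0 < k" using assms by (cases k) auto
  then show "q div k < k" "q mod k < k" using assms by (simp_all add: less_mult_imp_div_less)
qed

text \<open>Memory and recurrence are compared through the bounds \<open>\<le> w\<close> for all
  \<open>w\<close>, so that maxima become conjunctions and minima become disjunctions.\<close>

lemma wp_relax_step:
  assumes PS: "P \<noteq> []" "S \<noteq> []" and s: "inp P S \<epsilon> s" "vec 32 0 s = T"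
    and i: "nat_at s 6 = i" "Suc i < length P"
    and A: "\<And>q w. q < length S * length S \<Longrightarrow>
      snd s (adr 46 q) \<le> w \<longleftrightarrow> relaxed (\<lambda>i. P ! i + T) ((!) S) (length S) i q w"
    and Q: "\<And>t s'. t \<le> 25 * length S * length S \<Longrightarrow>
      (\<And>q w. q < length S * length S \<Longrightarrow>
        snd s' (adr 46 q) \<le> w \<longleftrightarrow> relaxed (\<lambda>i. P ! i + T) ((!) S) (length S) (Suc i) q w) \<Longrightarrow> Q t s'"
  shows "wp relax_step s Q"
proof -
  let ?k = "length S" and ?p = "\<lambda>i. P ! i + T"
  let ?sw = "\<lambda>j' j. switch_cost (S ! j') (S ! j) (?p i) (?p (Suc i))"
  have k: "0 < ?k" "?k \<le> ?k * ?k" using PS by (auto simp: Suc_le_eq)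
  have fr: "same inner s s' \<Longrightarrow> nat_at s' 6 = i \<Longrightarrow> inp P S \<epsilon> s' \<and> vec 32 0 s' = T \<and> nat_at s' 1 = ?k \<and>
      nat_at s' 2 = ?k * ?k \<and> vval (VMoved (NV 6)) s' = ?p i \<and> vval (VMoved NNext) s' = ?p (Suc i)" for s'
    using inner_frame[OF s(1), of s'] s(2) i vval_VMoved[of P S \<epsilon> s' "NV 6"] vval_VMoved[of P S \<epsilon> s' NNext] by simp
  have fr': "same X s s' \<Longrightarrow> X \<subseteq> {7, 46, 47, 48} \<Longrightarrow> inp P S \<epsilon> s' \<and> vec 32 0 s' = T \<and> nat_at s' 1 = ?k \<and>
      nat_at s' 2 = ?k * ?k \<and> vval (VMoved (NV 6)) s' = ?p i \<and> vval (VMoved NNext) s' = ?p (Suc i)" for s' X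
  proof (rule fr)
    assume sm: "same X s s'" and X: "X \<subseteq> {7, 46, 47, 48}"
    show "same inner s s'" by (rule same_mono[OF sm subset_trans[OF X]]) auto
    have "6 \<notin> X" using X by auto
    then show "nat_at s' 6 = i" using sameD(1)[OF sm, of 6] i by simp
  qed
  have xy: "inp P S \<epsilon> s' \<Longrightarrow> nat_at s' 7 = q \<Longrightarrow> q < ?k * ?k \<Longrightarrow> nval XQ s' = q div ?k \<and> nval YQ s' = q mod ?k \<and>
      vval (VSite XQ) s' = S ! (q div ?k) \<and> vval (VSite YQ) s' = S ! (q mod ?k)" for s' q
    using inpD(7,8)[of P S \<epsilon> s' q] vval_VSite[of P S \<epsilon> s' XQ] vval_VSite[of P S \<epsilon> s' YQ] div_mod_less[of q ?k] by simp
  define M1 where "M1 j w \<longleftrightarrow> (\<exists>q<?k * ?k. q mod ?k = j \<and> relaxed ?p ((!) S) ?k i q w)" for j w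
  show ?thesis unfolding relax_step_def wp_Seq
  proof (rule wp_map_loop[where m = ?k and f = "\<lambda>q. snd s (adr 46 q)"])
    show "nval (NV 1) s' = ?k" if "same {7, 47} s s'" for s' using fr'[OF that] by simp
    show "rval (RA 46 (NV 7)) s' = snd s (adr 46 q)" if "same {7, 47} s s'" "nat_at s' 7 = q" for s' q
      using that sameD(2)[OF that(1), of 46] by simp
  next
    fix t1 s1 assume t1: "t1 \<le> 3 * ?k + 2" and sm1: "same {7, 47} s s1"
      and m1: "\<And>q. q < ?k \<Longrightarrow> snd s1 (adr 47 q) = snd s (adr 46 q)"
    have to1: "same {7, 46, 47, 48} s s'" if "same X s1 s'" "X \<subseteq> {7, 46, 47, 48}" for s' X
      by (rule same_trans'[OF sm1 that(1)]) (use that in auto)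
    show "wp (For 7 (NV 2) (RASet 47 YQ (RMin (RA 47 YQ) (RA 46 (NV 7))))) s1 (\<lambda>t2 s2.
      wp (For 7 (NV 1) (RASet 48 (NV 7) (RMax (RA 47 (NConst 0))
        (RSwitch (VSite (NConst 0)) (VSite (NV 7)) (VMoved (NV 6)) (VMoved NNext))))) s2 (\<lambda>t3 s3.
      wp (For 7 (NV 2) (RASet 48 YQ (RMin (RA 48 YQ) (RMax (RA 47 XQ)
        (RSwitch (VSite XQ) (VSite YQ) (VMoved (NV 6)) (VMoved NNext)))))) s3 (\<lambda>t4 s4.
      wp (For 7 (NV 2) (RASet 46 (NV 7) (RMax (RSegDist (VMoved NNext) (VSite XQ) (VSite YQ))
        (RMin (RMax (RA 46 (NV 7)) (RSetback (VMoved (NV 6)) (VMoved NNext) (VSite XQ) (VSite YQ)))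
          (RA 48 XQ))))) s4 (\<lambda>t5. Q (t1 + (t2 + (t3 + (t4 + t5))))))))"
    proof (rule wp_scatter_min[where m = "?k * ?k" and f = "\<lambda>q. snd s (adr 46 q)" and G = "\<lambda>q. q mod ?k"])
      fix s' assume a: "same {7, 47} s1 s'"
      note f = fr'[OF to1[OF a]]
      show "nval (NV 2) s' = ?k * ?k" using f by simp
      fix q assume "q < ?k * ?k" "nat_at s' 7 = q"
      then show "rval (RA 46 (NV 7)) s' = snd s (adr 46 q) \<and> nval YQ s' = q mod ?k"
        using sameD(2)[OF a, of 46] sameD(2)[OF sm1, of 46] xy[of s' q] f by simp
    next
      fix t2 s2 assume t2: "t2 \<le> 3 * (?k * ?k) + 2" and sm2: "same {7, 47} s1 s2"
        and m2: "\<And>j w. snd s2 (adr 47 j) \<le> w \<longleftrightarrow> snd s1 (adr 47 j) \<le> w \<or> (\<exists>q<?k * ?k. q mod ?k = j \<and> snd s (adr 46 q) \<le> w)"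
      have M1: "snd s2 (adr 47 j) \<le> w \<longleftrightarrow> M1 j w" if "j < ?k" for j w
      proof -
        have j: "j < ?k * ?k" "j mod ?k = j" using less_le_trans[OF that k(2)] that by auto
        have "snd s2 (adr 47 j) \<le> w \<longleftrightarrow> (\<exists>q<?k * ?k. q mod ?k = j \<and> snd s (adr 46 q) \<le> w)"
          unfolding m2[of j w] m1[OF that] using j by blast
        then show ?thesis unfolding M1_def using A by blast
      qed
      have to2: "same {7, 46, 47, 48} s s'" if "same X s2 s'" "X \<subseteq> {7, 46, 47, 48}" for s' X
        by (rule same_trans'[OF to1[OF sm2] that(1)]) (use that in auto)
      show "wp (For 7 (NV 1) (RASet 48 (NV 7) (RMax (RA 47 (NConst 0))
        (RSwitch (VSite (NConst 0)) (VSite (NV 7)) (VMoved (NV 6)) (VMoved NNext))))) s2 (\<lambda>t3 s3.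
      wp (For 7 (NV 2) (RASet 48 YQ (RMin (RA 48 YQ) (RMax (RA 47 XQ)
        (RSwitch (VSite XQ) (VSite YQ) (VMoved (NV 6)) (VMoved NNext)))))) s3 (\<lambda>t4 s4.
      wp (For 7 (NV 2) (RASet 46 (NV 7) (RMax (RSegDist (VMoved NNext) (VSite XQ) (VSite YQ))
        (RMin (RMax (RA 46 (NV 7)) (RSetback (VMoved (NV 6)) (VMoved NNext) (VSite XQ) (VSite YQ)))
          (RA 48 XQ))))) s4 (\<lambda>t5. Q (t1 + (t2 + (t3 + (t4 + t5)))))))"
      proof (rule wp_map_loop[where m = ?k and f = "\<lambda>j. max (snd s2 (adr 47 0)) (?sw 0 j)"])
        fix s' assume a: "same {7, 48} s2 s'"
        note f = fr'[OF to2[OF a]]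
        show "nval (NV 1) s' = ?k" using f by simp
        fix j assume "j < ?k" "nat_at s' 7 = j"
        then show "rval (RMax (RA 47 (NConst 0)) (RSwitch (VSite (NConst 0)) (VSite (NV 7)) (VMoved (NV 6)) (VMoved NNext))) s' =
            max (snd s2 (adr 47 0)) (?sw 0 j)"
          using sameD(2)[OF a, of 47] f vval_VSite[of P S \<epsilon> s' "NConst 0"] vval_VSite[of P S \<epsilon> s' "NV 7"] k by simp
      next
        fix t3 s3 assume t3: "t3 \<le> 3 * ?k + 2" and sm3: "same {7, 48} s2 s3"
          and m3: "\<And>j. j < ?k \<Longrightarrow> snd s3 (adr 48 j) = max (snd s2 (adr 47 0)) (?sw 0 j)"
        have to3: "same {7, 46, 47, 48} s s'" if "same X s3 s'" "X \<subseteq> {7, 46, 47, 48}" for s' X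
          by (rule same_trans'[OF to2[OF sm3] that(1)]) (use that in auto)
        show "wp (For 7 (NV 2) (RASet 48 YQ (RMin (RA 48 YQ) (RMax (RA 47 XQ)
            (RSwitch (VSite XQ) (VSite YQ) (VMoved (NV 6)) (VMoved NNext)))))) s3 (\<lambda>t4 s4.
          wp (For 7 (NV 2) (RASet 46 (NV 7) (RMax (RSegDist (VMoved NNext) (VSite XQ) (VSite YQ))
            (RMin (RMax (RA 46 (NV 7)) (RSetback (VMoved (NV 6)) (VMoved NNext) (VSite XQ) (VSite YQ)))
              (RA 48 XQ))))) s4 (\<lambda>t5. Q (t1 + (t2 + (t3 + (t4 + t5))))))"
        proof (rule wp_scatter_min[where m = "?k * ?k" and G = "\<lambda>q. q mod ?k" and
              f = "\<lambda>q. max (snd s2 (adr 47 (q div ?k))) (?sw (q div ?k) (q mod ?k))"])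
          fix s' assume a: "same {7, 48} s3 s'"
          note f = fr'[OF to3[OF a]]
          show "nval (NV 2) s' = ?k * ?k" using f by simp
          fix q assume "q < ?k * ?k" "nat_at s' 7 = q"
          then show "rval (RMax (RA 47 XQ) (RSwitch (VSite XQ) (VSite YQ) (VMoved (NV 6)) (VMoved NNext))) s' =
              max (snd s2 (adr 47 (q div ?k))) (?sw (q div ?k) (q mod ?k)) \<and> nval YQ s' = q mod ?k"
            using sameD(2)[OF a, of 47] sameD(2)[OF sm3, of 47] xy[of s' q] f by simp
        next
          fix t4 s4 assume t4: "t4 \<le> 3 * (?k * ?k) + 2" and sm4: "same {7, 48} s3 s4"
            and m4: "\<And>j w. snd s4 (adr 48 j) \<le> w \<longleftrightarrow> snd s3 (adr 48 j) \<le> w \<or>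
              (\<exists>q<?k * ?k. q mod ?k = j \<and> max (snd s2 (adr 47 (q div ?k))) (?sw (q div ?k) (q mod ?k)) \<le> w)"
          have M2: "snd s4 (adr 48 j) \<le> w \<longleftrightarrow> (\<exists>q<?k * ?k. relaxed ?p ((!) S) ?k i q w \<and> ?sw (q mod ?k) j \<le> w)"
            if j: "j < ?k" for j w
          proof -
            have "snd s4 (adr 48 j) \<le> w \<longleftrightarrow> (\<exists>j'<?k. M1 j' w \<and> ?sw j' j \<le> w)"
            proof
              assume "snd s4 (adr 48 j) \<le> w"
              then consider "M1 0 w" "?sw 0 j \<le> w" | q where "q < ?k * ?k" "q mod ?k = j"
                  "snd s2 (adr 47 (q div ?k)) \<le> w" "?sw (q div ?k) (q mod ?k) \<le> w"
                unfolding m4[of j w] m3[OF j] using M1[OF k(1)] by auto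
              then show "\<exists>j'<?k. M1 j' w \<and> ?sw j' j \<le> w"
              proof cases
                case 1 then show ?thesis using k by blast
              next
                case 2 then show ?thesis using M1[of "q div ?k" w] div_mod_less(1)[OF 2(1)] by blast
              qed
            next
              assume "\<exists>j'<?k. M1 j' w \<and> ?sw j' j \<le> w"
              then obtain j' where j': "j' < ?k" "M1 j' w" "?sw j' j \<le> w" by blast
              have "j' * ?k + j < Suc j' * ?k" using j by simp
              also have "\<dots> \<le> ?k * ?k" using j' by (intro mult_right_mono) auto
              finally have "j' * ?k + j < ?k * ?k" .
              moreover have "(j' * ?k + j) div ?k = j'" "(j' * ?k + j) mod ?k = j" using j k by simp_all
              ultimately show "snd s4 (adr 48 j) \<le> w"
                unfolding m4[of j w] using M1[of j' w] j' by (intro disjI2 exI[of _ "j' * ?k + j"]) simp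
            qed
            also have "\<dots> \<longleftrightarrow> (\<exists>q<?k * ?k. relaxed ?p ((!) S) ?k i q w \<and> ?sw (q mod ?k) j \<le> w)"
              unfolding M1_def using div_mod_less(2) by blast
            finally show ?thesis .
          qed
          have to4: "same {7, 46, 47, 48} s s'" if "same X s4 s'" "X \<subseteq> {7, 46, 47, 48}" for s' X
            by (rule same_trans'[OF to3[OF sm4] that(1)]) (use that in auto)
          have a46: "snd s4 (adr 46 q) = snd s (adr 46 q)" for q
            using sameD(2)[OF sm1, of 46 q] sameD(2)[OF sm2, of 46 q] sameD(2)[OF sm3, of 46 q] sameD(2)[OF sm4, of 46 q] by simp
          show "wp (For 7 (NV 2) (RASet 46 (NV 7) (RMax (RSegDist (VMoved NNext) (VSite XQ) (VSite YQ))
            (RMin (RMax (RA 46 (NV 7)) (RSetback (VMoved (NV 6)) (VMoved NNext) (VSite XQ) (VSite YQ)))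
              (RA 48 XQ))))) s4 (\<lambda>t5. Q (t1 + (t2 + (t3 + (t4 + t5)))))"
          proof (rule wp_map_loop[where m = "?k * ?k" and
                f = "\<lambda>q. max (seg_dist (?p (Suc i)) (S ! (q div ?k)) (S ! (q mod ?k)))
                   (min (max (snd s (adr 46 q)) (setback (?p i) (?p (Suc i)) (S ! (q div ?k)) (S ! (q mod ?k))))
                     (snd s4 (adr 48 (q div ?k))))"])
            fix s' assume a: "same {7, 46} s4 s'"
            note f = fr'[OF to4[OF a]]
            show "nval (NV 2) s' = ?k * ?k" using f by simp
            fix q assume "q < ?k * ?k" "nat_at s' 7 = q" "snd s' (adr 46 q) = snd s4 (adr 46 q)"
            then show "rval (RMax (RSegDist (VMoved NNext) (VSite XQ) (VSite YQ))
               (RMin (RMax (RA 46 (NV 7)) (RSetback (VMoved (NV 6)) (VMoved NNext) (VSite XQ) (VSite YQ))) (RA 48 XQ))) s' =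
              max (seg_dist (?p (Suc i)) (S ! (q div ?k)) (S ! (q mod ?k)))
                   (min (max (snd s (adr 46 q)) (setback (?p i) (?p (Suc i)) (S ! (q div ?k)) (S ! (q mod ?k))))
                     (snd s4 (adr 48 (q div ?k))))"
              using sameD(2)[OF a, of 48] xy[of s' q] f a46 by simp
          next
            fix t5 and s5 :: state assume t5: "t5 \<le> 3 * (?k * ?k) + 2"
              and m5: "\<And>q. q < ?k * ?k \<Longrightarrow> snd s5 (adr 46 q) = max (seg_dist (?p (Suc i)) (S ! (q div ?k)) (S ! (q mod ?k)))
                   (min (max (snd s (adr 46 q)) (setback (?p i) (?p (Suc i)) (S ! (q div ?k)) (S ! (q mod ?k))))
                     (snd s4 (adr 48 (q div ?k))))"
            show "Q (t1 + (t2 + (t3 + (t4 + t5)))) s5"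
            proof (rule Q)
              have "1 \<le> ?k * ?k" using k by simp
              then have "t1 + (t2 + (t3 + (t4 + t5))) \<le> 25 * (?k * ?k)"
                using t1 t2 t3 t4 t5 k(2) by linarith
              then show "t1 + (t2 + (t3 + (t4 + t5))) \<le> 25 * ?k * ?k" by simp
              fix q w assume q: "q < ?k * ?k"
              show "snd s5 (adr 46 q) \<le> w \<longleftrightarrow> relaxed ?p ((!) S) ?k (Suc i) q w"
                unfolding m5[OF q] max.bounded_iff min_le_iff_disj A[OF q] M2[OF div_mod_less(1)[OF q]] by simp
            qed
          qed auto
        qed auto
      qed auto
    qed auto
  qed auto
qed

end

section \<open>Feasible translations in the continuous version\<close>

definition cfeas :: "'a::real_inner list \<Rightarrow> 'a list \<Rightarrow> 'a \<Rightarrow> real \<Rightarrow> bool" where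
  "cfeas P S t r \<longleftrightarrow> (\<exists>qs a b \<theta>. reach (\<lambda>i. P ! i + t) ((!) S) (length S) r (length P - 1) qs a b \<theta> \<and>
     dist (P ! (length P - 1) + t) (S ! b) \<le> r)"

lemma pair_less:
  assumes "a < k" "b < (k::nat)"
  shows "a * k + b < k * k"
proof -
  have "a * k + b < Suc a * k" using assms by simp
  also have "\<dots> \<le> k * k" using assms by (intro mult_right_mono) auto
  finally show ?thesis .
qed

lemma cfeas_relaxed:
  assumes "cfeas P S t r"
  shows "\<exists>q<length S * length S. relaxed (\<lambda>i. P ! i + t) ((!) S) (length S) (length P - 1) q (4 * r) \<and>
    dist (P ! (length P - 1) + t) (S ! (q mod length S)) \<le> 4 * r"
proof -
  obtain qs a b \<theta> where r: "reach (\<lambda>i. P ! i + t) ((!) S) (length S) r (length P - 1) qs a b \<theta>"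
     "dist (P ! (length P - 1) + t) (S ! b) \<le> r" using assms unfolding cfeas_def by blast
  note b = reach_bounds[OF r(1)]
  have "0 \<le> r" using r(2) zero_le_dist order_trans by blast
  then show ?thesis using relaxed_reach[OF r(1)] pair_less[OF b(1,2)] b r(2)
    by (intro exI[of _ "a * length S + b"]) auto
qed

lemma relaxed_cfeas:
  assumes "q < length S * length S" "relaxed (\<lambda>i. P ! i + t) ((!) S) (length S) (length P - 1) q w"
    "dist (P ! (length P - 1) + t) (S ! (q mod length S)) \<le> w" "P \<noteq> []"
  shows "cfeas P S t ((real (length P) + 1) * w)"
proof -
  have w: "0 \<le> w" using assms(3) zero_le_dist order_trans by blast
  have n: "length P - 1 < length P" using assms(4) by simp
  have "w \<le> (real (length P) + 1) * w" using w by (simp add: distrib_right)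
  then show ?thesis using reach_relaxed[OF assms(2,1) w n] assms(3) unfolding cfeas_def by fastforce
qed

lemma cfeas_alpha:
  fixes P S t r
  defines "\<alpha> \<equiv> alpha (\<lambda>i. P ! i + t) ((!) S) (length S) r (length P - 1)"
  shows "cfeas P S t r \<longleftrightarrow> (\<exists>q<length S * length S. \<alpha> q \<le> 1 \<and>
    dist (P ! (length P - 1) + t) (S ! (q mod length S)) \<le> r)"
proof
  assume "cfeas P S t r"
  then obtain qs a b \<theta> where r: "reach (\<lambda>i. P ! i + t) ((!) S) (length S) r (length P - 1) qs a b \<theta>"
     "dist (P ! (length P - 1) + t) (S ! b) \<le> r" unfolding cfeas_def by blast
  note b = reach_bounds[OF r(1)]
  have "\<alpha> (a * length S + b) \<le> 1" using alpha_le[OF r(1)] b(4) by (simp add: \<alpha>_def)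
  then show "\<exists>q<length S * length S. \<alpha> q \<le> 1 \<and> dist (P ! (length P - 1) + t) (S ! (q mod length S)) \<le> r"
    using pair_less[OF b(1,2)] b r(2) by (intro exI[of _ "a * length S + b"]) auto
next
  assume "\<exists>q<length S * length S. \<alpha> q \<le> 1 \<and> dist (P ! (length P - 1) + t) (S ! (q mod length S)) \<le> r"
  then show "cfeas P S t r" using reach_alpha unfolding cfeas_def \<alpha>_def by blast
qed

lemma cfeas_sound:
  assumes "cfeas P S t r" "P \<noteq> []" "S \<noteq> []"
  shows "\<exists>Q. subset_admissible (set S) Q \<and> frechet_dist (translate t P) Q \<le> r"
proof -
  obtain qs a b \<theta> where r: "reach (\<lambda>i. P ! i + t) ((!) S) (length S) r (length P - 1) qs a b \<theta>"
     "dist (P ! (length P - 1) + t) (S ! b) \<le> r" using assms unfolding cfeas_def by blast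
  note b = reach_bounds[OF r(1)]
  have "frechet_dist (translate t P) (map ((!) S) (qs @ [a, b])) \<le> r"
    by (rule frechet_dist_le_reach[where p = "\<lambda>i. P ! i + t" and k = "length S" and \<theta> = \<theta>])
      (use r assms(2) in \<open>auto simp: translate_def\<close>)
  moreover have "subset_admissible (set S) (map ((!) S) (qs @ [a, b]))"
    using b by (auto simp: subset_admissible_def)
  ultimately show ?thesis by blast
qed

lemma cfeas_complete:
  assumes "P \<noteq> []" "subset_admissible (set S) Q" "frechet_dist (translate t P) Q < r"
  shows "cfeas P S t r"
proof -
  have "set Q \<subseteq> (!) S ` {..<length S}"
    using assms(2) by (force simp: subset_admissible_def in_set_conv_nth)
  then have "\<exists>qs a b \<theta>. reach (\<lambda>i. P ! i + t) ((!) S) (length S) r (length (translate t P) - 1) qs a b \<theta> \<and>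
      dist (P ! (length (translate t P) - 1) + t) (S ! b) \<le> r"
    by (intro reach_frechet_dist_less[OF assms(3)])
      (use assms(1,2) in \<open>auto simp: translate_def subset_admissible_def\<close>)
  then show ?thesis by (simp add: cfeas_def translate_def)
qed

lemma cfeas_mono: "cfeas P S t r \<Longrightarrow> r \<le> r' \<Longrightarrow> cfeas P S t r'"
  unfolding cfeas_def using reach_mono order_trans by blast

lemma cfeas_translate:
  assumes "cfeas P S t r"
  shows "cfeas P S t' (r + dist t t')"
proof -
  obtain qs a b \<theta> where r: "reach (\<lambda>i. P ! i + t) ((!) S) (length S) r (length P - 1) qs a b \<theta>"
     "dist (P ! (length P - 1) + t) (S ! b) \<le> r" using assms unfolding cfeas_def by blast
  have n: "norm (t' - t) = dist t t'" by (simp add: dist_norm norm_minus_commute)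
  have "(\<lambda>i. P ! i + t + (t' - t)) = (\<lambda>i. P ! i + t')" by (simp add: algebra_simps)
  then have "reach (\<lambda>i. P ! i + t') ((!) S) (length S) (r + dist t t') (length P - 1) qs a b \<theta>"
    using reach_translate[OF r(1), of "t' - t"] n by simp
  moreover have "dist (P ! (length P - 1) + t') (S ! b) \<le> r + dist t t'"
    using dist_translate_le[OF r(2), of "t' - t"] n by simp
  ultimately show ?thesis unfolding cfeas_def by blast
qed

lemma cfeas_near:
  assumes "cfeas P S t r"
  shows "\<exists>j<length S. dist (P ! 0 + t) (S ! j) \<le> r"
proof -
  have "\<exists>j<k. dist (p 0) (S' j) \<le> r" if "reach p S' k r i qs a b \<theta>" for p :: "nat \<Rightarrow> 'a" and S' k i qs a b \<theta>
    using that by (induction rule: reach.induct) auto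
  then show ?thesis using assms unfolding cfeas_def by blast
qed

context axes
begin

section \<open>Correctness of the evaluation\<close>

lemma wp_ceval:
  assumes PS: "P \<noteq> []" "S \<noteq> []" and s: "inp P S \<epsilon> s"
  shows "wp ceval s (\<lambda>t s'. t \<le> 40 * length P * length S * length S + 20 \<and> cfeas P S (vec 32 0 s) (real_at s' 44) \<and>
     (\<forall>r. cfeas P S (vec 32 0 s) r \<longrightarrow> real_at s' 44 \<le> (4 * (real (length P) + 1)) * r))"
    (is "wp _ _ ?Q")
proof -
  define T where "T = vec 32 0 s"
  let ?k = "length S" and ?n = "length P" and ?p = "\<lambda>i. P ! i + T"
  let ?rel = "relaxed ?p ((!) S) ?k"
  have k: "0 < ?k" "0 < ?n" "1 \<le> ?k * ?k" using PS by (auto simp: Suc_le_eq)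
  have fr: "inp P S \<epsilon> s' \<and> vec 32 0 s' = T \<and> nat_at s' 0 = ?n \<and> nat_at s' 1 = ?k \<and>
      nat_at s' 2 = ?k * ?k \<and> vval (VMoved (NConst 0)) s' = ?p 0 \<and> vval (VMoved NLast) s' = ?p (?n - 1) \<and>
      vval (VSite (NConst 0)) s' = S ! 0" if "same inner s s'" for s'
    using inner_frame[OF s that] k vval_VMoved[of P S \<epsilon> s' "NConst 0"] vval_VMoved[of P S \<epsilon> s' NLast]
      vval_VSite[of P S \<epsilon> s' "NConst 0"] by (simp add: T_def)
  have xy: "inp P S \<epsilon> s' \<Longrightarrow> nat_at s' 7 = q \<Longrightarrow> q < ?k * ?k \<Longrightarrow>
      vval (VSite XQ) s' = S ! (q div ?k) \<and> vval (VSite YQ) s' = S ! (q mod ?k)" for s' q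
    using inpD(7,8)[of P S \<epsilon> s' q] vval_VSite[of P S \<epsilon> s' XQ] vval_VSite[of P S \<epsilon> s' YQ] div_mod_less[of q ?k] by simp
  have up: "same inner s s'" if "same inner s s1" "same X s1 s'" "X \<subseteq> inner" for X s1 s'
    by (rule same_trans[OF that(1) same_mono[OF that(2,3)]])
  let ?L = "RMax (RA 46 (NV 7)) (VDist (VMoved NLast) (VSite YQ))"
  let ?f = "For 7 (NV 2) (RASet 44 (NConst 0) (RMin (RA 44 (NConst 0)) ?L))"
  let ?m = "RSet 44 (RMul (ROfNat (NAdd (NV 0) (NConst 1))) (RV 44))"
  show ?thesis unfolding ceval_def wp_Seq
  proof (rule wp_map_loop[where m = "?k * ?k" and f = "\<lambda>q. dist (?p 0) (S ! (q div ?k))"])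
    fix s' assume "same {7, 46} s s'"
    then have sm: "same inner s s'" by (rule same_mono) auto
    show "nval (NV 2) s' = ?k * ?k" using fr[OF sm] by simp
    fix q assume "q < ?k * ?k" "nat_at s' 7 = q"
    then show "rval (VDist (VMoved (NConst 0)) (VSite XQ)) s' = dist (?p 0) (S ! (q div ?k))"
      using fr[OF sm] xy[of s' q] by simp
  next
    fix t1 s1 assume t1: "t1 \<le> 3 * (?k * ?k) + 2" and sm: "same {7, 46} s s1"
      and A1: "\<And>q. q < ?k * ?k \<Longrightarrow> snd s1 (adr 46 q) = dist (?p 0) (S ! (q div ?k))"
    have sm1: "same inner s s1" by (rule same_mono[OF sm]) auto
    show "wp (For 6 NLast relax_step) s1 (\<lambda>t2 s2. wp (RSet 44 (RMax (RA 46 (NConst 0)) (VDist (VMoved NLast) (VSite (NConst 0))))) s2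
       (\<lambda>t3 s3. wp ?f s3 (\<lambda>t4 s4. wp ?m s4 (\<lambda>t5. ?Q (t1 + (t2 + (t3 + (t4 + t5))))))))"
    proof (rule wp_For_bounded[where m = "?n - 1" and X = "{7, 46, 47, 48}" and T = "25 * ?k * ?k" and
          I = "\<lambda>i s'. \<forall>q<?k * ?k. \<forall>w. snd s' (adr 46 q) \<le> w \<longleftrightarrow> ?rel i q w"])
      show "nval NLast s' = ?n - 1" if "same (insert 6 {7, 46, 47, 48}) s1 s'" for s'
        using fr[OF up[OF sm1 that]] by (auto simp: inner_def)
      show "\<forall>q<?k * ?k. \<forall>w. snd (nupd (adr 6 0) 0 s1) (adr 46 q) \<le> w \<longleftrightarrow> ?rel 0 q w" using A1 by simp
    next
      fix i s2 assume i: "i < ?n - 1" "nat_at s2 6 = i" and sm2: "same (insert 6 {7, 46, 47, 48}) s1 s2"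
        and I: "\<forall>q<?k * ?k. \<forall>w. snd s2 (adr 46 q) \<le> w \<longleftrightarrow> ?rel i q w"
      have f2: "inp P S \<epsilon> s2" "vec 32 0 s2 = T" using fr[OF up[OF sm1 sm2]] by (auto simp: inner_def)
      show "wp relax_step s2 (\<lambda>t' s'. t' \<le> 25 * ?k * ?k \<and>
          (\<forall>q<?k * ?k. \<forall>w. snd (nupd (adr 6 0) (Suc i) s') (adr 46 q) \<le> w \<longleftrightarrow> ?rel (Suc i) q w))"
        by (rule wp_relax_step[OF PS f2 i(2)]) (use i I in auto)
    next
      fix t2 s2 assume sm2: "same (insert 6 {7, 46, 47, 48}) s1 s2" and t2: "t2 \<le> (25 * ?k * ?k + 2) * (?n - 1) + 2"
        and I: "\<forall>q<?k * ?k. \<forall>w. snd s2 (adr 46 q) \<le> w \<longleftrightarrow> ?rel (?n - 1) q w"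
      have s2: "same inner s s2" by (rule up[OF sm1 sm2]) auto
      let ?D = "\<lambda>q. dist (?p (?n - 1)) (S ! (q mod ?k))"
      define c0 where "c0 = max (snd s2 (adr 46 0)) (dist (?p (?n - 1)) (S ! 0))"
      have c0: "rval (RMax (RA 46 (NConst 0)) (VDist (VMoved NLast) (VSite (NConst 0)))) s2 = c0"
        using fr[OF s2] by (simp add: c0_def)
      let ?s3 = "rupd (adr 44 0) c0 s2"
      have s3: "same inner s ?s3" by (rule same_trans[OF s2]) (simp add: same_rupd)
      have "wp ?f ?s3 (\<lambda>t4 s4. wp ?m s4 (\<lambda>t5. ?Q (t1 + (t2 + (1 + (t4 + t5))))))"
      proof (rule wp_scatter_min[where m = "?k * ?k" and G = "\<lambda>_. 0" and f = "\<lambda>q. max (snd s2 (adr 46 q)) (?D q)"])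
        fix s' assume a: "same {7, 44} ?s3 s'"
        have s': "same inner s s'" by (rule up[OF s3 a]) auto
        show "nval (NV 2) s' = ?k * ?k" using fr[OF s'] by simp
        fix q assume "q < ?k * ?k" "nat_at s' 7 = q"
        then show "rval ?L s' = max (snd s2 (adr 46 q)) (?D q) \<and> nval (NConst 0) s' = 0"
          using fr[OF s'] xy[of s' q] sameD(2)[OF a, of 46] by simp
      next
        fix t4 s4 assume t4: "t4 \<le> 3 * (?k * ?k) + 2" and a: "same {7, 44} ?s3 s4"
          and m: "\<And>j w. snd s4 (adr 44 j) \<le> w \<longleftrightarrow> snd ?s3 (adr 44 j) \<le> w \<or>
            (\<exists>q<?k * ?k. 0 = j \<and> max (snd s2 (adr 46 q)) (?D q) \<le> w)"
        have s4: "same inner s s4" by (rule up[OF s3 a]) auto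
        define C where "C = real_at s4 44"
        have C: "C \<le> w \<longleftrightarrow> (\<exists>q<?k * ?k. ?rel (?n - 1) q w \<and> ?D q \<le> w)" for w
        proof -
          have "C \<le> w \<longleftrightarrow> c0 \<le> w \<or> (\<exists>q<?k * ?k. max (snd s2 (adr 46 q)) (?D q) \<le> w)"
            unfolding C_def m by simp
          also have "\<dots> \<longleftrightarrow> (\<exists>q<?k * ?k. max (snd s2 (adr 46 q)) (?D q) \<le> w)"
          proof -
            \<comment> \<open>The initial value is the contribution of pair 0 and is thus absorbed
              by the minimum over all pairs.\<close>
            have "c0 = max (snd s2 (adr 46 0)) (?D 0)" "0 < ?k * ?k" using k by (simp_all add: c0_def)
            then show ?thesis by blast
          qed
          finally show ?thesis using I by auto
        qed
        \<comment> \<open>Taking the value itself as the bound \<open>w\<close> produces a pair of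
          sites that attains it.\<close>
        have fe: "cfeas P S T ((real ?n + 1) * C)" using C[of C] relaxed_cfeas[OF _ _ _ PS(1)] by auto
        have low: "(real ?n + 1) * C \<le> 4 * (real ?n + 1) * r" if f: "cfeas P S T r" for r
        proof -
          have "C \<le> 4 * r" using C cfeas_relaxed[OF f] by blast
          then have "(real ?n + 1) * C \<le> (real ?n + 1) * (4 * r)" by (intro mult_left_mono) auto
          then show ?thesis by (simp only: mult_ac)
        qed
        obtain n' where n': "?n = Suc n'" using k by (cases ?n) auto
        have "t1 + (t2 + (1 + (t4 + 1))) \<le> 40 * ?n * ?k * ?k + 20"
        proof -
          have "n' \<le> n' * (?k * ?k)" using k(3) by simp
          moreover have "t2 \<le> 25 * (n' * (?k * ?k)) + 2 * n' + 2" using t2 unfolding n' by (simp add: algebra_simps)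
          ultimately have "t1 + (t2 + (1 + (t4 + 1))) \<le> 27 * (n' * (?k * ?k)) + 6 * (?k * ?k) + 8" using t1 t4 by linarith
          also have "\<dots> \<le> 40 * (n' * (?k * ?k) + ?k * ?k) + 20" by simp
          finally show ?thesis unfolding n' by (simp add: algebra_simps)
        qed
        then show "wp ?m s4 (\<lambda>t5. ?Q (t1 + (t2 + (1 + (t4 + t5)))))"
          using fe low fr[OF s4] by (simp add: C_def T_def[symmetric] add.commute)
      qed auto
      then show "wp (RSet 44 (RMax (RA 46 (NConst 0)) (VDist (VMoved NLast) (VSite (NConst 0))))) s2
       (\<lambda>t3 s3. wp ?f s3 (\<lambda>t4 s4. wp ?m s4 (\<lambda>t5. ?Q (t1 + (t2 + (t3 + (t4 + t5)))))))"
        unfolding wp_RStore c0 nval_Ad nval.simps .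
    qed (use writes_relax_step in auto)
  qed auto
qed

section \<open>The decision procedure as a program\<close>

definition BSwitch :: "rexp \<Rightarrow> nexp \<Rightarrow> nexp \<Rightarrow> bexp" where
  "BSwitch L i a = BAnd (RLe L (RNat 1)) (RLe (VDist (VSite a) (VLine (VMoved i) (VMoved (NAdd i (NConst 1)))
     (RMax L (RFirst (VSite a) (VMoved i) (VMoved (NAdd i (NConst 1))) (RV 37))))) (RV 37))"

definition REntry :: rexp where
  "REntry = RFirst (VSite YQ) (VMoved (NV 6)) (VMoved NNext) (RV 37)"

definition scan_loop :: com where
  "scan_loop = For 7 (NV 2) (Cond (BAnd (RLe (RA 46 (NV 7)) (RNat 1))
      (BAnd (RLe (VDist (VSite YQ) (VLine (VMoved (NV 6)) (VMoved NNext) REntry)) (RV 37)) (RLess REntry (RV 49))))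
    (Seq (RSet 49 REntry) (NASet 12 (NV 6) (NV 7))) Skip)"

definition advance_loop :: com where
  "advance_loop = For 7 (NV 2)
    (Seq (Cond (BSwitch (RV 49) (NV 6) XQ) (RSet 51 (RNat 0)) (RSet 51 (RA 46 (NV 7))))
    (Seq (RSet 52 (RMax (RV 51) (RFirst (VMoved NNext) (VSite XQ) (VSite YQ) (RV 37))))
      (Cond (BAnd (RLe (RV 51) (RNat 1)) (RLe (VDist (VMoved NNext) (VLine (VSite XQ) (VSite YQ) (RV 52))) (RV 37)))
        (RASet 46 (NV 7) (RV 52)) (RASet 46 (NV 7) (RNat 2)))))"

text \<open>Cell 49 is the running minimum of \<open>scan\<close>. Its final value and the chosen
  edge are kept for each vertex, in arrays 50 and 12, because the curve is traced from them
  later.\<close>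

definition decide_step :: com where
  "decide_step = Seq (RSet 49 (RNat 2)) (Seq (NASet 12 (NV 6) (NConst 0))
     (Seq scan_loop (Seq (RASet 50 (NV 6) (RV 49)) advance_loop)))"

definition cdecide :: com where
  "cdecide = Seq (For 7 (NV 2) (Cond (RLe (VDist (VMoved (NConst 0)) (VSite XQ)) (RV 37))
       (RASet 46 (NV 7) (RNat 0)) (RASet 46 (NV 7) (RNat 2))))
     (Seq (For 6 NLast decide_step)
     (Seq (NSet 11 (NConst 0))
       (For 7 (NV 2) (Cond (BAnd (RLe (RA 46 (NV 7)) (RNat 1)) (RLe (VDist (VMoved NLast) (VSite YQ)) (RV 37)))
         (Seq (NSet 11 (NConst 1)) (NSet 15 (NV 7))) Skip))))"

lemma writes_decide_step: "writes {7, 12, 46, 49, 50, 51, 52} decide_step"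
  unfolding decide_step_def scan_loop_def advance_loop_def by (intro writes_intros) auto

lemma writes_cdecide: "writes inner cdecide"
  unfolding cdecide_def by (intro writes_intros writes_mono[OF writes_decide_step]) auto

lemma bval_BSwitch:
  assumes "vval (VSite x) s = S a" "vval (VMoved j) s = p i" "vval (VMoved (NAdd j (NConst 1))) s = p (Suc i)"
    "real_at s 37 = r"
  shows "bval (BSwitch L j x) s \<longleftrightarrow> switches p S r (rval L s) i a"
  using assms by (simp add: BSwitch_def switches_def not_less)

lemma wp_decide_step:
  assumes PS: "P \<noteq> []" "S \<noteq> []" and s: "inp P S \<epsilon> s" "vec 32 0 s = T" "real_at s 37 = r"
    and i: "nat_at s 6 = i" "Suc i < length P"
    and A: "\<And>q. q < length S * length S \<Longrightarrow> snd s (adr 46 q) = alpha (\<lambda>i. P ! i + T) ((!) S) (length S) r i q"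
    and Q: "\<And>t s'. t \<le> 12 * (length S * length S) + 7 \<Longrightarrow>
      (\<And>q. q < length S * length S \<Longrightarrow> snd s' (adr 46 q) = alpha (\<lambda>i. P ! i + T) ((!) S) (length S) r (Suc i) q) \<Longrightarrow>
      snd s' (adr 50 i) = entry (\<lambda>i. P ! i + T) ((!) S) (length S) r i \<Longrightarrow>
      fst s' (adr 12 i) = pred (\<lambda>i. P ! i + T) ((!) S) (length S) r i \<Longrightarrow>
      (\<And>x. x \<noteq> i \<Longrightarrow> snd s' (adr 50 x) = snd s (adr 50 x) \<and> fst s' (adr 12 x) = fst s (adr 12 x)) \<Longrightarrow> Q t s'"
  shows "wp decide_step s Q"
proof -
  let ?k = "length S" and ?p = "\<lambda>i. P ! i + T"
  let ?al = "alpha ?p ((!) S) ?k r" and ?scan = "scan ?p ((!) S) ?k r"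
  let ?X = "{7, 12, 46, 49, 50, 51, 52}"
  have env: "inp P S \<epsilon> s' \<and> nat_at s' 6 = i \<and> nat_at s' 2 = ?k * ?k \<and> real_at s' 37 = r \<and>
      vval (VMoved (NV 6)) s' = ?p i \<and> vval (VMoved NNext) s' = ?p (Suc i)" if "same ?X s s'" for s'
  proof -
    have sm: "same inner s s'" by (rule same_mono[OF that]) auto
    have "nat_at s' 6 = i" using sameD(1)[OF that, of 6] i by simp
    then show ?thesis
      using inner_frame[OF s(1) sm] s i vval_VMoved[of P S \<epsilon> s' "NV 6"] vval_VMoved[of P S \<epsilon> s' NNext] by simp
  qed
  have xy: "nval XQ s' = q div ?k \<and> nval YQ s' = q mod ?k \<and>
      vval (VSite XQ) s' = S ! (q div ?k) \<and> vval (VSite YQ) s' = S ! (q mod ?k)"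
    if "inp P S \<epsilon> s'" "nat_at s' 7 = q" "q < ?k * ?k" for s' q
    using that inpD(7,8)[of P S \<epsilon> s' q] vval_VSite[of P S \<epsilon> s' XQ] vval_VSite[of P S \<epsilon> s' YQ] div_mod_less[of q ?k] by simp
  let ?s1 = "nupd (adr 12 i) 0 (rupd (adr 49 0) 2 s)"
  have s1: "same ?X s ?s1" by (simp add: same_def)
  have scan: "wp scan_loop ?s1 (\<lambda>t s'. t \<le> 5 * (?k * ?k) + 2 \<and> same {7, 12, 49} ?s1 s' \<and>
      (real_at s' 49, fst s' (adr 12 i)) = ?scan (?al i) i (?k * ?k) \<and>
      (\<forall>x. x \<noteq> i \<longrightarrow> fst s' (adr 12 x) = fst s (adr 12 x)))"
    unfolding scan_loop_def
  proof (rule wp_For_bounded[where m = "?k * ?k" and X = "{12, 49}" and T = 3 and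
      I = "\<lambda>m s'. (real_at s' 49, fst s' (adr 12 i)) = ?scan (?al i) i m \<and>
        (\<forall>x. x \<noteq> i \<longrightarrow> fst s' (adr 12 x) = fst s (adr 12 x))"])
    fix q s' assume q: "q < ?k * ?k" "nat_at s' 7 = q" and sm: "same (insert 7 {12, 49}) ?s1 s'"
      and I: "(real_at s' 49, fst s' (adr 12 i)) = ?scan (?al i) i q \<and> (\<forall>x. x \<noteq> i \<longrightarrow> fst s' (adr 12 x) = fst s (adr 12 x))"
    have e: "same ?X s s'" by (rule same_trans'[OF s1 sm]) auto
    note v = env[OF e]
    have w: "vval (VSite YQ) s' = S ! (q mod ?k)" "nval (NV 6) s' = i" "nval (NV 7) s' = q" using xy[of s' q] v q by simp_all
    have a: "snd s' (adr 46 q) = ?al i q" using sameD(2)[OF sm, of 46 q] A[OF q(1)] by simp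
    define \<mu> where "\<mu> = first_param (S ! (q mod ?k)) (?p i) (?p (Suc i)) r"
    have R: "rval REntry s' = \<mu>" using v w by (simp add: REntry_def \<mu>_def)
    have b: "bval (BAnd (RLe (RA 46 (NV 7)) (RNat 1))
      (BAnd (RLe (VDist (VSite YQ) (VLine (VMoved (NV 6)) (VMoved NNext) REntry)) (RV 37)) (RLess REntry (RV 49)))) s' \<longleftrightarrow>
      ?al i q \<le> 1 \<and> dist (S ! (q mod ?k)) (linepath (?p i) (?p (Suc i)) \<mu>) \<le> r \<and> \<mu> < real_at s' 49"
      using v w q a R by (simp add: not_less)
    have sc: "?scan (?al i) i (Suc q) = (if ?al i q \<le> 1 \<and> dist (S ! (q mod ?k)) (linepath (?p i) (?p (Suc i)) \<mu>) \<le> r \<and>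
        \<mu> < real_at s' 49 then (\<mu>, q) else (real_at s' 49, fst s' (adr 12 i)))"
      unfolding scan.simps Let_def \<mu>_def conjunct1[OF I, symmetric] by simp
    show "wp (Cond (BAnd (RLe (RA 46 (NV 7)) (RNat 1))
      (BAnd (RLe (VDist (VSite YQ) (VLine (VMoved (NV 6)) (VMoved NNext) REntry)) (RV 37)) (RLess REntry (RV 49))))
      (Seq (RSet 49 REntry) (NASet 12 (NV 6) (NV 7))) Skip) s'
      (\<lambda>t' s''. t' \<le> 3 \<and> (real_at (nupd (adr 7 0) (Suc q) s'') 49, fst (nupd (adr 7 0) (Suc q) s'') (adr 12 i)) = ?scan (?al i) i (Suc q) \<and>
        (\<forall>x. x \<noteq> i \<longrightarrow> fst (nupd (adr 7 0) (Suc q) s'') (adr 12 x) = fst s (adr 12 x)))"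
      unfolding wp_Cond b sc
    proof (split if_split, intro conjI impI)
      assume c: "?al i q \<le> 1 \<and> dist (S ! (q mod ?k)) (linepath (?p i) (?p (Suc i)) \<mu>) \<le> r \<and> \<mu> < real_at s' 49"
      show "wp (Seq (RSet 49 REntry) (NASet 12 (NV 6) (NV 7))) s' (\<lambda>t s''. 1 + t \<le> 3 \<and>
        (real_at (nupd (adr 7 0) (Suc q) s'') 49, fst (nupd (adr 7 0) (Suc q) s'') (adr 12 i)) =
          (if ?al i q \<le> 1 \<and> dist (S ! (q mod ?k)) (linepath (?p i) (?p (Suc i)) \<mu>) \<le> r \<and> \<mu> < real_at s' 49
           then (\<mu>, q) else (real_at s' 49, fst s' (adr 12 i))) \<and>
        (\<forall>x. x \<noteq> i \<longrightarrow> fst (nupd (adr 7 0) (Suc q) s'') (adr 12 x) = fst s (adr 12 x)))"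
        unfolding wp_Seq wp_RStore wp_NStore R if_P[OF c] using w I by simp
    next
      assume c: "\<not> (?al i q \<le> 1 \<and> dist (S ! (q mod ?k)) (linepath (?p i) (?p (Suc i)) \<mu>) \<le> r \<and> \<mu> < real_at s' 49)"
      show "wp Skip s' (\<lambda>t s''. 1 + t \<le> 3 \<and>
        (real_at (nupd (adr 7 0) (Suc q) s'') 49, fst (nupd (adr 7 0) (Suc q) s'') (adr 12 i)) =
          (if ?al i q \<le> 1 \<and> dist (S ! (q mod ?k)) (linepath (?p i) (?p (Suc i)) \<mu>) \<le> r \<and> \<mu> < real_at s' 49
           then (\<mu>, q) else (real_at s' 49, fst s' (adr 12 i))) \<and>
        (\<forall>x. x \<noteq> i \<longrightarrow> fst (nupd (adr 7 0) (Suc q) s'') (adr 12 x) = fst s (adr 12 x)))"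
        unfolding if_not_P[OF c] using I by simp
    qed
  next
    fix s' assume "same (insert 7 {12, 49}) ?s1 s'"
    then have "same ?X s s'" by (rule same_trans'[OF s1]) auto
    from env[OF this] show "nval (NV 2) s' = ?k * ?k" by simp
  qed (auto intro!: writes_intros)
  have "wp scan_loop ?s1 (\<lambda>t2 s2. wp (RASet 50 (NV 6) (RV 49)) s2 (\<lambda>t3 s3. wp advance_loop s3 (\<lambda>t4. Q (1 + (1 + (t2 + (t3 + t4)))))))"
  proof (rule wp_mono[OF scan], elim conjE)
    fix t2 s2 assume t2: "t2 \<le> 5 * (?k * ?k) + 2" and sm2: "same {7, 12, 49} ?s1 s2"
      and sc: "(real_at s2 49, fst s2 (adr 12 i)) = ?scan (?al i) i (?k * ?k)"
      and fr: "\<forall>x. x \<noteq> i \<longrightarrow> fst s2 (adr 12 x) = fst s (adr 12 x)"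
    have e2: "same ?X s s2" by (rule same_trans'[OF s1 sm2]) auto
    define L where "L = real_at s2 49"
    have L: "L = fst (?scan (?al i) i (?k * ?k))" "fst s2 (adr 12 i) = snd (?scan (?al i) i (?k * ?k))"
      unfolding L_def sc[symmetric] by simp_all
    let ?s3 = "rupd (adr 50 i) L s2"
    have e3: "same ?X s ?s3" by (rule same_trans[OF e2]) (simp add: same_rupd)
    have a46: "snd ?s3 (adr 46 q) = ?al i q" if "q < ?k * ?k" for q using sameD(2)[OF sm2, of 46 q] A[OF that] by simp
    \<comment> \<open>The update in place is sound: the new value for \<open>q\<close> depends on
      the old value for \<open>q\<close> only, and the entry parameter has been fixed before the
      loop.\<close>
    have "wp advance_loop ?s3 (\<lambda>t4. Q (1 + (1 + (t2 + (1 + t4)))))"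
      unfolding advance_loop_def
    proof (rule wp_For_bounded[where m = "?k * ?k" and X = "{46, 51, 52}" and T = 5 and
        I = "\<lambda>m s'. (\<forall>q<m. snd s' (adr 46 q) = ?al (Suc i) q) \<and> (\<forall>q. m \<le> q \<and> q < ?k * ?k \<longrightarrow> snd s' (adr 46 q) = ?al i q)"])
      fix q s' assume q: "q < ?k * ?k" "nat_at s' 7 = q" and sm: "same (insert 7 {46, 51, 52}) ?s3 s'"
        and I: "(\<forall>x<q. snd s' (adr 46 x) = ?al (Suc i) x) \<and> (\<forall>x. q \<le> x \<and> x < ?k * ?k \<longrightarrow> snd s' (adr 46 x) = ?al i x)"
      have e: "same ?X s s'" by (rule same_trans'[OF e3 sm]) auto
      note v = env[OF e]
      have w: "vval (VSite YQ) s' = S ! (q mod ?k)" "vval (VSite XQ) s' = S ! (q div ?k)" "nval XQ s' = q div ?k"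
        using xy[of s' q] v q by simp_all
      have a: "snd s' (adr 46 q) = ?al i q" using I q by simp
      have L': "real_at s' 49 = L" using sameD(2)[OF sm, of 49] by (simp add: L_def)
      let ?sw = "switches ?p ((!) S) r L i (q div ?k)"
      define base where "base = (if ?sw then 0 else ?al i q)"
      have b: "bval (BSwitch (RV 49) (NV 6) XQ) s' \<longleftrightarrow> ?sw"
        using bval_BSwitch[of XQ s' "(!) S" "q div ?k" "NV 6" ?p i r "RV 49"] v w L' by simp
      define \<theta> where "\<theta> = max base (first_param (?p (Suc i)) (S ! (q div ?k)) (S ! (q mod ?k)) r)"
      have new: "?al (Suc i) q = (if base \<le> 1 \<and> dist (?p (Suc i)) (linepath (S ! (q div ?k)) (S ! (q mod ?k)) \<theta>) \<le> r then \<theta> else 2)"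
        unfolding alpha.simps advance_def Let_def L(1)[symmetric] base_def[symmetric] \<theta>_def ..
      let ?C1 = "Cond (BSwitch (RV 49) (NV 6) XQ) (RSet 51 (RNat 0)) (RSet 51 (RA 46 (NV 7)))"
      let ?C2 = "Cond (BAnd (RLe (RV 51) (RNat 1)) (RLe (VDist (VMoved NNext) (VLine (VSite XQ) (VSite YQ) (RV 52))) (RV 37)))
        (RASet 46 (NV 7) (RV 52)) (RASet 46 (NV 7) (RNat 2))"
      let ?G = "\<lambda>(t::nat) s''. t \<le> 5 \<and> (\<forall>x<Suc q. snd (nupd (adr 7 0) (Suc q) s'') (adr 46 x) = ?al (Suc i) x) \<and>
        (\<forall>x. Suc q \<le> x \<and> x < ?k * ?k \<longrightarrow> snd (nupd (adr 7 0) (Suc q) s'') (adr 46 x) = ?al i x)"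
      have C1: "wp ?C1 s' Q' \<longleftrightarrow> Q' 2 (rupd (adr 51 0) base s')" for Q'
        unfolding wp_Cond b using q a by (simp add: base_def numeral_2_eq_2)
      let ?s4 = "rupd (adr 51 0) base s'"
      have sm4: "same (insert 7 {46, 51, 52}) ?s3 ?s4" by (rule same_trans[OF sm]) (simp add: same_rupd)
      have e4: "same ?X s ?s4" by (rule same_trans'[OF e3 sm4]) auto
      have w4: "vval (VSite YQ) ?s4 = S ! (q mod ?k)" "vval (VSite XQ) ?s4 = S ! (q div ?k)"
        using xy[of ?s4 q] env[OF e4] q by simp_all
      have r52: "rval (RMax (RV 51) (RFirst (VMoved NNext) (VSite XQ) (VSite YQ) (RV 37))) ?s4 = \<theta>"
        using env[OF e4] w4 by (simp add: \<theta>_def)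
      let ?s5 = "rupd (adr 52 0) \<theta> ?s4"
      have e5: "same ?X s ?s5" by (rule same_trans[OF e4]) (simp add: same_rupd)
      have w5: "vval (VSite YQ) ?s5 = S ! (q mod ?k)" "vval (VSite XQ) ?s5 = S ! (q div ?k)"
        using xy[of ?s5 q] env[OF e5] q by simp_all
      have b5: "bval (BAnd (RLe (RV 51) (RNat 1)) (RLe (VDist (VMoved NNext) (VLine (VSite XQ) (VSite YQ) (RV 52))) (RV 37))) ?s5 \<longleftrightarrow>
        base \<le> 1 \<and> dist (?p (Suc i)) (linepath (S ! (q div ?k)) (S ! (q mod ?k)) \<theta>) \<le> r"
        using env[OF e5] w5 by (simp add: not_less)
      have fin: "?G 5 (rupd (adr 46 q) (?al (Suc i) q) ?s5)" using I by (simp add: less_Suc_eq)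
      have C2: "wp ?C2 ?s5 Q' \<longleftrightarrow> Q' 2 (rupd (adr 46 q) (?al (Suc i) q) ?s5)" for Q'
        unfolding wp_Cond b5 new using q by (simp add: numeral_2_eq_2)
      show "wp (Seq ?C1 (Seq (RSet 52 (RMax (RV 51) (RFirst (VMoved NNext) (VSite XQ) (VSite YQ) (RV 37)))) ?C2)) s' ?G"
        unfolding wp_Seq C1 wp_RStore r52 nval_Ad nval.simps C2 using fin by simp
    next
      fix s' assume "same (insert 7 {46, 51, 52}) ?s3 s'"
      then have "same ?X s s'" by (rule same_trans'[OF e3]) auto
      from env[OF this] show "nval (NV 2) s' = ?k * ?k" by simp
    next
      fix t s' assume sm: "same (insert 7 {46, 51, 52}) ?s3 s'" and t: "t \<le> (5 + 2) * (?k * ?k) + 2"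
        and I: "(\<forall>q<?k * ?k. snd s' (adr 46 q) = ?al (Suc i) q) \<and> (\<forall>q. ?k * ?k \<le> q \<and> q < ?k * ?k \<longrightarrow> snd s' (adr 46 q) = ?al i q)"
      show "Q (1 + (1 + (t2 + (1 + t)))) s'"
      proof (rule Q)
        have "t \<le> 7 * (?k * ?k) + 2" using t by simp
        then show "1 + (1 + (t2 + (1 + t))) \<le> 12 * (?k * ?k) + 7" using t2 by linarith
        show "snd s' (adr 50 i) = fst (?scan (?al i) i (?k * ?k))" using sameD(2)[OF sm, of 50 i] L by simp
        show "fst s' (adr 12 i) = snd (?scan (?al i) i (?k * ?k))" using sameD(1)[OF sm, of 12 i] L by simp
        show "snd s' (adr 50 x) = snd s (adr 50 x) \<and> fst s' (adr 12 x) = fst s (adr 12 x)" if "x \<noteq> i" for x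
          using sameD(2)[OF sm, of 50 x] sameD(1)[OF sm, of 12 x] sameD(2)[OF sm2, of 50 x] fr that by simp
      qed (use I in blast)
    qed (use a46 in \<open>auto intro!: writes_intros\<close>)
    then show "wp (RASet 50 (NV 6) (RV 49)) s2 (\<lambda>t3 s3. wp advance_loop s3 (\<lambda>t4. Q (1 + (1 + (t2 + (t3 + t4))))))"
      using env[OF e2] by (simp add: L_def)
  qed
  then show ?thesis unfolding decide_step_def wp_Seq wp_RStore wp_NStore nval_Ad nval.simps rval.simps
    using i by simp
qed

lemma wp_cdecide:
  assumes PS: "P \<noteq> []" "S \<noteq> []" and s: "inp P S \<epsilon> s" "vec 32 0 s = T" "real_at s 37 = r"
    and Q: "\<And>t s'. t \<le> 21 * (length P * (length S * length S)) + 7 \<Longrightarrow> same inner s s' \<Longrightarrow>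
      nat_at s' 11 = (if cfeas P S T r then 1 else 0) \<Longrightarrow>
      (cfeas P S T r \<Longrightarrow> nat_at s' 15 < length S * length S \<and>
        alpha (\<lambda>i. P ! i + T) ((!) S) (length S) r (length P - 1) (nat_at s' 15) \<le> 1 \<and>
        dist (P ! (length P - 1) + T) (S ! (nat_at s' 15 mod length S)) \<le> r) \<Longrightarrow>
      (\<And>i. i < length P - 1 \<Longrightarrow> snd s' (adr 50 i) = entry (\<lambda>i. P ! i + T) ((!) S) (length S) r i \<and>
        fst s' (adr 12 i) = pred (\<lambda>i. P ! i + T) ((!) S) (length S) r i) \<Longrightarrow> Q t s'"
  shows "wp cdecide s Q"
proof -
  let ?k = "length S" and ?n = "length P" and ?p = "\<lambda>i. P ! i + T"
  let ?al = "alpha ?p ((!) S) ?k r"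
  let ?en = "entry ?p ((!) S) ?k r" and ?pr = "pred ?p ((!) S) ?k r"
  have k: "1 \<le> ?k" "1 \<le> ?n" using PS by (auto simp: Suc_le_eq)
  have fr: "inp P S \<epsilon> s' \<and> vec 32 0 s' = T \<and> real_at s' 37 = r \<and> nat_at s' 0 = ?n \<and>
      nat_at s' 2 = ?k * ?k \<and> vval (VMoved (NConst 0)) s' = ?p 0 \<and> vval (VMoved NLast) s' = ?p (?n - 1)"
    if "same inner s s'" for s'
    using inner_frame[OF s(1) that] k s PS vval_VMoved[of P S \<epsilon> s' "NConst 0"] vval_VMoved[of P S \<epsilon> s' NLast] by simp
  have xy: "vval (VSite XQ) s' = S ! (q div ?k) \<and> vval (VSite YQ) s' = S ! (q mod ?k)"
    if "inp P S \<epsilon> s'" "nat_at s' 7 = q" "q < ?k * ?k" for s' q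
    using that inpD(7,8)[of P S \<epsilon> s' q] vval_VSite[of P S \<epsilon> s' XQ] vval_VSite[of P S \<epsilon> s' YQ] div_mod_less[of q ?k] by simp
  have up: "same inner s s'" if "same inner s s1" "same X s1 s'" "X \<subseteq> inner" for X s1 s'
    by (rule same_trans[OF that(1) same_mono[OF that(2,3)]])
  let ?acc = "\<lambda>q. ?al (?n - 1) q \<le> 1 \<and> dist (?p (?n - 1)) (S ! (q mod ?k)) \<le> r"
  let ?C0 = "Cond (RLe (VDist (VMoved (NConst 0)) (VSite XQ)) (RV 37)) (RASet 46 (NV 7) (RNat 0)) (RASet 46 (NV 7) (RNat 2))"
  let ?C1 = "Cond (BAnd (RLe (RA 46 (NV 7)) (RNat 1)) (RLe (VDist (VMoved NLast) (VSite YQ)) (RV 37)))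
         (Seq (NSet 11 (NConst 1)) (NSet 15 (NV 7))) Skip"
  show ?thesis unfolding cdecide_def wp_Seq
  proof (rule wp_For_bounded[where m = "?k * ?k" and X = "{46}" and T = 2 and
      I = "\<lambda>m s'. \<forall>q<m. snd s' (adr 46 q) = ?al 0 q"])
    fix q s' assume q: "q < ?k * ?k" "nat_at s' 7 = q" and sm: "same (insert 7 {46}) s s'"
      and I: "\<forall>x<q. snd s' (adr 46 x) = ?al 0 x"
    have e: "same inner s s'" by (rule same_mono[OF sm]) auto
    have "bval (RLe (VDist (VMoved (NConst 0)) (VSite XQ)) (RV 37)) s' \<longleftrightarrow> dist (?p 0) (S ! (q div ?k)) \<le> r"
      using fr[OF e] xy[of s' q] q by (simp add: not_less)
    then show "wp ?C0 s' (\<lambda>t' s''. t' \<le> 2 \<and> (\<forall>x<Suc q. snd (nupd (adr 7 0) (Suc q) s'') (adr 46 x) = ?al 0 x))"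
      unfolding wp_Cond using I q by (simp add: less_Suc_eq)
  next
    fix s' assume "same (insert 7 {46}) s s'"
    then have "same inner s s'" by (rule same_mono) auto
    from fr[OF this] show "nval (NV 2) s' = ?k * ?k" by simp
  next
    fix t1 s1 assume sm: "same (insert 7 {46}) s s1" and I1: "\<forall>q<?k * ?k. snd s1 (adr 46 q) = ?al 0 q"
      and t1: "t1 \<le> (2 + 2) * (?k * ?k) + 2"
    have e1: "same inner s s1" by (rule same_mono[OF sm]) auto
    show "wp (For 6 NLast decide_step) s1 (\<lambda>t2 s2. wp (NSet 11 (NConst 0)) s2 (\<lambda>t3 s3.
      wp (For 7 (NV 2) ?C1) s3 (\<lambda>t4. Q (t1 + (t2 + (t3 + t4))))))"
    proof (rule wp_For_bounded[where m = "?n - 1" and X = "{7, 12, 46, 49, 50, 51, 52}" and T = "12 * (?k * ?k) + 7" and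
      I = "\<lambda>i s'. (\<forall>q<?k * ?k. snd s' (adr 46 q) = ?al i q) \<and>
        (\<forall>x<i. snd s' (adr 50 x) = ?en x \<and> fst s' (adr 12 x) = ?pr x)"])
      fix i s2 assume i: "i < ?n - 1" "nat_at s2 6 = i" and sm2: "same (insert 6 {7, 12, 46, 49, 50, 51, 52}) s1 s2"
        and I: "(\<forall>q<?k * ?k. snd s2 (adr 46 q) = ?al i q) \<and> (\<forall>x<i. snd s2 (adr 50 x) = ?en x \<and> fst s2 (adr 12 x) = ?pr x)"
      have e2: "same inner s s2" by (rule up[OF e1 sm2]) auto
      have f2: "inp P S \<epsilon> s2" "vec 32 0 s2 = T" "real_at s2 37 = r" using fr[OF e2] by auto
      have i': "Suc i < ?n" using i by simp
      show "wp decide_step s2 (\<lambda>t' s'. t' \<le> 12 * (?k * ?k) + 7 \<and>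
        (\<forall>q<?k * ?k. snd (nupd (adr 6 0) (Suc i) s') (adr 46 q) = ?al (Suc i) q) \<and>
        (\<forall>x<Suc i. snd (nupd (adr 6 0) (Suc i) s') (adr 50 x) = ?en x \<and> fst (nupd (adr 6 0) (Suc i) s') (adr 12 x) = ?pr x))"
      proof (rule wp_decide_step[OF PS f2 i(2) i'])
        fix q assume "q < ?k * ?k" then show "snd s2 (adr 46 q) = ?al i q" using I by blast
      next
        fix t' s' assume a: "t' \<le> 12 * (?k * ?k) + 7" "\<And>q. q < ?k * ?k \<Longrightarrow> snd s' (adr 46 q) = ?al (Suc i) q"
          "snd s' (adr 50 i) = ?en i" "fst s' (adr 12 i) = ?pr i"
          "\<And>x. x \<noteq> i \<Longrightarrow> snd s' (adr 50 x) = snd s2 (adr 50 x) \<and> fst s' (adr 12 x) = fst s2 (adr 12 x)"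
        have "snd s' (adr 50 x) = ?en x \<and> fst s' (adr 12 x) = ?pr x" if "x < Suc i" for x
        proof (cases "x = i")
          case False
          then have "x < i" using that by simp
          then show ?thesis using a(5)[OF False] I by metis
        qed (use a in simp)
        then show "t' \<le> 12 * (?k * ?k) + 7 \<and>
        (\<forall>q<?k * ?k. snd (nupd (adr 6 0) (Suc i) s') (adr 46 q) = ?al (Suc i) q) \<and>
        (\<forall>x<Suc i. snd (nupd (adr 6 0) (Suc i) s') (adr 50 x) = ?en x \<and> fst (nupd (adr 6 0) (Suc i) s') (adr 12 x) = ?pr x)"
          using a(1,2) by (simp del: alpha.simps)
      qed
    next
      fix s' assume a: "same (insert 6 {7, 12, 46, 49, 50, 51, 52}) s1 s'"
      have "same inner s s'" by (rule up[OF e1 a]) auto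
      from fr[OF this] show "nval NLast s' = ?n - 1" by simp
    next
      show "(\<forall>q<?k * ?k. snd (nupd (adr 6 0) 0 s1) (adr 46 q) = ?al 0 q) \<and>
        (\<forall>x<0. snd (nupd (adr 6 0) 0 s1) (adr 50 x) = ?en x \<and> fst (nupd (adr 6 0) 0 s1) (adr 12 x) = ?pr x)"
        using I1 by simp
    next
      fix t2 s2 assume sm2: "same (insert 6 {7, 12, 46, 49, 50, 51, 52}) s1 s2" and t2: "t2 \<le> (12 * (?k * ?k) + 7 + 2) * (?n - 1) + 2"
        and I: "(\<forall>q<?k * ?k. snd s2 (adr 46 q) = ?al (?n - 1) q) \<and>
          (\<forall>x<?n - 1. snd s2 (adr 50 x) = ?en x \<and> fst s2 (adr 12 x) = ?pr x)"
      have e2: "same inner s s2" by (rule up[OF e1 sm2]) auto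
      let ?s3 = "nupd (adr 11 0) 0 s2"
      have e3: "same inner s ?s3" by (rule same_trans[OF e2]) (simp add: same_nupd)
      have "wp (For 7 (NV 2) ?C1) ?s3 (\<lambda>t4. Q (t1 + (t2 + (1 + t4))))"
      proof (rule wp_For_bounded[where m = "?k * ?k" and X = "{11, 15}" and T = 3 and
          I = "\<lambda>m s'. nat_at s' 11 = (if \<exists>q<m. ?acc q then 1 else 0) \<and>
            ((\<exists>q<m. ?acc q) \<longrightarrow> nat_at s' 15 < m \<and> ?acc (nat_at s' 15))"])
        fix q s' assume q: "q < ?k * ?k" "nat_at s' 7 = q" and sm: "same (insert 7 {11, 15}) ?s3 s'"
          and J: "nat_at s' 11 = (if \<exists>x<q. ?acc x then 1 else 0) \<and> ((\<exists>x<q. ?acc x) \<longrightarrow> nat_at s' 15 < q \<and> ?acc (nat_at s' 15))"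
        have e: "same inner s s'" by (rule up[OF e3 sm]) auto
        have "snd s' (adr 46 q) = ?al (?n - 1) q" using sameD(2)[OF sm, of 46 q] I q by simp
        then have b: "bval (BAnd (RLe (RA 46 (NV 7)) (RNat 1)) (RLe (VDist (VMoved NLast) (VSite YQ)) (RV 37))) s' \<longleftrightarrow> ?acc q"
          using fr[OF e] xy[of s' q] q by (simp add: not_less)
        show "wp ?C1 s' (\<lambda>t' s''. t' \<le> 3 \<and> nat_at (nupd (adr 7 0) (Suc q) s'') 11 = (if \<exists>x<Suc q. ?acc x then 1 else 0) \<and>
            ((\<exists>x<Suc q. ?acc x) \<longrightarrow> nat_at (nupd (adr 7 0) (Suc q) s'') 15 < Suc q \<and> ?acc (nat_at (nupd (adr 7 0) (Suc q) s'') 15)))"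
          unfolding wp_Cond b
        proof (split if_split, intro conjI impI)
          assume c: "?acc q"
          have E: "(\<exists>x<Suc q. ?acc x) \<longleftrightarrow> True" using c by blast
          show "wp (Seq (NSet 11 (NConst 1)) (NSet 15 (NV 7))) s' (\<lambda>t s''. 1 + t \<le> 3 \<and>
            nat_at (nupd (adr 7 0) (Suc q) s'') 11 = (if \<exists>x<Suc q. ?acc x then 1 else 0) \<and>
            ((\<exists>x<Suc q. ?acc x) \<longrightarrow> nat_at (nupd (adr 7 0) (Suc q) s'') 15 < Suc q \<and> ?acc (nat_at (nupd (adr 7 0) (Suc q) s'') 15)))"
            unfolding E using c q by simp
        next
          assume c: "\<not> ?acc q"
          have E: "(\<exists>x<Suc q. ?acc x) \<longleftrightarrow> (\<exists>x<q. ?acc x)" using c less_Suc_eq by metis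
          have J': "(\<exists>x<q. ?acc x) \<longrightarrow> nat_at s' 15 < Suc q \<and> ?acc (nat_at s' 15)"
            using conjunct2[OF J] less_SucI by blast
          show "wp Skip s' (\<lambda>t s''. 1 + t \<le> 3 \<and>
            nat_at (nupd (adr 7 0) (Suc q) s'') 11 = (if \<exists>x<Suc q. ?acc x then 1 else 0) \<and>
            ((\<exists>x<Suc q. ?acc x) \<longrightarrow> nat_at (nupd (adr 7 0) (Suc q) s'') 15 < Suc q \<and> ?acc (nat_at (nupd (adr 7 0) (Suc q) s'') 15)))"
            unfolding E using conjunct1[OF J] J' by simp
        qed
      next
        fix s' assume a: "same (insert 7 {11, 15}) ?s3 s'"
        have "same inner s s'" by (rule up[OF e3 a]) auto
        from fr[OF this] show "nval (NV 2) s' = ?k * ?k" by simp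
      next
        fix t4 s4 assume sm4: "same (insert 7 {11, 15}) ?s3 s4" and t4: "t4 \<le> (3 + 2) * (?k * ?k) + 2"
          and J: "nat_at s4 11 = (if \<exists>q<?k * ?k. ?acc q then 1 else 0) \<and>
            ((\<exists>q<?k * ?k. ?acc q) \<longrightarrow> nat_at s4 15 < ?k * ?k \<and> ?acc (nat_at s4 15))"
        have ca: "cfeas P S T r \<longleftrightarrow> (\<exists>q<?k * ?k. ?acc q)" by (rule cfeas_alpha)
        show "Q (t1 + (t2 + (1 + t4))) s4"
        proof (rule Q)
          obtain m where m: "?n = Suc m" using k by (cases ?n) auto
          have t1': "t1 \<le> 4 * (?k * ?k) + 2" and t4': "t4 \<le> 5 * (?k * ?k) + 2" using t1 t4 by simp_all
          have "m \<le> m * (?k * ?k)" using k by simp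
          then have "(12 * (?k * ?k) + 7 + 2) * (?n - 1) \<le> 21 * (m * (?k * ?k))" unfolding m by (simp add: algebra_simps)
          then have "t1 + (t2 + (1 + t4)) \<le> 21 * (m * (?k * ?k)) + 9 * (?k * ?k) + 7"
            using t1' t2 t4' by linarith
          then show "t1 + (t2 + (1 + t4)) \<le> 21 * (?n * (?k * ?k)) + 7" unfolding m by simp
          show "same inner s s4" by (rule up[OF e3 sm4]) auto
          show "snd s4 (adr 50 i) = ?en i \<and> fst s4 (adr 12 i) = ?pr i" if "i < ?n - 1" for i
            using sameD(2)[OF sm4, of 50 i] sameD(1)[OF sm4, of 12 i] I that by simp
          show "nat_at s4 11 = (if cfeas P S T r then 1 else 0)" unfolding ca by (rule conjunct1[OF J])
          show "nat_at s4 15 < ?k * ?k \<and> ?acc (nat_at s4 15)" if "cfeas P S T r"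
            using conjunct2[OF J] that unfolding ca by blast
        qed
      qed (auto intro!: writes_intros)
      then show "wp (NSet 11 (NConst 0)) s2 (\<lambda>t3 s3. wp (For 7 (NV 2) ?C1) s3 (\<lambda>t4. Q (t1 + (t2 + (t3 + t4)))))"
        unfolding wp_NStore nval_Ad nval.simps .
    qed (use writes_decide_step in auto)
  qed (auto intro!: writes_intros)
qed

section \<open>Recovering the curve\<close>

abbreviation "NBack \<equiv> NSub (NSub (NV 0) (NConst 2)) (NV 6)"

text \<open>Loops count upwards only, so round x treats the edge \<open>n - 2 - x\<close> of
  \<open>P\<close>. The curve is found from its end; the two sites of an edge are appended in
  reverse order, and the output reads the list backwards.\<close>

definition trace_step :: com where
  "trace_step = Cond (BSwitch (RA 50 NBack) NBack (NA 3 (NV 15)))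
     (Seq (NSet 15 (NA 12 NBack)) (Seq (append_site (NA 4 (NV 15))) (append_site (NA 3 (NV 15))))) Skip"

definition cfin :: com where
  "cfin = Seq cdecide (Seq (NSet 14 (NConst 0)) (Seq (append_site (NA 4 (NV 15))) (Seq (append_site (NA 3 (NV 15)))
     (For 6 NLast trace_step))))"

lemma writes_trace_step: "writes {13, 14, 15} trace_step"
  unfolding trace_step_def by (intro writes_intros writes_append_site) auto

lemma writes_cfin: "writes inner cfin"
  unfolding cfin_def
  by (intro writes_intros writes_cdecide writes_append_site writes_mono[OF writes_trace_step]) auto

lemma wp_append_pair:
  assumes s: "inp P S \<epsilon> s" "nat_at s 15 = q" "q < length S * length S"
    and L: "nat_at s 14 = length L" "map (\<lambda>x. fst s (adr 13 x)) [0..<length L] = L"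
    and Q: "\<And>s'. same {13, 14} s s' \<Longrightarrow> nat_at s' 14 = length (L @ [q mod length S, q div length S]) \<Longrightarrow>
      map (\<lambda>x. fst s' (adr 13 x)) [0..<length (L @ [q mod length S, q div length S])] = L @ [q mod length S, q div length S] \<Longrightarrow> Q 4 s'"
  shows "wp (append_site (NA 4 (NV 15))) s (\<lambda>t s'. wp (append_site (NA 3 (NV 15))) s' (\<lambda>t'. Q (t + t')))"
proof (rule wp_append_site[OF L])
  show "nval (NA 4 (NV 15)) s = q mod length S" using inpD(8)[OF s(1), of q] s by simp
  fix s1 assume sm: "same {13, 14} s s1" and L1: "nat_at s1 14 = length (L @ [q mod length S])"
    "map (\<lambda>x. fst s1 (adr 13 x)) [0..<length (L @ [q mod length S])] = L @ [q mod length S]"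
  show "wp (append_site (NA 3 (NV 15))) s1 (\<lambda>t'. Q (2 + t'))"
  proof (rule wp_append_site[OF L1])
    have "inp P S \<epsilon> s1" by (rule inp_same[OF s(1) sm]) simp
    then show "nval (NA 3 (NV 15)) s1 = q div length S"
      using inpD(7)[of P S \<epsilon> s1 q] s sameD(1)[OF sm, of 15] by simp
    fix s2 assume a: "same {13, 14} s1 s2" "nat_at s2 14 = length ((L @ [q mod length S]) @ [q div length S])"
      "map (\<lambda>x. fst s2 (adr 13 x)) [0..<length ((L @ [q mod length S]) @ [q div length S])] = (L @ [q mod length S]) @ [q div length S]"
    have "Q 4 s2" by (rule Q[OF same_trans[OF sm a(1)]]) (use a(2,3) in simp_all)
    then show "Q (2 + 2) s2" by simp
  qed
qed

lemma wp_cfin: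
  assumes PS: "P \<noteq> []" "S \<noteq> []" and s: "inp P S \<epsilon> s" "vec 32 0 s = T" "real_at s 37 = r" and f: "cfeas P S T r"
    and Q: "\<And>t s' L. t \<le> 40 * (length P * (length S * length S)) + 20 \<Longrightarrow> nat_at s' 14 = length L \<Longrightarrow>
      map (\<lambda>x. fst s' (adr 13 x)) [0..<length L] = L \<Longrightarrow> length L \<le> 2 * length P \<Longrightarrow>
      set L \<subseteq> {..<length S} \<Longrightarrow> subset_admissible (set S) (map ((!) S) (rev L)) \<Longrightarrow>
      frechet_dist (translate T P) (map ((!) S) (rev L)) \<le> r \<Longrightarrow> Q t s'"
  shows "wp cfin s Q"
  unfolding cfin_def wp_Seq[of cdecide]
proof (rule wp_cdecide[OF PS s])
  let ?k = "length S" and ?n = "length P" and ?p = "\<lambda>i. P ! i + T"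
  let ?al = "alpha ?p ((!) S) ?k r" and ?tr = "trace ?p ((!) S) ?k r"
  let ?en = "entry ?p ((!) S) ?k r" and ?pr = "pred ?p ((!) S) ?k r"
  fix t1 s1 assume t1: "t1 \<le> 21 * (?n * (?k * ?k)) + 7" and sm1: "same inner s s1"
    and acc: "cfeas P S T r \<Longrightarrow> nat_at s1 15 < ?k * ?k \<and> ?al (?n - 1) (nat_at s1 15) \<le> 1 \<and>
        dist (?p (?n - 1)) (S ! (nat_at s1 15 mod ?k)) \<le> r"
    and tab: "\<And>i. i < ?n - 1 \<Longrightarrow> snd s1 (adr 50 i) = ?en i \<and> fst s1 (adr 12 i) = ?pr i"
  define q0 where "q0 = nat_at s1 15"
  have q0: "q0 < ?k * ?k" "?al (?n - 1) q0 \<le> 1" "dist (?p (?n - 1)) (S ! (q0 mod ?k)) \<le> r"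
    using acc[OF f] by (simp_all add: q0_def)
  have k: "1 \<le> ?k" "1 \<le> ?n" using PS by (auto simp: Suc_le_eq)
  let ?s2 = "nupd (adr 14 0) 0 s1"
  have e2: "same inner s ?s2" by (rule same_trans[OF sm1]) (simp add: same_nupd)
  have i2: "inp P S \<epsilon> ?s2" using inner_frame(1)[OF s(1) e2] .
  let ?F = "For 6 NLast trace_step"
  have "wp (append_site (NA 4 (NV 15))) ?s2 (\<lambda>t s'. wp (append_site (NA 3 (NV 15))) s' (\<lambda>t'.
      (\<lambda>t s'. wp ?F s' (\<lambda>t2. Q (t1 + (1 + (t + t2))))) (t + t')))"
  proof (rule wp_append_pair[OF i2 _ q0(1), where L = "[]"])
    fix s3 assume sm3: "same {13, 14} ?s2 s3" and L3: "nat_at s3 14 = length ([] @ [q0 mod ?k, q0 div ?k])"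
      "map (\<lambda>x. fst s3 (adr 13 x)) [0..<length ([] @ [q0 mod ?k, q0 div ?k])] = [] @ [q0 mod ?k, q0 div ?k]"
    have e3: "same inner s s3" by (rule same_trans[OF e2 same_mono[OF sm3]]) auto
    have q3: "nat_at s3 15 = q0" using sameD(1)[OF sm3, of 15] by (simp add: q0_def)
    have tab3: "snd s3 (adr 50 i) = ?en i \<and> fst s3 (adr 12 i) = ?pr i" if "i < ?n - 1" for i
      using tab[OF that] sameD(2)[OF sm3, of 50 i] sameD(1)[OF sm3, of 12 i] by simp
    \<comment> \<open>What has been found, read backwards, is the end of the curve; what is missing
      is the trace of the pair in cell 15.\<close>
    let ?I = "\<lambda>x s'. \<exists>L q. nat_at s' 15 = q \<and> q < ?k * ?k \<and> ?al (?n - 1 - x) q \<le> 1 \<and> nat_at s' 14 = length L \<and>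
       map (\<lambda>x. fst s' (adr 13 x)) [0..<length L] = L \<and>
       ?tr (?n - 1) q0 @ [q0 div ?k, q0 mod ?k] = ?tr (?n - 1 - x) q @ rev L \<and> length L \<le> 2 + 2 * x"
    show "wp ?F s3 (\<lambda>t2. Q (t1 + (1 + (4 + t2))))"
    proof (rule wp_For_bounded[where m = "?n - 1" and X = "{13, 14, 15}" and T = 6 and I = ?I, OF writes_trace_step])
      fix s' assume a: "same (insert 6 {13, 14, 15}) s3 s'"
      have "same inner s s'" by (rule same_trans[OF e3 same_mono[OF a]]) auto
      from inner_frame(3)[OF s(1) this] show "nval NLast s' = ?n - 1" by simp
    next
      show "?I 0 (nupd (adr 6 0) 0 s3)"
        using q0 q3 L3 by (intro exI[of _ "[q0 mod ?k, q0 div ?k]"]) simp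
    next
      fix x s' assume x: "x < ?n - 1" "nat_at s' 6 = x" and sm: "same (insert 6 {13, 14, 15}) s3 s'" and "?I x s'"
      then obtain L q where I: "nat_at s' 15 = q" "q < ?k * ?k" "?al (?n - 1 - x) q \<le> 1" "nat_at s' 14 = length L"
        "map (\<lambda>x. fst s' (adr 13 x)) [0..<length L] = L"
        "?tr (?n - 1) q0 @ [q0 div ?k, q0 mod ?k] = ?tr (?n - 1 - x) q @ rev L" "length L \<le> 2 + 2 * x" by blast
      have e: "same inner s s'" by (rule same_trans[OF e3 same_mono[OF sm]]) auto
      note fr = inner_frame[OF s(1) e]
      define i where "i = ?n - 1 - Suc x"
      have i: "?n - 1 - x = Suc i" "i < ?n - 1" "Suc i < ?n" using x by (auto simp: i_def)
      have nb: "nval NBack s' = i" using fr(3) x by (simp add: i_def)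
      have tb: "snd s' (adr 50 i) = ?en i" "fst s' (adr 12 i) = ?pr i"
        using tab3[OF i(2)] sameD(2)[OF sm, of 50 i] sameD(1)[OF sm, of 12 i] by simp_all
      have vm: "vval (VMoved NBack) s' = ?p i" "vval (VMoved (NAdd NBack (NConst 1))) s' = ?p (Suc i)"
        using vval_VMoved[OF fr(1), of NBack] vval_VMoved[OF fr(1), of "NAdd NBack (NConst 1)"] nb i fr(2)[of 0] s(2)
        by simp_all
      have x15: "nval (NA 3 (NV 15)) s' = q div ?k" using fr(7)[OF I(2)] I(1) by simp
      have vs: "vval (VSite (NA 3 (NV 15))) s' = S ! (q div ?k)"
        using vval_VSite[OF fr(1), of "NA 3 (NV 15)"] x15 div_mod_less[OF I(2)] by simp
      have b: "bval (BSwitch (RA 50 NBack) NBack (NA 3 (NV 15))) s' \<longleftrightarrow> switches ?p ((!) S) r (?en i) i (q div ?k)"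
        using bval_BSwitch[of "NA 3 (NV 15)" s' "(!) S" "q div ?k" NBack ?p i r "RA 50 NBack"] vs vm fr(6) s(3) nb tb
        by simp
      let ?G = "\<lambda>(t'::nat) s''. t' \<le> 6 \<and> ?I (Suc x) (nupd (adr 6 0) (Suc x) s'')"
      show "wp trace_step s' ?G"
      proof (cases "switches ?p ((!) S) r (?en i) i (q div ?k)")
        case True
        then have "?en i \<le> 1" by (simp add: switches_def)
        note v = scan_valid[OF this]
        let ?q = "?pr i"
        have tr: "?tr (Suc i) q = ?tr i ?q @ [?q div ?k, ?q mod ?k]" using True by simp
        let ?s4 = "nupd (adr 15 0) ?q s'"
        have i4: "inp P S \<epsilon> ?s4" by (rule inp_same[OF fr(1) same_nupd[of 15 "{15}"]]) auto
        have q4: "nat_at ?s4 15 = ?q" "?q < ?k * ?k" using v by simp_all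
        have L4: "nat_at ?s4 14 = length L" "map (\<lambda>x. fst ?s4 (adr 13 x)) [0..<length L] = L" using I by simp_all
        have "wp (append_site (NA 4 (NV 15))) ?s4 (\<lambda>t s'. wp (append_site (NA 3 (NV 15))) s' (\<lambda>t'.
            (\<lambda>t s''. ?G (1 + (1 + t)) s'') (t + t')))"
        proof (rule wp_append_pair[OF i4 q4 L4])
          fix s5 assume sm5: "same {13, 14} ?s4 s5" and L5: "nat_at s5 14 = length (L @ [?q mod ?k, ?q div ?k])"
            "map (\<lambda>x. fst s5 (adr 13 x)) [0..<length (L @ [?q mod ?k, ?q div ?k])] = L @ [?q mod ?k, ?q div ?k]"
          have "nat_at s5 15 = ?q" using sameD(1)[OF sm5, of 15] by simp
          then have "?I (Suc x) (nupd (adr 6 0) (Suc x) s5)"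
            using v L5 I(6,7) tr i(1) unfolding i_def[symmetric]
            by (intro exI[of _ "L @ [?q mod ?k, ?q div ?k]"] exI[of _ ?q]) simp
          then show "?G (1 + (1 + 4)) s5" by simp
        qed
        then show ?thesis unfolding trace_step_def wp_Cond b using True nb tb by simp
      next
        case False
        have "?tr (Suc i) q = ?tr i q" using False by simp
        \<comment> \<open>Without a switch the previous position is the base of
          \<open>advance\<close>; were it above 1, the result would be the failure value 2.\<close>
        moreover have "?al i q \<le> 1" using I(3) False unfolding i(1) alpha.simps advance_def by (auto simp: Let_def split: if_splits)
        ultimately have "?I (Suc x) (nupd (adr 6 0) (Suc x) s')"
          using I i(1) unfolding i_def[symmetric] by (intro exI[of _ L] exI[of _ q]) simp
        then show ?thesis unfolding trace_step_def wp_Cond b using False by simp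
      qed
    next
      fix t2 s' assume t2: "t2 \<le> (6 + 2) * (?n - 1) + 2" and "?I (?n - 1) s'"
      then obtain L q where I: "nat_at s' 14 = length L" "map (\<lambda>x. fst s' (adr 13 x)) [0..<length L] = L"
        "?tr (?n - 1) q0 @ [q0 div ?k, q0 mod ?k] = rev L" "length L \<le> 2 + 2 * (?n - 1)" by auto
      have re: "reach ?p ((!) S) ?k r (?n - 1) (?tr (?n - 1) q0) (q0 div ?k) (q0 mod ?k) (?al (?n - 1) q0)"
        by (rule reach_alpha[OF q0(2,1)])
      note bd = reach_bounds[OF re]
      have "set (rev L) \<subseteq> {..<?k}" unfolding I(3)[symmetric] using bd by auto
      then have sub: "set L \<subseteq> {..<?k}" by simp
      have "rev L \<noteq> []" unfolding I(3)[symmetric] by simp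
      then have adm: "subset_admissible (set S) (map ((!) S) (rev L))"
        using sub by (auto simp: subset_admissible_def)
      have fd: "frechet_dist (translate T P) (map ((!) S) (rev L)) \<le> r"
        unfolding I(3)[symmetric]
        by (rule frechet_dist_le_reach[where p = ?p and k = ?k and \<theta> = "?al (?n - 1) q0"])
          (use re q0 PS in \<open>simp_all add: translate_def\<close>)
      have "?n * 1 \<le> ?n * (?k * ?k)" using k by (intro mult_le_mono2) simp
      moreover have "t2 \<le> 8 * ?n + 2" using t2 by simp
      ultimately have "t1 + (1 + (4 + t2)) \<le> 40 * (?n * (?k * ?k)) + 20" using t1 by linarith
      moreover have "length L \<le> 2 * ?n" using I(4) k by linarith
      ultimately show "Q (t1 + (1 + (4 + t2))) s'" using I(1,2) sub adm fd by (intro Q[of _ s' L])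
    qed auto
  qed (simp_all add: q0_def)
  then show "wp (Seq (NSet 14 (NConst 0)) (Seq (append_site (NA 4 (NV 15))) (Seq (append_site (NA 3 (NV 15))) ?F))) s1 (\<lambda>t2. Q (t1 + t2))"
    unfolding wp_Seq wp_NStore nval_Ad nval.simps by (simp only: add.assoc)
qed

text \<open>\<Lambda> combines the two losses of the relaxation, 4 in one direction and
  \<open>n + 1\<close> in the other. The output map undoes the reversal made by the tracing.\<close>

lemma continuous_scheme:
  "scheme es frechet_dist subset_admissible cfeas ceval cdecide cfin
     (NSub (NSub (NV 14) (NConst 1)) (NV 5)) (\<lambda>m j. m - 1 - j) (\<lambda>n. 4 * (real n + 1)) (\<lambda>n k. 60 * n * k * k + 60)"
proof
  fix P S :: "(real ^ 'd) list" and t t' r r'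
  assume "cfeas P S t r"
  then show "\<exists>j<length S. dist (P ! 0 + t) (S ! j) \<le> r" by (rule cfeas_near)
next
  fix P S :: "(real ^ 'd) list" and t r
  assume "P \<noteq> []" "S \<noteq> []" "cfeas P S t r"
  then show "\<exists>Q. subset_admissible (set S) Q \<and> frechet_dist (translate t P) Q \<le> r" by (intro cfeas_sound)
next
  fix S :: "(real ^ 'd) list" assume "S \<noteq> []"
  then show "\<exists>Q. subset_admissible (set S) Q" by (intro exI[of _ S]) (simp add: subset_admissible_def)
next
  fix P S :: "(real ^ 'd) list" and \<epsilon> s
  assume PS: "P \<noteq> []" "S \<noteq> []" and s: "inp P S \<epsilon> s"
  show "wp ceval s (\<lambda>t s'. t \<le> 60 * length P * length S * length S + 60 \<and> cfeas P S (vec 32 0 s) (real_at s' 44) \<and>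
      (\<forall>r. cfeas P S (vec 32 0 s) r \<longrightarrow> real_at s' 44 \<le> 4 * (real (length P) + 1) * r))"
    by (rule wp_mono[OF wp_ceval[OF PS s]]) auto
  show "wp cdecide s (\<lambda>t s'. t \<le> 60 * length P * length S * length S + 60 \<and>
      nat_at s' 11 = (if cfeas P S (vec 32 0 s) (real_at s 37) then 1 else 0))"
    by (rule wp_cdecide[OF PS s refl refl]) auto
  assume f: "cfeas P S (vec 32 0 s) (real_at s 37)"
  show "wp cfin s (\<lambda>t s'. t \<le> 60 * length P * length S * length S + 60 \<and>
      nat_at s' 14 < 60 * length P * length S * length S + 60 \<and>
      (\<forall>j<nat_at s' 14. fst s' (adr 13 (nat_at s' 14 - 1 - j)) < length S) \<and>
      (let Q = map (\<lambda>j. S ! fst s' (adr 13 (nat_at s' 14 - 1 - j))) [0..<nat_at s' 14] in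
        subset_admissible (set S) Q \<and> frechet_dist (translate (vec 32 0 s) P) Q \<le> real_at s 37))"
  proof (rule wp_cfin[OF PS s refl refl f])
    fix t s' L assume t: "t \<le> 40 * (length P * (length S * length S)) + 20" and L: "nat_at s' 14 = length L"
      "map (\<lambda>x. fst s' (adr 13 x)) [0..<length L] = L" "length L \<le> 2 * length P" "set L \<subseteq> {..<length S}"
      and Q: "subset_admissible (set S) (map ((!) S) (rev L))"
        "frechet_dist (translate (vec 32 0 s) P) (map ((!) S) (rev L)) \<le> real_at s 37"
    have nth: "fst s' (adr 13 x) = L ! x" if "x < length L" for x
      using arg_cong[OF L(2), of "\<lambda>l. l ! x"] that by simp
    have e: "map (\<lambda>j. S ! fst s' (adr 13 (nat_at s' 14 - 1 - j))) [0..<nat_at s' 14] = map ((!) S) (rev L)"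
      by (rule nth_equalityI) (simp_all add: L(1) nth rev_nth)
    have "\<forall>j<nat_at s' 14. fst s' (adr 13 (nat_at s' 14 - 1 - j)) < length S"
    proof (intro allI impI)
      fix j assume "j < nat_at s' 14"
      then have x: "nat_at s' 14 - 1 - j < length L" using L(1) by simp
      show "fst s' (adr 13 (nat_at s' 14 - 1 - j)) < length S"
        unfolding nth[OF x] using nth_mem[OF x] L(4) by auto
    qed
    moreover have "1 \<le> length S" using PS by (simp add: Suc_le_eq)
    then have "length P * 1 \<le> length P * (length S * length S)" by (intro mult_le_mono2) simp
    then have "nat_at s' 14 < 60 * (length P * (length S * length S)) + 60" using L(1,3) by linarith
    then have "nat_at s' 14 < 60 * length P * length S * length S + 60" by (simp only: mult.assoc)
    moreover have "t \<le> 60 * length P * length S * length S + 60" using t by (simp add: mult.assoc)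
    ultimately show "t \<le> 60 * length P * length S * length S + 60 \<and>
      nat_at s' 14 < 60 * length P * length S * length S + 60 \<and>
      (\<forall>j<nat_at s' 14. fst s' (adr 13 (nat_at s' 14 - 1 - j)) < length S) \<and>
      (let Q = map (\<lambda>j. S ! fst s' (adr 13 (nat_at s' 14 - 1 - j))) [0..<nat_at s' 14] in
        subset_admissible (set S) Q \<and> frechet_dist (translate (vec 32 0 s) P) Q \<le> real_at s 37)"
      unfolding e using Q by (simp add: Let_def)
  qed
qed (use cfeas_mono cfeas_translate cfeas_complete frechet_dist_nonneg writes_ceval writes_cdecide writes_cfin in auto)

text \<open>Up to a constant the program takes
  \<open>n * k ^ 2 * (k / \<epsilon> ^ CARD('d) + ln (n * k))\<close> steps wherever the claimed
  bound is positive. The product in the claim dominates this sum because the logarithm is then at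
  least \<open>ln 2\<close>.\<close>

lemma continuous_approximable:
  "approximable_in_time es frechet_dist subset_admissible
     (\<lambda>n k \<epsilon>. real n * real k ^ 3 * ln (real n * real k) / \<epsilon> ^ CARD('d))"
proof -
  interpret scheme es frechet_dist subset_admissible cfeas ceval cdecide cfin
     "NSub (NSub (NV 14) (NConst 1)) (NV 5)" "\<lambda>m j. m - 1 - j" "\<lambda>n. 4 * (real n + 1)" "\<lambda>n k. 60 * n * k * k + 60"
    by (rule continuous_scheme)
  show ?thesis
  proof (rule approximable[where K = 1500])
    fix n k :: nat and \<epsilon> :: real
    assume a: "0 < n" "0 < k" "0 < \<epsilon>" "\<epsilon> \<le> 1"
      and pos: "0 < real n * real k ^ 3 * ln (real n * real k) / \<epsilon> ^ CARD('d)"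
    define E where "E = 1 / \<epsilon> ^ CARD('d)"
    define l where "l = ln (real n * real k)"
    have E: "1 \<le> E" using a by (simp add: E_def power_le_one)
    have nk: "1 \<le> real n" "1 \<le> real k" using a by auto
    \<comment> \<open>A positive bound excludes \<open>n = k = 1\<close>, hence \<open>n * k\<close>
      is at least 2 and the logarithm is bounded away from 0.\<close>
    have "0 < l"
    proof (rule ccontr)
      assume "\<not> 0 < l"
      moreover have "0 < real n * real k ^ 3" using a by simp
      ultimately have "real n * real k ^ 3 * l \<le> 0" by (intro mult_nonneg_nonpos) auto
      then have "real n * real k ^ 3 * l / \<epsilon> ^ CARD('d) \<le> 0" using a by (intro divide_nonpos_pos) auto
      then show False using pos by (simp add: l_def)
    qed
    then have "1 < real n * real k" using a by (simp add: l_def)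
    then have "1 < real (n * k)" by simp
    then have "1 < n * k" by (metis of_nat_1 of_nat_less_iff)
    then have "real 2 \<le> real (n * k)" by (intro of_nat_mono) simp
    then have nk2: "2 \<le> real n * real k" by simp
    have ln2: "1 / 2 \<le> ln (2 :: real)"
      using ln2_ge_two_thirds by linarith
    have "ln 2 \<le> l" unfolding l_def
      by (rule iffD2[OF ln_le_cancel_iff]) (use nk2 in linarith)+
    then have l: "1 \<le> 2 * l" using ln2 by linarith
    \<comment> \<open>The logarithm of the right-hand side is \<open>4 + log 2 (n * k)\<close>; with
      \<open>1 \<le> 2 * l\<close> and \<open>log 2 (n * k) \<le> 2 * l\<close> this is at most
      \<open>10 * l\<close>.\<close>
    have "8 * (real n + 1) \<le> 16 * (real n * real k)"
    proof -
      define y where "y = real n * real k"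
      have "real n * 1 \<le> y" unfolding y_def using nk by (intro mult_left_mono) auto
      then have "real n \<le> y" by simp
      have "8 * (real n + 1) \<le> 8 * (real n + real n)" using nk(1) by (intro mult_left_mono add_left_mono) auto
      also have "\<dots> = 16 * real n" by simp
      also have "\<dots> \<le> 16 * y" using \<open>real n \<le> y\<close> by simp
      finally have "8 * (real n + 1) \<le> 16 * y" .
      then show ?thesis unfolding y_def .
    qed
    then have "log 2 (8 * (real n + 1)) \<le> log 2 (16 * (real n * real k))"
      using a by (intro iffD2[OF log_le_cancel_iff]) auto
    also have "\<dots> = log 2 16 + log 2 (real n * real k)" using a by (intro log_mult_pos) auto
    also have "log 2 16 = (4::real)" using log_pow_cancel[of "2::real" 4] by simp
    also have "log 2 (real n * real k) = l / ln 2" by (simp add: log_def l_def)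
    also have "l / ln 2 \<le> 2 * l" using ln2 \<open>0 < l\<close> by (simp add: divide_le_eq)
    finally have L: "log 2 (8 * (real n + 1)) \<le> 10 * l" using l by linarith
    define u where "u = real n * real k ^ 2"
    have k2: "1 \<le> real k ^ 2" using nk by simp
    have u: "1 \<le> u" "real k ^ 2 \<le> u" "real n \<le> u"
      using mult_mono[of 1 "real n" 1 "real k ^ 2"] mult_right_mono[of 1 "real n" "real k ^ 2"]
        mult_left_mono[of 1 "real k ^ 2" "real n"] nk k2 by (auto simp: u_def)
    define v where "v = u * (real k * E) * l"
    have kE: "1 \<le> real k * E" using mult_mono[of 1 "real k" 1 E] nk E by simp
    have ul: "u * l \<le> v"
      using mult_right_mono[OF mult_left_mono[OF kE, of u], of l] u \<open>0 < l\<close> by (simp add: v_def)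
    have u2: "u \<le> 2 * (u * l)" using mult_left_mono[OF l, of u] u by simp
    have "real (60 * n * k * k + 60) = 60 * u + 60" by (simp add: u_def power2_eq_square)
    also have "\<dots> \<le> 120 * u" using u by simp
    finally have t: "real (60 * n * k * k + 60) \<le> 120 * u" .
    have "0 \<le> log 2 (8 * (real n + 1))" using a by simp
    then have "real (60 * n * k * k + 60) * (real k * E + log 2 (8 * (real n + 1))) \<le> 120 * u * (real k * E + 10 * l)"
      using t L kE E u by (intro mult_mono add_mono add_nonneg_nonneg) auto
    also have "\<dots> = 120 * (u * (real k * E)) + 1200 * (u * l)" by (simp add: algebra_simps)
    also have "u * (real k * E) \<le> 2 * v"
      using mult_left_mono[OF l, of "u * (real k * E)"] u kE by (simp add: v_def)
    \<comment> \<open>The decisions contribute \<open>240 * v + 1200 * v\<close>, and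
      \<open>k ^ 2 + n\<close> is at most \<open>2 * u\<close>, hence at most
      \<open>4 * v\<close>.\<close>
    finally have "real k ^ 2 + real n + real (60 * n * k * k + 60) * (real k * E + log 2 (8 * (real n + 1))) \<le> 1500 * v"
      using u u2 ul by linarith
    then show "real k ^ 2 + real n + real (60 * n * k * k + 60) * (real k / \<epsilon> ^ CARD('d) + log 2 (2 * (4 * (real n + 1)))) \<le>
        1500 * (real n * real k ^ 3 * ln (real n * real k) / \<epsilon> ^ CARD('d))"
      by (simp add: E_def v_def u_def l_def power3_eq_cube power2_eq_square mult_ac)
  qed auto
qed

end

theorem theorem4:
  fixes es :: "'d::finite list"
  assumes "distinct es" and "set es = UNIV"
  shows
    "approximable_in_time es frechet_dist subset_admissible
       (\<lambda>n k \<epsilon>. real n * real k ^ 3 * ln (real n * real k) / \<epsilon> ^ CARD('d)) \<and>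
     approximable_in_time es discrete_frechet_dist subset_admissible
       (\<lambda>n k \<epsilon>. real n * real k ^ 2 / \<epsilon> ^ CARD('d)) \<and>
     approximable_in_time es discrete_frechet_dist all_points_admissible
       (\<lambda>n k \<epsilon>. real n * real k ^ 2 / \<epsilon> ^ CARD('d))"
proof -
  interpret axes es by (rule axes.intro) (rule assms)+
  show ?thesis
    using continuous_approximable discrete_approximable[of False] discrete_approximable[of True]
    by (simp add: discrete_adm_def)
qed

end
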